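(* Let $\Omega'$ be a connected open subset of $\mathbb{R}^{n-1}$ and $\Omega=\Omega'\times\,]-1,1[$, with coordinates $x=(x',x_n)$, $x'\in\Omega'$, $x_n\in\,]-1,1[$, and covariable $\xi=(\xi',\xi_n)\in\mathbb{R}^n\setminus\{0\}$. Let $\psi=\psi(x,\xi)$ be an admissible phase function which locally represents, near the boundary $\{x_n=0\}$, the extension $\tilde\chi$ of a boundary-preserving symplectomorphism $\chi$ (see context), and let $\psi_\partial(x',\xi')=\psi(x',0,\xi',\xi_n)$. For any $a\in S^m(\mathbb{R}^n\times\mathbb{R}^n)$ satisfying the transmission condition and supported in a suitably small collar neighborhood of the boundary $\{x_n=0\}$, consider the operator family, parametrized by $(x',\xi')$, $$A_n^\chi=A_n^\chi(x',\xi'):\ u\mapsto\Big(x_n\mapsto\int e^{i(\psi(x',x_n,\xi',\xi_n)-\psi_\partial(x',\xi'))}\,a(x',x_n,\xi',\xi_n)\,\widehat u(\xi_n)\,\frac{d\xi_n}{2\pi}\Big).$$ Then $$A_n^\chi\in S^m(\mathbb{R}^{n-1},\mathbb{R}^{n-1};\mathscr{S}(\mathbb{R}),\mathscr{S}(\mathbb{R}))\quad\text{and}\quad A_n^\chi\in S^m(\mathbb{R}^{n-1},\mathbb{R}^{n-1};\mathscr{S}'(\mathbb{R}),\mathscr{S}'(\mathbb{R})).$$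
   Context: Notation: $\langle v\rangle=(1+|v|^2)^{1/2}$; $\widehat u=\mathscr{F}u$ is the Fourier transform, $\widehat u(\xi_n)=\int e^{-iy_n\xi_n}u(y_n)\,dy_n$. $S^m(\mathbb{R}^n\times\mathbb{R}^n)$ is the usual Hörmander class $S^m_{1,0}$ of symbols $a(x,\xi)$ of order $m$. Symplectomorphisms. $X$ and $Y$ are compact $n$-dimensional manifolds with boundary and $\chi:T^*Y\setminus0\to T^*X\setminus0$ is a symplectomorphism, positively homogeneous of degree $1$ in the fibers, which preserves the boundary, i.e. $\pi_{\partial X}\circ\chi=b\circ\pi_{\partial Y}$ over the boundary, with a diffeomorphism $b:\partial Y\to\partial X$ and the canonical projections $\pi_{\partial X},\pi_{\partial Y}$ at the boundaries. It extends to a symplectomorphism $\tilde\chi:T^*\widetilde Y\setminus0\to T^*\widetilde X\setminus0$, where $\widetilde Y,\widetilde X$ are neighborhoods of $Y,X$ in closed $n$-dimensional manifolds containing them. Local coordinates $y=(y',y_n)$ on $\widetilde Y$ and $x=(x',x_n)$ on $\widetilde X$ near the boundary are chosen so that $y_n$, $x_n$ are boundary defining functions of $Y$, $X$ (zero on the boundary, positive in the interior). Phase functions. A real-valued $\psi(x,\xi)$, smooth for $\xi\ne0$ and positively homogeneous of degree $1$ in $\xi$, locally represents $\tilde\chi$ if $\phi(x,y,\xi)=\psi(x,\xi)-\langle y,\xi\rangle$ is a phase function parametrizing the Lagrangian submanifold given by the graph of $\tilde\chi$; that is, $\tilde\chi(\psi'_\xi(x,\xi),\xi)=(x,\psi'_x(x,\xi))$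 and $(x,\xi)\mapsto(\psi'_\xi(x,\xi),\xi)$ is locally a diffeomorphism. Because the boundary is preserved, $\psi(x',0,\xi',\xi_n)$ is independent of $\xi_n$, so that $\psi_\partial$ is well defined; it is linear in $\xi'$. Admissibility. A function $p(x,\xi)$ positively homogeneous of degree $\mu$ in $\xi$ satisfies the transmission condition at $x_n=0$ if, for all $l\in\mathbb{N}$, $\alpha,\beta\in\mathbb{N}^{n-1}$, $$\partial_{x_n}^l\partial_{\xi'}^\alpha\partial_{x'}^\beta p(x',0,0,1)=(-1)^{\mu-|\alpha|}\partial_{x_n}^l\partial_{\xi'}^\alpha\partial_{x'}^\beta p(x',0,0,-1),$$ the last two arguments being $(\xi',\xi_n)$. The symplectomorphism is admissible if all its components (in local coordinates) satisfy the transmission condition at the boundary; a phase function $\psi$ representing an admissible symplectomorphism is called admissible, and then the first derivatives of $\psi$ satisfy the transmission condition. Transmission condition for general symbols. Let $H^+=\{\mathscr{F}(e^+u): u\in\mathscr{S}(\mathbb{R}_+)\}$ and $H^-_0=\{\mathscr{F}(e^-u):u\in\mathscr{S}(\mathbb{R}_-)\}$, where $\mathscr{S}(\mathbb{R}_\pm)$ is the space of restrictions of Schwartz functions to the half line $\mathbb{R}_\pm$ and $e^\pm$ is extension by zero to $\mathbb{R}$; let $H'$ be the space of all polynomials in one variable and $H=H^+\oplus H_0^-\oplus H'$. A symbol $a\in S^m(\mathbb{R}^n\times\mathbb{R}^n)$ satisfies the transmission condition at $x_n=0$ if for all $l$, $\partial_{x_n}^la(x',0,\xi',\langle\xi'\rangle\xi_n)\in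 S^m(\mathbb{R}^{n-1}\times\mathbb{R}^{n-1})\,\hat\otimes_\pi\,H_{\xi_n}$. Conventions. The amplitude $a$ is a local one: its support lies over the set where $\psi$ is defined (the integrand is zero elsewhere). Whenever $\psi$ is referred to as a symbol, this is understood after a modification near $|\xi|=0$; the precise form of the modification is regarded as irrelevant (modulo operators with smooth kernel). Operator-valued symbols. On $E=\mathscr{S}(\mathbb{R})$ or $E=\mathscr{S}'(\mathbb{R})$ (strong dual topology) let $(\kappa_\lambda u)(t)=\lambda^{1/2}u(\lambda t)$, $\lambda>0$ (in the sense of distributions on $\mathscr{S}'$). A smooth family $p(x',\xi')$, $(x',\xi')\in\mathbb{R}^{n-1}\times\mathbb{R}^{n-1}$, of continuous linear operators $E\to E$ belongs to $S^m(\mathbb{R}^{n-1},\mathbb{R}^{n-1};E,E)$ if for all multi-indices $\alpha,\beta$ and every continuous seminorm $q$ on $E$ there exist a continuous seminorm $r$ on $E$ and a constant $C$ such that $$q\big(\kappa_{\langle\xi'\rangle^{-1}}\,(\partial_{\xi'}^\alpha\partial_{x'}^\beta p)(x',\xi')\,\kappa_{\langle\xi'\rangle}u\big)\le C\,\langle\xi'\rangle^{m-|\alpha|}\,r(u),\qquad u\in E,$$ for all $\xi'\in\mathbb{R}^{n-1}$, locally uniformly in $x'$. *)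

theory Defs
  imports "HOL-Analysis.Analysis" "HOL-Computational_Algebra.Polynomial"
begin

subsection \<open>Smooth maps and iterated partial derivatives\<close>

definition japanese :: "'a::real_normed_vector \<Rightarrow> real" where
  "japanese v = sqrt (1 + (norm v)\<^sup>2)"

text \<open>Meant for open sets \<^term>\<open>S\<close>, as derivatives are taken in the whole space.\<close>

primrec cdiff_on :: "nat \<Rightarrow> 'a::euclidean_space set \<Rightarrow> ('a \<Rightarrow> 'b::real_normed_vector) \<Rightarrow> bool" where
  "cdiff_on 0 S f \<longleftrightarrow> continuous_on S f"
| "cdiff_on (Suc k) S f \<longleftrightarrow>
     (\<forall>x\<in>S. f differentiable (at x)) \<and> (\<forall>v. cdiff_on k S (\<lambda>x. frechet_derivative f (at x) v))"

definition smooth_on :: "'a::euclidean_space set \<Rightarrow> ('a \<Rightarrow> 'b::real_normed_vector) \<Rightarrow> bool" where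
  "smooth_on S f \<longleftrightarrow> (\<forall>k. cdiff_on k S f)"

text \<open>Iterated directional derivatives. Throughout, a multi-index is given by a list of basis
  vectors, its order being the length of the list; for smooth functions only the multiplicities
  matter.\<close>

definition dirs :: "'a::euclidean_space list \<Rightarrow> ('a \<Rightarrow> 'b::real_normed_vector) \<Rightarrow> 'a \<Rightarrow> 'b" where
  "dirs vs f = foldr (\<lambda>v g x. frechet_derivative g (at x) v) vs f"

definition grad :: "('a::euclidean_space \<Rightarrow> real) \<Rightarrow> 'a \<Rightarrow> 'a" where
  "grad f x = (\<Sum>b\<in>Basis. frechet_derivative f (at x) b *\<^sub>R b)"

definition local_diffeo_on ::
  "'a::euclidean_space set \<Rightarrow> ('a \<Rightarrow> 'b::euclidean_space) \<Rightarrow> bool" where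
  "local_diffeo_on S G \<longleftrightarrow>
     (\<forall>z\<in>S. \<exists>N. open N \<and> z \<in> N \<and> N \<subseteq> S \<and> inj_on G N \<and> open (G ` N) \<and>
        smooth_on N G \<and> smooth_on (G ` N) (inv_into N G))"


subsection \<open>Locally convex function spaces\<close>

text \<open>A locally convex space of complex functions is given by a topology on the set of its
  elements; the vector space operations are pointwise.\<close>

definition seminorm_on :: "('x \<Rightarrow> complex) set \<Rightarrow> (('x \<Rightarrow> complex) \<Rightarrow> real) \<Rightarrow> bool" where
  "seminorm_on V q \<longleftrightarrow>
     (\<forall>u\<in>V. \<forall>v\<in>V. q (\<lambda>s. u s + v s) \<le> q u + q v) \<and>
     (\<forall>c. \<forall>u\<in>V. q (\<lambda>s. c * u s) = cmod c * q u)"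

definition lc_topology ::
  "('x \<Rightarrow> complex) set \<Rightarrow> (('x \<Rightarrow> complex) \<Rightarrow> real) set \<Rightarrow> ('x \<Rightarrow> complex) topology" where
  "lc_topology V P =
     topology_generated_by {{v \<in> V. p (\<lambda>s. v s - u s) < r} | u p r. u \<in> V \<and> p \<in> P \<and> 0 < r}"

definition cont_seminorm :: "('x \<Rightarrow> complex) topology \<Rightarrow> (('x \<Rightarrow> complex) \<Rightarrow> real) \<Rightarrow> bool" where
  "cont_seminorm E q \<longleftrightarrow> seminorm_on (topspace E) q \<and> continuous_map E euclideanreal q"

definition bounded_in :: "('x \<Rightarrow> complex) topology \<Rightarrow> ('x \<Rightarrow> complex) set \<Rightarrow> bool" where
  "bounded_in E B \<longleftrightarrow> B \<subseteq> topspace E \<and> (\<forall>q. cont_seminorm E q \<longrightarrow> bdd_above (q ` B))"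

definition cont_lin_op ::
  "('x \<Rightarrow> complex) topology \<Rightarrow> (('x \<Rightarrow> complex) \<Rightarrow> ('x \<Rightarrow> complex)) \<Rightarrow> bool" where
  "cont_lin_op E T \<longleftrightarrow> continuous_map E E T \<and>
     (\<forall>c d. \<forall>u\<in>topspace E. \<forall>v\<in>topspace E.
        T (\<lambda>s. c * u s + d * v s) = (\<lambda>s. c * T u s + d * T v s))"

text \<open>The value 0 outside the space makes a functional determined by its restriction to it.\<close>

definition dual :: "('x \<Rightarrow> complex) topology \<Rightarrow> (('x \<Rightarrow> complex) \<Rightarrow> complex) set" where
  "dual E = {T. continuous_map E euclidean T \<and>
     (\<forall>c d. \<forall>u\<in>topspace E. \<forall>v\<in>topspace E. T (\<lambda>s. c * u s + d * v s) = c * T u + d * T v) \<and>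
     (\<forall>u. u \<notin> topspace E \<longrightarrow> T u = 0)}"

definition strong_dual ::
  "('x \<Rightarrow> complex) topology \<Rightarrow> (('x \<Rightarrow> complex) \<Rightarrow> complex) topology" where
  "strong_dual E = lc_topology (dual E)
     {\<lambda>T. (SUP u\<in>B. cmod (T u)) | B. bounded_in E B \<and> B \<noteq> {}}"

text \<open>The completed projective tensor product of two function spaces, realised as a space of
  functions on the product set: its elements are the pointwise limits of Cauchy filters on the
  algebraic tensor product, for the uniformity given by the projective seminorms.\<close>

definition tensor_sum :: "nat \<Rightarrow> (nat \<Rightarrow> 'x \<Rightarrow> complex) \<Rightarrow> (nat \<Rightarrow> 'y \<Rightarrow> complex) \<Rightarrow> 'x \<times> 'y \<Rightarrow> complex"
  where "tensor_sum N f h = (\<lambda>(x, y). \<Sum>j<N. f j x * h j y)"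

definition alg_tensor ::
  "('x \<Rightarrow> complex) topology \<Rightarrow> ('y \<Rightarrow> complex) topology \<Rightarrow> ('x \<times> 'y \<Rightarrow> complex) set" where
  "alg_tensor E F = {tensor_sum N f h | N f h. \<forall>j<N. f j \<in> topspace E \<and> h j \<in> topspace F}"

definition proj_seminorm ::
  "('x \<Rightarrow> complex) topology \<Rightarrow> ('y \<Rightarrow> complex) topology \<Rightarrow> (('x \<Rightarrow> complex) \<Rightarrow> real) \<Rightarrow>
   (('y \<Rightarrow> complex) \<Rightarrow> real) \<Rightarrow> ('x \<times> 'y \<Rightarrow> complex) \<Rightarrow> real" where
  "proj_seminorm E F p q t =
     Inf {\<Sum>j<N. p (f j) * q (h j) | N f h.
            (\<forall>j<N. f j \<in> topspace E \<and> h j \<in> topspace F) \<and> t = tensor_sum N f h}"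

definition proj_tensor ::
  "('x \<Rightarrow> complex) topology \<Rightarrow> ('y \<Rightarrow> complex) topology \<Rightarrow> ('x \<times> 'y \<Rightarrow> complex) set" where
  "proj_tensor E F = {b. \<exists>\<Phi>. \<Phi> \<noteq> bot \<and> eventually (\<lambda>t. t \<in> alg_tensor E F) \<Phi> \<and>
     (\<forall>p q e. cont_seminorm E p \<and> cont_seminorm F q \<and> 0 < e \<longrightarrow>
        (\<exists>A. A \<subseteq> alg_tensor E F \<and> eventually (\<lambda>t. t \<in> A) \<Phi> \<and>
           (\<forall>s\<in>A. \<forall>t\<in>A. proj_seminorm E F p q (\<lambda>z. s z - t z) < e))) \<and>
     (\<forall>z. ((\<lambda>t. t z) \<longlongrightarrow> b z) \<Phi>)}"


subsection \<open>Schwartz functions and tempered distributions on the line\<close>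

definition schwartz :: "(real \<Rightarrow> complex) set" where
  "schwartz = {u. smooth_on UNIV u \<and>
     (\<forall>j k. bounded (range (\<lambda>t. of_real (t ^ j) * dirs (replicate k 1) u t)))}"

definition schwartz_space :: "(real \<Rightarrow> complex) topology" where
  "schwartz_space = lc_topology schwartz
     {\<lambda>u. (SUP t. cmod (of_real (t ^ j) * dirs (replicate k 1) u t)) | j k. True}"

definition tempered_space :: "((real \<Rightarrow> complex) \<Rightarrow> complex) topology" where
  "tempered_space = strong_dual schwartz_space"

definition fourier :: "(real \<Rightarrow> complex) \<Rightarrow> real \<Rightarrow> complex" where
  "fourier u s = (LBINT t. exp (- \<i> * of_real (t * s)) * u t)"

definition tempered_fourier ::
  "((real \<Rightarrow> complex) \<Rightarrow> complex) \<Rightarrow> (real \<Rightarrow> complex) \<Rightarrow> complex" where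
  "tempered_fourier T f = (if f \<in> schwartz then T (fourier f) else 0)"

definition dilate :: "real \<Rightarrow> (real \<Rightarrow> complex) \<Rightarrow> real \<Rightarrow> complex" where
  "dilate r u = (\<lambda>t. of_real (sqrt r) * u (r * t))"

text \<open>The transpose of \<^term>\<open>dilate r\<close> with respect to the bilinear pairing (integral of the
  product of two functions) is \<^term>\<open>dilate (1 / r)\<close>.\<close>

definition tempered_dilate ::
  "real \<Rightarrow> ((real \<Rightarrow> complex) \<Rightarrow> complex) \<Rightarrow> (real \<Rightarrow> complex) \<Rightarrow> complex" where
  "tempered_dilate r T = (\<lambda>f. T (dilate (1 / r) f))"


subsection \<open>Symbols\<close>

definition symbols :: "real \<Rightarrow> ('a::euclidean_space \<times> 'a \<Rightarrow> complex) set" where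
  "symbols m = {a. smooth_on UNIV a \<and>
     (\<forall>\<alpha> \<beta>. set \<alpha> \<subseteq> Basis \<and> set \<beta> \<subseteq> Basis \<longrightarrow>
        (\<exists>C. \<forall>x \<xi>. cmod (dirs (map (\<lambda>b. (0, b)) \<alpha> @ map (\<lambda>b. (b, 0)) \<beta>) a (x, \<xi>))
                   \<le> C * japanese \<xi> powr (m - length \<alpha>)))}"

definition symbol_space :: "real \<Rightarrow> ('a::euclidean_space \<times> 'a \<Rightarrow> complex) topology" where
  "symbol_space m = lc_topology (symbols m)
     {\<lambda>a. (SUP (x, \<xi>). cmod (dirs (map (\<lambda>b. (0, b)) \<alpha> @ map (\<lambda>b. (b, 0)) \<beta>) a (x, \<xi>))
                       / japanese \<xi> powr (m - length \<alpha>))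
      | \<alpha> \<beta>. set \<alpha> \<subseteq> Basis \<and> set \<beta> \<subseteq> Basis}"

definition e_plus :: "(real \<Rightarrow> complex) \<Rightarrow> real \<Rightarrow> complex" where
  "e_plus u t = (if t > 0 then u t else 0)"

definition e_minus :: "(real \<Rightarrow> complex) \<Rightarrow> real \<Rightarrow> complex" where
  "e_minus u t = (if t < 0 then u t else 0)"

definition H_plus :: "(real \<Rightarrow> complex) set" where
  "H_plus = {fourier (e_plus u) | u. u \<in> schwartz}"

definition H_minus0 :: "(real \<Rightarrow> complex) set" where
  "H_minus0 = {fourier (e_minus u) | u. u \<in> schwartz}"

definition H_poly :: "(real \<Rightarrow> complex) set" where
  "H_poly = {\<lambda>s. poly P (of_real s) | P. True}"

definition H_carrier :: "(real \<Rightarrow> complex) set" where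
  "H_carrier = {\<lambda>s. f s + g s + h s | f g h. f \<in> H_plus \<and> g \<in> H_minus0 \<and> h \<in> H_poly}"

text \<open>The direct sum topology, \<^term>\<open>H_plus\<close> and \<^term>\<open>H_minus0\<close> carrying the Frechet topology
  of the Schwartz spaces of the half lines (quotients of the one of the line) and
  \<^term>\<open>H_poly\<close> the inductive limit topology of its finite-dimensional subspaces, for which
  every seminorm is continuous.\<close>

definition H_space :: "(real \<Rightarrow> complex) topology" where
  "H_space = lc_topology H_carrier
     {q. seminorm_on H_carrier q \<and>
         cont_seminorm schwartz_space (\<lambda>u. q (fourier (e_plus u))) \<and>
         cont_seminorm schwartz_space (\<lambda>u. q (fourier (e_minus u)))}"

type_synonym 'm rn = "(real ^ 'm) \<times> real"

definition symbol_transmission :: "real \<Rightarrow> ('m::finite rn \<times> 'm rn \<Rightarrow> complex) \<Rightarrow> bool" where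
  "symbol_transmission m a \<longleftrightarrow>
     (\<forall>l. (\<lambda>((x', \<xi>'), s). dirs (replicate l ((0, 1), 0)) a ((x', 0), (\<xi>', japanese \<xi>' * s)))
            \<in> proj_tensor (symbol_space m) H_space)"

text \<open>Convergence of operators uniformly on bounded sets.\<close>

definition op_tendsto ::
  "('x \<Rightarrow> complex) topology \<Rightarrow> ('t \<Rightarrow> ('x \<Rightarrow> complex) \<Rightarrow> ('x \<Rightarrow> complex)) \<Rightarrow>
   (('x \<Rightarrow> complex) \<Rightarrow> ('x \<Rightarrow> complex)) \<Rightarrow> 't filter \<Rightarrow> bool" where
  "op_tendsto E f L F \<longleftrightarrow> (\<forall>B q e. bounded_in E B \<and> cont_seminorm E q \<and> 0 < e \<longrightarrow>
     eventually (\<lambda>t. \<forall>u\<in>B. q (\<lambda>s. f t u s - L u s) < e) F)"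

text \<open>The family \<^term>\<open>D\<close> collects the partial derivatives of \<^term>\<open>p\<close>: the first index refers
  to the covariable, the second one to the variable.\<close>

definition op_derivs ::
  "('x \<Rightarrow> complex) topology \<Rightarrow> ('a::euclidean_space \<times> 'a \<Rightarrow> ('x \<Rightarrow> complex) \<Rightarrow> ('x \<Rightarrow> complex)) \<Rightarrow>
   ('a list \<Rightarrow> 'a list \<Rightarrow> 'a \<times> 'a \<Rightarrow> ('x \<Rightarrow> complex) \<Rightarrow> ('x \<Rightarrow> complex)) \<Rightarrow> bool" where
  "op_derivs E p D \<longleftrightarrow> D [] [] = p \<and>
     (\<forall>\<alpha> \<beta>. set \<alpha> \<subseteq> Basis \<and> set \<beta> \<subseteq> Basis \<longrightarrow> (\<forall>x \<xi>.
        cont_lin_op E (D \<alpha> \<beta> (x, \<xi>)) \<and>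
        op_tendsto E (D \<alpha> \<beta>) (D \<alpha> \<beta> (x, \<xi>)) (at (x, \<xi>)) \<and>
        (\<forall>b\<in>Basis.
           op_tendsto E
             (\<lambda>t u s. (D \<alpha> \<beta> (x, \<xi> + t *\<^sub>R b) u s - D \<alpha> \<beta> (x, \<xi>) u s) / of_real t)
             (D (b # \<alpha>) \<beta> (x, \<xi>)) (at (0::real)) \<and>
           op_tendsto E
             (\<lambda>t u s. (D \<alpha> \<beta> (x + t *\<^sub>R b, \<xi>) u s - D \<alpha> \<beta> (x, \<xi>) u s) / of_real t)
             (D \<alpha> (b # \<beta>) (x, \<xi>)) (at (0::real)))))"

definition op_symbols ::
  "('x \<Rightarrow> complex) topology \<Rightarrow> (real \<Rightarrow> ('x \<Rightarrow> complex) \<Rightarrow> ('x \<Rightarrow> complex)) \<Rightarrow> real \<Rightarrow>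
   ('a::euclidean_space \<times> 'a \<Rightarrow> ('x \<Rightarrow> complex) \<Rightarrow> ('x \<Rightarrow> complex)) set" where
  "op_symbols E \<kappa> m = {p. \<exists>D. op_derivs E p D \<and>
     (\<forall>\<alpha> \<beta> q K. set \<alpha> \<subseteq> Basis \<and> set \<beta> \<subseteq> Basis \<and> cont_seminorm E q \<and> compact K \<longrightarrow>
        (\<exists>r C. cont_seminorm E r \<and>
           (\<forall>x\<in>K. \<forall>\<xi>. \<forall>u\<in>topspace E.
              q (\<kappa> (1 / japanese \<xi>) (D \<alpha> \<beta> (x, \<xi>) (\<kappa> (japanese \<xi>) u)))
                \<le> C * japanese \<xi> powr (m - length \<alpha>) * r u)))}"


subsection \<open>Manifolds and cotangent bundles\<close>

type_synonym ('p, 'e) chart = "'p set \<times> ('p \<Rightarrow> 'e)"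

definition is_chart :: "('p::topological_space, 'e::euclidean_space) chart \<Rightarrow> bool" where
  "is_chart c \<longleftrightarrow> open (fst c) \<and> open (snd c ` fst c) \<and>
     homeomorphism (fst c) (snd c ` fst c) (snd c) (inv_into (fst c) (snd c))"

definition transition :: "('p, 'e) chart \<Rightarrow> ('p, 'e) chart \<Rightarrow> 'e \<Rightarrow> 'e" where
  "transition c d = snd d \<circ> inv_into (fst c) (snd c)"

definition compatible :: "('p, 'e::euclidean_space) chart \<Rightarrow> ('p, 'e) chart \<Rightarrow> bool" where
  "compatible c d \<longleftrightarrow> smooth_on (snd c ` (fst c \<inter> fst d)) (transition c d) \<and>
     smooth_on (snd d ` (fst c \<inter> fst d)) (transition d c)"

text \<open>The points of the manifold are those of the type, the smooth structure is a maximal atlas.\<close>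

definition closed_manifold :: "('p::t2_space, 'e::euclidean_space) chart set \<Rightarrow> bool" where
  "closed_manifold A \<longleftrightarrow> compact (UNIV :: 'p set) \<and> \<Union> (fst ` A) = UNIV \<and>
     (\<forall>c\<in>A. is_chart c) \<and> (\<forall>c\<in>A. \<forall>d\<in>A. compatible c d) \<and>
     (\<forall>c. is_chart c \<and> (\<forall>d\<in>A. compatible c d) \<longrightarrow> c \<in> A)"

text \<open>Charts mapping \<^term>\<open>X\<close> to the half space: the last coordinate is a boundary defining
  function.\<close>

definition boundary_chart ::
  "('p::t2_space, 'm::finite rn) chart set \<Rightarrow> 'p set \<Rightarrow> ('p, 'm rn) chart \<Rightarrow> bool" where
  "boundary_chart A X c \<longleftrightarrow> c \<in> A \<and> (\<forall>p\<in>fst c. p \<in> X \<longleftrightarrow> 0 \<le> snd (snd c p))"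

text \<open>\<^term>\<open>X\<close> is a compact manifold with boundary, of full dimension in the closed manifold;
  its boundary is \<^term>\<open>frontier X\<close>.\<close>

definition manifold_with_boundary ::
  "('p::t2_space, 'm::finite rn) chart set \<Rightarrow> 'p set \<Rightarrow> bool" where
  "manifold_with_boundary A X \<longleftrightarrow> compact X \<and>
     (\<forall>p\<in>frontier X. \<exists>c. boundary_chart A X c \<and> p \<in> fst c)"

text \<open>A covector at \<^term>\<open>p\<close> is the family of its coordinate vectors in the charts around
  \<^term>\<open>p\<close> (and 0 for all other charts).\<close>

type_synonym ('p, 'e) covector = "'p \<times> (('p, 'e) chart \<Rightarrow> 'e)"

definition cotangent0 ::
  "('p, 'e::euclidean_space) chart set \<Rightarrow> 'p set \<Rightarrow> ('p, 'e) covector set" where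
  "cotangent0 A W = {(p, \<omega>). p \<in> W \<and> \<omega> \<noteq> (\<lambda>_. 0) \<and>
     (\<forall>c. c \<notin> A \<or> p \<notin> fst c \<longrightarrow> \<omega> c = 0) \<and>
     (\<forall>c\<in>A. \<forall>d\<in>A. p \<in> fst c \<and> p \<in> fst d \<longrightarrow>
        (\<forall>v. \<omega> c \<bullet> v = \<omega> d \<bullet> frechet_derivative (transition c d) (at (snd c p)) v))}"

definition scale_covector ::
  "real \<Rightarrow> ('p, 'e::real_vector) covector \<Rightarrow> ('p, 'e) covector" where
  "scale_covector t z = (fst z, \<lambda>c. t *\<^sub>R snd z c)"

definition cot_chart :: "('p, 'e) chart \<Rightarrow> ('p, 'e) covector \<Rightarrow> 'e \<times> 'e" where
  "cot_chart c z = (snd c (fst z), snd z c)"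

text \<open>The expression of a map \<^term>\<open>chi\<close> from \<^term>\<open>cotangent0 A W\<close> to covectors in the canonical
  coordinates induced by the charts \<^term>\<open>c\<close> and \<^term>\<open>d\<close>, and its domain of definition.\<close>

definition cot_expr ::
  "('q, 'e::euclidean_space) chart set \<Rightarrow> 'q set \<Rightarrow> ('q, 'e) chart \<Rightarrow> ('p, 'e) chart \<Rightarrow>
   (('q, 'e) covector \<Rightarrow> ('p, 'e) covector) \<Rightarrow> 'e \<times> 'e \<Rightarrow> 'e \<times> 'e" where
  "cot_expr A W c d chi = cot_chart d \<circ> chi \<circ> inv_into (cotangent0 A (W \<inter> fst c)) (cot_chart c)"

definition cot_dom ::
  "('q, 'e::euclidean_space) chart set \<Rightarrow> 'q set \<Rightarrow> ('q, 'e) chart \<Rightarrow> ('p, 'e) chart \<Rightarrow>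
   (('q, 'e) covector \<Rightarrow> ('p, 'e) covector) \<Rightarrow> ('e \<times> 'e) set" where
  "cot_dom A W c d chi = cot_chart c ` {z \<in> cotangent0 A (W \<inter> fst c). fst (chi z) \<in> fst d}"

definition smooth_cot_map ::
  "('q, 'e::euclidean_space) chart set \<Rightarrow> 'q set \<Rightarrow> ('p, 'e) chart set \<Rightarrow>
   (('q, 'e) covector \<Rightarrow> ('p, 'e) covector) \<Rightarrow> bool" where
  "smooth_cot_map A W B chi \<longleftrightarrow>
     (\<forall>c\<in>A. \<forall>d\<in>B. open (cot_dom A W c d chi) \<and> smooth_on (cot_dom A W c d chi) (cot_expr A W c d chi))"

definition sympl_form :: "'e::real_inner \<times> 'e \<Rightarrow> 'e \<times> 'e \<Rightarrow> real" where
  "sympl_form v w = snd v \<bullet> fst w - snd w \<bullet> fst v"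

definition symplectomorphism ::
  "('q, 'e::euclidean_space) chart set \<Rightarrow> 'q set \<Rightarrow> ('p, 'e) chart set \<Rightarrow> 'p set \<Rightarrow>
   (('q, 'e) covector \<Rightarrow> ('p, 'e) covector) \<Rightarrow> bool" where
  "symplectomorphism A W B V chi \<longleftrightarrow>
     bij_betw chi (cotangent0 A W) (cotangent0 B V) \<and>
     smooth_cot_map A W B chi \<and> smooth_cot_map B V A (inv_into (cotangent0 A W) chi) \<and>
     (\<forall>c\<in>A. \<forall>d\<in>B. \<forall>z\<in>cot_dom A W c d chi. \<forall>v w.
        sympl_form (frechet_derivative (cot_expr A W c d chi) (at z) v)
                   (frechet_derivative (cot_expr A W c d chi) (at z) w) = sympl_form v w)"

definition smooth_boundary_map ::
  "('q::t2_space, 'm::finite rn) chart set \<Rightarrow> 'q set \<Rightarrow>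
   ('p::t2_space, 'm rn) chart set \<Rightarrow> 'p set \<Rightarrow> ('q \<Rightarrow> 'p) \<Rightarrow> bool" where
  "smooth_boundary_map A Y B X b \<longleftrightarrow>
     (\<forall>c d. boundary_chart A Y c \<and> boundary_chart B X d \<longrightarrow>
        (let D = {y'. (y', 0) \<in> snd c ` fst c \<and> b (inv_into (fst c) (snd c) (y', 0)) \<in> fst d}
         in open D \<and> smooth_on D (\<lambda>y'. fst (snd d (b (inv_into (fst c) (snd c) (y', 0)))))))"

text \<open>\<^term>\<open>chi\<close> is the extended symplectomorphism over the neighbourhoods \<^term>\<open>Yt\<close> and
  \<^term>\<open>Xt\<close>; the given one is its restriction to the covectors over \<^term>\<open>Y\<close>.\<close>

definition boundary_symplectomorphism ::
  "('q::t2_space, 'm::finite rn) chart set \<Rightarrow> 'q set \<Rightarrow> 'q set \<Rightarrow>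
   ('p::t2_space, 'm rn) chart set \<Rightarrow> 'p set \<Rightarrow> 'p set \<Rightarrow>
   (('q, 'm rn) covector \<Rightarrow> ('p, 'm rn) covector) \<Rightarrow> bool" where
  "boundary_symplectomorphism A Y Yt B X Xt chi \<longleftrightarrow>
     manifold_with_boundary A Y \<and> open Yt \<and> Y \<subseteq> Yt \<and>
     manifold_with_boundary B X \<and> open Xt \<and> X \<subseteq> Xt \<and>
     symplectomorphism A Yt B Xt chi \<and>
     (\<forall>z\<in>cotangent0 A Yt. \<forall>t>0. chi (scale_covector t z) = scale_covector t (chi z)) \<and>
     bij_betw chi (cotangent0 A Y) (cotangent0 B X) \<and>
     (\<exists>b. bij_betw b (frontier Y) (frontier X) \<and>
          smooth_boundary_map A Y B X b \<and>
          smooth_boundary_map B X A Y (inv_into (frontier Y) b) \<and>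
          (\<forall>z\<in>cotangent0 A (frontier Y). fst (chi z) = b (fst z)))"

text \<open>The transmission condition for a function \<^term>\<open>p\<close>, homogeneous of degree \<^term>\<open>\<mu>\<close> in
  the covariable and defined on the open set \<^term>\<open>D\<close>.\<close>

definition hom_transmission ::
  "int \<Rightarrow> ('m::finite rn \<times> 'm rn) set \<Rightarrow> ('m rn \<times> 'm rn \<Rightarrow> real) \<Rightarrow> bool" where
  "hom_transmission \<mu> D p \<longleftrightarrow>
     (\<forall>x'. ((x', 0), (0, 1)) \<in> D \<and> ((x', 0), (0, -1)) \<in> D \<longrightarrow>
       (\<forall>l \<alpha> \<beta>. set \<alpha> \<subseteq> Basis \<and> set \<beta> \<subseteq> Basis \<longrightarrow>
         (let P = dirs (replicate l ((0, 1), 0) @ map (\<lambda>b. (0, (b, 0))) \<alpha> @ map (\<lambda>b. ((b, 0), 0)) \<beta>) p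
          in P ((x', 0), (0, 1)) = (-1) powi (\<mu> - int (length \<alpha>)) * P ((x', 0), (0, -1)))))"

definition admissible ::
  "('q::t2_space, 'm::finite rn) chart set \<Rightarrow> 'q set \<Rightarrow> 'q set \<Rightarrow>
   ('p::t2_space, 'm rn) chart set \<Rightarrow> 'p set \<Rightarrow>
   (('q, 'm rn) covector \<Rightarrow> ('p, 'm rn) covector) \<Rightarrow> bool" where
  "admissible A Y Yt B X chi \<longleftrightarrow>
     (\<forall>c d. boundary_chart A Y c \<and> boundary_chart B X d \<longrightarrow> (\<forall>k\<in>Basis.
        hom_transmission 0 (cot_dom A Yt c d chi) (\<lambda>z. fst (cot_expr A Yt c d chi z) \<bullet> k) \<and>
        hom_transmission 1 (cot_dom A Yt c d chi) (\<lambda>z. snd (cot_expr A Yt c d chi z) \<bullet> k)))"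


subsection \<open>Phase functions and the operator family\<close>

definition phase_represents ::
  "('q::t2_space, 'm::finite rn) chart set \<Rightarrow> 'q set \<Rightarrow> ('q, 'm rn) chart \<Rightarrow> ('p, 'm rn) chart \<Rightarrow>
   (('q, 'm rn) covector \<Rightarrow> ('p, 'm rn) covector) \<Rightarrow> 'm rn set \<Rightarrow>
   ('m rn \<times> 'm rn \<Rightarrow> real) \<Rightarrow> bool" where
  "phase_represents A Yt c d chi \<Omega> \<psi> \<longleftrightarrow>
     smooth_on (\<Omega> \<times> (- {0})) \<psi> \<and>
     (\<forall>x\<in>\<Omega>. \<forall>\<xi>. \<xi> \<noteq> 0 \<longrightarrow> (\<forall>t>0. \<psi> (x, t *\<^sub>R \<xi>) = t * \<psi> (x, \<xi>))) \<and>
     (\<forall>x\<in>\<Omega>. \<forall>\<xi>. \<xi> \<noteq> 0 \<longrightarrow>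
        (let y = grad (\<lambda>\<eta>. \<psi> (x, \<eta>)) \<xi>
         in (y, \<xi>) \<in> cot_dom A Yt c d chi \<and>
            cot_expr A Yt c d chi (y, \<xi>) = (x, grad (\<lambda>w. \<psi> (w, \<xi>)) x))) \<and>
     local_diffeo_on (\<Omega> \<times> (- {0})) (\<lambda>(x, \<xi>). (grad (\<lambda>\<eta>. \<psi> (x, \<eta>)) \<xi>, \<xi>))"

text \<open>\<open>\<psi>((x',0),(\<xi>',s))\<close> does not depend on \<open>s\<close>; the choice \<open>s = 1\<close> keeps the covariable nonzero
  also for \<open>\<xi>' = 0\<close>.\<close>

definition phase_boundary ::
  "('m::finite rn \<times> 'm rn \<Rightarrow> real) \<Rightarrow> real ^ 'm \<Rightarrow> real ^ 'm \<Rightarrow> real" where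
  "phase_boundary \<psi> x' \<xi>' = \<psi> ((x', 0), (\<xi>', 1))"

text \<open>A homogeneous phase function is in general singular at the zero section; it is modified
  there to a smooth function.\<close>

definition phase_modification ::
  "'m::finite rn set \<Rightarrow> ('m rn \<times> 'm rn \<Rightarrow> real) \<Rightarrow> ('m rn \<times> 'm rn \<Rightarrow> real) \<Rightarrow> bool" where
  "phase_modification \<Omega> \<psi> \<psi>m \<longleftrightarrow> smooth_on (\<Omega> \<times> UNIV) \<psi>m \<and>
     (\<exists>R>0. \<forall>x\<in>\<Omega>. \<forall>\<xi>. R \<le> norm \<xi> \<longrightarrow> \<psi>m (x, \<xi>) = \<psi> (x, \<xi>))"

definition kernel_A ::
  "('m::finite rn \<times> 'm rn \<Rightarrow> real) \<Rightarrow> ('m rn \<times> 'm rn \<Rightarrow> real) \<Rightarrow>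
   ('m rn \<times> 'm rn \<Rightarrow> complex) \<Rightarrow> (real ^ 'm) \<times> (real ^ 'm) \<Rightarrow> real \<Rightarrow> real \<Rightarrow> complex" where
  "kernel_A \<psi> \<psi>m a = (\<lambda>(x', \<xi>') t s.
     exp (\<i> * of_real (\<psi>m ((x', t), (\<xi>', s)) - phase_boundary \<psi> x' \<xi>')) * a ((x', t), (\<xi>', s)))"

definition op_A ::
  "('m::finite rn \<times> 'm rn \<Rightarrow> real) \<Rightarrow> ('m rn \<times> 'm rn \<Rightarrow> real) \<Rightarrow> ('m rn \<times> 'm rn \<Rightarrow> complex) \<Rightarrow>
   (real ^ 'm) \<times> (real ^ 'm) \<Rightarrow> (real \<Rightarrow> complex) \<Rightarrow> real \<Rightarrow> complex" where
  "op_A \<psi> \<psi>m a z u = (\<lambda>t. LBINT s. kernel_A \<psi> \<psi>m a z t s * fourier u s / of_real (2 * pi))"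

text \<open>On distributions the integral is the pairing of the distributional Fourier transform of
  \<^term>\<open>T\<close> with the kernel, smeared with a test function in the first variable. For \<^term>\<open>T\<close> given
  by a Schwartz function this is \<^const>\<open>op_A\<close>, by interchanging the integrals.\<close>

definition op_A_tempered ::
  "('m::finite rn \<times> 'm rn \<Rightarrow> real) \<Rightarrow> ('m rn \<times> 'm rn \<Rightarrow> real) \<Rightarrow> ('m rn \<times> 'm rn \<Rightarrow> complex) \<Rightarrow>
   (real ^ 'm) \<times> (real ^ 'm) \<Rightarrow>
   ((real \<Rightarrow> complex) \<Rightarrow> complex) \<Rightarrow> (real \<Rightarrow> complex) \<Rightarrow> complex" where
  "op_A_tempered \<psi> \<psi>m a z T = (\<lambda>f. if f \<in> schwartz
     then tempered_fourier T (\<lambda>s. LBINT t. kernel_A \<psi> \<psi>m a z t s * f t / of_real (2 * pi))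
     else 0)"

end

(* After conjugation with the group action, the kernel of the operator is exp(i phi) a in the
   variables <xi'> x_n and xi_n / <xi'>, with phi the difference of psi and its boundary values.
   A boundary preserving chi forces d psi / d xi_n to vanish at x_n = 0 to first order exactly, so
   near the boundary <xi'> |d phi / d xi_n| dominates <xi'> |x_n|, while |xi'| + |d phi / d x_n|
   dominates |xi| by nondegeneracy and homogeneity. Partial integration in xi_n or in x_n therefore
   gains arbitrary decay in the other variable with constants uniform in xi', which gives the symbol
   estimates on Schwartz functions. The same holds for the transposed kernel, and the statement on
   tempered distributions follows by duality. *)

theory Submission
  imports Defs
begin

section \<open>Symmetry and locality of iterated partial derivatives\<close>

section \<open>Iterated directional derivatives\<close>

text \<open>Estimates are recorded by three exponents: the order in <xi'>, and the growth in <xi'>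
  x_n and in xi_n / <xi'>. Only the first must be sharp, for after dilation the other two are mere
  polynomial weights: growth in the integration variable is absorbed by the Schwartz function,
  growth in the outer one drops by one with each partial integration. Hence a crude bound such as
  <xi'>^m (1 + |xi_n| / <xi'>)^|m| is enough for an amplitude of order m. The partial integrations
  divide by 1 + <xi'>^2 (d phi / d xi_n)^2 or by <xi'>^2 + (d phi / d x_n)^2, which stay positive
  where the derivative of the phase vanishes. One obstacle is the region |xi'| <= R, where the
  modified phase need not agree with its boundary value at x_n = 0; there <xi'> is bounded, so its
  powers can be traded for constants. The other is that constants are uniform only over compact
  pieces of the collar, while the symbol estimates concern all compact sets of x'; over points not
  covered by such a piece the kernel vanishes, because the closed support of \<open>a\<close> lies
  in the collar.\<close>

abbreviation pd :: "'a::euclidean_space \<Rightarrow> ('a \<Rightarrow> 'b::real_normed_vector) \<Rightarrow> 'a \<Rightarrow> 'b" where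
  "pd v f \<equiv> (\<lambda>x. frechet_derivative f (at x) v)"

lemma dirs_Nil [simp]: "dirs [] f = f"
  by (simp add: dirs_def)

lemma dirs_Cons [simp]: "dirs (v # vs) f = pd v (dirs vs f)"
  by (simp add: dirs_def)

lemma dirs_append: "dirs (vs @ ws) f = dirs vs (dirs ws f)"
  by (induction vs) auto

lemma pd_eqI: "(f has_derivative f') (at x) \<Longrightarrow> pd v f x = f' v"
  by (metis frechet_derivative_at)

lemma pd_zero [simp]: "pd v (\<lambda>x. 0) = (\<lambda>x. 0)"
  by simp

lemma differentiable_cong_open:
  assumes "open D" "p \<in> D" "\<And>x. x \<in> D \<Longrightarrow> f x = g x"
  shows "f differentiable (at p) \<longleftrightarrow> g differentiable (at p)" "pd v f p = pd v g p"
proof -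
  have *: "(f has_derivative h) (at p) \<longleftrightarrow> (g has_derivative h) (at p)" for h
    using assms has_derivative_transform_within_open[OF _ assms(1,2)] by metis
  show "f differentiable (at p) \<longleftrightarrow> g differentiable (at p)"
    unfolding differentiable_def using * by auto
  show "pd v f p = pd v g p"
    unfolding frechet_derivative_def using * by simp
qed

lemma dirs_cong_open:
  assumes "open D" "\<And>x. x \<in> D \<Longrightarrow> f x = g x" "p \<in> D"
  shows "dirs vs f p = dirs vs g p"
  using assms(3)
proof (induction vs arbitrary: p)
  case (Cons v vs)
  show ?case
    using differentiable_cong_open(2)[OF assms(1) Cons.prems Cons.IH] by simp
qed (use assms in auto)

lemma pd_sum_Basis:
  assumes "f differentiable (at p)"
  shows "pd v f p = (\<Sum>b\<in>Basis. (v \<bullet> b) *\<^sub>R pd b f p)"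
proof -
  have "linear (frechet_derivative f (at p))"
    using assms by (rule linear_frechet_derivative)
  then have "frechet_derivative f (at p) (\<Sum>b\<in>Basis. (v \<bullet> b) *\<^sub>R b) = (\<Sum>b\<in>Basis. (v \<bullet> b) *\<^sub>R pd b f p)"
    by (simp add: linear_sum linear_scale)
  then show ?thesis
    by (simp add: euclidean_representation)
qed

lemma line_derivative:
  fixes f :: "'a::euclidean_space \<Rightarrow> 'b::real_normed_vector"
  assumes "f differentiable (at (p + s *\<^sub>R v))"
  shows "((\<lambda>s. f (p + s *\<^sub>R v)) has_vector_derivative pd v f (p + s *\<^sub>R v)) (at s)"
proof -
  have 1: "(f has_derivative frechet_derivative f (at (p + s *\<^sub>R v))) (at (p + s *\<^sub>R v))"
    using assms by (simp add: frechet_derivative_works)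
  have 2: "((\<lambda>s. p + s *\<^sub>R v) has_derivative (\<lambda>h. h *\<^sub>R v)) (at s)"
    by (auto intro!: derivative_eq_intros)
  have "((\<lambda>s. f (p + s *\<^sub>R v)) has_derivative (\<lambda>h. frechet_derivative f (at (p + s *\<^sub>R v)) (h *\<^sub>R v))) (at s)"
    using has_derivative_compose[OF 2 1] by simp
  moreover have "frechet_derivative f (at (p + s *\<^sub>R v)) (h *\<^sub>R v) = h *\<^sub>R frechet_derivative f (at (p + s *\<^sub>R v)) v" for h
    using linear_frechet_derivative[OF assms] by (simp add: linear_scale)
  ultimately show ?thesis
    by (simp add: has_vector_derivative_def)
qed

lemma mean_value_bound:
  fixes g :: "real \<Rightarrow> 'b::real_normed_vector"
  assumes "\<And>x. x \<in> closed_segment a b \<Longrightarrow> (g has_vector_derivative g' x) (at x)"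
    and "\<And>x. x \<in> closed_segment a b \<Longrightarrow> norm (g' x) \<le> B"
  shows "norm (g b - g a) \<le> B * \<bar>b - a\<bar>"
proof -
  have "norm (g b - g a) \<le> B * norm (b - a)"
  proof (rule differentiable_bound[where S = "closed_segment a b" and f' = "\<lambda>x h. h *\<^sub>R g' x"])
    show "(g has_derivative (\<lambda>h. h *\<^sub>R g' x)) (at x within closed_segment a b)" if "x \<in> closed_segment a b" for x
      using assms(1)[OF that] by (simp add: has_vector_derivative_def has_derivative_at_withinI)
    show "onorm (\<lambda>h. h *\<^sub>R g' x) \<le> B" if "x \<in> closed_segment a b" for x
      using assms(2)[OF that] by (intro onorm_le) (simp add: mult.commute[of B] mult_left_mono)
  qed auto
  then show ?thesis by simp
qed

text \<open>Only basis directions occur, in contrast to \<open>smooth_on\<close>. The notion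
  therefore passes to differences, complexifications and affine substitutions by short inductions
  over the list of directions. Continuity of each derivative is implied by its
  differentiability.\<close>

definition partials_on :: "'a::euclidean_space set \<Rightarrow> ('a \<Rightarrow> 'b::real_normed_vector) \<Rightarrow> bool" where
  "partials_on D f \<longleftrightarrow> (\<forall>vs. set vs \<subseteq> Basis \<longrightarrow> (\<forall>p\<in>D. dirs vs f differentiable (at p)))"

lemma partials_onD: "partials_on D f \<Longrightarrow> set vs \<subseteq> Basis \<Longrightarrow> p \<in> D \<Longrightarrow> dirs vs f differentiable (at p)"
  by (auto simp: partials_on_def)

lemma partials_on_dirs:
  "partials_on D f \<Longrightarrow> set vs \<subseteq> Basis \<Longrightarrow> partials_on D (dirs vs f)"
  unfolding partials_on_def by (metis dirs_append le_sup_iff set_append)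

lemma partials_on_subset: "partials_on D f \<Longrightarrow> E \<subseteq> D \<Longrightarrow> partials_on E f"
  by (auto simp: partials_on_def)

lemma smooth_on_pd: "smooth_on D f \<Longrightarrow> smooth_on D (pd v f)"
  unfolding smooth_on_def by (metis cdiff_on.simps(2))

lemma smooth_on_differentiable: "smooth_on D f \<Longrightarrow> p \<in> D \<Longrightarrow> f differentiable (at p)"
  unfolding smooth_on_def by (metis cdiff_on.simps(2))

lemma smooth_on_dirs: "smooth_on D f \<Longrightarrow> smooth_on D (dirs vs f)"
  by (induction vs) (auto intro: smooth_on_pd)

lemma smooth_on_partials: "smooth_on D f \<Longrightarrow> partials_on D f"
  unfolding partials_on_def using smooth_on_dirs smooth_on_differentiable by blast

lemma smooth_on_continuous: "smooth_on D f \<Longrightarrow> continuous_on D (dirs vs f)"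
  using smooth_on_dirs[of D f vs] unfolding smooth_on_def by (metis cdiff_on.simps(1))

text \<open>The mean value theorem is applied twice: in direction \<open>b\<close> to
  \<open>pd a f\<close> minus its linear model with slope \<open>V\<close>, and in direction
  \<open>a\<close> to the increment of \<open>f\<close> by \<open>h *\<^sub>R b\<close>.\<close>

lemma second_difference:
  fixes f :: "'a::euclidean_space \<Rightarrow> 'b::real_normed_vector"
  assumes "r > 0" and f: "\<And>x. x \<in> ball p r \<Longrightarrow> f differentiable (at x)"
    and fa: "\<And>x. x \<in> ball p r \<Longrightarrow> pd a f differentiable (at x)"
    and e: "\<And>x. x \<in> ball p r \<Longrightarrow> norm (pd b (pd a f) x - V) \<le> e"
    and h: "0 < h" "h * (norm a + norm b) < r"
  shows "norm (f (p + h *\<^sub>R a + h *\<^sub>R b) - f (p + h *\<^sub>R a) - f (p + h *\<^sub>R b) + f p - h\<^sup>2 *\<^sub>R V) \<le> h\<^sup>2 * e"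
proof -
  have mem: "p + s *\<^sub>R a + t *\<^sub>R b \<in> ball p r" if "s \<in> {0..h}" "t \<in> {0..h}" for s t
  proof -
    have "norm (s *\<^sub>R a + t *\<^sub>R b) \<le> s * norm a + t * norm b"
      using that norm_triangle_ineq[of "s *\<^sub>R a" "t *\<^sub>R b"] by simp
    also have "\<dots> \<le> h * norm a + h * norm b"
      using that by (intro add_mono mult_right_mono) auto
    finally have "norm (s *\<^sub>R a + t *\<^sub>R b) < r"
      using h by (simp add: distrib_left)
    then show ?thesis
      by (simp only: mem_ball dist_norm norm_minus_commute[of p]) (simp add: algebra_simps)
  qed
  have inner: "norm (pd a f (p + s *\<^sub>R a + h *\<^sub>R b) - pd a f (p + s *\<^sub>R a) - h *\<^sub>R V) \<le> e * h"
    if s: "s \<in> {0..h}" for s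
  proof -
    have "norm ((pd a f (p + s *\<^sub>R a + h *\<^sub>R b) - h *\<^sub>R V) - (pd a f (p + s *\<^sub>R a + 0 *\<^sub>R b) - 0 *\<^sub>R V)) \<le> e * \<bar>h - 0\<bar>"
    proof (rule mean_value_bound[where g' = "\<lambda>t. pd b (pd a f) (p + s *\<^sub>R a + t *\<^sub>R b) - V"])
      fix t assume "t \<in> closed_segment 0 h"
      then have "p + s *\<^sub>R a + t *\<^sub>R b \<in> ball p r"
        using h s by (intro mem) (auto simp: closed_segment_eq_real_ivl split: if_splits)
      then show "((\<lambda>t. pd a f (p + s *\<^sub>R a + t *\<^sub>R b) - t *\<^sub>R V) has_vector_derivative
          pd b (pd a f) (p + s *\<^sub>R a + t *\<^sub>R b) - V) (at t)"
        "norm (pd b (pd a f) (p + s *\<^sub>R a + t *\<^sub>R b) - V) \<le> e"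
        using line_derivative[OF fa] e
        by (auto intro!: derivative_eq_intros simp: has_vector_derivative_diff)
    qed
    then show ?thesis using h by (simp add: algebra_simps)
  qed
  have "norm ((f (p + h *\<^sub>R a + h *\<^sub>R b) - f (p + h *\<^sub>R a) - h *\<^sub>R (h *\<^sub>R V))
            - (f (p + 0 *\<^sub>R a + h *\<^sub>R b) - f (p + 0 *\<^sub>R a) - 0 *\<^sub>R (h *\<^sub>R V))) \<le> e * h * \<bar>h - 0\<bar>"
  proof (rule mean_value_bound[where g' = "\<lambda>s. pd a f (p + s *\<^sub>R a + h *\<^sub>R b) - pd a f (p + s *\<^sub>R a) - h *\<^sub>R V"])
    fix s assume "s \<in> closed_segment 0 h"
    then have s: "s \<in> {0..h}"
      using h by (auto simp: closed_segment_eq_real_ivl split: if_splits)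
    have m: "(p + h *\<^sub>R b) + s *\<^sub>R a \<in> ball p r" "p + s *\<^sub>R a \<in> ball p r"
      using mem[OF s, of h] mem[OF s, of 0] h by (auto simp: algebra_simps)
    have "((\<lambda>s. f ((p + h *\<^sub>R b) + s *\<^sub>R a) - f (p + s *\<^sub>R a) - s *\<^sub>R (h *\<^sub>R V)) has_vector_derivative
        pd a f ((p + h *\<^sub>R b) + s *\<^sub>R a) - pd a f (p + s *\<^sub>R a) - h *\<^sub>R V) (at s)"
      using line_derivative[OF f[OF m(1)]] line_derivative[OF f[OF m(2)]]
      by (auto intro!: derivative_eq_intros has_vector_derivative_diff)
    then show "((\<lambda>s. f (p + s *\<^sub>R a + h *\<^sub>R b) - f (p + s *\<^sub>R a) - s *\<^sub>R (h *\<^sub>R V)) has_vector_derivative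
        pd a f (p + s *\<^sub>R a + h *\<^sub>R b) - pd a f (p + s *\<^sub>R a) - h *\<^sub>R V) (at s)"
      by (simp add: algebra_simps)
    show "norm (pd a f (p + s *\<^sub>R a + h *\<^sub>R b) - pd a f (p + s *\<^sub>R a) - h *\<^sub>R V) \<le> e * h"
      by (rule inner[OF s])
  qed
  then show ?thesis using h by (simp add: power2_eq_square algebra_simps)
qed

text \<open>Schwarz's theorem: the second difference is symmetric in \<open>a\<close> and
  \<open>b\<close>, and divided by h^2 it approximates either mixed derivative.\<close>

lemma pd_commute:
  fixes f :: "'a::euclidean_space \<Rightarrow> 'b::real_normed_vector"
  assumes D: "open D" "p \<in> D" and f: "\<And>x. x \<in> D \<Longrightarrow> f differentiable (at x)"
    and fa: "\<And>x. x \<in> D \<Longrightarrow> pd a f differentiable (at x)"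
    and fb: "\<And>x. x \<in> D \<Longrightarrow> pd b f differentiable (at x)"
    and cont: "isCont (pd b (pd a f)) p" "isCont (pd a (pd b f)) p"
  shows "pd a (pd b f) p = pd b (pd a f) p"
proof (rule ccontr)
  let ?V = "pd b (pd a f) p" and ?W = "pd a (pd b f) p"
  assume ne: "?W \<noteq> ?V"
  \<comment> \<open>A third of the gap: two approximations with error \<open>e\<close> leave a
    distance of at most 2 e, whereas the gap is 3 e.\<close>
  define e where "e = norm (?V - ?W) / 3"
  have "e > 0" using ne by (simp add: e_def)
  obtain r0 where r0: "r0 > 0" "ball p r0 \<subseteq> D" using D open_contains_ball by blast
  obtain r1 where r1: "r1 > 0" "\<And>x. dist x p < r1 \<Longrightarrow> norm (pd b (pd a f) x - ?V) < e"
    using cont(1) \<open>e > 0\<close> unfolding continuous_at dist_norm Lim_at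
    by (metis dist_norm norm_zero diff_self zero_less_norm_iff dist_nz)
  obtain r2 where r2: "r2 > 0" "\<And>x. dist x p < r2 \<Longrightarrow> norm (pd a (pd b f) x - ?W) < e"
    using cont(2) \<open>e > 0\<close> unfolding continuous_at dist_norm Lim_at
    by (metis dist_norm norm_zero diff_self zero_less_norm_iff dist_nz)
  define r where "r = min r0 (min r1 r2)"
  have r: "r > 0" using r0 r1 r2 by (simp add: r_def)
  define h where "h = r / (2 * (norm a + norm b + 1))"
  have na: "0 < norm a + norm b + 1" by (smt (verit) norm_ge_zero)
  have h: "h > 0" using r na by (simp add: h_def)
  have "h * (norm a + norm b + 1) = r / 2" using na by (simp add: h_def field_simps)
  then have hr: "h * (norm a + norm b) < r" using h r by (simp add: distrib_left)
  have sub: "ball p r \<subseteq> D" using r0 by (auto simp: r_def)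
  let ?\<Delta> = "f (p + h *\<^sub>R a + h *\<^sub>R b) - f (p + h *\<^sub>R a) - f (p + h *\<^sub>R b) + f p"
  have 1: "norm (?\<Delta> - h\<^sup>2 *\<^sub>R ?V) \<le> h\<^sup>2 * e"
    by (rule second_difference[OF r _ _ _ h hr])
       (use sub f fa r1(2) in \<open>auto simp: r_def dist_commute less_imp_le subset_iff\<close>)
  have "norm (f (p + h *\<^sub>R b + h *\<^sub>R a) - f (p + h *\<^sub>R b) - f (p + h *\<^sub>R a) + f p - h\<^sup>2 *\<^sub>R ?W) \<le> h\<^sup>2 * e"
    by (rule second_difference[OF r _ _ _ h])
       (use sub f fb r2(2) hr in \<open>auto simp: r_def dist_commute less_imp_le subset_iff add.commute\<close>)
  then have 2: "norm (?\<Delta> - h\<^sup>2 *\<^sub>R ?W) \<le> h\<^sup>2 * e" by (simp add: algebra_simps)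
  have "h\<^sup>2 * norm (?V - ?W) = norm ((?\<Delta> - h\<^sup>2 *\<^sub>R ?W) - (?\<Delta> - h\<^sup>2 *\<^sub>R ?V))"
  proof -
    have "(?\<Delta> - h\<^sup>2 *\<^sub>R ?W) - (?\<Delta> - h\<^sup>2 *\<^sub>R ?V) = h\<^sup>2 *\<^sub>R (?V - ?W)"
      by (simp add: algebra_simps)
    then show ?thesis by (metis abs_of_nonneg norm_scaleR zero_le_power2)
  qed
  also have "\<dots> \<le> h\<^sup>2 * e + h\<^sup>2 * e" using 1 2 by (meson order_trans[OF norm_triangle_ineq4] add_mono)
  also have "\<dots> = h\<^sup>2 * (2 * e)" by simp
  finally have "norm (?V - ?W) \<le> 2 * e" using h by simp
  then show False using \<open>e > 0\<close> by (simp add: e_def)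
qed

lemma pd_commute_partials:
  assumes "open D" "partials_on D f" "a \<in> Basis" "b \<in> Basis" "p \<in> D"
  shows "pd a (pd b f) p = pd b (pd a f) p"
proof (rule pd_commute[OF assms(1,5)])
  show "f differentiable (at x)" "pd a f differentiable (at x)" "pd b f differentiable (at x)" if "x \<in> D" for x
    using partials_onD[OF assms(2) _ that, of "[]"] partials_onD[OF assms(2) _ that, of "[a]"]
      partials_onD[OF assms(2) _ that, of "[b]"] assms by auto
  show "isCont (pd b (pd a f)) p" "isCont (pd a (pd b f)) p"
    using partials_onD[OF assms(2) _ assms(5), of "[a, b]"] partials_onD[OF assms(2) _ assms(5), of "[b, a]"] assms
    by (auto intro: differentiable_imp_continuous_within)
qed

lemma dirs_pd_commute:
  assumes "open D" "partials_on D f" "set vs \<subseteq> Basis" "b \<in> Basis" "p \<in> D"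
  shows "dirs vs (pd b f) p = pd b (dirs vs f) p"
  using assms(3,5)
proof (induction vs arbitrary: p)
  case (Cons v vs)
  have "dirs (v # vs) (pd b f) p = pd v (pd b (dirs vs f)) p"
    using differentiable_cong_open(2)[OF assms(1) Cons.prems(2) Cons.IH] Cons.prems by simp
  also have "\<dots> = pd b (pd v (dirs vs f)) p"
    by (rule pd_commute_partials[OF assms(1) partials_on_dirs[OF assms(2)]]) (use Cons.prems assms in auto)
  finally show ?case by simp
qed auto

text \<open>The head of the first list is moved by \<open>dirs_pd_commute\<close> past the entries
  that precede it in the second list. Lists of basis vectors thereby behave as
  multi-indices.\<close>

lemma dirs_perm:
  assumes "open D" "partials_on D f" "set vs \<subseteq> Basis" "mset vs = mset ws" "p \<in> D"
  shows "dirs vs f p = dirs ws f p"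
  using assms(3-5)
proof (induction vs arbitrary: ws p)
  case (Cons v vs)
  have "v \<in> set ws" using mset_eq_setD[OF Cons.prems(2)] by auto
  then obtain w1 w2 where ws: "ws = w1 @ v # w2"
    by (meson split_list)
  have m: "mset vs = mset (w1 @ w2)" using Cons.prems ws by simp
  have B: "set w1 \<subseteq> Basis" "set w2 \<subseteq> Basis" "v \<in> Basis" "set vs \<subseteq> Basis"
    using Cons.prems(1) mset_eq_setD[OF Cons.prems(2)] by (auto simp: ws)
  have "dirs (v # vs) f p = pd v (dirs (w1 @ w2) f) p"
    unfolding dirs_Cons by (rule differentiable_cong_open(2)[OF assms(1) Cons.prems(3) Cons.IH[OF B(4) m]])
  also have "\<dots> = dirs w1 (pd v (dirs w2 f)) p"
    unfolding dirs_append
    by (rule dirs_pd_commute[symmetric, OF assms(1) partials_on_dirs[OF assms(2)]]) (use B Cons.prems in auto)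
  finally show ?case by (simp add: ws dirs_append)
qed simp

section \<open>Neighbourhoods and continuous seminorms in a space given by seminorms\<close>

section \<open>Locally convex spaces given by seminorms\<close>

text \<open>Collects the conditions under which \<open>lc_topology V P\<close> is a locally convex
  vector space topology; the definition itself makes sense for arbitrary \<open>V\<close> and
  \<open>P\<close>.\<close>

locale lc_space =
  fixes V :: "('x \<Rightarrow> complex) set" and P :: "(('x \<Rightarrow> complex) \<Rightarrow> real) set"
  assumes add_mem: "u \<in> V \<Longrightarrow> v \<in> V \<Longrightarrow> (\<lambda>s. u s + v s) \<in> V"
    and scale_mem: "u \<in> V \<Longrightarrow> (\<lambda>s. c * u s) \<in> V"
    and zero_mem: "(\<lambda>s. 0) \<in> V"
    and seminorm: "p \<in> P \<Longrightarrow> seminorm_on V p"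
    and nonempty: "P \<noteq> {}"
begin

abbreviation E where "E \<equiv> lc_topology V P"

lemma diff_mem: "u \<in> V \<Longrightarrow> v \<in> V \<Longrightarrow> (\<lambda>s. u s - v s) \<in> V"
  using add_mem[OF _ scale_mem[of v "-1"], of u] by simp

lemma seminorm_scale: "seminorm_on V q \<Longrightarrow> u \<in> V \<Longrightarrow> q (\<lambda>s. c * u s) = cmod c * q u"
  unfolding seminorm_on_def by simp

lemma seminorm_zero: "seminorm_on V q \<Longrightarrow> q (\<lambda>s. 0) = 0"
  using seminorm_scale[of q "\<lambda>s. 0" 0] zero_mem by simp

lemma seminorm_add: "seminorm_on V q \<Longrightarrow> u \<in> V \<Longrightarrow> v \<in> V \<Longrightarrow> q (\<lambda>s. u s + v s) \<le> q u + q v"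
  unfolding seminorm_on_def by simp

lemma seminorm_nonneg: "seminorm_on V q \<Longrightarrow> u \<in> V \<Longrightarrow> 0 \<le> q u"
  using seminorm_add[of q u "\<lambda>s. -1 * u s"] scale_mem[of u "-1"] seminorm_scale[of q u "-1"] seminorm_zero[of q]
  by simp

lemma seminorm_triangle:
  assumes "seminorm_on V q" "u \<in> V" "v \<in> V" "w \<in> V"
  shows "q (\<lambda>s. u s - w s) \<le> q (\<lambda>s. u s - v s) + q (\<lambda>s. v s - w s)"
  using seminorm_add[OF assms(1) diff_mem[OF assms(2,3)] diff_mem[OF assms(3,4)]] by simp

lemma seminorm_minus:
  assumes "seminorm_on V q" "u \<in> V" "v \<in> V"
  shows "q (\<lambda>s. u s - v s) = q (\<lambda>s. v s - u s)"
  using seminorm_scale[OF assms(1) diff_mem[OF assms(2,3)], of "-1"] by simp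

lemma seminorm_diff_bound:
  assumes "seminorm_on V q" "u \<in> V" "v \<in> V"
  shows "\<bar>q u - q v\<bar> \<le> q (\<lambda>s. u s - v s)"
  using seminorm_triangle[OF assms(1,2,3) zero_mem] seminorm_triangle[OF assms(1,3,2) zero_mem]
    seminorm_minus[OF assms] by simp

lemma seminorm_sum: "finite F \<Longrightarrow> F \<subseteq> P \<Longrightarrow> seminorm_on V (\<lambda>u. \<Sum>p\<in>F. p u)"
  unfolding seminorm_on_def
  by (auto simp: sum_distrib_left sum.distrib[symmetric] subset_iff
      intro!: sum_mono sum.cong seminorm_add seminorm_scale seminorm)

lemma topspace_E [simp]: "topspace E = V"
proof -
  obtain p where p: "p \<in> P" using nonempty by blast
  have "u \<in> {v \<in> V. p (\<lambda>s. v s - u s) < 1}" if "u \<in> V" for u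
    using that seminorm_zero[OF seminorm[OF p]] by simp
  then show ?thesis
    using p zero_less_one unfolding lc_topology_def topology_generated_by_topspace by blast
qed

text \<open>The generating sets are seminorm balls with arbitrary centres. By the triangle
  inequality each point of such a ball is the centre of a smaller ball inside it, which yields the
  usual neighbourhood bases.\<close>

lemma openin_E_iff:
  "openin E A \<longleftrightarrow> A \<subseteq> V \<and> (\<forall>u\<in>A. \<exists>F e. finite F \<and> F \<subseteq> P \<and> 0 < e \<and>
     (\<forall>v\<in>V. (\<forall>p\<in>F. p (\<lambda>s. v s - u s) < e) \<longrightarrow> v \<in> A))"
  (is "_ \<longleftrightarrow> ?nbhd A")
proof
  assume A: "openin E A"
  then have "A \<subseteq> V" using openin_subset topspace_E by metis
  moreover from A have "generate_topology_on {{v \<in> V. p (\<lambda>s. v s - u s) < r} | u p r. u \<in> V \<and> p \<in> P \<and> 0 < r} A"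
    unfolding lc_topology_def by (rule openin_topology_generated_by)
  then have "\<forall>u\<in>A. u \<in> V \<longrightarrow> (\<exists>F e. finite F \<and> F \<subseteq> P \<and> 0 < e \<and>
     (\<forall>v\<in>V. (\<forall>p\<in>F. p (\<lambda>s. v s - u s) < e) \<longrightarrow> v \<in> A))"
  proof induction
    case (Int a b)
    show ?case
    proof (intro ballI impI)
      fix u assume u: "u \<in> a \<inter> b" "u \<in> V"
      then obtain F e F' e' where F: "finite F" "F \<subseteq> P" "0 < e" "\<forall>v\<in>V. (\<forall>p\<in>F. p (\<lambda>s. v s - u s) < e) \<longrightarrow> v \<in> a"
        "finite F'" "F' \<subseteq> P" "0 < e'" "\<forall>v\<in>V. (\<forall>p\<in>F'. p (\<lambda>s. v s - u s) < e') \<longrightarrow> v \<in> b"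
        using Int.IH(1)[rule_format, OF IntD1[OF u(1)] u(2)] Int.IH(2)[rule_format, OF IntD2[OF u(1)] u(2)] by blast
      show "\<exists>F e. finite F \<and> F \<subseteq> P \<and> 0 < e \<and> (\<forall>v\<in>V. (\<forall>p\<in>F. p (\<lambda>s. v s - u s) < e) \<longrightarrow> v \<in> a \<inter> b)"
        by (rule exI[of _ "F \<union> F'"], rule exI[of _ "min e e'"]) (use F in auto)
    qed
  next
    case (UN K)
    show ?case
    proof (intro ballI impI)
      fix u assume u: "u \<in> \<Union>K" "u \<in> V"
      then obtain k where k: "k \<in> K" "u \<in> k" by blast
      obtain F e where "finite F" "F \<subseteq> P" "0 < e" "\<forall>v\<in>V. (\<forall>p\<in>F. p (\<lambda>s. v s - u s) < e) \<longrightarrow> v \<in> k"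
        using UN.IH[OF k(1), rule_format, OF k(2) u(2)] by blast
      with k(1) show "\<exists>F e. finite F \<and> F \<subseteq> P \<and> 0 < e \<and> (\<forall>v\<in>V. (\<forall>p\<in>F. p (\<lambda>s. v s - u s) < e) \<longrightarrow> v \<in> \<Union>K)"
        by (intro exI[of _ F] exI[of _ e]) blast
    qed
  next
    case (Basis S)
    then obtain w p r where S: "S = {v \<in> V. p (\<lambda>s. v s - w s) < r}" "w \<in> V" "p \<in> P" "0 < r" by blast
    show ?case
    proof (intro ballI impI)
      fix u assume u: "u \<in> S" "u \<in> V"
      show "\<exists>F e. finite F \<and> F \<subseteq> P \<and> 0 < e \<and> (\<forall>v\<in>V. (\<forall>p\<in>F. p (\<lambda>s. v s - u s) < e) \<longrightarrow> v \<in> S)"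
        by (rule exI[of _ "{p}"], rule exI[of _ "r - p (\<lambda>s. u s - w s)"])
           (use S u seminorm_triangle[OF seminorm[OF S(3)] _ u(2) S(2)] in force)
    qed
  qed simp
  ultimately show "?nbhd A" by blast
next
  assume A: "?nbhd A"
  show "openin E A"
  proof (subst openin_subopen, intro ballI)
    fix u assume u: "u \<in> A"
    then obtain F e where F: "finite F" "F \<subseteq> P" "0 < e" "\<forall>v\<in>V. (\<forall>p\<in>F. p (\<lambda>s. v s - u s) < e) \<longrightarrow> v \<in> A"
      using A by blast
    have uV: "u \<in> V" using A u by blast
    let ?T = "(\<Inter>p\<in>F. {v \<in> V. p (\<lambda>s. v s - u s) < e}) \<inter> topspace E"
    have "openin E ?T"
    proof (rule openin_INT[OF F(1)])
      fix p assume "p \<in> F"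
      then show "openin E {v \<in> V. p (\<lambda>s. v s - u s) < e}"
        unfolding lc_topology_def by (intro topology_generated_by_Basis) (use F uV in blast)
    qed
    moreover have "u \<in> ?T"
    proof -
      have "p (\<lambda>s. u s - u s) < e" if "p \<in> F" for p
        using seminorm_zero[OF seminorm, of p] F that by auto
      then show ?thesis using uV by simp
    qed
    moreover have "?T \<subseteq> A" using F by auto
    ultimately show "\<exists>T. openin E T \<and> u \<in> T \<and> T \<subseteq> A" by blast
  qed
qed

text \<open>The open set where \<open>q\<close> is less than 1 contains a neighbourhood of 0 given
  by finitely many generators and a radius \<open>e\<close>; any vector is scaled into that
  neighbourhood.\<close>

lemma cont_seminorm_bound:
  assumes "cont_seminorm E q"
  shows "\<exists>F C. finite F \<and> F \<subseteq> P \<and> 0 \<le> C \<and> (\<forall>u\<in>V. q u \<le> C * (\<Sum>p\<in>F. p u))"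
proof -
  have q: "seminorm_on V q" and qc: "continuous_map E euclideanreal q"
    using assms by (auto simp: cont_seminorm_def)
  have "openin E {v \<in> V. q v \<in> {..<1}}"
    using openin_continuous_map_preimage[OF qc, of "{..<1}"] by simp
  then obtain F e where F: "finite F" "F \<subseteq> P" "0 < e" "\<forall>v\<in>V. (\<forall>p\<in>F. p (\<lambda>s. v s) < e) \<longrightarrow> q v < 1"
    unfolding openin_E_iff using zero_mem seminorm_zero[OF q] by (force dest: bspec[of _ _ "\<lambda>s. 0"])
  have "q u \<le> 2 / e * (\<Sum>p\<in>F. p u)" if u: "u \<in> V" for u
  proof (rule field_le_epsilon)
    fix d :: real assume d: "d > 0"
    \<comment> \<open>The second summand keeps \<open>S\<close> positive even if all seminorms in
      \<open>F\<close> vanish at \<open>u\<close>; after multiplication by \<open>2 / e\<close> it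
      contributes exactly \<open>d\<close>.\<close>
    define S where "S = (\<Sum>p\<in>F. p u) + d * e / 2"
    have nn: "0 \<le> p u" if "p \<in> F" for p using seminorm_nonneg[OF seminorm u] that F by blast
    have "(\<Sum>p\<in>F. p u) \<ge> 0" using nn by (rule sum_nonneg)
    then have S: "S > 0" using d F by (simp add: S_def add_nonneg_pos)
    have le: "p u < S * 2" if "p \<in> F" for p
      using member_le_sum[OF that, of "\<lambda>p. p u"] nn F S mult_pos_pos[OF d F(3)]
        sum_nonneg[of F "\<lambda>p. p u"] by (simp add: S_def)
    let ?c = "complex_of_real (e / (2 * S))"
    have c: "cmod ?c = e / (2 * S)" using S F by (simp only: norm_of_real) simp
    have "p (\<lambda>s. ?c * u s) < e" if "p \<in> F" for p
    proof -
      have "p (\<lambda>s. ?c * u s) = e / (2 * S) * p u"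
        using seminorm_scale[OF seminorm u, of p ?c] that F c by auto
      also have "\<dots> < e" using le[OF that] S F by (simp add: field_simps)
      finally show ?thesis .
    qed
    then have "q (\<lambda>s. ?c * u s) < 1" using F(4) scale_mem[OF u, of ?c] by blast
    then have "e / (2 * S) * q u < 1" using seminorm_scale[OF q u, of ?c] c by simp
    then have "q u \<le> 2 * S / e" using S F by (simp add: field_simps)
    also have "\<dots> = 2 / e * (\<Sum>p\<in>F. p u) + d" using F by (simp add: S_def field_simps)
    finally show "q u \<le> 2 / e * (\<Sum>p\<in>F. p u) + d" .
  qed
  then show ?thesis using F by (intro exI[of _ F] exI[of _ "2 / e"]) auto
qed

lemma seminorm_ball_open:
  assumes q: "seminorm_on V q" and F: "finite F" "F \<subseteq> P" and C: "\<And>u. u \<in> V \<Longrightarrow> q u \<le> C * (\<Sum>p\<in>F. p u)"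
    and u: "u \<in> V"
  shows "openin E {v \<in> V. q (\<lambda>s. v s - u s) < r}"
  unfolding openin_E_iff
proof (intro conjI ballI)
  fix w assume "w \<in> {v \<in> V. q (\<lambda>s. v s - u s) < r}"
  then have w: "w \<in> V" "q (\<lambda>s. w s - u s) < r" by auto
  define d where "d = r - q (\<lambda>s. w s - u s)"
  \<comment> \<open>Adding 1 to both factors rules out a zero denominator and makes the final
    estimate strict.\<close>
  define e where "e = d / ((\<bar>C\<bar> + 1) * (card F + 1))"
  have d: "d > 0" using w by (simp add: d_def)
  have pos: "(\<bar>C\<bar> + 1) * (card F + 1) > (0::real)" by (intro mult_pos_pos) auto
  have e: "e > 0" using d pos by (simp add: e_def)
  have "v \<in> {v \<in> V. q (\<lambda>s. v s - u s) < r}" if v: "v \<in> V" "\<forall>p\<in>F. p (\<lambda>s. v s - w s) < e" for v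
  proof -
    have vw: "(\<lambda>s. v s - w s) \<in> V" by (rule diff_mem[OF v(1) w(1)])
    have nn: "0 \<le> (\<Sum>p\<in>F. p (\<lambda>s. v s - w s))"
      using seminorm_nonneg[OF seminorm_sum[OF F] vw] .
    have "q (\<lambda>s. v s - w s) \<le> C * (\<Sum>p\<in>F. p (\<lambda>s. v s - w s))" by (rule C[OF vw])
    also have "\<dots> \<le> (\<bar>C\<bar> + 1) * (\<Sum>p\<in>F. p (\<lambda>s. v s - w s))"
      using nn by (intro mult_right_mono) auto
    also have "\<dots> \<le> (\<bar>C\<bar> + 1) * (card F * e)"
      using sum_bounded_above[of F "\<lambda>p. p (\<lambda>s. v s - w s)" e] v by (intro mult_left_mono) (auto simp: less_imp_le)
    also have "\<dots> < (\<bar>C\<bar> + 1) * ((card F + 1) * e)"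
      using e by (intro mult_strict_left_mono) (auto simp: algebra_simps)
    also have "\<dots> = d" using pos by (simp add: e_def field_simps)
    finally show ?thesis
      using seminorm_triangle[OF q v(1) w(1) u] v by (simp add: d_def)
  qed
  then show "\<exists>F e. finite F \<and> F \<subseteq> P \<and> 0 < e \<and>
      (\<forall>v\<in>V. (\<forall>p\<in>F. p (\<lambda>s. v s - w s) < e) \<longrightarrow> v \<in> {v \<in> V. q (\<lambda>s. v s - u s) < r})"
    using F e by blast
qed auto

lemma cont_seminormI:
  assumes q: "seminorm_on V q" and F: "finite F" "F \<subseteq> P" and C: "\<And>u. u \<in> V \<Longrightarrow> q u \<le> C * (\<Sum>p\<in>F. p u)"
  shows "cont_seminorm E q"
proof -
  have "continuous_map E euclideanreal q"
    unfolding continuous_map_def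
  proof (intro conjI allI impI)
    fix U :: "real set" assume "openin euclideanreal U"
    then have U: "open U" by simp
    show "openin E {x \<in> topspace E. q x \<in> U}"
    proof (subst openin_subopen, intro ballI)
      fix u assume "u \<in> {x \<in> topspace E. q x \<in> U}"
      then have u: "u \<in> V" "q u \<in> U" by auto
      then obtain e where e: "e > 0" "\<And>y. \<bar>y - q u\<bar> < e \<Longrightarrow> y \<in> U"
        using U by (metis open_real)
      have "{v \<in> V. q (\<lambda>s. v s - u s) < e} \<subseteq> {x \<in> topspace E. q x \<in> U}"
      proof (intro subsetI)
        fix v assume "v \<in> {v \<in> V. q (\<lambda>s. v s - u s) < e}"
        then show "v \<in> {x \<in> topspace E. q x \<in> U}"
          using seminorm_diff_bound[OF q _ u(1), of v] e(2)[of "q v"] by auto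
      qed
      moreover have "u \<in> {v \<in> V. q (\<lambda>s. v s - u s) < e}" using u e seminorm_zero[OF q] by simp
      ultimately show "\<exists>T. openin E T \<and> u \<in> T \<and> T \<subseteq> {x \<in> topspace E. q x \<in> U}"
        using seminorm_ball_open[OF q F C u(1)] by meson
    qed
  qed auto
  then show ?thesis using q by (simp add: cont_seminorm_def)
qed

lemma cont_seminorm_generator: "p \<in> P \<Longrightarrow> cont_seminorm E p"
  by (rule cont_seminormI[of p "{p}" 1]) (auto intro: seminorm)

lemma cont_seminorm_mono:
  assumes "cont_seminorm E r" "seminorm_on V q" "\<And>u. u \<in> V \<Longrightarrow> q u \<le> C * r u" "0 \<le> C"
  shows "cont_seminorm E q"
proof -
  obtain F c where F: "finite F" "F \<subseteq> P" "\<forall>u\<in>V. r u \<le> c * (\<Sum>p\<in>F. p u)"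
    using cont_seminorm_bound[OF assms(1)] by blast
  have "q u \<le> (C * c) * (\<Sum>p\<in>F. p u)" if "u \<in> V" for u
    using assms(3)[OF that] mult_left_mono[OF bspec[OF F(3) that] assms(4)] by (simp add: mult.assoc)
  then show ?thesis by (rule cont_seminormI[OF assms(2) F(1,2)])
qed

lemma cont_seminorm_ball_open:
  assumes "cont_seminorm E q" "u \<in> V"
  shows "openin E {v \<in> V. q (\<lambda>s. v s - u s) < r}"
proof -
  obtain F c where F: "finite F" "F \<subseteq> P" "\<forall>u\<in>V. q u \<le> c * (\<Sum>p\<in>F. p u)"
    using cont_seminorm_bound[OF assms(1)] by blast
  have "seminorm_on V q" using assms by (simp add: cont_seminorm_def)
  from seminorm_ball_open[OF this F(1,2) _ assms(2)] F(3) show ?thesis by blast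
qed

end

text \<open>Additivity transports a ball around \<open>u\<close> to one around \<open>T u\<close>,
  so continuity at every point reduces to continuity of the pulled back generating
  seminorms.\<close>

lemma lc_continuous_map:
  assumes "lc_space V P" "lc_space W Q"
    and T: "\<And>u. u \<in> V \<Longrightarrow> T u \<in> W"
      "\<And>u v. u \<in> V \<Longrightarrow> v \<in> V \<Longrightarrow> T (\<lambda>s. u s - v s) = (\<lambda>s. T u s - T v s)"
    and q: "\<And>q. q \<in> Q \<Longrightarrow> cont_seminorm (lc_topology V P) (\<lambda>u. q (T u))"
  shows "continuous_map (lc_topology V P) (lc_topology W Q) T"
proof -
  interpret V: lc_space V P by fact
  interpret W: lc_space W Q by fact
  have "openin V.E (T -` U \<inter> topspace V.E)" if "U \<in> {{v \<in> W. p (\<lambda>s. v s - u s) < r} |u p r. u \<in> W \<and> p \<in> Q \<and> 0 < r}" for U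
  proof -
    from that obtain w p r where U: "U = {v \<in> W. p (\<lambda>s. v s - w s) < r}" "w \<in> W" "p \<in> Q" "0 < r" by blast
    show ?thesis
    proof (subst openin_subopen, intro ballI)
      fix u assume "u \<in> T -` U \<inter> topspace V.E"
      then have u: "u \<in> V" "p (\<lambda>s. T u s - w s) < r" using U by auto
      let ?A = "{v \<in> V. p (T (\<lambda>s. v s - u s)) < r - p (\<lambda>s. T u s - w s)}"
      have "openin V.E ?A" by (rule V.cont_seminorm_ball_open[OF q[OF U(3)] u(1)])
      moreover have "seminorm_on V (\<lambda>u. p (T u))" using q[OF U(3)] by (simp add: cont_seminorm_def)
      then have "u \<in> ?A" using u V.seminorm_zero[of "\<lambda>u. p (T u)"] by simp
      moreover have "?A \<subseteq> T -` U \<inter> topspace V.E"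
      proof (intro subsetI)
        fix v assume "v \<in> ?A"
        then show "v \<in> T -` U \<inter> topspace V.E"
          using W.seminorm_triangle[OF W.seminorm[OF U(3)] T(1) T(1)[OF u(1)] U(2), of v] T(2)[of v u] u T(1)[of v]
          by (auto simp: U(1))
      qed
      ultimately show "\<exists>A. openin V.E A \<and> u \<in> A \<and> A \<subseteq> T -` U \<inter> topspace V.E" by blast
    qed
  qed
  moreover have "T ` topspace V.E \<subseteq> \<Union>{{v \<in> W. p (\<lambda>s. v s - u s) < r} |u p r. u \<in> W \<and> p \<in> Q \<and> 0 < r}"
    using T(1) W.topspace_E unfolding lc_topology_def by auto
  ultimately show ?thesis
    unfolding lc_topology_def[of W] continuous_on_generated_topo_iff by blast
qed

section \<open>Functionals, bounded sets and the seminorms of the strong dual\<close>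

section \<open>The strong dual\<close>

context lc_space
begin

definition dual_seminorm :: "('x \<Rightarrow> complex) set \<Rightarrow> (('x \<Rightarrow> complex) \<Rightarrow> complex) \<Rightarrow> real" where
  "dual_seminorm B T = (SUP u\<in>B. cmod (T u))"

lemma dual_linear:
  assumes "T \<in> dual E" "u \<in> V" "v \<in> V"
  shows "T (\<lambda>s. c * u s + d * v s) = c * T u + d * T v"
    "T (\<lambda>s. u s + v s) = T u + T v" "T (\<lambda>s. c * u s) = c * T u" "T (\<lambda>s. u s - v s) = T u - T v"
proof -
  have *: "T (\<lambda>s. c * u s + d * v s) = c * T u + d * T v" for c d
    using assms unfolding dual_def by simp
  show "T (\<lambda>s. c * u s + d * v s) = c * T u + d * T v"
    "T (\<lambda>s. u s + v s) = T u + T v" "T (\<lambda>s. c * u s) = c * T u" "T (\<lambda>s. u s - v s) = T u - T v"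
    using *[of c d] *[of 1 1] *[of c 0] *[of 1 "-1"] by simp_all
qed

lemma dual_outside: "T \<in> dual E \<Longrightarrow> u \<notin> V \<Longrightarrow> T u = 0"
  unfolding dual_def by simp

lemma dual_cont_seminorm:
  assumes T: "T \<in> dual E"
  shows "cont_seminorm E (\<lambda>u. cmod (T u))"
  unfolding cont_seminorm_def seminorm_on_def
proof (intro conjI ballI allI)
  have "continuous_map E euclidean T" using T by (simp add: dual_def)
  then have "continuous_map E euclideanreal (cmod \<circ> T)"
    by (rule continuous_map_compose) (auto intro: continuous_intros)
  then show "continuous_map E euclideanreal (\<lambda>u. cmod (T u))" by (simp add: o_def)
qed (use dual_linear[OF T] in \<open>auto simp: norm_triangle_ineq norm_mult\<close>)

lemma dualI:
  assumes lin: "\<And>u v c d. u \<in> V \<Longrightarrow> v \<in> V \<Longrightarrow> T (\<lambda>s. c * u s + d * v s) = c * T u + d * T v"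
    and out: "\<And>u. u \<notin> V \<Longrightarrow> T u = 0"
    and r: "cont_seminorm E r" "\<And>u. u \<in> V \<Longrightarrow> cmod (T u) \<le> C * r u"
  shows "T \<in> dual E"
proof -
  have "seminorm_on V r" using r by (simp add: cont_seminorm_def)
  have diff: "T u - T v = T (\<lambda>s. u s - v s)" if "u \<in> V" "v \<in> V" for u v
    using lin[OF that, of 1 "-1"] by simp
  have "continuous_map E euclidean T"
    unfolding continuous_map_def
  proof (intro conjI allI impI)
    fix U :: "complex set" assume "openin euclidean U"
    then have U: "open U" by simp
    show "openin E {x \<in> topspace E. T x \<in> U}"
    proof (subst openin_subopen, intro ballI)
      fix u assume "u \<in> {x \<in> topspace E. T x \<in> U}"
      then have u: "u \<in> V" "T u \<in> U" by auto
      then obtain e where e: "e > 0" "ball (T u) e \<subseteq> U"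
        using U open_contains_ball by blast
      let ?A = "{v \<in> V. r (\<lambda>s. v s - u s) < e / (\<bar>C\<bar> + 1)}"
      have "?A \<subseteq> {x \<in> topspace E. T x \<in> U}"
      proof (intro subsetI)
        fix v assume "v \<in> ?A"
        then have v: "v \<in> V" "r (\<lambda>s. v s - u s) < e / (\<bar>C\<bar> + 1)" by auto
        have "cmod (T v - T u) \<le> C * r (\<lambda>s. v s - u s)"
          using r(2)[OF diff_mem[OF v(1) u(1)]] diff[OF v(1) u(1)] by simp
        also have "\<dots> \<le> (\<bar>C\<bar> + 1) * r (\<lambda>s. v s - u s)"
          using seminorm_nonneg[OF \<open>seminorm_on V r\<close> diff_mem[OF v(1) u(1)]] by (intro mult_right_mono) auto
        also have "\<dots> < e" using v(2) by (simp add: field_simps)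
        finally show "v \<in> {x \<in> topspace E. T x \<in> U}"
          using v e by (auto simp: dist_norm norm_minus_commute)
      qed
      moreover have "u \<in> ?A" using u e seminorm_zero[OF \<open>seminorm_on V r\<close>] by simp
      ultimately show "\<exists>A. openin E A \<and> u \<in> A \<and> A \<subseteq> {x \<in> topspace E. T x \<in> U}"
        using cont_seminorm_ball_open[OF r(1) u(1)] by meson
    qed
  qed auto
  then show ?thesis using lin out by (simp add: dual_def)
qed

lemma bounded_bdd: "bounded_in E B \<Longrightarrow> T \<in> dual E \<Longrightarrow> bdd_above ((\<lambda>u. cmod (T u)) ` B)"
  using dual_cont_seminorm[of T] unfolding bounded_in_def by simp

lemma dual_seminorm_upper: "bounded_in E B \<Longrightarrow> T \<in> dual E \<Longrightarrow> u \<in> B \<Longrightarrow> cmod (T u) \<le> dual_seminorm B T"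
  unfolding dual_seminorm_def by (rule cSUP_upper[OF _ bounded_bdd])

lemma dual_seminorm_least: "B \<noteq> {} \<Longrightarrow> (\<And>u. u \<in> B \<Longrightarrow> cmod (T u) \<le> C) \<Longrightarrow> dual_seminorm B T \<le> C"
  unfolding dual_seminorm_def by (rule cSUP_least)

lemma dual_closed:
  shows "S \<in> dual E \<Longrightarrow> T \<in> dual E \<Longrightarrow> (\<lambda>u. S u + T u) \<in> dual E"
    and "T \<in> dual E \<Longrightarrow> (\<lambda>u. c * T u) \<in> dual E"
    and "(\<lambda>u. 0) \<in> dual E"
proof -
  assume S: "S \<in> dual E" and T: "T \<in> dual E"
  obtain F C where F: "finite F" "F \<subseteq> P" "0 \<le> C" "\<forall>u\<in>V. cmod (S u) \<le> C * (\<Sum>p\<in>F. p u)"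
    using cont_seminorm_bound[OF dual_cont_seminorm[OF S]] by blast
  obtain F' C' where F': "finite F'" "F' \<subseteq> P" "0 \<le> C'" "\<forall>u\<in>V. cmod (T u) \<le> C' * (\<Sum>p\<in>F'. p u)"
    using cont_seminorm_bound[OF dual_cont_seminorm[OF T]] by blast
  \<comment> \<open>Merging the two finite sets of generators gives one continuous seminorm that
    dominates both functionals.\<close>
  have FF: "finite (F \<union> F')" "F \<union> F' \<subseteq> P" using F F' by auto
  show "(\<lambda>u. S u + T u) \<in> dual E"
  proof (rule dualI)
    show "cont_seminorm E (\<lambda>u. \<Sum>p\<in>F \<union> F'. p u)"
      by (rule cont_seminormI[OF seminorm_sum[OF FF] FF, of 1]) simp
    show "cmod (S u + T u) \<le> (C + C') * (\<Sum>p\<in>F \<union> F'. p u)" if u: "u \<in> V" for u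
    proof -
      have nn: "0 \<le> p u" if "p \<in> F \<union> F'" for p using seminorm_nonneg[OF seminorm u] that FF by blast
      have "cmod (S u + T u) \<le> C * (\<Sum>p\<in>F. p u) + C' * (\<Sum>p\<in>F'. p u)"
        using bspec[OF F(4) u] bspec[OF F'(4) u] norm_triangle_ineq[of "S u" "T u"] by linarith
      also have "\<dots> \<le> C * (\<Sum>p\<in>F \<union> F'. p u) + C' * (\<Sum>p\<in>F \<union> F'. p u)"
        using F F' nn by (intro add_mono mult_left_mono sum_mono2) auto
      finally show ?thesis by (simp add: distrib_right)
    qed
  qed (use dual_linear[OF S] dual_linear[OF T] dual_outside[OF S] dual_outside[OF T] in \<open>auto simp: algebra_simps\<close>)
next
  assume T: "T \<in> dual E"
  show "(\<lambda>u. c * T u) \<in> dual E"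
    by (rule dualI[OF _ _ dual_cont_seminorm[OF T], of _ "cmod c"])
       (use dual_linear[OF T] dual_outside[OF T] in \<open>auto simp: algebra_simps norm_mult\<close>)
next
  obtain p where "p \<in> P" using nonempty by blast
  then show "(\<lambda>u. 0) \<in> dual E"
    using cont_seminorm_generator seminorm seminorm_nonneg by (intro dualI[of _ p 1]) auto
qed

lemma bounded_zero: "bounded_in E {\<lambda>s. 0}"
  unfolding bounded_in_def using zero_mem by auto

lemma bounded_Un: "bounded_in E A \<Longrightarrow> bounded_in E B \<Longrightarrow> bounded_in E (A \<union> B)"
  unfolding bounded_in_def by (auto simp: image_Un)

definition dual_seminorms :: "((('x \<Rightarrow> complex) \<Rightarrow> complex) \<Rightarrow> real) set" where
  "dual_seminorms = {dual_seminorm B | B. bounded_in E B \<and> B \<noteq> {}}"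

lemma strong_dual_eq: "strong_dual E = lc_topology (dual E) dual_seminorms"
  unfolding strong_dual_def dual_seminorms_def dual_seminorm_def by (simp add: fun_eq_iff[of "dual_seminorm _"] dual_seminorm_def[abs_def])

lemma dual_seminorm_seminorm:
  assumes B: "bounded_in E B" "B \<noteq> {}"
  shows "seminorm_on (dual E) (dual_seminorm B)"
  unfolding seminorm_on_def
proof (intro conjI ballI allI)
  fix S T assume ST: "S \<in> dual E" "T \<in> dual E"
  show "dual_seminorm B (\<lambda>u. S u + T u) \<le> dual_seminorm B S + dual_seminorm B T"
    using dual_seminorm_upper[OF B(1)] ST by (intro dual_seminorm_least[OF B(2)] order_trans[OF norm_triangle_ineq] add_mono) auto
next
  fix c T assume T: "T \<in> dual E"
  have le: "dual_seminorm B (\<lambda>u. c * T u) \<le> cmod c * dual_seminorm B T" for c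
    using dual_seminorm_upper[OF B(1) T] by (intro dual_seminorm_least[OF B(2)]) (auto simp: norm_mult mult_left_mono)
  show "dual_seminorm B (\<lambda>u. c * T u) = cmod c * dual_seminorm B T"
  proof (cases "c = 0")
    case True
    then show ?thesis using B by (simp add: dual_seminorm_def)
  next
    case False
    have "dual_seminorm B T \<le> cmod (1 / c) * dual_seminorm B (\<lambda>u. c * T u)"
      using dual_seminorm_upper[OF B(1) dual_closed(2)[OF T, of c]] False
      by (intro dual_seminorm_least[OF B(2)]) (auto simp: norm_mult norm_divide field_simps)
    then show ?thesis using le[of c] False by (intro antisym) (auto simp: norm_divide field_simps)
  qed
qed

lemma strong_dual_lc: "lc_space (dual E) dual_seminorms"
proof
  show "dual_seminorms \<noteq> {}" using bounded_zero by (auto simp: dual_seminorms_def)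
qed (use dual_closed in \<open>auto simp: dual_seminorms_def intro!: dual_seminorm_seminorm\<close>)

lemma topspace_strong_dual: "topspace (strong_dual E) = dual E"
  using lc_space.topspace_E[OF strong_dual_lc] by (simp add: strong_dual_eq)

lemma dual_seminorm_cont_seminorm: "bounded_in E B \<Longrightarrow> B \<noteq> {} \<Longrightarrow> cont_seminorm (strong_dual E) (dual_seminorm B)"
  unfolding strong_dual_eq by (rule lc_space.cont_seminorm_generator[OF strong_dual_lc]) (auto simp: dual_seminorms_def)

text \<open>Finite unions of bounded sets are bounded, so the generating seminorms are directed and
  one bounded set takes care of finitely many of them.\<close>

lemma strong_dual_seminorm_bound:
  assumes "cont_seminorm (strong_dual E) q"
  shows "\<exists>B C. bounded_in E B \<and> B \<noteq> {} \<and> 0 \<le> C \<and> (\<forall>T\<in>dual E. q T \<le> C * dual_seminorm B T)"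
proof -
  obtain F C where F: "finite F" "F \<subseteq> dual_seminorms" "0 \<le> C" "\<forall>T\<in>dual E. q T \<le> C * (\<Sum>p\<in>F. p T)"
    using lc_space.cont_seminorm_bound[OF strong_dual_lc] assms strong_dual_eq by metis
  have "\<exists>B. bounded_in E B \<and> B \<noteq> {} \<and> (\<forall>p\<in>F. \<forall>T\<in>dual E. p T \<le> dual_seminorm B T)"
    using F(1,2)
  proof (induction F)
    case empty
    then show ?case using bounded_zero by auto
  next
    case (insert p F)
    then obtain B B' where B: "bounded_in E B" "B \<noteq> {}" "\<forall>p\<in>F. \<forall>T\<in>dual E. p T \<le> dual_seminorm B T"
      "bounded_in E B'" "p = dual_seminorm B'" "B' \<noteq> {}" by (auto simp: dual_seminorms_def)
    have "dual_seminorm C T \<le> dual_seminorm (B \<union> B') T" if "T \<in> dual E" "C \<noteq> {}" "C \<subseteq> B \<union> B'" for C T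
      using dual_seminorm_upper[OF bounded_Un[OF B(1,4)] that(1)] that by (intro dual_seminorm_least) auto
    then have "\<forall>q\<in>insert p F. \<forall>T\<in>dual E. q T \<le> dual_seminorm (B \<union> B') T"
      using B by (metis Un_upper1 Un_upper2 insertE order_trans)
    then show ?case using bounded_Un[OF B(1,4)] B(2) by blast
  qed
  then obtain B where B: "bounded_in E B" "B \<noteq> {}" "\<forall>p\<in>F. \<forall>T\<in>dual E. p T \<le> dual_seminorm B T" by blast
  have "q T \<le> (C * card F) * dual_seminorm B T" if "T \<in> dual E" for T
  proof -
    have "(\<Sum>p\<in>F. p T) \<le> card F * dual_seminorm B T"
      using sum_bounded_above[of F "\<lambda>p. p T" "dual_seminorm B T"] B(3) that by simp
    then show ?thesis using F(3,4) that mult_left_mono[of "\<Sum>p\<in>F. p T" _ C] by (fastforce simp: mult.assoc)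
  qed
  then show ?thesis using B F(3) by (intro exI[of _ B] exI[of _ "C * card F"]) auto
qed

end

section \<open>Operator-valued symbols from equicontinuous families, their transposes and
  compositions\<close>

section \<open>Operator families with equicontinuous difference quotients\<close>

definition lin_on :: "('x \<Rightarrow> complex) set \<Rightarrow> (('x \<Rightarrow> complex) \<Rightarrow> ('y \<Rightarrow> complex)) \<Rightarrow> bool" where
  "lin_on V T \<longleftrightarrow> (\<forall>c d. \<forall>u\<in>V. \<forall>v\<in>V. T (\<lambda>s. c * u s + d * v s) = (\<lambda>s. c * T u s + d * T v s))"

text \<open>With index set \<open>{()}\<close> this expresses the continuity of a single operator.
  Otherwise the index is a step size, a nearby parameter, or a parameter over a compact set of
  x'.\<close>

definition equicont ::
  "('x \<Rightarrow> complex) topology \<Rightarrow> 'i set \<Rightarrow> ('i \<Rightarrow> ('x \<Rightarrow> complex) \<Rightarrow> ('x \<Rightarrow> complex)) \<Rightarrow> bool" where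
  "equicont E I Q \<longleftrightarrow> (\<forall>i\<in>I. \<forall>u\<in>topspace E. Q i u \<in> topspace E) \<and>
     (\<forall>q. cont_seminorm E q \<longrightarrow> (\<exists>r. cont_seminorm E r \<and> (\<forall>i\<in>I. \<forall>u\<in>topspace E. q (Q i u) \<le> r u)))"

text \<open>Equicontinuity of the second order difference quotients gives convergence uniformly on
  bounded sets and, unlike the latter, passes to the transposed operators on the strong dual.\<close>

definition op_family ::
  "('x \<Rightarrow> complex) topology \<Rightarrow> (real \<Rightarrow> ('x \<Rightarrow> complex) \<Rightarrow> ('x \<Rightarrow> complex)) \<Rightarrow>
   (real \<Rightarrow> ('x \<Rightarrow> complex) \<Rightarrow> ('x \<Rightarrow> complex)) \<Rightarrow> real \<Rightarrow>
   ('a::euclidean_space list \<Rightarrow> 'a list \<Rightarrow> 'a \<times> 'a \<Rightarrow> ('x \<Rightarrow> complex) \<Rightarrow> ('x \<Rightarrow> complex)) \<Rightarrow> bool" where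
  "op_family E \<kappa>1 \<kappa>2 m D \<longleftrightarrow> (\<forall>\<alpha> \<beta>. set \<alpha> \<subseteq> Basis \<and> set \<beta> \<subseteq> Basis \<longrightarrow>
     (\<forall>z. lin_on (topspace E) (D \<alpha> \<beta> z) \<and> equicont E {()} (\<lambda>_. D \<alpha> \<beta> z) \<and>
       (\<exists>\<delta>>0. equicont E {z'. z' \<noteq> z \<and> dist z' z < \<delta>}
          (\<lambda>z' u s. (D \<alpha> \<beta> z' u s - D \<alpha> \<beta> z u s) / of_real (dist z' z)))) \<and>
     (\<forall>x \<xi>. \<forall>b\<in>Basis.
       (\<exists>\<delta>>0. equicont E {h::real. h \<noteq> 0 \<and> \<bar>h\<bar> < \<delta>}
          (\<lambda>h u s. ((D \<alpha> \<beta> (x, \<xi> + h *\<^sub>R b) u s - D \<alpha> \<beta> (x, \<xi>) u s) / of_real h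
             - D (b # \<alpha>) \<beta> (x, \<xi>) u s) / of_real h)) \<and>
       (\<exists>\<delta>>0. equicont E {h::real. h \<noteq> 0 \<and> \<bar>h\<bar> < \<delta>}
          (\<lambda>h u s. ((D \<alpha> \<beta> (x + h *\<^sub>R b, \<xi>) u s - D \<alpha> \<beta> (x, \<xi>) u s) / of_real h
             - D \<alpha> (b # \<beta>) (x, \<xi>) u s) / of_real h))) \<and>
     (\<forall>K. compact K \<longrightarrow> equicont E (K \<times> UNIV)
        (\<lambda>(x, \<xi>) u s. \<kappa>1 (japanese \<xi>) (D \<alpha> \<beta> (x, \<xi>) (\<kappa>2 (japanese \<xi>) u)) s
           / of_real (japanese \<xi> powr (m - length \<alpha>)))))"

lemma lin_onD: "lin_on V T \<Longrightarrow> u \<in> V \<Longrightarrow> v \<in> V \<Longrightarrow> T (\<lambda>s. c * u s + d * v s) = (\<lambda>s. c * T u s + d * T v s)"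
  by (simp add: lin_on_def)

lemma equicont_cong:
  assumes "\<And>i u. i \<in> I \<Longrightarrow> u \<in> topspace E \<Longrightarrow> Q i u = R i u"
  shows "equicont E I Q = equicont E I R"
  unfolding equicont_def using assms by simp

lemma op_familyD:
  assumes "op_family E \<kappa>1 \<kappa>2 m D" "set \<alpha> \<subseteq> Basis" "set \<beta> \<subseteq> Basis"
  shows "lin_on (topspace E) (D \<alpha> \<beta> z)" "equicont E {()} (\<lambda>_. D \<alpha> \<beta> z)"
    "u \<in> topspace E \<Longrightarrow> D \<alpha> \<beta> z u \<in> topspace E"
proof -
  from assms show "lin_on (topspace E) (D \<alpha> \<beta> z)" and e: "equicont E {()} (\<lambda>_. D \<alpha> \<beta> z)"
    unfolding op_family_def by blast+
  from e show "u \<in> topspace E \<Longrightarrow> D \<alpha> \<beta> z u \<in> topspace E"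
    unfolding equicont_def by blast
qed

lemma japanese_pos: "0 < japanese v" and japanese_ge_1: "1 \<le> japanese v"
  by (simp_all add: japanese_def add_pos_nonneg)

context lc_space
begin

text \<open>The deviation from the limit is the scalar \<open>c t\<close> times a member of an
  equicontinuous family. Such a family is uniformly bounded on a bounded set, and \<open>c t\<close>
  tends to 0.\<close>

lemma op_tendstoI:
  assumes Q: "equicont E I Q"
    and ev: "eventually (\<lambda>t. t \<in> I \<and> (\<forall>u\<in>V. (\<lambda>s. f t u s - L u s) = (\<lambda>s. c t * Q t u s))) F"
    and c: "(c \<longlongrightarrow> 0) F"
  shows "op_tendsto E f L F"
  unfolding op_tendsto_def
proof (intro allI impI)
  fix B q and e :: real
  assume *: "bounded_in E B \<and> cont_seminorm E q \<and> 0 < e"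
  then obtain r where r: "cont_seminorm E r" "\<forall>i\<in>I. \<forall>u\<in>V. q (Q i u) \<le> r u"
    using Q unfolding equicont_def by auto
  have B: "B \<subseteq> V" using * by (simp add: bounded_in_def)
  have q: "seminorm_on V q" using * by (simp add: cont_seminorm_def)
  obtain M where M: "\<forall>u\<in>B. r u \<le> M"
    using * r(1) unfolding bounded_in_def bdd_above_def by (metis imageI)
  have "eventually (\<lambda>t. dist (c t) 0 < e / (\<bar>M\<bar> + 1)) F"
    by (rule tendstoD[OF c]) (use * in auto)
  with ev show "eventually (\<lambda>t. \<forall>u\<in>B. q (\<lambda>s. f t u s - L u s) < e) F"
  proof eventually_elim
    case (elim t)
    show ?case
    proof
      fix u assume u: "u \<in> B"
      then have uV: "u \<in> V" using B by blast
      have Qu: "Q t u \<in> V" using Q elim uV unfolding equicont_def by auto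
      have "q (\<lambda>s. f t u s - L u s) = cmod (c t) * q (Q t u)"
        using elim uV seminorm_scale[OF q Qu] by simp
      also have "\<dots> \<le> cmod (c t) * (\<bar>M\<bar> + 1)"
      proof (rule mult_left_mono)
        have "q (Q t u) \<le> r u" using r(2) elim uV by blast
        also have "\<dots> \<le> M" using M u by blast
        finally show "q (Q t u) \<le> \<bar>M\<bar> + 1" by simp
      qed auto
      also have "\<dots> < e" using elim by (simp add: field_simps)
      finally show "q (\<lambda>s. f t u s - L u s) < e" .
    qed
  qed
qed

lemma equicont_cont_lin_op:
  assumes "lin_on V T" "equicont E {()} (\<lambda>_. T)"
  shows "cont_lin_op E T"
proof -
  have T: "T u \<in> V" if "u \<in> V" for u using assms(2) that unfolding equicont_def by auto
  have "continuous_map E E T"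
  proof (rule lc_continuous_map[OF lc_space_axioms lc_space_axioms T])
    show "T (\<lambda>s. u s - v s) = (\<lambda>s. T u s - T v s)" if "u \<in> V" "v \<in> V" for u v
      using lin_onD[OF assms(1) that, of 1 "-1"] by simp
    fix q assume q: "q \<in> P"
    obtain r where r: "cont_seminorm E r" "\<forall>u\<in>V. q (T u) \<le> r u"
      using assms(2) cont_seminorm_generator[OF q] unfolding equicont_def by auto
    show "cont_seminorm E (\<lambda>u. q (T u))"
    proof (rule cont_seminorm_mono[OF r(1), of _ 1])
      show "seminorm_on V (\<lambda>u. q (T u))"
        unfolding seminorm_on_def
      proof (intro conjI ballI allI)
        fix u v c assume uv: "u \<in> V" "v \<in> V"
        show "q (T (\<lambda>s. u s + v s)) \<le> q (T u) + q (T v)"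
          using lin_onD[OF assms(1) uv, of 1 1] seminorm_add[OF seminorm[OF q] T[OF uv(1)] T[OF uv(2)]] by simp
      next
        fix u c assume u: "u \<in> V"
        show "q (T (\<lambda>s. c * u s)) = cmod c * q (T u)"
          using lin_onD[OF assms(1) u u, of c 0] seminorm_scale[OF seminorm[OF q] T[OF u], of c] by simp
      qed
    qed (use r in auto)
  qed
  then show ?thesis
    using assms(1) by (simp add: cont_lin_op_def lin_on_def)
qed

text \<open>The quotients in \<open>op_family\<close> are the deviations that
  \<open>op_derivs\<close> requires to be small, divided by \<open>dist z' z\<close> or by the step
  \<open>h\<close>. Multiplying back produces the factor tending to 0 in
  \<open>op_tendstoI\<close>.\<close>

lemma op_family_op_symbols:
  fixes D :: "'n::euclidean_space list \<Rightarrow> 'n list \<Rightarrow> 'n \<times> 'n \<Rightarrow> ('x \<Rightarrow> complex) \<Rightarrow> ('x \<Rightarrow> complex)"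
  assumes D: "op_family E (\<lambda>r. \<kappa> (1 / r)) \<kappa> m D"
  shows "D [] [] \<in> op_symbols E \<kappa> m"
proof -
  have "op_derivs E (D [] []) D"
    unfolding op_derivs_def
  proof (intro conjI allI impI ballI)
    fix \<alpha> \<beta> :: "'n list" and x \<xi> assume A: "set \<alpha> \<subseteq> Basis \<and> set \<beta> \<subseteq> Basis"
    note DD = D[unfolded op_family_def, rule_format, OF A]
    show "cont_lin_op E (D \<alpha> \<beta> (x, \<xi>))"
      by (rule equicont_cont_lin_op) (use DD in auto)
    obtain \<delta> where \<delta>: "\<delta> > 0" "equicont E {z'. z' \<noteq> (x, \<xi>) \<and> dist z' (x, \<xi>) < \<delta>}
          (\<lambda>z' u s. (D \<alpha> \<beta> z' u s - D \<alpha> \<beta> (x, \<xi>) u s) / of_real (dist z' (x, \<xi>)))"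
      using DD by blast
    show "op_tendsto E (D \<alpha> \<beta>) (D \<alpha> \<beta> (x, \<xi>)) (at (x, \<xi>))"
    proof (rule op_tendstoI[OF \<delta>(2), where c = "\<lambda>z'. of_real (dist z' (x, \<xi>))"])
      show "eventually (\<lambda>t. t \<in> {z'. z' \<noteq> (x, \<xi>) \<and> dist z' (x, \<xi>) < \<delta>} \<and>
          (\<forall>u\<in>V. (\<lambda>s. D \<alpha> \<beta> t u s - D \<alpha> \<beta> (x, \<xi>) u s) =
          (\<lambda>s. of_real (dist t (x, \<xi>)) * ((D \<alpha> \<beta> t u s - D \<alpha> \<beta> (x, \<xi>) u s) / of_real (dist t (x, \<xi>)))))) (at (x, \<xi>))"
        unfolding eventually_at using \<delta>(1) by (intro exI[of _ \<delta>]) auto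
      show "((\<lambda>z'. complex_of_real (dist z' (x, \<xi>))) \<longlongrightarrow> 0) (at (x, \<xi>))"
        by (rule tendsto_eq_intros tendsto_ident_at refl | simp)+
    qed
    fix b :: 'n assume b: "b \<in> Basis"
    {
      obtain \<delta> where \<delta>: "\<delta> > 0" "equicont E {h::real. h \<noteq> 0 \<and> \<bar>h\<bar> < \<delta>}
          (\<lambda>h u s. ((D \<alpha> \<beta> (x, \<xi> + h *\<^sub>R b) u s - D \<alpha> \<beta> (x, \<xi>) u s) / of_real h
             - D (b # \<alpha>) \<beta> (x, \<xi>) u s) / of_real h)"
        using DD b by blast
      show "op_tendsto E (\<lambda>t u s. (D \<alpha> \<beta> (x, \<xi> + t *\<^sub>R b) u s - D \<alpha> \<beta> (x, \<xi>) u s) / of_real t)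
             (D (b # \<alpha>) \<beta> (x, \<xi>)) (at (0::real))"
      proof (rule op_tendstoI[OF \<delta>(2), where c = of_real])
        show "((of_real :: real \<Rightarrow> complex) \<longlongrightarrow> 0) (at 0)"
          by (rule tendsto_eq_intros tendsto_ident_at refl | simp)+
      qed (use \<delta>(1) in \<open>auto simp: eventually_at intro!: exI[of _ \<delta>]\<close>)
    }
    {
      obtain \<delta> where \<delta>: "\<delta> > 0" "equicont E {h::real. h \<noteq> 0 \<and> \<bar>h\<bar> < \<delta>}
          (\<lambda>h u s. ((D \<alpha> \<beta> (x + h *\<^sub>R b, \<xi>) u s - D \<alpha> \<beta> (x, \<xi>) u s) / of_real h
             - D \<alpha> (b # \<beta>) (x, \<xi>) u s) / of_real h)"
        using DD b by blast
      show "op_tendsto E (\<lambda>t u s. (D \<alpha> \<beta> (x + t *\<^sub>R b, \<xi>) u s - D \<alpha> \<beta> (x, \<xi>) u s) / of_real t)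
             (D \<alpha> (b # \<beta>) (x, \<xi>)) (at (0::real))"
      proof (rule op_tendstoI[OF \<delta>(2), where c = of_real])
        show "((of_real :: real \<Rightarrow> complex) \<longlongrightarrow> 0) (at 0)"
          by (rule tendsto_eq_intros tendsto_ident_at refl | simp)+
      qed (use \<delta>(1) in \<open>auto simp: eventually_at intro!: exI[of _ \<delta>]\<close>)
    }
  qed simp
  moreover have "\<exists>r C. cont_seminorm E r \<and> (\<forall>x\<in>K. \<forall>\<xi>. \<forall>u\<in>topspace E.
      q (\<kappa> (1 / japanese \<xi>) (D \<alpha> \<beta> (x, \<xi>) (\<kappa> (japanese \<xi>) u))) \<le> C * japanese \<xi> powr (m - length \<alpha>) * r u)"
    if A: "set \<alpha> \<subseteq> Basis \<and> set \<beta> \<subseteq> Basis" and q: "cont_seminorm E q" and K: "compact K" for \<alpha> \<beta> :: "'n list" and q K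
  proof -
    let ?Q = "\<lambda>(x, \<xi>) u s. \<kappa> (1 / japanese \<xi>) (D \<alpha> \<beta> (x, \<xi>) (\<kappa> (japanese \<xi>) u)) s
           / of_real (japanese \<xi> powr (m - length \<alpha>))"
    have eq: "equicont E (K \<times> UNIV) ?Q"
      using D[unfolded op_family_def, rule_format, OF A] K by blast
    then obtain r where r: "cont_seminorm E r" "\<forall>i\<in>K \<times> UNIV. \<forall>u\<in>V. q (?Q i u) \<le> r u"
      using q unfolding equicont_def by auto
    have "q (\<kappa> (1 / japanese \<xi>) (D \<alpha> \<beta> (x, \<xi>) (\<kappa> (japanese \<xi>) u))) \<le> 1 * japanese \<xi> powr (m - length \<alpha>) * r u"
      if "x \<in> K" "u \<in> V" for x \<xi> u
    proof -
      have j: "japanese \<xi> powr (m - length \<alpha>) > 0" using japanese_pos[of \<xi>] by simp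
      have Q: "?Q (x, \<xi>) u \<in> V" using eq that unfolding equicont_def by force
      have "q (\<lambda>s. of_real (japanese \<xi> powr (m - length \<alpha>)) * ?Q (x, \<xi>) u s) = japanese \<xi> powr (m - length \<alpha>) * q (?Q (x, \<xi>) u)"
        using seminorm_scale[OF _ Q, of q "of_real (japanese \<xi> powr (m - length \<alpha>))"] q j by (simp add: cont_seminorm_def)
      also have "\<dots> \<le> japanese \<xi> powr (m - length \<alpha>) * r u"
        using r(2) that j by (intro mult_left_mono) force+
      finally show ?thesis using j by simp
    qed
    then show ?thesis using r(1) by (metis topspace_E)
  qed
  ultimately show ?thesis unfolding op_symbols_def by blast
qed

text \<open>The images of a bounded set under all members of an equicontinuous family have a bounded
  union. The seminorm of the strong dual belonging to this union dominates all transposed operators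
  at once.\<close>

lemma equicont_transpose:
  assumes Q: "equicont E I Q" and lin: "\<And>i. i \<in> I \<Longrightarrow> lin_on V (Q i)"
  shows "equicont (strong_dual E) I (\<lambda>i T f. if f \<in> V then T (Q i f) else 0)"
  unfolding equicont_def topspace_strong_dual
proof (intro conjI ballI allI impI)
  have QV: "Q i f \<in> V" if "i \<in> I" "f \<in> V" for i f using Q that unfolding equicont_def by auto
  fix i T assume i: "i \<in> I" and T: "T \<in> dual E"
  obtain r where r: "cont_seminorm E r" "\<forall>i\<in>I. \<forall>u\<in>V. cmod (T (Q i u)) \<le> r u"
    using Q dual_cont_seminorm[OF T] unfolding equicont_def by auto
  show "(\<lambda>f. if f \<in> V then T (Q i f) else 0) \<in> dual E"
  proof (rule dualI[OF _ _ r(1), of _ 1])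
    fix u v c d assume uv: "u \<in> V" "v \<in> V"
    have "(\<lambda>s. c * u s + d * v s) \<in> V" using uv by (intro add_mem scale_mem)
    then show "(if (\<lambda>s. c * u s + d * v s) \<in> V then T (Q i (\<lambda>s. c * u s + d * v s)) else 0) =
        c * (if u \<in> V then T (Q i u) else 0) + d * (if v \<in> V then T (Q i v) else 0)"
      using lin_onD[OF lin[OF i] uv] dual_linear(1)[OF T QV[OF i uv(1)] QV[OF i uv(2)]] uv by simp
  qed (use r i in auto)
next
  fix q assume "cont_seminorm (strong_dual E) q"
  then obtain B C where B: "bounded_in E B" "B \<noteq> {}" "0 \<le> C" "\<forall>T\<in>dual E. q T \<le> C * dual_seminorm B T"
    using strong_dual_seminorm_bound by blast
  have BV: "B \<subseteq> V" using B by (simp add: bounded_in_def)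
  have QV: "Q i f \<in> V" if "i \<in> I" "f \<in> V" for i f using Q that unfolding equicont_def by auto
  \<comment> \<open>The zero function keeps the set nonempty when \<open>I\<close> is empty.\<close>
  define B' where "B' = insert (\<lambda>s. 0) (\<Union>i\<in>I. Q i ` B)"
  have "bounded_in E B'"
    unfolding bounded_in_def
  proof (intro conjI allI impI)
    show "B' \<subseteq> topspace E" using QV BV zero_mem by (auto simp: B'_def)
    fix p assume p: "cont_seminorm E p"
    obtain r where r: "cont_seminorm E r" "\<forall>i\<in>I. \<forall>u\<in>V. p (Q i u) \<le> r u"
      using Q p unfolding equicont_def by auto
    obtain M where M: "\<forall>u\<in>B. r u \<le> M"
      using B(1) r(1) unfolding bounded_in_def bdd_above_def by (metis imageI)
    have "p v \<le> max M (p (\<lambda>s. 0))" if "v \<in> B'" for v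
      using that r(2) M BV by (fastforce simp: B'_def subset_iff intro: order_trans le_max_iff_disj[THEN iffD2])
    then show "bdd_above (p ` B')" by (intro bdd_aboveI2)
  qed
  moreover have "B' \<noteq> {}" by (simp add: B'_def)
  ultimately have B': "cont_seminorm (strong_dual E) (dual_seminorm B')" "bounded_in E B'" "B' \<noteq> {}"
    by (auto intro: dual_seminorm_cont_seminorm)
  interpret SD: lc_space "dual E" dual_seminorms by (rule strong_dual_lc)
  have "cont_seminorm (strong_dual E) (\<lambda>T. C * dual_seminorm B' T)"
    unfolding strong_dual_eq
  proof (rule SD.cont_seminorm_mono[OF B'(1)[unfolded strong_dual_eq], of _ C])
    show "seminorm_on (dual E) (\<lambda>T. C * dual_seminorm B' T)"
      unfolding seminorm_on_def using dual_seminorm_seminorm[OF B'(2,3)] B(3)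
      by (auto simp: seminorm_on_def distrib_left[symmetric] intro!: mult_left_mono)
  qed (use B in auto)
  moreover have "q (\<lambda>f. if f \<in> V then T (Q i f) else 0) \<le> C * dual_seminorm B' T" if i: "i \<in> I" and T: "T \<in> dual E" for i T
  proof -
    have "(\<lambda>f. if f \<in> V then T (Q i f) else 0) \<in> dual E"
    proof -
      obtain r where r: "cont_seminorm E r" "\<forall>i\<in>I. \<forall>u\<in>V. cmod (T (Q i u)) \<le> r u"
        using Q dual_cont_seminorm[OF T] unfolding equicont_def by auto
      show ?thesis
      proof (rule dualI[OF _ _ r(1), of _ 1])
        fix u v c d assume uv: "u \<in> V" "v \<in> V"
        have "(\<lambda>s. c * u s + d * v s) \<in> V" using uv by (intro add_mem scale_mem)
        then show "(if (\<lambda>s. c * u s + d * v s) \<in> V then T (Q i (\<lambda>s. c * u s + d * v s)) else 0) =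
            c * (if u \<in> V then T (Q i u) else 0) + d * (if v \<in> V then T (Q i v) else 0)"
          using lin_onD[OF lin[OF i] uv] dual_linear(1)[OF T QV[OF i uv(1)] QV[OF i uv(2)]] uv by simp
      qed (use r i in auto)
    qed
    then have "q (\<lambda>f. if f \<in> V then T (Q i f) else 0) \<le> C * dual_seminorm B (\<lambda>f. if f \<in> V then T (Q i f) else 0)"
      using B by blast
    also have "\<dots> \<le> C * dual_seminorm B' T"
      using i BV dual_seminorm_upper[OF B'(2) T] by (intro mult_left_mono B(3) dual_seminorm_least[OF B(2)]) (auto simp: B'_def subset_iff)
    finally show ?thesis .
  qed
  ultimately show "\<exists>r. cont_seminorm (strong_dual E) r \<and>
      (\<forall>i\<in>I. \<forall>T\<in>dual E. q (\<lambda>f. if f \<in> V then T (Q i f) else 0) \<le> r T)"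
    by blast
qed

text \<open>Transposition reverses compositions, so the left and the right group action change
  places. A difference quotient of transposes is the transpose of a difference quotient, which
  reduces every clause to \<open>equicont_transpose\<close>.\<close>

lemma op_family_transpose:
  fixes D :: "'n::euclidean_space list \<Rightarrow> 'n list \<Rightarrow> 'n \<times> 'n \<Rightarrow> ('x \<Rightarrow> complex) \<Rightarrow> ('x \<Rightarrow> complex)"
  assumes D: "op_family E \<kappa>1 \<kappa>2 m D"
    and \<kappa>: "\<And>r f. 0 < r \<Longrightarrow> \<kappa>2 r f \<in> V \<longleftrightarrow> f \<in> V" "\<And>r. lin_on V (\<kappa>2 r)"
      "\<And>r f. 0 < r \<Longrightarrow> f \<in> V \<Longrightarrow> \<kappa>1 r f \<in> V" "\<And>r. lin_on V (\<kappa>1 r)"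
  shows "op_family (strong_dual E) (\<lambda>r T f. T (\<kappa>2 r f)) (\<lambda>r T f. T (\<kappa>1 r f)) m
    (\<lambda>\<alpha> \<beta> z T f. if f \<in> V then T (D \<alpha> \<beta> z f) else 0)"
  unfolding op_family_def topspace_strong_dual
proof (intro allI impI conjI ballI)
  have DD: "D \<alpha> \<beta> z f \<in> V" "lin_on V (D \<alpha> \<beta> z)" if "set \<alpha> \<subseteq> Basis" "set \<beta> \<subseteq> Basis" "f \<in> V" for \<alpha> \<beta> z f
    using op_familyD(1,3)[OF D that(1,2)] that(3) by auto
  have lin: "lin_on V (\<lambda>u s. c * A u s + d * B u s)" if "lin_on V A" "lin_on V B" for A B c d
    using that by (auto simp: lin_on_def algebra_simps)
  have lin1: "lin_on V (\<lambda>u s. (A u s - B u s) / c)" if "lin_on V A" "lin_on V B" for A B c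
    using lin[OF that, of "1/c" "-1/c"] by (simp add: diff_divide_distrib)
  fix \<alpha> \<beta> :: "'n list" assume A: "set \<alpha> \<subseteq> Basis \<and> set \<beta> \<subseteq> Basis"
  note E = D[unfolded op_family_def, rule_format, OF A]
  {
    fix z
    show "lin_on (dual E) (\<lambda>T f. if f \<in> V then T (D \<alpha> \<beta> z f) else 0)"
      unfolding lin_on_def by auto
    show "equicont (strong_dual E) {()} (\<lambda>_ T f. if f \<in> V then T (D \<alpha> \<beta> z f) else 0)"
      by (rule equicont_transpose) (use op_familyD(1,2)[OF D] A in auto)
    obtain \<delta> where \<delta>: "\<delta> > 0" "equicont E {z'. z' \<noteq> z \<and> dist z' z < \<delta>}
          (\<lambda>z' u s. (D \<alpha> \<beta> z' u s - D \<alpha> \<beta> z u s) / of_real (dist z' z))"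
      using E by blast
    have *: "(\<lambda>f. if f \<in> V then T (\<lambda>s. (D \<alpha> \<beta> z' f s - D \<alpha> \<beta> z f s) / of_real (dist z' z)) else 0) =
      (\<lambda>f. ((if f \<in> V then T (D \<alpha> \<beta> z' f) else 0) - (if f \<in> V then T (D \<alpha> \<beta> z f) else 0)) / of_real (dist z' z))"
      if T: "T \<in> dual E" for T z'
    proof
      fix f
      show "(if f \<in> V then T (\<lambda>s. (D \<alpha> \<beta> z' f s - D \<alpha> \<beta> z f s) / of_real (dist z' z)) else 0) =
        ((if f \<in> V then T (D \<alpha> \<beta> z' f) else 0) - (if f \<in> V then T (D \<alpha> \<beta> z f) else 0)) / of_real (dist z' z)"
        using dual_linear(1)[OF T DD(1) DD(1), of \<alpha> \<beta> f \<alpha> \<beta> f "1 / of_real (dist z' z)" z' "- 1 / of_real (dist z' z)" z] A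
        by (simp add: diff_divide_distrib)
    qed
    have l: "lin_on V (\<lambda>u s. (D \<alpha> \<beta> z' u s - D \<alpha> \<beta> z u s) / of_real (dist z' z))" for z'
      using op_familyD(1)[OF D] A by (intro lin1) auto
    have "equicont (strong_dual E) {z'. z' \<noteq> z \<and> dist z' z < \<delta>}
        (\<lambda>z' T f. ((if f \<in> V then T (D \<alpha> \<beta> z' f) else 0) - (if f \<in> V then T (D \<alpha> \<beta> z f) else 0)) / of_real (dist z' z))"
      by (subst equicont_cong[where R = "\<lambda>z' T f. if f \<in> V then T (\<lambda>s. (D \<alpha> \<beta> z' f s - D \<alpha> \<beta> z f s) / of_real (dist z' z)) else 0"])
        (use equicont_transpose[OF \<delta>(2) l] * in \<open>auto simp: topspace_strong_dual\<close>)
    then show "\<exists>\<delta>>0. equicont (strong_dual E) {z'. z' \<noteq> z \<and> dist z' z < \<delta>}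
        (\<lambda>z' T f. ((if f \<in> V then T (D \<alpha> \<beta> z' f) else 0) - (if f \<in> V then T (D \<alpha> \<beta> z f) else 0)) / of_real (dist z' z))"
      using \<delta>(1) by blast
  }
  \<comment> \<open>Stated for two arbitrary points and an arbitrary candidate for the derivative,
    so that the quotients in the covariable and in the variable are both instances.\<close>
  have quot: "(\<lambda>f. if f \<in> V then T (\<lambda>s. ((D \<alpha> \<beta> z' f s - D \<alpha> \<beta> z f s) / of_real h - D \<alpha>' \<beta>' z f s) / of_real h) else 0) =
      (\<lambda>f. (((if f \<in> V then T (D \<alpha> \<beta> z' f) else 0) - (if f \<in> V then T (D \<alpha> \<beta> z f) else 0)) / of_real h
         - (if f \<in> V then T (D \<alpha>' \<beta>' z f) else 0)) / of_real h)"
    if T: "T \<in> dual E" and A': "set \<alpha>' \<subseteq> Basis" "set \<beta>' \<subseteq> Basis" for T z z' \<alpha>' \<beta>' and h :: real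
  proof
    fix f
    show "(if f \<in> V then T (\<lambda>s. ((D \<alpha> \<beta> z' f s - D \<alpha> \<beta> z f s) / of_real h - D \<alpha>' \<beta>' z f s) / of_real h) else 0) =
      (((if f \<in> V then T (D \<alpha> \<beta> z' f) else 0) - (if f \<in> V then T (D \<alpha> \<beta> z f) else 0)) / of_real h
         - (if f \<in> V then T (D \<alpha>' \<beta>' z f) else 0)) / of_real h"
    proof (cases "f \<in> V")
      case f: True
      let ?h = "complex_of_real h"
      let ?d = "\<lambda>s. D \<alpha> \<beta> z' f s - D \<alpha> \<beta> z f s"
      have d: "?d \<in> V" using DD(1)[OF _ _ f] A by (intro diff_mem) auto
      have "T (\<lambda>s. (1 / ?h / ?h) * ?d s + (- 1 / ?h) * D \<alpha>' \<beta>' z f s) = (1 / ?h / ?h) * T ?d + (- 1 / ?h) * T (D \<alpha>' \<beta>' z f)"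
        by (rule dual_linear(1)[OF T d DD(1)[OF A' f]])
      moreover have "T ?d = T (D \<alpha> \<beta> z' f) - T (D \<alpha> \<beta> z f)"
        using DD(1)[OF _ _ f] A by (intro dual_linear(4)[OF T]) auto
      ultimately show ?thesis using f by (simp add: diff_divide_distrib)
    qed simp
  qed
  {
    fix x \<xi> and b :: 'n assume b: "b \<in> Basis"
    have lin2: "lin_on V (\<lambda>u s. ((D \<alpha> \<beta> z' u s - D \<alpha> \<beta> z u s) / of_real h - D \<alpha>' \<beta>' z u s) / of_real h)"
      if "set \<alpha>' \<subseteq> Basis" "set \<beta>' \<subseteq> Basis" for z z' \<alpha>' \<beta>' and h :: real
      using op_familyD(1)[OF D] A that by (intro lin1) auto
    obtain \<delta> where \<delta>: "\<delta> > 0" "equicont E {h::real. h \<noteq> 0 \<and> \<bar>h\<bar> < \<delta>}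
          (\<lambda>h u s. ((D \<alpha> \<beta> (x, \<xi> + h *\<^sub>R b) u s - D \<alpha> \<beta> (x, \<xi>) u s) / of_real h
             - D (b # \<alpha>) \<beta> (x, \<xi>) u s) / of_real h)"
        using E b by blast
    have "equicont (strong_dual E) {h::real. h \<noteq> 0 \<and> \<bar>h\<bar> < \<delta>}
       (\<lambda>h T f. (((if f \<in> V then T (D \<alpha> \<beta> (x, \<xi> + h *\<^sub>R b) f) else 0) - (if f \<in> V then T (D \<alpha> \<beta> (x, \<xi>) f) else 0)) / of_real h
         - (if f \<in> V then T (D (b # \<alpha>) \<beta> (x, \<xi>) f) else 0)) / of_real h)"
      using equicont_transpose[OF \<delta>(2) lin2] A b
      by (subst equicont_cong[where R = "\<lambda>h T f. if f \<in> V then T (\<lambda>s. ((D \<alpha> \<beta> (x, \<xi> + h *\<^sub>R b) f s - D \<alpha> \<beta> (x, \<xi>) f s) / of_real h - D (b # \<alpha>) \<beta> (x, \<xi>) f s) / of_real h) else 0"])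
        (auto simp: quot[of _ "b # \<alpha>" \<beta>] topspace_strong_dual)
    then show "\<exists>\<delta>>0. equicont (strong_dual E) {h::real. h \<noteq> 0 \<and> \<bar>h\<bar> < \<delta>}
       (\<lambda>h T f. (((if f \<in> V then T (D \<alpha> \<beta> (x, \<xi> + h *\<^sub>R b) f) else 0) - (if f \<in> V then T (D \<alpha> \<beta> (x, \<xi>) f) else 0)) / of_real h
         - (if f \<in> V then T (D (b # \<alpha>) \<beta> (x, \<xi>) f) else 0)) / of_real h)"
      using \<delta>(1) by blast
    obtain \<delta> where \<delta>: "\<delta> > 0" "equicont E {h::real. h \<noteq> 0 \<and> \<bar>h\<bar> < \<delta>}
          (\<lambda>h u s. ((D \<alpha> \<beta> (x + h *\<^sub>R b, \<xi>) u s - D \<alpha> \<beta> (x, \<xi>) u s) / of_real h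
             - D \<alpha> (b # \<beta>) (x, \<xi>) u s) / of_real h)"
        using E b by blast
    have "equicont (strong_dual E) {h::real. h \<noteq> 0 \<and> \<bar>h\<bar> < \<delta>}
       (\<lambda>h T f. (((if f \<in> V then T (D \<alpha> \<beta> (x + h *\<^sub>R b, \<xi>) f) else 0) - (if f \<in> V then T (D \<alpha> \<beta> (x, \<xi>) f) else 0)) / of_real h
         - (if f \<in> V then T (D \<alpha> (b # \<beta>) (x, \<xi>) f) else 0)) / of_real h)"
      using equicont_transpose[OF \<delta>(2) lin2] A b
      by (subst equicont_cong[where R = "\<lambda>h T f. if f \<in> V then T (\<lambda>s. ((D \<alpha> \<beta> (x + h *\<^sub>R b, \<xi>) f s - D \<alpha> \<beta> (x, \<xi>) f s) / of_real h - D \<alpha> (b # \<beta>) (x, \<xi>) f s) / of_real h) else 0"])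
        (auto simp: quot[of _ \<alpha> "b # \<beta>"] topspace_strong_dual)
    then show "\<exists>\<delta>>0. equicont (strong_dual E) {h::real. h \<noteq> 0 \<and> \<bar>h\<bar> < \<delta>}
       (\<lambda>h T f. (((if f \<in> V then T (D \<alpha> \<beta> (x + h *\<^sub>R b, \<xi>) f) else 0) - (if f \<in> V then T (D \<alpha> \<beta> (x, \<xi>) f) else 0)) / of_real h
         - (if f \<in> V then T (D \<alpha> (b # \<beta>) (x, \<xi>) f) else 0)) / of_real h)"
      using \<delta>(1) by blast
  }
  fix K :: "'n set" assume K: "compact K"
  let ?Q = "\<lambda>(x, \<xi>) u s. \<kappa>1 (japanese \<xi>) (D \<alpha> \<beta> (x, \<xi>) (\<kappa>2 (japanese \<xi>) u)) s
           / of_real (japanese \<xi> powr (m - length \<alpha>))"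
  have lin3: "lin_on V (?Q i)" for i :: "'n \<times> 'n"
  proof -
    obtain x \<xi> where i: "i = (x, \<xi>)" by fastforce
    have "\<kappa>1 (japanese \<xi>) (D \<alpha> \<beta> (x, \<xi>) (\<kappa>2 (japanese \<xi>) (\<lambda>s. c * u s + d * v s))) =
       (\<lambda>s. c * \<kappa>1 (japanese \<xi>) (D \<alpha> \<beta> (x, \<xi>) (\<kappa>2 (japanese \<xi>) u)) s + d * \<kappa>1 (japanese \<xi>) (D \<alpha> \<beta> (x, \<xi>) (\<kappa>2 (japanese \<xi>) v)) s)"
      if uv: "u \<in> V" "v \<in> V" for u v c d
    proof -
      have k: "\<kappa>2 (japanese \<xi>) u \<in> V" "\<kappa>2 (japanese \<xi>) v \<in> V" using \<kappa>(1) uv japanese_pos by auto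
      show ?thesis
        using A k uv
        by (simp add: lin_onD[OF \<kappa>(2) uv] lin_onD[OF DD(2) k] lin_onD[OF \<kappa>(4) DD(1) DD(1)])
    qed
    then show ?thesis unfolding i lin_on_def by (simp add: add_divide_distrib)
  qed
  have eq: "equicont E (K \<times> UNIV) ?Q" using E K by blast
  show "equicont (strong_dual E) (K \<times> UNIV)
     (\<lambda>(x, \<xi>) T f. (if \<kappa>2 (japanese \<xi>) f \<in> V then T (\<kappa>1 (japanese \<xi>) (D \<alpha> \<beta> (x, \<xi>) (\<kappa>2 (japanese \<xi>) f))) else 0)
         / of_real (japanese \<xi> powr (m - length \<alpha>)))"
  proof (subst equicont_cong[where R = "\<lambda>i T f. if f \<in> V then T (?Q i f) else 0"])
    fix i :: "'n \<times> 'n" and T assume T: "T \<in> topspace (strong_dual E)"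
    obtain x \<xi> where i: "i = (x, \<xi>)" by fastforce
    have "(if \<kappa>2 (japanese \<xi>) f \<in> V then T (\<kappa>1 (japanese \<xi>) (D \<alpha> \<beta> (x, \<xi>) (\<kappa>2 (japanese \<xi>) f))) else 0)
         / of_real (japanese \<xi> powr (m - length \<alpha>)) = (if f \<in> V then T (?Q (x, \<xi>) f) else 0)" for f
    proof (cases "f \<in> V")
      case True
      then have k: "\<kappa>2 (japanese \<xi>) f \<in> V" using \<kappa>(1) japanese_pos by auto
      have "\<kappa>1 (japanese \<xi>) (D \<alpha> \<beta> (x, \<xi>) (\<kappa>2 (japanese \<xi>) f)) \<in> V"
        using \<kappa>(3) DD(1)[OF _ _ k, of \<alpha> \<beta>] A japanese_pos[of \<xi>] by simp
      from dual_linear(3)[OF _ this this, of T "1 / of_real (japanese \<xi> powr (m - length \<alpha>))"] T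
      show ?thesis using True k by (simp add: topspace_strong_dual)
    qed (use \<kappa>(1) japanese_pos in auto)
    then show "(case i of (x, \<xi>) \<Rightarrow> \<lambda>T f. (if \<kappa>2 (japanese \<xi>) f \<in> V then T (\<kappa>1 (japanese \<xi>) (D \<alpha> \<beta> (x, \<xi>) (\<kappa>2 (japanese \<xi>) f))) else 0)
         / of_real (japanese \<xi> powr (m - length \<alpha>))) T = (\<lambda>f. if f \<in> V then T (?Q i f) else 0)"
      unfolding i by (intro ext) (simp only: prod.case)
  qed (use equicont_transpose[OF eq lin3] in auto)
qed

end

lemma equicont_comp_right:
  assumes "equicont E I Q" "equicont E {()} (\<lambda>_. A)"
  shows "equicont E I (\<lambda>i u. Q i (A u))"
  unfolding equicont_def
proof (intro conjI allI impI)
  fix q assume "cont_seminorm E q"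
  then obtain r where r: "cont_seminorm E r" "\<forall>i\<in>I. \<forall>u\<in>topspace E. q (Q i u) \<le> r u"
    using assms(1) unfolding equicont_def by blast
  then obtain r' where r': "cont_seminorm E r'" "\<forall>u\<in>topspace E. r (A u) \<le> r' u"
    using assms(2) unfolding equicont_def by auto
  have "q (Q i (A u)) \<le> r' u" if "i \<in> I" "u \<in> topspace E" for i u
  proof -
    have "A u \<in> topspace E" using assms(2) that unfolding equicont_def by auto
    then show ?thesis using r(2) r'(2) that order_trans by blast
  qed
  then show "\<exists>r. cont_seminorm E r \<and> (\<forall>i\<in>I. \<forall>u\<in>topspace E. q (Q i (A u)) \<le> r u)"
    using r'(1) by blast
qed (use assms in \<open>auto simp: equicont_def\<close>)

text \<open>Meant for \<open>A\<close> the Fourier transform on functions or on distributions. It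
  turns dilation by r into dilation by 1 / r, which is the reason for keeping the two group actions
  of an \<open>op_family\<close> separate.\<close>

lemma op_family_comp_right:
  fixes D :: "'n::euclidean_space list \<Rightarrow> 'n list \<Rightarrow> 'n \<times> 'n \<Rightarrow> ('x \<Rightarrow> complex) \<Rightarrow> ('x \<Rightarrow> complex)"
  assumes D: "op_family E \<kappa>1 \<kappa>2 m D"
    and A: "lin_on (topspace E) A" "equicont E {()} (\<lambda>_. A)"
    and \<kappa>: "\<And>r u. 0 < r \<Longrightarrow> u \<in> topspace E \<Longrightarrow> A (\<kappa> r u) = \<kappa>2 r (A u)"
  shows "op_family E \<kappa>1 \<kappa> m (\<lambda>\<alpha> \<beta> z u. D \<alpha> \<beta> z (A u))"
  unfolding op_family_def
proof (intro allI impI conjI ballI)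
  fix \<alpha> \<beta> :: "'n list" assume B: "set \<alpha> \<subseteq> Basis \<and> set \<beta> \<subseteq> Basis"
  note E = D[unfolded op_family_def, rule_format, OF B]
  have AV: "A u \<in> topspace E" if "u \<in> topspace E" for u using A(2) that by (auto simp: equicont_def)
  {
    fix z
    show "lin_on (topspace E) (\<lambda>u. D \<alpha> \<beta> z (A u))"
      using op_familyD(1)[OF D, of \<alpha> \<beta> z] B AV A(1) by (auto simp: lin_on_def)
    show "equicont E {()} (\<lambda>_ u. D \<alpha> \<beta> z (A u))"
      using op_familyD(2)[OF D, of \<alpha> \<beta> z] B by (intro equicont_comp_right[OF _ A(2)]) auto
    show "\<exists>\<delta>>0. equicont E {z'. z' \<noteq> z \<and> dist z' z < \<delta>}
          (\<lambda>z' u s. (D \<alpha> \<beta> z' (A u) s - D \<alpha> \<beta> z (A u) s) / of_real (dist z' z))"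
    proof -
      obtain \<delta> where "\<delta> > 0" "equicont E {z'. z' \<noteq> z \<and> dist z' z < \<delta>}
          (\<lambda>z' u s. (D \<alpha> \<beta> z' u s - D \<alpha> \<beta> z u s) / of_real (dist z' z))"
        using E by blast
      from this(1) equicont_comp_right[OF this(2) A(2)] show ?thesis by blast
    qed
  }
  fix x \<xi> and b :: 'n assume "b \<in> Basis"
  then obtain \<delta> \<delta>' where *: "\<delta> > 0" "equicont E {h::real. h \<noteq> 0 \<and> \<bar>h\<bar> < \<delta>}
          (\<lambda>h u s. ((D \<alpha> \<beta> (x, \<xi> + h *\<^sub>R b) u s - D \<alpha> \<beta> (x, \<xi>) u s) / of_real h
             - D (b # \<alpha>) \<beta> (x, \<xi>) u s) / of_real h)"
    "\<delta>' > 0" "equicont E {h::real. h \<noteq> 0 \<and> \<bar>h\<bar> < \<delta>'}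
          (\<lambda>h u s. ((D \<alpha> \<beta> (x + h *\<^sub>R b, \<xi>) u s - D \<alpha> \<beta> (x, \<xi>) u s) / of_real h
             - D \<alpha> (b # \<beta>) (x, \<xi>) u s) / of_real h)"
    using E by blast
  show "\<exists>\<delta>>0. equicont E {h::real. h \<noteq> 0 \<and> \<bar>h\<bar> < \<delta>}
          (\<lambda>h u s. ((D \<alpha> \<beta> (x, \<xi> + h *\<^sub>R b) (A u) s - D \<alpha> \<beta> (x, \<xi>) (A u) s) / of_real h
             - D (b # \<alpha>) \<beta> (x, \<xi>) (A u) s) / of_real h)"
    using *(1) equicont_comp_right[OF *(2) A(2)] by blast
  show "\<exists>\<delta>>0. equicont E {h::real. h \<noteq> 0 \<and> \<bar>h\<bar> < \<delta>}
          (\<lambda>h u s. ((D \<alpha> \<beta> (x + h *\<^sub>R b, \<xi>) (A u) s - D \<alpha> \<beta> (x, \<xi>) (A u) s) / of_real h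
             - D \<alpha> (b # \<beta>) (x, \<xi>) (A u) s) / of_real h)"
    using *(3) equicont_comp_right[OF *(4) A(2)] by blast
next
  fix \<alpha> \<beta> :: "'n list" and K :: "'n set" assume B: "set \<alpha> \<subseteq> Basis \<and> set \<beta> \<subseteq> Basis" and K: "compact K"
  have "equicont E (K \<times> UNIV)
      (\<lambda>(x, \<xi>) u s. \<kappa>1 (japanese \<xi>) (D \<alpha> \<beta> (x, \<xi>) (\<kappa>2 (japanese \<xi>) u)) s
           / of_real (japanese \<xi> powr (m - length \<alpha>)))"
    using D[unfolded op_family_def, rule_format, OF B] K by blast
  from equicont_comp_right[OF this A(2)]
  show "equicont E (K \<times> UNIV)
      (\<lambda>(x, \<xi>) u s. \<kappa>1 (japanese \<xi>) (D \<alpha> \<beta> (x, \<xi>) (A (\<kappa> (japanese \<xi>) u))) s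
           / of_real (japanese \<xi> powr (m - length \<alpha>)))"
    by (rule iffD1[OF equicont_cong, rotated -1]) (auto simp: \<kappa> japanese_pos)
qed

section \<open>Dominated convergence, vanishing boundary terms and differentiation under the
  integral\<close>

section \<open>Integrals over the line depending on a parameter\<close>

lemma integrable_inverse_1_plus_square: "integrable lborel (\<lambda>s::real. 1 / (1 + s\<^sup>2))"
proof -
  have "set_integrable lborel (einterval (-\<infinity>) \<infinity>) (\<lambda>s::real. 1 / (1 + s\<^sup>2))"
  proof (rule interval_integral_FTC_nonneg(1)[where F = arctan and A = "-pi/2" and B = "pi/2"])
    show "((arctan \<circ> real_of_ereal) \<longlongrightarrow> -pi/2) (at_right (-\<infinity>))"
      using tendsto_arctan_at_bot by (simp add: ereal_tendsto_simps1)
    show "((arctan \<circ> real_of_ereal) \<longlongrightarrow> pi/2) (at_left \<infinity>)"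
      using tendsto_arctan_at_top by (simp add: ereal_tendsto_simps1)
    show "isCont (\<lambda>s::real. 1 / (1 + s\<^sup>2)) x" for x
      by (auto intro!: continuous_intros simp: add_nonneg_eq_0_iff)
    show "DERIV arctan x :> 1 / (1 + x\<^sup>2)" for x
      by (rule derivative_eq_intros refl)+ (simp add: field_simps)
  qed (auto simp: add_nonneg_nonneg)
  then show ?thesis by (simp add: set_integrable_def)
qed

lemma integrable_decay:
  fixes f :: "real \<Rightarrow> 'a::{banach, second_countable_topology}"
  assumes "f \<in> borel_measurable borel" "\<And>s. (1 + s\<^sup>2) * norm (f s) \<le> C"
  shows "integrable lborel f" "(LBINT s. norm (f s)) \<le> C * (LBINT s. 1 / (1 + s\<^sup>2))"
    "norm (LBINT s. f s) \<le> C * (LBINT s. 1 / (1 + s\<^sup>2))"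
proof -
  have pos: "0 < 1 + s\<^sup>2" for s :: real by (simp add: add_pos_nonneg)
  have le: "norm (f s) \<le> C * (1 / (1 + s\<^sup>2))" for s
    using assms(2)[of s] pos[of s] by (simp add: field_simps)
  have i: "integrable lborel (\<lambda>s. C * (1 / (1 + s\<^sup>2)))"
    by (intro integrable_mult_right integrable_inverse_1_plus_square)
  show 1: "integrable lborel f"
  proof (rule Bochner_Integration.integrable_bound[OF i])
    show "AE s in lborel. norm (f s) \<le> norm (C * (1 / (1 + s\<^sup>2)))"
      using order_trans[OF le abs_ge_self] by (intro AE_I2) simp
  qed (use assms(1) in auto)
  show 2: "(LBINT s. norm (f s)) \<le> C * (LBINT s. 1 / (1 + s\<^sup>2))"
    using integral_mono[OF integrable_norm[OF 1] i le] by (simp only: integral_mult_right_zero)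
  show "norm (LBINT s. f s) \<le> C * (LBINT s. 1 / (1 + s\<^sup>2))"
    by (rule order_trans[OF integral_norm_bound 2])
qed

text \<open>Partial integration without boundary terms: \<open>F\<close> will be the product of a
  kernel and a Schwartz function. The whole integral is the limit of those over [-n, n], which are
  evaluated by the fundamental theorem.\<close>

lemma integral_derivative_zero:
  fixes F :: "real \<Rightarrow> complex"
  assumes F: "\<And>s. (F has_vector_derivative F' s) (at s)" and F': "continuous_on UNIV F'" "integrable lborel F'"
    and lim: "(F \<longlongrightarrow> 0) at_top" "(F \<longlongrightarrow> 0) at_bot"
  shows "(LBINT s. F' s) = 0"
proof -
  have "(\<lambda>n::nat. LBINT s. indicator {-real n..real n} s *\<^sub>R F' s) \<longlonglongrightarrow> (LBINT s. F' s)"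
  proof (rule integral_dominated_convergence[where w = "\<lambda>s. norm (F' s)"])
    show "AE s in lborel. (\<lambda>n. indicator {-real n..real n} s *\<^sub>R F' s) \<longlonglongrightarrow> F' s"
    proof (rule AE_I2)
      fix s :: real
      obtain N where N: "\<bar>s\<bar> \<le> real N" using real_arch_simple by blast
      have "eventually (\<lambda>n. indicator {-real n..real n} s *\<^sub>R F' s = F' s) sequentially"
        by (rule eventually_sequentiallyI[of N]) (use N in \<open>auto simp: indicator_def\<close>)
      then show "(\<lambda>n. indicator {-real n..real n} s *\<^sub>R F' s) \<longlonglongrightarrow> F' s"
        by (rule tendsto_eventually)
    qed
  qed (use F' in \<open>auto simp: indicator_def\<close>)
  moreover have "(LBINT s. indicator {-real n..real n} s *\<^sub>R F' s) = F n - F (- real n)" for n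
    by (rule integral_FTC_Icc) (use F F' in \<open>auto intro: has_vector_derivative_at_within continuous_on_subset\<close>)
  moreover have "(\<lambda>n::nat. F n - F (- real n)) \<longlonglongrightarrow> 0 - 0"
    by (intro tendsto_diff filterlim_compose[OF lim(1)] filterlim_compose[OF lim(2)]
        filterlim_real_sequentially filterlim_compose[OF filterlim_uminus_at_bot_at_top])
  ultimately show ?thesis using LIMSEQ_unique by fastforce
qed

text \<open>By the mean value theorem the difference quotients are dominated by \<open>g\<close>, so
  dominated convergence applies along every sequence of steps tending to 0.\<close>

lemma has_vector_derivative_integral:
  fixes f :: "real \<Rightarrow> real \<Rightarrow> complex"
  assumes "0 < \<delta>"
    and f: "\<And>\<theta> s. \<bar>\<theta> - \<theta>0\<bar> < \<delta> \<Longrightarrow> ((\<lambda>\<theta>. f \<theta> s) has_vector_derivative f' \<theta> s) (at \<theta>)"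
    and b: "\<And>\<theta> s. \<bar>\<theta> - \<theta>0\<bar> < \<delta> \<Longrightarrow> norm (f' \<theta> s) \<le> g s"
    and g: "integrable lborel g" and i: "\<And>\<theta>. \<bar>\<theta> - \<theta>0\<bar> < \<delta> \<Longrightarrow> integrable lborel (f \<theta>)"
  shows "((\<lambda>\<theta>. LBINT s. f \<theta> s) has_vector_derivative (LBINT s. f' \<theta>0 s)) (at \<theta>0)"
    "integrable lborel (f' \<theta>0)"
proof -
  let ?q = "\<lambda>h s. (f (\<theta>0 + h) s - f \<theta>0 s) /\<^sub>R h"
  have q: "((\<lambda>h. ?q h s) \<longlongrightarrow> f' \<theta>0 s) (at 0)" for s
  proof -
    have "((\<lambda>\<theta>. f \<theta> s) has_vector_derivative f' \<theta>0 s) (at \<theta>0)" using f[of \<theta>0] assms(1) by simp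
    then have "((\<lambda>h. norm (f (\<theta>0 + h) s - f \<theta>0 s - h *\<^sub>R f' \<theta>0 s) / norm h) \<longlongrightarrow> 0) (at 0)"
      unfolding has_vector_derivative_def has_derivative_at by simp
    then have "((\<lambda>h. norm (?q h s - f' \<theta>0 s)) \<longlongrightarrow> 0) (at 0)"
    proof (rule Lim_transform_eventually)
      have "norm (f (\<theta>0 + h) s - f \<theta>0 s - h *\<^sub>R f' \<theta>0 s) / norm h = norm (?q h s - f' \<theta>0 s)" if "h \<noteq> 0" for h
      proof -
        have "f (\<theta>0 + h) s - f \<theta>0 s - h *\<^sub>R f' \<theta>0 s = h *\<^sub>R (?q h s - f' \<theta>0 s)"
          using that by (simp add: scaleR_diff_right)
        then show ?thesis using that by (simp only: norm_scaleR) simp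
      qed
      then show "\<forall>\<^sub>F h in at 0. norm (f (\<theta>0 + h) s - f \<theta>0 s - h *\<^sub>R f' \<theta>0 s) / norm h = norm (?q h s - f' \<theta>0 s)"
        by (auto simp: eventually_at_filter)
    qed
    then show ?thesis by (rule LIM_zero_cancel[OF tendsto_norm_zero_cancel])
  qed
  have qb: "norm (?q h s) \<le> g s" if h: "h \<noteq> 0" "\<bar>h\<bar> < \<delta>" for h s
  proof -
    have "norm (f (\<theta>0 + h) s - f \<theta>0 s) \<le> g s * \<bar>(\<theta>0 + h) - \<theta>0\<bar>"
      by (rule mean_value_bound[where g' = "\<lambda>\<theta>. f' \<theta> s"])
         (use h in \<open>auto intro!: f b simp: closed_segment_eq_real_ivl split: if_splits\<close>)
    then have "norm (f (\<theta>0 + h) s - f \<theta>0 s) / \<bar>h\<bar> \<le> g s" using h by (simp add: field_simps)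
    then show ?thesis by (simp add: divide_inverse_commute)
  qed
  have qi: "integrable lborel (?q h)" if "\<bar>h\<bar> < \<delta>" for h
    using i[of "\<theta>0 + h"] i[of \<theta>0] that assms(1) by (intro integrable_scaleR_right integrable_diff) auto
  \<comment> \<open>A concrete sequence of steps that exhibits \<open>f' \<theta>0\<close> as a
    pointwise limit of measurable functions. The 2 makes even the initial step strictly smaller than
    \<open>\<delta>\<close>.\<close>
  define X where "X n = \<delta> / real (n + 2)" for n
  have X: "X n \<noteq> 0" "\<bar>X n\<bar> < \<delta>" for n using assms(1) by (auto simp: X_def field_simps add_pos_nonneg)
  have "X \<longlonglongrightarrow> 0" unfolding X_def
    using LIMSEQ_ignore_initial_segment[OF lim_const_over_n[of \<delta>], of 2] by simp
  then have qX: "(\<lambda>n. ?q (X n) s) \<longlonglongrightarrow> f' \<theta>0 s" for s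
    using q[of s] X unfolding tendsto_at_iff_sequentially by (auto simp: o_def)
  have qm: "?q h \<in> borel_measurable lborel" if "\<bar>h\<bar> < \<delta>" for h
    by (rule borel_measurable_integrable[OF qi[OF that]])
  have m: "f' \<theta>0 \<in> borel_measurable lborel"
    by (rule borel_measurable_LIMSEQ_metric[of "\<lambda>n. ?q (X n)"]) (use qm X qX in auto)
  then show "integrable lborel (f' \<theta>0)"
    by (rule Bochner_Integration.integrable_bound[OF g])
       (use assms(1) in \<open>auto intro!: order_trans[OF b[of \<theta>0] abs_ge_self]\<close>)
  have lim: "((\<lambda>h. LBINT s. ?q h s) \<longlongrightarrow> (LBINT s. f' \<theta>0 s)) (at 0)"
    unfolding tendsto_at_iff_sequentially o_def
  proof (intro allI impI)
    fix Y :: "nat \<Rightarrow> real" assume Y: "\<forall>i. Y i \<in> UNIV - {0}" "Y \<longlonglongrightarrow> 0"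
    obtain N where N: "\<And>n. n \<ge> N \<Longrightarrow> \<bar>Y n\<bar> < \<delta>"
      using LIMSEQ_D[OF Y(2) assms(1)] by auto
    show "(\<lambda>n. LBINT s. ?q (Y n) s) \<longlonglongrightarrow> (LBINT s. f' \<theta>0 s)"
    proof (rule LIMSEQ_offset[of _ N], rule integral_dominated_convergence[where w = g])
      show "AE s in lborel. (\<lambda>n. ?q (Y (n + N)) s) \<longlonglongrightarrow> f' \<theta>0 s"
        using q Y unfolding tendsto_at_iff_sequentially
        by (intro AE_I2 LIMSEQ_ignore_initial_segment) (auto simp: o_def)
    qed (use m qm qb N Y g in auto)
  qed
  have *: "(LBINT s. ?q h s) = ((LBINT s. f (\<theta>0 + h) s) - (LBINT s. f \<theta>0 s)) /\<^sub>R h" if "\<bar>h\<bar> < \<delta>" for h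
    using i[of "\<theta>0 + h"] i[of \<theta>0] that assms(1) by (simp add: integral_diff)
  have "eventually (\<lambda>h. \<bar>h\<bar> < \<delta>) (at (0::real))"
    unfolding eventually_at using assms(1) by (intro exI[of _ \<delta>]) auto
  then have "eventually (\<lambda>h. (LBINT s. ?q h s) = ((LBINT s. f (\<theta>0 + h) s) - (LBINT s. f \<theta>0 s)) /\<^sub>R h) (at 0)"
    by (rule eventually_mono) (rule *)
  with lim have *: "((\<lambda>h. ((LBINT s. f (\<theta>0 + h) s) - (LBINT s. f \<theta>0 s)) /\<^sub>R h) \<longlongrightarrow> (LBINT s. f' \<theta>0 s)) (at 0)"
    by (rule Lim_transform_eventually)
  show "((\<lambda>\<theta>. LBINT s. f \<theta> s) has_vector_derivative (LBINT s. f' \<theta>0 s)) (at \<theta>0)"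
    unfolding has_vector_derivative_def has_derivative_at
  proof
    let ?I = "\<lambda>\<theta>. LBINT s. f \<theta> s" and ?J = "LBINT s. f' \<theta>0 s"
    have "((\<lambda>h. norm ((?I (\<theta>0 + h) - ?I \<theta>0) /\<^sub>R h - ?J)) \<longlongrightarrow> 0) (at 0)"
      using tendsto_norm_zero[OF LIM_zero[OF *]] .
    then show "((\<lambda>h. norm (?I (\<theta>0 + h) - ?I \<theta>0 - h *\<^sub>R ?J) / norm h) \<longlongrightarrow> 0) (at 0)"
    proof (rule Lim_transform_eventually)
      have "norm ((?I (\<theta>0 + h) - ?I \<theta>0) /\<^sub>R h - ?J) = norm (?I (\<theta>0 + h) - ?I \<theta>0 - h *\<^sub>R ?J) / norm h" if "h \<noteq> 0" for h
      proof -
        have "?I (\<theta>0 + h) - ?I \<theta>0 - h *\<^sub>R ?J = h *\<^sub>R ((?I (\<theta>0 + h) - ?I \<theta>0) /\<^sub>R h - ?J)"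
          using that by (simp add: scaleR_diff_right)
        then show ?thesis using that by (simp only: norm_scaleR) simp
      qed
      then show "\<forall>\<^sub>F h in at 0. norm ((?I (\<theta>0 + h) - ?I \<theta>0) /\<^sub>R h - ?J) = norm (?I (\<theta>0 + h) - ?I \<theta>0 - h *\<^sub>R ?J) / norm h"
        by (auto simp: eventually_at_filter)
    qed
  qed (rule bounded_linear_scaleR_left)
qed

section \<open>Schwartz seminorms, the Fourier transform and dilations on the Schwartz space\<close>

section \<open>The Schwartz space\<close>

abbreviation iter_deriv :: "nat \<Rightarrow> (real \<Rightarrow> complex) \<Rightarrow> real \<Rightarrow> complex" where
  "iter_deriv k u \<equiv> dirs (replicate k 1) u"

lemma iter_deriv_vector_derivative:
  assumes "u \<in> schwartz"
  shows "(iter_deriv k u has_vector_derivative iter_deriv (Suc k) u t) (at t)"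
proof -
  have "iter_deriv k u differentiable (at t)"
    by (rule smooth_on_differentiable[OF smooth_on_dirs[of UNIV]]) (use assms in \<open>auto simp: schwartz_def\<close>)
  then show ?thesis using line_derivative[of "iter_deriv k u" 0 t 1] by simp
qed

lemma iter_deriv_continuous: "u \<in> schwartz \<Longrightarrow> continuous_on UNIV (iter_deriv k u)"
  by (rule smooth_on_continuous) (simp add: schwartz_def)

text \<open>The scalar \<open>c\<close> is needed for the induction: the derivative of c U_k in the
  direction v is (c v) U_{k+1}.\<close>

lemma cdiff_on_sequence:
  fixes U :: "nat \<Rightarrow> real \<Rightarrow> complex"
  assumes "\<And>k t. (U k has_vector_derivative U (Suc k) t) (at t)"
  shows "cdiff_on n UNIV (\<lambda>t. c *\<^sub>R U k t)"
proof (induction n arbitrary: c k)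
  case 0
  have "isCont (U k) t" for t
    using assms by (meson has_vector_derivative_continuous)
  then show ?case by (auto intro!: continuous_intros continuous_at_imp_continuous_on)
next
  case (Suc n)
  have d: "((\<lambda>t. c *\<^sub>R U k t) has_derivative (\<lambda>h. c *\<^sub>R h *\<^sub>R U (Suc k) t)) (at t)" for t
    using assms[of k t] unfolding has_vector_derivative_def by (rule has_derivative_scaleR_right)
  have "(\<lambda>t. frechet_derivative (\<lambda>t. c *\<^sub>R U k t) (at t) v) = (\<lambda>t. (c * v) *\<^sub>R U (Suc k) t)" for v
    using pd_eqI[OF d] by auto
  moreover have "(\<lambda>t. c *\<^sub>R U k t) differentiable (at t)" for t
    using d unfolding differentiable_def by blast
  ultimately show ?case using Suc by simp
qed

text \<open>All derivatives are proposed at once, so membership and the values of the iterated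
  derivatives are obtained together. Every Schwartz function constructed below arises in this
  way.\<close>

lemma schwartzI:
  assumes U: "\<And>k t. (U k has_vector_derivative U (Suc k) t) (at t)"
    and b: "\<And>j k. \<exists>C. \<forall>t. \<bar>t\<bar> ^ j * cmod (U k t) \<le> C"
  shows "U 0 \<in> schwartz" "iter_deriv k (U 0) = U k"
proof -
  show D: "iter_deriv k (U 0) = U k" for k
  proof (induction k)
    case (Suc k)
    have "pd 1 (U k) = U (Suc k)"
      using pd_eqI[OF U[of k, unfolded has_vector_derivative_def], where v = 1] by auto
    then show ?case using Suc by simp
  qed simp
  have "smooth_on UNIV (U 0)"
    unfolding smooth_on_def using cdiff_on_sequence[of U _ 1 0] U by simp
  moreover have "bounded (range (\<lambda>t. of_real (t ^ j) * U k t))" for j k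
  proof -
    obtain C where "\<forall>t. \<bar>t\<bar> ^ j * cmod (U k t) \<le> C" using b by blast
    then show ?thesis by (intro boundedI[of _ C]) (auto simp: norm_mult norm_power)
  qed
  ultimately show "U 0 \<in> schwartz" by (simp add: schwartz_def D)
qed

definition schwartz_seminorm :: "nat \<Rightarrow> nat \<Rightarrow> (real \<Rightarrow> complex) \<Rightarrow> real" where
  "schwartz_seminorm j k u = (SUP t. cmod (of_real (t ^ j) * iter_deriv k u t))"

text \<open>An increasing sequence that generates the topology, so that a single index replaces a
  finite set of seminorms.\<close>

definition schwartz_norm :: "nat \<Rightarrow> (real \<Rightarrow> complex) \<Rightarrow> real" where
  "schwartz_norm n u = (\<Sum>j\<le>n. \<Sum>k\<le>n. schwartz_seminorm j k u)"

lemma schwartz_seminorm_upper: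
  assumes "u \<in> schwartz"
  shows "\<bar>t\<bar> ^ j * cmod (iter_deriv k u t) \<le> schwartz_seminorm j k u"
proof -
  have "bdd_above (range (\<lambda>t. cmod (of_real (t ^ j) * iter_deriv k u t)))"
  proof -
    have "bounded (range (\<lambda>t. of_real (t ^ j) * iter_deriv k u t))" using assms by (simp add: schwartz_def)
    then obtain C where "\<And>t. cmod (of_real (t ^ j) * iter_deriv k u t) \<le> C" unfolding bounded_iff by auto
    then show ?thesis by (intro bdd_aboveI2)
  qed
  from cSUP_upper[OF UNIV_I this, of t] show ?thesis
    by (simp add: schwartz_seminorm_def norm_mult norm_power)
qed

lemma schwartz_seminorm_least: "(\<And>t. \<bar>t\<bar> ^ j * cmod (iter_deriv k u t) \<le> C) \<Longrightarrow> schwartz_seminorm j k u \<le> C"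
  unfolding schwartz_seminorm_def by (rule cSUP_least) (auto simp: norm_mult norm_power)

lemma schwartz_seminorm_nonneg: "u \<in> schwartz \<Longrightarrow> 0 \<le> schwartz_seminorm j k u"
  by (rule order_trans[OF _ schwartz_seminorm_upper[of u 0]]) auto

lemma schwartz_seminorm_le_schwartz_norm: "u \<in> schwartz \<Longrightarrow> j \<le> n \<Longrightarrow> k \<le> n \<Longrightarrow> schwartz_seminorm j k u \<le> schwartz_norm n u"
  unfolding schwartz_norm_def
  using member_le_sum[of k "{..n}" "\<lambda>k. schwartz_seminorm j k u"] member_le_sum[of j "{..n}" "\<lambda>j. \<Sum>k\<le>n. schwartz_seminorm j k u"]
  by (smt (verit) atMost_iff finite_atMost schwartz_seminorm_nonneg sum_nonneg)

lemma schwartz_norm_nonneg: "u \<in> schwartz \<Longrightarrow> 0 \<le> schwartz_norm n u"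
  unfolding schwartz_norm_def by (intro sum_nonneg schwartz_seminorm_nonneg)

lemma schwartz_norm_mono: "u \<in> schwartz \<Longrightarrow> m \<le> n \<Longrightarrow> schwartz_norm m u \<le> schwartz_norm n u"
  unfolding schwartz_norm_def
  by (rule order_trans[OF sum_mono[OF sum_mono2] sum_mono2]) (auto intro!: sum_nonneg schwartz_seminorm_nonneg)

lemma schwartz_norm_least:
  assumes "u \<in> schwartz" "\<And>j k t. j \<le> n \<Longrightarrow> k \<le> n \<Longrightarrow> \<bar>t\<bar> ^ j * cmod (iter_deriv k u t) \<le> C"
  shows "schwartz_norm n u \<le> (n + 1)\<^sup>2 * C"
proof -
  have "schwartz_norm n u \<le> (\<Sum>j\<le>n. \<Sum>k\<le>n. C)"
    unfolding schwartz_norm_def using assms by (intro sum_mono schwartz_seminorm_least) auto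
  then show ?thesis by (simp add: power2_eq_square algebra_simps)
qed

lemma weight_le_schwartz_norm:
  assumes u: "u \<in> schwartz" and "j \<le> n" "k \<le> n"
  shows "(1 + \<bar>t\<bar>) ^ j * cmod (iter_deriv k u t) \<le> 2 ^ (n + 1) * schwartz_norm n u"
proof -
  have "(1 + \<bar>t\<bar>) ^ j \<le> (2 * max 1 \<bar>t\<bar>) ^ j" by (intro power_mono) auto
  also have "\<dots> = 2 ^ j * max 1 \<bar>t\<bar> ^ j" by (simp add: power_mult_distrib)
  also have "\<dots> \<le> 2 ^ j * (1 + \<bar>t\<bar> ^ j)"
    by (intro mult_left_mono) (auto simp: max_def)
  also have "\<dots> \<le> 2 ^ n * (1 + \<bar>t\<bar> ^ j)"
    using assms by (intro mult_right_mono power_increasing) auto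
  finally have "(1 + \<bar>t\<bar>) ^ j * cmod (iter_deriv k u t) \<le> 2 ^ n * (1 + \<bar>t\<bar> ^ j) * cmod (iter_deriv k u t)"
    by (intro mult_right_mono) auto
  also have "\<dots> = 2 ^ n * (\<bar>t\<bar> ^ 0 * cmod (iter_deriv k u t) + \<bar>t\<bar> ^ j * cmod (iter_deriv k u t))"
    by (simp add: algebra_simps)
  also have "\<dots> \<le> 2 ^ n * (schwartz_norm n u + schwartz_norm n u)"
    using order_trans[OF schwartz_seminorm_upper[OF u, of t 0 k] schwartz_seminorm_le_schwartz_norm[OF u, of 0 n k]]
      order_trans[OF schwartz_seminorm_upper[OF u, of t j k] schwartz_seminorm_le_schwartz_norm[OF u, of j n k]] assms
    by (intro mult_left_mono add_mono) auto
  finally show ?thesis by simp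
qed

lemma schwartz_lin:
  assumes u: "u \<in> schwartz" and v: "v \<in> schwartz"
  shows "(\<lambda>s. c * u s + d * v s) \<in> schwartz"
    "iter_deriv k (\<lambda>s. c * u s + d * v s) = (\<lambda>s. c * iter_deriv k u s + d * iter_deriv k v s)"
proof -
  let ?U = "\<lambda>k s. c * iter_deriv k u s + d * iter_deriv k v s"
  have 1: "(?U k has_vector_derivative ?U (Suc k) t) (at t)" for k t
    by (intro has_vector_derivative_add has_vector_derivative_mult_right iter_deriv_vector_derivative u v)
  have 2: "\<exists>C. \<forall>t. \<bar>t\<bar> ^ j * cmod (?U k t) \<le> C" for j k
  proof (intro exI allI)
    fix t
    have "\<bar>t\<bar> ^ j * cmod (?U k t) \<le> \<bar>t\<bar> ^ j * (cmod c * cmod (iter_deriv k u t) + cmod d * cmod (iter_deriv k v t))"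
      by (intro mult_left_mono order_trans[OF norm_triangle_ineq]) (auto simp: norm_mult)
    also have "\<dots> = cmod c * (\<bar>t\<bar> ^ j * cmod (iter_deriv k u t)) + cmod d * (\<bar>t\<bar> ^ j * cmod (iter_deriv k v t))"
      by (simp add: algebra_simps)
    also have "\<dots> \<le> cmod c * schwartz_seminorm j k u + cmod d * schwartz_seminorm j k v"
      by (intro add_mono mult_left_mono schwartz_seminorm_upper u v) auto
    finally show "\<bar>t\<bar> ^ j * cmod (?U k t) \<le> cmod c * schwartz_seminorm j k u + cmod d * schwartz_seminorm j k v" .
  qed
  from schwartzI[of ?U, OF 1 2] show "(\<lambda>s. c * u s + d * v s) \<in> schwartz"
    "iter_deriv k (\<lambda>s. c * u s + d * v s) = (\<lambda>s. c * iter_deriv k u s + d * iter_deriv k v s)"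
    by simp_all
qed

lemma schwartz_zero: "(\<lambda>s. 0) \<in> schwartz" and iter_deriv_zero: "iter_deriv k (\<lambda>s. 0) = (\<lambda>s. 0)"
  using schwartzI[of "\<lambda>k s. 0"] by auto

definition schwartz_seminorms :: "((real \<Rightarrow> complex) \<Rightarrow> real) set" where
  "schwartz_seminorms = {schwartz_seminorm j k | j k. True}"

lemma schwartz_space_eq: "schwartz_space = lc_topology schwartz schwartz_seminorms"
  unfolding schwartz_space_def schwartz_seminorms_def schwartz_seminorm_def[abs_def] by (rule refl)

lemma seminorm_on_schwartz_seminorm: "seminorm_on schwartz (schwartz_seminorm j k)"
  unfolding seminorm_on_def
proof (intro conjI ballI allI)
  fix u v assume u: "u \<in> schwartz" and v: "v \<in> schwartz"
  have D: "iter_deriv k (\<lambda>s. u s + v s) = (\<lambda>s. iter_deriv k u s + iter_deriv k v s)"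
    using schwartz_lin(2)[OF u v, of k 1 1] by simp
  show "schwartz_seminorm j k (\<lambda>s. u s + v s) \<le> schwartz_seminorm j k u + schwartz_seminorm j k v"
  proof (rule schwartz_seminorm_least)
    fix t
    have "\<bar>t\<bar> ^ j * cmod (iter_deriv k u t + iter_deriv k v t) \<le> \<bar>t\<bar> ^ j * cmod (iter_deriv k u t) + \<bar>t\<bar> ^ j * cmod (iter_deriv k v t)"
      by (simp add: distrib_left[symmetric] mult_left_mono norm_triangle_ineq)
    also have "\<dots> \<le> schwartz_seminorm j k u + schwartz_seminorm j k v" by (intro add_mono schwartz_seminorm_upper u v)
    finally show "\<bar>t\<bar> ^ j * cmod (iter_deriv k (\<lambda>s. u s + v s) t) \<le> schwartz_seminorm j k u + schwartz_seminorm j k v" by (simp add: D)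
  qed
next
  fix c u assume u: "u \<in> schwartz"
  have D: "iter_deriv k (\<lambda>s. c * u s) = (\<lambda>s. c * iter_deriv k u s)" for c
    using schwartz_lin(2)[OF u u, of k c 0] by simp
  have le: "schwartz_seminorm j k (\<lambda>s. c * u s) \<le> cmod c * schwartz_seminorm j k u" for c
    using schwartz_seminorm_upper[OF u, of _ j k] by (intro schwartz_seminorm_least) (simp add: D norm_mult mult.left_commute[of _ "cmod c"] mult_left_mono)
  show "schwartz_seminorm j k (\<lambda>s. c * u s) = cmod c * schwartz_seminorm j k u"
  proof (cases "c = 0")
    case True
    then show ?thesis by (simp add: schwartz_seminorm_def iter_deriv_zero)
  next
    case False
    have cu: "(\<lambda>s. c * u s) \<in> schwartz" using schwartz_lin(1)[OF u u, of c 0] by simp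
    have "\<bar>t\<bar> ^ j * cmod (iter_deriv k u t) \<le> schwartz_seminorm j k (\<lambda>s. c * u s) / cmod c" for t
      using schwartz_seminorm_upper[OF cu, of t j k] False by (simp add: D norm_mult field_simps)
    then have "schwartz_seminorm j k u \<le> schwartz_seminorm j k (\<lambda>s. c * u s) / cmod c" by (rule schwartz_seminorm_least)
    then show ?thesis using le[of c] False by (intro antisym) (auto simp: field_simps)
  qed
qed

lemma schwartz_lc: "lc_space schwartz schwartz_seminorms"
proof
  show "(\<lambda>s. u s + v s) \<in> schwartz" if "u \<in> schwartz" "v \<in> schwartz" for u v
    using schwartz_lin(1)[OF that, of 1 1] by simp
  show "(\<lambda>s. c * u s) \<in> schwartz" if "u \<in> schwartz" for u c
    using schwartz_lin(1)[OF that that, of c 0] by simp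
qed (auto simp: schwartz_seminorms_def seminorm_on_schwartz_seminorm schwartz_zero)

lemma topspace_schwartz [simp]: "topspace schwartz_space = schwartz"
  unfolding schwartz_space_eq by (rule lc_space.topspace_E[OF schwartz_lc])

lemma schwartz_norm_cont_seminorm: "cont_seminorm schwartz_space (schwartz_norm n)"
proof -
  let ?F = "(\<lambda>(j, k). schwartz_seminorm j k) ` ({..n} \<times> {..n})"
  have fin: "finite ?F" and sub: "?F \<subseteq> schwartz_seminorms" by (auto simp: schwartz_seminorms_def)
  have "seminorm_on schwartz (schwartz_norm n)"
    unfolding seminorm_on_def schwartz_norm_def using seminorm_on_schwartz_seminorm
    by (auto simp: seminorm_on_def sum_distrib_left sum.distrib[symmetric] intro!: sum_mono)
  moreover have "schwartz_norm n u \<le> (n + 1)\<^sup>2 * (\<Sum>p\<in>?F. p u)" if u: "u \<in> schwartz" for u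
  proof -
    have "schwartz_seminorm j k u \<le> (\<Sum>p\<in>?F. p u)" if "j \<le> n" "k \<le> n" for j k
      using that u by (intro member_le_sum[of "schwartz_seminorm j k" ?F "\<lambda>p. p u"]) (auto intro: schwartz_seminorm_nonneg)
    then have "schwartz_norm n u \<le> (\<Sum>j\<le>n. \<Sum>k\<le>n. (\<Sum>p\<in>?F. p u))"
      unfolding schwartz_norm_def by (intro sum_mono) auto
    then show ?thesis by (simp add: power2_eq_square algebra_simps)
  qed
  ultimately show ?thesis
    unfolding schwartz_space_eq by (rule lc_space.cont_seminormI[OF schwartz_lc _ fin sub])
qed

lemma schwartz_seminorm_bound:
  assumes "cont_seminorm schwartz_space q"
  shows "\<exists>n C. 0 \<le> C \<and> (\<forall>u\<in>schwartz. q u \<le> C * schwartz_norm n u)"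
proof -
  obtain F C where F: "finite F" "F \<subseteq> schwartz_seminorms" "0 \<le> C" "\<forall>u\<in>schwartz. q u \<le> C * (\<Sum>p\<in>F. p u)"
    using lc_space.cont_seminorm_bound[OF schwartz_lc] assms schwartz_space_eq by metis
  have "\<exists>n. \<forall>p\<in>F. \<forall>u\<in>schwartz. p u \<le> schwartz_norm n u"
    using F(1,2)
  proof (induction F)
    case (insert p F)
    then obtain n j k where n: "\<forall>p\<in>F. \<forall>u\<in>schwartz. p u \<le> schwartz_norm n u" "p = schwartz_seminorm j k" by (auto simp: schwartz_seminorms_def)
    show ?case
    proof (intro exI ballI)
      fix q u assume "q \<in> insert p F" and u: "u \<in> schwartz"
      then show "q u \<le> schwartz_norm (max n (max j k)) u"
        using n schwartz_seminorm_le_schwartz_norm[OF u, of j "max n (max j k)" k] schwartz_norm_mono[OF u, of n "max n (max j k)"] by fastforce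
    qed
  qed auto
  then obtain n where n: "\<forall>p\<in>F. \<forall>u\<in>schwartz. p u \<le> schwartz_norm n u" by blast
  have "q u \<le> (C * card F) * schwartz_norm n u" if u: "u \<in> schwartz" for u
  proof -
    have "(\<Sum>p\<in>F. p u) \<le> card F * schwartz_norm n u"
      using sum_bounded_above[of F "\<lambda>p. p u" "schwartz_norm n u"] n u by simp
    then have "C * (\<Sum>p\<in>F. p u) \<le> C * (card F * schwartz_norm n u)" using F(3) by (rule mult_left_mono)
    then show ?thesis using F(4) u by (fastforce simp: mult.assoc)
  qed
  then show ?thesis using F(3) by (intro exI[of _ n] exI[of _ "C * card F"]) auto
qed

text \<open>Reduces equicontinuity to the pointwise estimates that kernels provide. A given seminorm
  involves finitely many pairs \<open>(j, k)\<close>, so the largest of the corresponding indices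
  \<open>n\<close> serves for all of them.\<close>

lemma equicont_schwartz_iff:
  "equicont schwartz_space I Q \<longleftrightarrow> (\<forall>i\<in>I. \<forall>u\<in>schwartz. Q i u \<in> schwartz) \<and>
     (\<forall>j k. \<exists>n C. \<forall>i\<in>I. \<forall>u\<in>schwartz. \<forall>t. \<bar>t\<bar> ^ j * cmod (iter_deriv k (Q i u) t) \<le> C * schwartz_norm n u)"
  (is "?L \<longleftrightarrow> ?R1 \<and> ?R2")
proof
  assume L: ?L
  then have R1: ?R1 by (simp add: equicont_def)
  moreover have ?R2
  proof (intro allI)
    fix j k
    have "cont_seminorm schwartz_space (schwartz_seminorm j k)"
      unfolding schwartz_space_eq by (rule lc_space.cont_seminorm_generator[OF schwartz_lc]) (auto simp: schwartz_seminorms_def)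
    then obtain r where r: "cont_seminorm schwartz_space r" "\<forall>i\<in>I. \<forall>u\<in>schwartz. schwartz_seminorm j k (Q i u) \<le> r u"
      using L unfolding equicont_def by auto
    obtain n C where n: "\<forall>u\<in>schwartz. r u \<le> C * schwartz_norm n u" using schwartz_seminorm_bound[OF r(1)] by blast
    have "\<bar>t\<bar> ^ j * cmod (iter_deriv k (Q i u) t) \<le> C * schwartz_norm n u" if "i \<in> I" "u \<in> schwartz" for i u t
      using schwartz_seminorm_upper[of "Q i u" t j k] R1 r(2) n that by fastforce
    then show "\<exists>n C. \<forall>i\<in>I. \<forall>u\<in>schwartz. \<forall>t. \<bar>t\<bar> ^ j * cmod (iter_deriv k (Q i u) t) \<le> C * schwartz_norm n u" by blast
  qed
  ultimately show "?R1 \<and> ?R2" by blast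
next
  assume R: "?R1 \<and> ?R2"
  then obtain n C where nC: "\<And>j k i u t. i \<in> I \<Longrightarrow> u \<in> schwartz \<Longrightarrow>
      \<bar>t\<bar> ^ j * cmod (iter_deriv k (Q i u) t) \<le> C j k * schwartz_norm (n j k) u"
    by metis
  show ?L
    unfolding equicont_def
  proof (intro conjI allI impI)
    fix q assume "cont_seminorm schwartz_space q"
    then obtain N K where N: "0 \<le> K" "\<forall>u\<in>schwartz. q u \<le> K * schwartz_norm N u" using schwartz_seminorm_bound by blast
    define r where "r u = K * (\<Sum>j\<le>N. \<Sum>k\<le>N. \<bar>C j k\<bar> * schwartz_norm (n j k) u)" for u
    define m where "m = Max ((\<lambda>(j, k). n j k) ` ({..N} \<times> {..N}))"
    define A where "A = K * (\<Sum>j\<le>N. \<Sum>k\<le>N. \<bar>C j k\<bar>)"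
    have A: "0 \<le> A" using N by (simp add: A_def sum_nonneg)
    have m: "n j k \<le> m" if "j \<le> N" "k \<le> N" for j k
      unfolding m_def using that by (intro Max_ge) auto
    have "q (Q i u) \<le> A * schwartz_norm m u" if i: "i \<in> I" and u: "u \<in> schwartz" for i u
    proof -
      have "q (Q i u) \<le> K * schwartz_norm N (Q i u)" using N R i u by blast
      also have "\<dots> \<le> K * (\<Sum>j\<le>N. \<Sum>k\<le>N. \<bar>C j k\<bar> * schwartz_norm m u)"
      proof (intro mult_left_mono N(1))
        show "schwartz_norm N (Q i u) \<le> (\<Sum>j\<le>N. \<Sum>k\<le>N. \<bar>C j k\<bar> * schwartz_norm m u)"
          unfolding schwartz_norm_def[of N]
        proof (intro sum_mono schwartz_seminorm_least)
          fix j k t assume "j \<in> {..N}" "k \<in> {..N}"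
          then have "C j k * schwartz_norm (n j k) u \<le> \<bar>C j k\<bar> * schwartz_norm m u"
            using schwartz_norm_mono[OF u m, of j k] schwartz_norm_nonneg[OF u, of "n j k"] by (intro mult_mono) auto
          then show "\<bar>t\<bar> ^ j * cmod (iter_deriv k (Q i u) t) \<le> \<bar>C j k\<bar> * schwartz_norm m u"
            using nC[OF i u, of t j k] by linarith
        qed
      qed
      also have "\<dots> = A * schwartz_norm m u" by (simp add: A_def sum_distrib_right mult.assoc)
      finally show ?thesis .
    qed
    moreover have "cont_seminorm schwartz_space (\<lambda>u. A * schwartz_norm m u)"
      using schwartz_norm_cont_seminorm[of m] unfolding schwartz_space_eq
    proof (rule lc_space.cont_seminorm_mono[OF schwartz_lc, of _ _ A])
      have "seminorm_on schwartz (schwartz_norm m)" using schwartz_norm_cont_seminorm[of m] by (simp add: cont_seminorm_def)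
      then show "seminorm_on schwartz (\<lambda>u. A * schwartz_norm m u)"
        using A unfolding seminorm_on_def by (auto simp: distrib_left[symmetric] intro!: mult_left_mono)
    qed (use A in auto)
    ultimately show "\<exists>r. cont_seminorm schwartz_space r \<and> (\<forall>i\<in>I. \<forall>u\<in>topspace schwartz_space. q (Q i u) \<le> r u)"
      by (intro exI[of _ "\<lambda>u. A * schwartz_norm m u"]) auto
  qed (use R in auto)
qed

lemma iter_deriv_add: "iter_deriv k (iter_deriv l u) = iter_deriv (k + l) u"
  by (simp add: replicate_add dirs_append)

lemma schwartz_iter_deriv: "u \<in> schwartz \<Longrightarrow> iter_deriv l u \<in> schwartz"
  using schwartzI(1)[of "\<lambda>k. iter_deriv (k + l) u"] iter_deriv_vector_derivative[of u "_ + l"] schwartz_seminorm_upper[of u _ _ "_ + l"]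
  by fastforce

text \<open>Leibniz' rule stops after two terms. For \<open>k = 0\<close> the truncated index
  \<open>k - 1\<close> does no harm because its coefficient is 0.\<close>

lemma schwartz_mult_id:
  fixes c :: complex
  assumes u: "u \<in> schwartz"
  shows "(\<lambda>t. c * of_real t * u t) \<in> schwartz"
    "iter_deriv k (\<lambda>t. c * of_real t * u t) = (\<lambda>t. c * (of_real t * iter_deriv k u t + of_nat k * iter_deriv (k - 1) u t))"
proof -
  let ?U = "\<lambda>k t. c * (of_real t * iter_deriv k u t + of_nat k * iter_deriv (k - 1) u t)"
  have D: "(?U k has_vector_derivative ?U (Suc k) t) (at t)" for k t
  proof -
    have id: "((\<lambda>t. complex_of_real t) has_vector_derivative 1) (at t)"
      using has_vector_derivative_of_real[OF DERIV_ident] by simp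
    have 2: "((\<lambda>t. of_nat k * iter_deriv (k - 1) u t) has_vector_derivative of_nat k * iter_deriv k u t) (at t)"
    proof (cases k)
      case (Suc k')
      then show ?thesis
        using has_vector_derivative_mult_right[OF iter_deriv_vector_derivative[OF u, of k' t], of "of_nat k"] by simp
    qed simp
    show ?thesis
      using has_vector_derivative_mult_right[OF has_vector_derivative_add[OF has_vector_derivative_mult[OF id iter_deriv_vector_derivative[OF u, of k t]] 2], of c]
      by (simp add: algebra_simps)
  qed
  have b: "\<exists>C. \<forall>t. \<bar>t\<bar> ^ j * cmod (?U k t) \<le> C" for j k
  proof (intro exI allI)
    fix t
    have "\<bar>t\<bar> ^ j * cmod (?U k t) \<le> \<bar>t\<bar> ^ j * (cmod c * (\<bar>t\<bar> * cmod (iter_deriv k u t) + real k * cmod (iter_deriv (k - 1) u t)))"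
      by (auto simp: norm_mult intro!: mult_left_mono order_trans[OF norm_triangle_ineq])
    also have "\<dots> = cmod c * (\<bar>t\<bar> ^ Suc j * cmod (iter_deriv k u t) + real k * (\<bar>t\<bar> ^ j * cmod (iter_deriv (k - 1) u t)))"
      by (simp add: algebra_simps)
    also have "\<dots> \<le> cmod c * (schwartz_seminorm (Suc j) k u + real k * schwartz_seminorm j (k - 1) u)"
      by (intro mult_left_mono add_mono schwartz_seminorm_upper u) auto
    finally show "\<bar>t\<bar> ^ j * cmod (?U k t) \<le> cmod c * (schwartz_seminorm (Suc j) k u + real k * schwartz_seminorm j (k - 1) u)" .
  qed
  from schwartzI[of ?U, OF D b]
  show "(\<lambda>t. c * of_real t * u t) \<in> schwartz"
    "iter_deriv k (\<lambda>t. c * of_real t * u t) = (\<lambda>t. c * (of_real t * iter_deriv k u t + of_nat k * iter_deriv (k - 1) u t))"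
    by (simp_all add: mult.assoc)
qed

lemma equicont_iter_deriv: "equicont schwartz_space {()} (\<lambda>_ u. iter_deriv l u)"
  unfolding equicont_schwartz_iff
proof (intro conjI ballI allI)
  fix j k
  show "\<exists>n C. \<forall>i\<in>{()}. \<forall>u\<in>schwartz. \<forall>t. \<bar>t\<bar> ^ j * cmod (iter_deriv k (iter_deriv l u) t) \<le> C * schwartz_norm n u"
    by (intro exI[of _ "max j (k + l)"] exI[of _ 1])
       (auto simp: iter_deriv_add intro!: order_trans[OF schwartz_seminorm_upper schwartz_seminorm_le_schwartz_norm])
qed (auto intro: schwartz_iter_deriv)

lemma equicont_mult_id: "equicont schwartz_space {()} (\<lambda>_ u t. c * of_real t * u t)"
  unfolding equicont_schwartz_iff
proof (intro conjI ballI allI)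
  fix j k
  have "\<bar>t\<bar> ^ j * cmod (iter_deriv k (\<lambda>t. c * of_real t * u t) t) \<le> (cmod c * (1 + k)) * schwartz_norm (Suc (j + k)) u" if u: "u \<in> schwartz" for u t
  proof -
    have "\<bar>t\<bar> ^ j * cmod (iter_deriv k (\<lambda>t. c * of_real t * u t) t)
        \<le> \<bar>t\<bar> ^ j * (cmod c * (\<bar>t\<bar> * cmod (iter_deriv k u t) + real k * cmod (iter_deriv (k - 1) u t)))"
      unfolding schwartz_mult_id[OF u]
      by (auto simp: norm_mult intro!: mult_left_mono order_trans[OF norm_triangle_ineq])
    also have "\<dots> = cmod c * (\<bar>t\<bar> ^ Suc j * cmod (iter_deriv k u t) + real k * (\<bar>t\<bar> ^ j * cmod (iter_deriv (k - 1) u t)))"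
      by (simp add: algebra_simps)
    also have "\<dots> \<le> cmod c * (schwartz_norm (Suc (j + k)) u + real k * schwartz_norm (Suc (j + k)) u)"
      by (intro mult_left_mono add_mono order_trans[OF schwartz_seminorm_upper schwartz_seminorm_le_schwartz_norm] u) auto
    finally show ?thesis by (simp add: algebra_simps)
  qed
  then show "\<exists>n C. \<forall>i\<in>{()}. \<forall>u\<in>schwartz. \<forall>t. \<bar>t\<bar> ^ j * cmod (iter_deriv k (\<lambda>t. c * of_real t * u t) t) \<le> C * schwartz_norm n u"
    by blast
qed (auto intro: schwartz_mult_id)

text \<open>Of the \<open>N + 2\<close> powers of 1 + |s| taken from \<open>u\<close>, two produce
  the integrable weight 1 / (1 + s^2) and the others compensate the growth of the kernel.\<close>

lemma schwartz_kernel_bound: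
  assumes u: "u \<in> schwartz" and \<kappa>: "\<kappa> \<in> borel_measurable borel" "\<And>s. cmod (\<kappa> s) \<le> B * (1 + \<bar>s\<bar>) ^ N"
  shows "integrable lborel (\<lambda>s. \<kappa> s * u s)"
    "cmod (LBINT s. \<kappa> s * u s) \<le> B * (2 ^ (N + 3) * (LBINT s. 1 / (1 + s\<^sup>2))) * schwartz_norm (N + 2) u"
proof -
  have B: "0 \<le> B" using order_trans[OF norm_ge_zero \<kappa>(2)[of 0]] by simp
  have um: "u \<in> borel_measurable borel"
    using iter_deriv_continuous[OF u, of 0] by (auto intro: borel_measurable_continuous_onI)
  have le: "(1 + s\<^sup>2) * cmod (\<kappa> s * u s) \<le> B * (2 ^ (N + 3) * schwartz_norm (N + 2) u)" for s
  proof -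
    have "1 + s\<^sup>2 \<le> (1 + \<bar>s\<bar>)\<^sup>2" by (simp add: power2_eq_square algebra_simps)
    then have "(1 + s\<^sup>2) * cmod (\<kappa> s * u s) \<le> (1 + \<bar>s\<bar>)\<^sup>2 * (B * (1 + \<bar>s\<bar>) ^ N * cmod (u s))"
      unfolding norm_mult by (intro mult_mono \<kappa>) (auto simp: B)
    also have "\<dots> = B * ((1 + \<bar>s\<bar>) ^ (N + 2) * cmod (iter_deriv 0 u s))"
      by (simp add: power_add power2_eq_square algebra_simps)
    also have "\<dots> \<le> B * (2 ^ (N + 3) * schwartz_norm (N + 2) u)"
      using weight_le_schwartz_norm[OF u, of "N + 2" "N + 2" 0 s] B by (intro mult_left_mono) (auto simp: eval_nat_numeral)
    finally show ?thesis .
  qed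
  have m: "(\<lambda>s. \<kappa> s * u s) \<in> borel_measurable borel" using um \<kappa>(1) by simp
  show "integrable lborel (\<lambda>s. \<kappa> s * u s)" by (rule integrable_decay(1)[OF m le])
  show "cmod (LBINT s. \<kappa> s * u s) \<le> B * (2 ^ (N + 3) * (LBINT s. 1 / (1 + s\<^sup>2))) * schwartz_norm (N + 2) u"
    using integrable_decay(3)[OF m le] by (simp add: mult_ac)
qed

lemma schwartz_lim:
  assumes u: "u \<in> schwartz" and \<kappa>: "\<And>s. cmod (\<kappa> s) \<le> B * (1 + \<bar>s\<bar>) ^ N"
  shows "((\<lambda>s. \<kappa> s * u s) \<longlongrightarrow> 0) at_top" "((\<lambda>s. \<kappa> s * u s) \<longlongrightarrow> 0) at_bot"
proof -
  have B: "0 \<le> B" using order_trans[OF norm_ge_zero \<kappa>[of 0]] by simp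
  define C where "C = B * (2 ^ (N + 2) * schwartz_norm (N + 1) u)"
  have "(1 + \<bar>s\<bar>) * cmod (\<kappa> s * u s) \<le> C" for s
  proof -
    have "(1 + \<bar>s\<bar>) * cmod (\<kappa> s * u s) \<le> (1 + \<bar>s\<bar>) * (B * (1 + \<bar>s\<bar>) ^ N * cmod (u s))"
      unfolding norm_mult by (intro mult_mono \<kappa>) (auto simp: B)
    also have "\<dots> = B * ((1 + \<bar>s\<bar>) ^ (N + 1) * cmod (iter_deriv 0 u s))" by (simp add: algebra_simps)
    also have "\<dots> \<le> C"
      using weight_le_schwartz_norm[OF u, of "N + 1" "N + 1" 0 s] B unfolding C_def by (intro mult_left_mono) (auto simp: eval_nat_numeral)
    finally show ?thesis .
  qed
  then have le: "cmod (\<kappa> s * u s) \<le> C / (1 + \<bar>s\<bar>)" for s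
    by (simp add: field_simps)
  have 1: "((\<lambda>s. C / (1 + \<bar>s\<bar>)) \<longlongrightarrow> 0) at_top" "((\<lambda>s. C / (1 + \<bar>s\<bar>)) \<longlongrightarrow> 0) at_bot"
    by (rule real_tendsto_divide_at_top[OF tendsto_const], rule filterlim_tendsto_add_at_top[OF tendsto_const],
        rule filterlim_abs_real filterlim_compose[OF filterlim_abs_real filterlim_uminus_at_top_at_bot, simplified])+
  show "((\<lambda>s. \<kappa> s * u s) \<longlongrightarrow> 0) at_top" "((\<lambda>s. \<kappa> s * u s) \<longlongrightarrow> 0) at_bot"
    using 1 le by (auto intro!: Lim_null_comparison[where g = "\<lambda>s. C / (1 + \<bar>s\<bar>)"])
qed

lemma exp_vector_derivative:
  "((\<lambda>\<theta>. exp (- \<i> * of_real (t * \<theta>))) has_vector_derivative (- \<i> * of_real t) * exp (- \<i> * of_real (t * s))) (at s)"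
proof -
  have "((\<lambda>z. exp (- \<i> * of_real t * z)) has_field_derivative (- \<i> * of_real t) * exp (- \<i> * of_real (t * s))) (at (of_real s))"
    by (auto intro!: derivative_eq_intros simp: mult.assoc)
  from has_vector_derivative_real_field[OF this]
  show ?thesis by (simp add: mult.assoc)
qed

lemma fourier_integrable:
  assumes "u \<in> schwartz" shows "integrable lborel (\<lambda>t. exp (- \<i> * of_real (t * s)) * u t)"
  by (rule schwartz_kernel_bound(1)[OF assms, of _ 1 0]) (auto intro!: borel_measurable_continuous_onI continuous_intros)

lemma fourier_bound:
  assumes "u \<in> schwartz"
  shows "cmod (fourier u s) \<le> (8 * (LBINT s. 1 / (1 + s\<^sup>2))) * schwartz_norm 2 u"
  unfolding fourier_def
  using schwartz_kernel_bound(2)[OF assms, of "\<lambda>t. exp (- \<i> * of_real (t * s))" 1 0]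
  by (auto intro!: borel_measurable_continuous_onI continuous_intros simp: eval_nat_numeral)

lemma fourier_derivative:
  assumes u: "u \<in> schwartz"
  shows "(fourier u has_vector_derivative fourier (\<lambda>t. - \<i> * of_real t * u t) s) (at s)"
proof -
  let ?v = "\<lambda>t. - \<i> * of_real t * u t"
  have v: "?v \<in> schwartz" by (rule schwartz_mult_id(1)[OF u])
  have vi: "integrable lborel (\<lambda>t. norm (?v t))"
    using fourier_integrable[OF v, of 0] by (intro integrable_norm) simp
  have "((\<lambda>s. LBINT t. exp (- \<i> * of_real (t * s)) * u t) has_vector_derivative
      (LBINT t. exp (- \<i> * of_real (t * s)) * ?v t)) (at s)"
  proof (rule has_vector_derivative_integral(1)[where \<delta> = 1 and f' = "\<lambda>s t. exp (- \<i> * of_real (t * s)) * ?v t", OF _ _ _ vi])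
    show "((\<lambda>s. exp (- \<i> * of_real (t * s)) * u t) has_vector_derivative exp (- \<i> * of_real (t * s)) * ?v t) (at s)" for s t
      using has_vector_derivative_mult_left[OF exp_vector_derivative[of t s], of "u t"] by (simp add: mult_ac)
  qed (use fourier_integrable[OF u] in \<open>auto simp: norm_mult\<close>)
  then show ?thesis by (simp add: fourier_def[abs_def])
qed

lemma fourier_iter_deriv_1:
  assumes u: "u \<in> schwartz"
  shows "fourier (iter_deriv 1 u) s = \<i> * of_real s * fourier u s"
proof -
  let ?e = "\<lambda>t. exp (- \<i> * of_real (s * t))"
  have e: "cmod (?e t) \<le> 1 * (1 + \<bar>t\<bar>) ^ 0" for t by simp
  have i: "integrable lborel (\<lambda>t. ?e t * w t)" if "w \<in> schwartz" for w
    using fourier_integrable[OF that, of s] by (simp add: mult.commute[of s])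
  have "(LBINT t. ?e t * iter_deriv 1 u t + (- \<i> * of_real s) * (?e t * u t)) = 0"
  proof (rule integral_derivative_zero[where F = "\<lambda>t. ?e t * u t"])
    show "((\<lambda>t. ?e t * u t) has_vector_derivative ?e t * iter_deriv 1 u t + (- \<i> * of_real s) * (?e t * u t)) (at t)" for t
      using has_vector_derivative_mult[OF exp_vector_derivative[of s t] iter_deriv_vector_derivative[OF u, of 0 t]]
      by (simp add: mult_ac)
    show "continuous_on UNIV (\<lambda>t. ?e t * iter_deriv 1 u t + (- \<i> * of_real s) * (?e t * u t))"
      using iter_deriv_continuous[OF u, of 0] iter_deriv_continuous[OF u, of 1] by (auto intro!: continuous_intros)
    show "integrable lborel (\<lambda>t. ?e t * iter_deriv 1 u t + (- \<i> * of_real s) * (?e t * u t))"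
      by (intro Bochner_Integration.integrable_add integrable_mult_right i u schwartz_iter_deriv)
  qed (rule schwartz_lim[OF u e])+
  then have "(LBINT t. ?e t * iter_deriv 1 u t) + (- \<i> * of_real s) * (LBINT t. ?e t * u t) = 0"
    using i[OF u] i[OF schwartz_iter_deriv[OF u, of 1]] by (simp add: Bochner_Integration.integral_add integrable_mult_right)
  then show ?thesis by (simp add: fourier_def mult.commute[of s] algebra_simps)
qed

lemma fourier_iter_deriv: "u \<in> schwartz \<Longrightarrow> fourier (iter_deriv j u) s = (\<i> * of_real s) ^ j * fourier u s"
proof (induction j)
  case (Suc j)
  then show ?case
    using fourier_iter_deriv_1[OF schwartz_iter_deriv[OF Suc.prems, of j]] by (simp add: mult_ac)
qed simp

text \<open>The k-th derivative of the transform is the transform after k multiplications by -i t,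
  and multiplication by s^j corresponds to j derivatives before the transform. Both operations are
  continuous, and \<open>fourier_bound\<close> estimates the result.\<close>

lemma equicont_fourier: "equicont schwartz_space {()} (\<lambda>_. fourier)"
proof -
  let ?M = "\<lambda>u t. - \<i> * complex_of_real t * u t"
  have M: "equicont schwartz_space {()} (\<lambda>_. ?M ^^ k)" for k
  proof (induction k)
    case 0
    show ?case unfolding equicont_def by auto
  next
    case (Suc k)
    from equicont_comp_right[OF Suc.IH equicont_mult_id[of "- \<i>"]]
    show ?case by (simp only: funpow_Suc_right o_def)
  qed
  have MS: "(?M ^^ k) u \<in> schwartz" if "u \<in> schwartz" for k u
    using M[of k] that by (auto simp: equicont_def)
  have b: "\<exists>n C. \<forall>u\<in>schwartz. \<forall>s. \<bar>s\<bar> ^ j * cmod (fourier ((?M ^^ k) u) s) \<le> C * schwartz_norm n u" for j k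
  proof -
    have "equicont schwartz_space {()} (\<lambda>_ u. iter_deriv j ((?M ^^ k) u))"
      by (rule equicont_comp_right[OF equicont_iter_deriv M])
    then obtain r where r: "cont_seminorm schwartz_space r" "\<forall>u\<in>schwartz. schwartz_norm 2 (iter_deriv j ((?M ^^ k) u)) \<le> r u"
      using schwartz_norm_cont_seminorm[of 2] unfolding equicont_def by auto
    obtain n C where n: "\<forall>u\<in>schwartz. r u \<le> C * schwartz_norm n u" using schwartz_seminorm_bound[OF r(1)] by blast
    let ?K = "8 * (LBINT s. 1 / (1 + s\<^sup>2)) :: real"
    have K: "0 \<le> ?K" by (auto intro!: integral_nonneg simp: add_nonneg_nonneg)
    have "\<bar>s\<bar> ^ j * cmod (fourier ((?M ^^ k) u) s) \<le> (?K * C) * schwartz_norm n u" if u: "u \<in> schwartz" for u s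
    proof -
      have "\<bar>s\<bar> ^ j * cmod (fourier ((?M ^^ k) u) s) = cmod (fourier (iter_deriv j ((?M ^^ k) u)) s)"
        by (simp only: fourier_iter_deriv[OF MS[OF u]] norm_mult norm_power norm_ii norm_of_real mult_1_left)
      also have "\<dots> \<le> ?K * schwartz_norm 2 (iter_deriv j ((?M ^^ k) u))"
        by (rule fourier_bound[OF schwartz_iter_deriv[OF MS[OF u]]])
      also have "\<dots> \<le> ?K * (C * schwartz_norm n u)"
        using r(2) n u order_trans by (intro mult_left_mono K) blast
      finally show ?thesis by (simp add: mult.assoc)
    qed
    then show ?thesis by blast
  qed
  have S: "fourier u \<in> schwartz" "iter_deriv k (fourier u) = fourier ((?M ^^ k) u)" if u: "u \<in> schwartz" for u k
  proof -
    have 1: "(fourier ((?M ^^ k) u) has_vector_derivative fourier ((?M ^^ Suc k) u) s) (at s)" for k s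
      using fourier_derivative[OF MS[OF u, of k], of s] by simp
    have 2: "\<exists>C. \<forall>s. \<bar>s\<bar> ^ j * cmod (fourier ((?M ^^ k) u) s) \<le> C" for j k
      using b[of j k] u by blast
    from schwartzI[of "\<lambda>k. fourier ((?M ^^ k) u)", OF 1 2] show "fourier u \<in> schwartz" "iter_deriv k (fourier u) = fourier ((?M ^^ k) u)"
      by simp_all
  qed
  show ?thesis
    unfolding equicont_schwartz_iff using S b by simp
qed

lemma lin_on_fourier: "lin_on schwartz fourier"
  unfolding lin_on_def
proof (intro allI ballI ext)
  fix c d u v s assume "u \<in> schwartz" "v \<in> schwartz"
  from fourier_integrable[OF this(1), of s] fourier_integrable[OF this(2), of s]
  have "(LBINT t. c * (exp (- \<i> * of_real (t * s)) * u t) + d * (exp (- \<i> * of_real (t * s)) * v t)) =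
    c * (LBINT t. exp (- \<i> * of_real (t * s)) * u t) + d * (LBINT t. exp (- \<i> * of_real (t * s)) * v t)"
    by (simp add: Bochner_Integration.integral_add integrable_mult_right)
  then show "fourier (\<lambda>s. c * u s + d * v s) s = c * fourier u s + d * fourier v s"
    by (simp add: fourier_def algebra_simps)
qed

lemma iter_deriv_dilate:
  assumes u: "u \<in> schwartz" and r: "0 < r"
  shows "dilate r u \<in> schwartz" "iter_deriv k (dilate r u) = (\<lambda>t. of_real (sqrt r * r ^ k) * iter_deriv k u (r * t))"
proof -
  let ?U = "\<lambda>k t. of_real (sqrt r * r ^ k) * iter_deriv k u (r * t)"
  have D: "(?U k has_vector_derivative ?U (Suc k) t) (at t)" for k t
  proof -
    have "((\<lambda>t. iter_deriv k u (r * t)) has_vector_derivative r *\<^sub>R iter_deriv (Suc k) u (r * t)) (at t)"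
    proof -
      have "((\<lambda>t. r * t) has_vector_derivative r) (at t)"
        using has_vector_derivative_mult_right[OF has_vector_derivative_id, of r "at t"] by simp
      from vector_diff_chain_at[OF this iter_deriv_vector_derivative[OF u]] show ?thesis
        by (simp add: o_def)
    qed
    from has_vector_derivative_mult_right[OF this, of "of_real (sqrt r * r ^ k)"]
    show ?thesis by (simp add: scaleR_conv_of_real mult_ac)
  qed
  have b: "\<exists>C. \<forall>t. \<bar>t\<bar> ^ j * cmod (?U k t) \<le> C" for j k
  proof (intro exI allI)
    fix t
    have "\<bar>t\<bar> ^ j * cmod (?U k t) = (sqrt r * r ^ k / r ^ j) * (\<bar>r * t\<bar> ^ j * cmod (iter_deriv k u (r * t)))"
      using r by (simp add: norm_mult norm_power abs_mult power_mult_distrib)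
    also have "\<dots> \<le> (sqrt r * r ^ k / r ^ j) * schwartz_seminorm j k u"
      using r by (intro mult_left_mono schwartz_seminorm_upper u) auto
    finally show "\<bar>t\<bar> ^ j * cmod (?U k t) \<le> (sqrt r * r ^ k / r ^ j) * schwartz_seminorm j k u" .
  qed
  from schwartzI[of ?U, OF D b]
  show "dilate r u \<in> schwartz" "iter_deriv k (dilate r u) = ?U k"
    by (simp_all add: dilate_def[abs_def])
qed

lemma dilate_dilate: "0 < r \<Longrightarrow> 0 < q \<Longrightarrow> dilate r (dilate q u) = dilate (r * q) u"
  by (auto simp: dilate_def real_sqrt_mult mult_ac)

lemma dilate_inverse: "0 < r \<Longrightarrow> dilate (1 / r) (dilate r u) = u" "0 < r \<Longrightarrow> dilate r (dilate (1 / r) u) = u"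
  by (simp_all add: dilate_dilate) (simp_all add: dilate_def)

lemma schwartz_dilate_iff: "0 < r \<Longrightarrow> dilate r u \<in> schwartz \<longleftrightarrow> u \<in> schwartz"
  using iter_deriv_dilate(1)[of u r] iter_deriv_dilate(1)[of "dilate r u" "1 / r"] dilate_inverse(1)[of r u] by auto

lemma lin_on_dilate: "lin_on V (dilate r)"
  by (auto simp: lin_on_def dilate_def algebra_simps)

text \<open>Uniformity needs parameters in a compact part of the positive half line; this is where
  <xi'> and its inverse range as long as xi' is bounded.\<close>

lemma equicont_dilate:
  assumes "0 < a"
  shows "equicont schwartz_space {a..b} dilate"
  unfolding equicont_schwartz_iff
proof (intro conjI ballI allI)
  fix j k
  have "\<bar>t\<bar> ^ j * cmod (iter_deriv k (dilate r u) t) \<le> (sqrt b * b ^ k / a ^ j) * schwartz_norm (j + k) u" if r: "r \<in> {a..b}" and u: "u \<in> schwartz" for r u t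
  proof -
    have r0: "0 < r" using r assms by auto
    have "\<bar>t\<bar> ^ j * cmod (iter_deriv k (dilate r u) t) = (sqrt r * r ^ k / r ^ j) * (\<bar>r * t\<bar> ^ j * cmod (iter_deriv k u (r * t)))"
      using r0 by (simp add: iter_deriv_dilate[OF u r0] norm_mult norm_power abs_mult power_mult_distrib)
    also have "\<dots> \<le> (sqrt b * b ^ k / a ^ j) * schwartz_norm (j + k) u"
    proof (intro mult_mono frac_le order_trans[OF schwartz_seminorm_upper schwartz_seminorm_le_schwartz_norm] u power_mono)
    qed (use r r0 assms in auto)
    finally show ?thesis .
  qed
  then show "\<exists>n C. \<forall>r\<in>{a..b}. \<forall>u\<in>schwartz. \<forall>t. \<bar>t\<bar> ^ j * cmod (iter_deriv k (dilate r u) t) \<le> C * schwartz_norm n u" by blast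
qed (use assms in \<open>auto intro: iter_deriv_dilate\<close>)

text \<open>Substitution contributes 1 / r, and the normalisation of \<open>dilate\<close> by a
  square root turns sqrt r / r into sqrt (1 / r), so no constant remains.\<close>

lemma fourier_dilate:
  assumes "0 < r"
  shows "fourier (dilate r u) = dilate (1 / r) (fourier u)"
proof
  fix s
  have "fourier u (s / r) = r *\<^sub>R (LBINT t. exp (- \<i> * of_real (t * s)) * u (r * t))"
    unfolding fourier_def using lborel_integral_real_affine[of r "\<lambda>t. exp (- \<i> * of_real (t * (s / r))) * u t" 0] assms
    by simp
  moreover have "fourier (dilate r u) s = of_real (sqrt r) * (LBINT t. exp (- \<i> * of_real (t * s)) * u (r * t))"
    unfolding fourier_def dilate_def
    by (subst integral_mult_right_zero[symmetric]) (simp add: mult_ac)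
  moreover have "sqrt (1 / r) * r = sqrt r"
    using assms by (simp add: real_sqrt_divide real_div_sqrt)
  then have "complex_of_real (sqrt (1 / r)) * of_real r = of_real (sqrt r)"
    by (metis of_real_mult)
  ultimately show "fourier (dilate r u) s = dilate (1 / r) (fourier u) s"
    by (simp add: dilate_def scaleR_conv_of_real mult.assoc[symmetric])
qed

section \<open>Smooth dependence of integral operators on the parameters x' and xi'\<close>

section \<open>Families of integral operators on the Schwartz space\<close>

text \<open>\<open>kk l \<alpha> \<beta>\<close> is the derivative of the kernel of order \<open>l\<close> in \<open>t\<close>, \<open>\<alpha>\<close> in the
  covariable and \<open>\<beta>\<close> in the variable. The exponent \<open>\<tau>\<close> is 1 for the kernel acting on
  Fourier transforms and -1 for its transpose, where the roles of \<open>x\<^sub>n\<close> and \<open>\<xi>\<^sub>n\<close> are exchanged.\<close>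

locale kernel_family =
  fixes kk :: "nat \<Rightarrow> 'n::euclidean_space list \<Rightarrow> 'n list \<Rightarrow> 'n \<times> 'n \<Rightarrow> real \<Rightarrow> real \<Rightarrow> complex"
    and \<tau> m :: real
  assumes cont: "set \<alpha> \<subseteq> Basis \<Longrightarrow> set \<beta> \<subseteq> Basis \<Longrightarrow> continuous_on UNIV (kk l \<alpha> \<beta> z t)"
    and dt: "set \<alpha> \<subseteq> Basis \<Longrightarrow> set \<beta> \<subseteq> Basis \<Longrightarrow>
      ((\<lambda>t. kk l \<alpha> \<beta> z t s) has_vector_derivative kk (Suc l) \<alpha> \<beta> z t s) (at t)"
    and dz: "set \<alpha> \<subseteq> Basis \<Longrightarrow> set \<beta> \<subseteq> Basis \<Longrightarrow>
      ((\<lambda>z. kk l \<alpha> \<beta> z t s) has_derivative (\<lambda>v. (\<Sum>b\<in>Basis. (fst v \<bullet> b) *\<^sub>R kk l \<alpha> (b # \<beta>) z t s)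
         + (\<Sum>b\<in>Basis. (snd v \<bullet> b) *\<^sub>R kk l (b # \<alpha>) \<beta> z t s))) (at z)"
    and bd: "set \<alpha> \<subseteq> Basis \<Longrightarrow> set \<beta> \<subseteq> Basis \<Longrightarrow>
      \<exists>B N. \<forall>z\<in>cball 0 r. \<forall>t\<in>{-r..r}. \<forall>s. cmod (kk l \<alpha> \<beta> z t s) \<le> B * (1 + \<bar>s\<bar>) ^ N"
    and est: "set \<alpha> \<subseteq> Basis \<Longrightarrow> set \<beta> \<subseteq> Basis \<Longrightarrow> compact K \<Longrightarrow>
      \<exists>n c. \<forall>x\<in>K. \<forall>\<xi>. \<forall>g\<in>schwartz. \<forall>t. \<bar>t\<bar> ^ j * cmod (LBINT s. kk l \<alpha> \<beta> (x, \<xi>)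
         (japanese \<xi> powr - \<tau> * t) (s / japanese \<xi> powr - \<tau>) * g s)
         \<le> c * japanese \<xi> powr (m - length \<alpha> + \<tau> * l) * schwartz_norm n g"
begin

definition I :: "nat \<Rightarrow> 'n list \<Rightarrow> 'n list \<Rightarrow> 'n \<times> 'n \<Rightarrow> (real \<Rightarrow> complex) \<Rightarrow> real \<Rightarrow> complex" where
  "I l \<alpha> \<beta> z g t = (LBINT s. kk l \<alpha> \<beta> z t s * g s)"

text \<open>The factor by which both sides are dilated. For \<open>\<tau> = 1\<close> the kernel
  acts on Fourier transforms, where the dilation of functions by <xi'> becomes the one by its
  inverse.\<close>

definition \<rho> :: "'n \<Rightarrow> real" where "\<rho> \<xi> = japanese \<xi> powr - \<tau>"

lemma \<rho>_pos: "0 < \<rho> \<xi>"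
  by (simp add: \<rho>_def japanese_pos less_imp_neq[symmetric])

context
  fixes \<alpha> \<beta> :: "'n list" assumes ab: "set \<alpha> \<subseteq> Basis" "set \<beta> \<subseteq> Basis"
begin

lemma kk_integrable:
  assumes "g \<in> schwartz"
  shows "integrable lborel (\<lambda>s. kk l \<alpha> \<beta> z t s * g s)"
proof -
  define r where "r = norm z + \<bar>t\<bar>"
  obtain B N where B: "\<forall>z\<in>cball 0 r. \<forall>t\<in>{-r..r}. \<forall>s. cmod (kk l \<alpha> \<beta> z t s) \<le> B * (1 + \<bar>s\<bar>) ^ N"
    using bd[OF ab, where r = r and l = l] by blast
  have "z \<in> cball 0 r" "t \<in> {-r..r}"
    using norm_ge_zero[of z] unfolding r_def by (simp, unfold atLeastAtMost_iff, linarith)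
  then have "cmod (kk l \<alpha> \<beta> z t s) \<le> B * (1 + \<bar>s\<bar>) ^ N" for s
    using B by blast
  then show ?thesis
    by (rule schwartz_kernel_bound(1)[OF assms borel_measurable_continuous_onI[OF cont[OF ab]]])
qed

lemma lin_on_I: "lin_on schwartz (I l \<alpha> \<beta> z)"
  unfolding lin_on_def
proof (intro allI ballI ext)
  fix c d u v t assume uv: "u \<in> schwartz" "v \<in> schwartz"
  have "(LBINT s. c * (kk l \<alpha> \<beta> z t s * u s) + d * (kk l \<alpha> \<beta> z t s * v s)) =
    c * (LBINT s. kk l \<alpha> \<beta> z t s * u s) + d * (LBINT s. kk l \<alpha> \<beta> z t s * v s)"
    using kk_integrable[OF uv(1), of l z t] kk_integrable[OF uv(2), of l z t]
    by (simp add: Bochner_Integration.integral_add integrable_mult_right)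
  then show "I l \<alpha> \<beta> z (\<lambda>s. c * u s + d * v s) t = c * I l \<alpha> \<beta> z u t + d * I l \<alpha> \<beta> z v t"
    by (simp add: I_def algebra_simps)
qed

lemma I_derivative:
  assumes g: "g \<in> schwartz"
  shows "(I l \<alpha> \<beta> z g has_vector_derivative I (Suc l) \<alpha> \<beta> z g t) (at t)"
proof -
  define r where "r = norm z + \<bar>t\<bar> + 1"
  obtain B N where B: "\<forall>z\<in>cball 0 r. \<forall>t\<in>{-r..r}. \<forall>s. cmod (kk (Suc l) \<alpha> \<beta> z t s) \<le> B * (1 + \<bar>s\<bar>) ^ N"
    using bd[OF ab, where r = r and l = "Suc l"] by blast
  have B0: "cmod (kk (Suc l) \<alpha> \<beta> z t' s) \<le> B * (1 + \<bar>s\<bar>) ^ N" if "\<bar>t' - t\<bar> < 1" for t' s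
  proof -
    have "z \<in> cball 0 r" "t' \<in> {-r..r}"
      using that norm_ge_zero[of z] unfolding r_def by (simp, unfold atLeastAtMost_iff, linarith)
    then show ?thesis using B by blast
  qed
  have "0 \<le> B" using order_trans[OF norm_ge_zero B0[of t 0]] by simp
  have "integrable lborel (\<lambda>s. of_real (B * (1 + \<bar>s\<bar>) ^ N) * g s)"
    using g \<open>0 \<le> B\<close> by (intro schwartz_kernel_bound(1)[where B = B and N = N])
      (auto simp: norm_mult norm_power simp del: of_real_add of_real_mult of_real_power of_real_1 intro!: borel_measurable_continuous_onI continuous_intros)
  then have i: "integrable lborel (\<lambda>s. norm (of_real (B * (1 + \<bar>s\<bar>) ^ N) * g s))" by (rule integrable_norm)
  have "((\<lambda>t. LBINT s. kk l \<alpha> \<beta> z t s * g s) has_vector_derivative (LBINT s. kk (Suc l) \<alpha> \<beta> z t s * g s)) (at t)"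
  proof (rule has_vector_derivative_integral(1)[where \<delta> = 1 and f' = "\<lambda>t s. kk (Suc l) \<alpha> \<beta> z t s * g s", OF _ _ _ i])
    show "norm (kk (Suc l) \<alpha> \<beta> z t' s * g s) \<le> norm (of_real (B * (1 + \<bar>s\<bar>) ^ N) * g s)" if "\<bar>t' - t\<bar> < 1" for t' s
      using B0[OF that, of s] \<open>0 \<le> B\<close>
      by (simp add: norm_mult norm_power abs_mult mult_right_mono del: of_real_add of_real_mult of_real_power of_real_1)
  qed (auto intro!: has_vector_derivative_mult_left dt[OF ab] kk_integrable g)
  then show ?thesis by (simp add: I_def[abs_def])
qed

lemma line_kk:
  "((\<lambda>\<theta>. kk l \<alpha> \<beta> (z + \<theta> *\<^sub>R v) t s) has_vector_derivative
     (\<Sum>b\<in>Basis. (fst v \<bullet> b) *\<^sub>R kk l \<alpha> (b # \<beta>) (z + \<theta> *\<^sub>R v) t s)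
         + (\<Sum>b\<in>Basis. (snd v \<bullet> b) *\<^sub>R kk l (b # \<alpha>) \<beta> (z + \<theta> *\<^sub>R v) t s)) (at \<theta>)"
proof -
  have 2: "((\<lambda>s. z + s *\<^sub>R v) has_derivative (\<lambda>h. h *\<^sub>R v)) (at \<theta>)"
    by (auto intro!: derivative_eq_intros)
  from has_derivative_compose[OF 2 dz[OF ab]] show ?thesis
    by (simp add: has_vector_derivative_def scaleR_add_right scaleR_sum_right)
qed

lemma line_I:
  assumes g: "g \<in> schwartz"
  shows "((\<lambda>\<theta>. I l \<alpha> \<beta> (z + \<theta> *\<^sub>R v) g t) has_vector_derivative
     (\<Sum>b\<in>Basis. (fst v \<bullet> b) *\<^sub>R I l \<alpha> (b # \<beta>) (z + \<theta> *\<^sub>R v) g t)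
         + (\<Sum>b\<in>Basis. (snd v \<bullet> b) *\<^sub>R I l (b # \<alpha>) \<beta> (z + \<theta> *\<^sub>R v) g t)) (at \<theta>)"
proof -
  \<comment> \<open>Covers all \<open>z + \<theta>' *\<^sub>R v\<close> with
    \<open>\<theta>'\<close> within distance 1 of \<open>\<theta>\<close>, so that \<open>bd\<close>
    supplies one dominating function for the whole interval.\<close>
  define r where "r = norm z + (\<bar>\<theta>\<bar> + 1) * norm v + \<bar>t\<bar>"
  have ab': "set (b # \<alpha>) \<subseteq> Basis" "set (b # \<beta>) \<subseteq> Basis" if "b \<in> Basis" for b using ab that by auto
  have "\<exists>B N. \<forall>z\<in>cball 0 r. \<forall>t\<in>{-r..r}. \<forall>s. cmod (kk l \<alpha> (b # \<beta>) z t s) \<le> B * (1 + \<bar>s\<bar>) ^ N" if "b \<in> Basis" for b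
    using bd[OF ab(1) ab'(2)[OF that]] by blast
  then obtain B1 N1 where B1: "\<And>b z t s. b \<in> Basis \<Longrightarrow> z \<in> cball 0 r \<Longrightarrow> t \<in> {-r..r} \<Longrightarrow> cmod (kk l \<alpha> (b # \<beta>) z t s) \<le> B1 b * (1 + \<bar>s\<bar>) ^ N1 b"
    by metis
  have "\<exists>B N. \<forall>z\<in>cball 0 r. \<forall>t\<in>{-r..r}. \<forall>s. cmod (kk l (b # \<alpha>) \<beta> z t s) \<le> B * (1 + \<bar>s\<bar>) ^ N" if "b \<in> Basis" for b
    using bd[OF ab'(1)[OF that] ab(2)] by blast
  then obtain B2 N2 where B2: "\<And>b z t s. b \<in> Basis \<Longrightarrow> z \<in> cball 0 r \<Longrightarrow> t \<in> {-r..r} \<Longrightarrow> cmod (kk l (b # \<alpha>) \<beta> z t s) \<le> B2 b * (1 + \<bar>s\<bar>) ^ N2 b"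
    by metis
  let ?k' = "\<lambda>\<theta> s. (\<Sum>b\<in>Basis. (fst v \<bullet> b) *\<^sub>R kk l \<alpha> (b # \<beta>) (z + \<theta> *\<^sub>R v) t s)
         + (\<Sum>b\<in>Basis. (snd v \<bullet> b) *\<^sub>R kk l (b # \<alpha>) \<beta> (z + \<theta> *\<^sub>R v) t s)"
  let ?G = "\<lambda>s. (\<Sum>b\<in>Basis. \<bar>fst v \<bullet> b\<bar> * (B1 b * (1 + \<bar>s\<bar>) ^ N1 b)) + (\<Sum>b\<in>Basis. \<bar>snd v \<bullet> b\<bar> * (B2 b * (1 + \<bar>s\<bar>) ^ N2 b))"
  have zr: "z + \<theta>' *\<^sub>R v \<in> cball 0 r" "t \<in> {-r..r}" if "\<bar>\<theta>' - \<theta>\<bar> < 1" for \<theta>'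
  proof -
    have "norm (z + \<theta>' *\<^sub>R v) \<le> norm z + \<bar>\<theta>'\<bar> * norm v"
      using norm_triangle_ineq[of z "\<theta>' *\<^sub>R v"] by simp
    also have "\<dots> \<le> norm z + (\<bar>\<theta>\<bar> + 1) * norm v"
      using that by (intro add_left_mono mult_right_mono) auto
    finally show "z + \<theta>' *\<^sub>R v \<in> cball 0 r" by (simp add: r_def)
    have "0 \<le> (\<bar>\<theta>\<bar> + 1) * norm v" by simp
    then show "t \<in> {-r..r}" using norm_ge_zero[of z] unfolding r_def atLeastAtMost_iff by linarith
  qed
  have le: "norm (?k' \<theta>' s) \<le> ?G s" if "\<bar>\<theta>' - \<theta>\<bar> < 1" for \<theta>' s
    by (intro norm_triangle_le add_mono sum_norm_le) (auto intro!: mult_left_mono B1 B2 zr[OF that])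
  have iG: "integrable lborel (\<lambda>s. ?G s * norm (g s))"
  proof -
    have "integrable lborel (\<lambda>s. c * (B * (1 + \<bar>s\<bar>) ^ N) * norm (g s))" for c B :: real and N
    proof -
      have "integrable lborel (\<lambda>s. of_real ((1 + \<bar>s\<bar>) ^ N) * g s)"
        using g by (intro schwartz_kernel_bound(1)[where B = 1 and N = N])
          (auto simp del: of_real_add of_real_power of_real_1 intro!: borel_measurable_continuous_onI continuous_intros)
      from integrable_mult_right[OF integrable_norm[OF this], of "c * B"]
      show ?thesis by (simp add: norm_mult norm_power mult_ac del: of_real_add of_real_power of_real_1)
    qed
    then show ?thesis unfolding distrib_right sum_distrib_right
      by (intro Bochner_Integration.integrable_add Bochner_Integration.integrable_sum)
  qed
  have "((\<lambda>\<theta>. LBINT s. kk l \<alpha> \<beta> (z + \<theta> *\<^sub>R v) t s * g s) has_vector_derivative (LBINT s. ?k' \<theta> s * g s)) (at \<theta>)"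
  proof (rule has_vector_derivative_integral(1)[where \<delta> = 1 and f' = "\<lambda>\<theta> s. ?k' \<theta> s * g s", OF _ _ _ iG])
    show "norm (?k' \<theta>' s * g s) \<le> ?G s * norm (g s)" if "\<bar>\<theta>' - \<theta>\<bar> < 1" for \<theta>' s
      unfolding norm_mult using le[OF that] by (rule mult_right_mono) simp
  qed (auto intro!: has_vector_derivative_mult_left line_kk kk_integrable g)
  moreover have "(LBINT s. ?k' \<theta> s * g s) = (\<Sum>b\<in>Basis. (fst v \<bullet> b) *\<^sub>R I l \<alpha> (b # \<beta>) (z + \<theta> *\<^sub>R v) g t)
         + (\<Sum>b\<in>Basis. (snd v \<bullet> b) *\<^sub>R I l (b # \<alpha>) \<beta> (z + \<theta> *\<^sub>R v) g t)"
  proof -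
    have B: "b \<in> Basis \<Longrightarrow> integrable lborel (\<lambda>s. (fst v \<bullet> b) *\<^sub>R (kk l \<alpha> (b # \<beta>) (z + \<theta> *\<^sub>R v) t s * g s))"
      "b \<in> Basis \<Longrightarrow> integrable lborel (\<lambda>s. (snd v \<bullet> b) *\<^sub>R (kk l (b # \<alpha>) \<beta> (z + \<theta> *\<^sub>R v) t s * g s))" for b
      using kernel_family.kk_integrable[OF kernel_family_axioms ab(1) ab'(2) g]
        kernel_family.kk_integrable[OF kernel_family_axioms ab'(1) ab(2) g] by (auto intro!: integrable_scaleR_right)
    have "(\<lambda>s. ?k' \<theta> s * g s) = (\<lambda>s. (\<Sum>b\<in>Basis. (fst v \<bullet> b) *\<^sub>R (kk l \<alpha> (b # \<beta>) (z + \<theta> *\<^sub>R v) t s * g s))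
         + (\<Sum>b\<in>Basis. (snd v \<bullet> b) *\<^sub>R (kk l (b # \<alpha>) \<beta> (z + \<theta> *\<^sub>R v) t s * g s)))"
      by (simp add: distrib_right sum_distrib_right)
    then show ?thesis
      using B by (simp only: I_def) (subst Bochner_Integration.integral_add Bochner_Integration.integral_sum;
        simp add: Bochner_Integration.integral_add Bochner_Integration.integral_sum Bochner_Integration.integrable_sum)
  qed
  ultimately show ?thesis by (simp add: I_def)
qed

text \<open>Equal factors on both sides do not cancel: one rescales the outer variable, the other
  rescales the integration variable in the opposite sense. The resulting arguments are the ones for
  which \<open>est\<close> is stated.\<close>

lemma I_dilated:
  assumes g: "g \<in> schwartz" and r: "0 < r"
  shows "dilate r (I l \<alpha> \<beta> z (dilate r g)) t = (LBINT s. kk l \<alpha> \<beta> z (r * t) (s / r) * g s)"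
proof -
  have "(LBINT s. kk l \<alpha> \<beta> z (r * t) (s / r) * g s) = r *\<^sub>R (LBINT s. kk l \<alpha> \<beta> z (r * t) s * g (r * s))"
    using lborel_integral_real_affine[of r "\<lambda>s. kk l \<alpha> \<beta> z (r * t) (s / r) * g s" 0] r by simp
  moreover have "I l \<alpha> \<beta> z (dilate r g) (r * t) = of_real (sqrt r) * (LBINT s. kk l \<alpha> \<beta> z (r * t) s * g (r * s))"
    unfolding I_def dilate_def by (subst integral_mult_right_zero[symmetric]) (simp add: mult_ac)
  moreover have "complex_of_real (sqrt r) * of_real (sqrt r) = of_real r"
    using r by (metis abs_of_pos of_real_mult real_sqrt_mult_self)
  ultimately show ?thesis by (simp add: dilate_def scaleR_conv_of_real mult.assoc[symmetric])
qed

text \<open>On a bounded set of parameters the dilations in \<open>est\<close> can be undone, as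
  their factors stay in \<open>{1 / A..A}\<close>, where dilations are equicontinuous.\<close>

lemma I_bound:
  "\<exists>n c. 0 \<le> c \<and> (\<forall>z\<in>cball 0 r. \<forall>g\<in>schwartz. \<forall>t. \<bar>t\<bar> ^ j * cmod (I l \<alpha> \<beta> z g t) \<le> c * schwartz_norm n g)"
proof -
  define R where "R = max 1 (sqrt (1 + r\<^sup>2))"
  obtain n c where c: "\<forall>x\<in>cball 0 r. \<forall>\<xi>. \<forall>g\<in>schwartz. \<forall>t. \<bar>t\<bar> ^ j * cmod (LBINT s. kk l \<alpha> \<beta> (x, \<xi>)
         (\<rho> \<xi> * t) (s / \<rho> \<xi>) * g s) \<le> c * japanese \<xi> powr (m - length \<alpha> + \<tau> * l) * schwartz_norm n g"
    using est[OF ab compact_cball[of 0 r], of j l] unfolding \<rho>_def by blast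
  define A where "A = R powr \<bar>\<tau>\<bar>"
  have R: "1 \<le> R" by (simp add: R_def)
  have A: "1 \<le> A" using R by (simp add: A_def ge_one_powr_ge_zero)
  have jR: "japanese \<xi> \<le> R" if "norm \<xi> \<le> r" for \<xi> :: 'n
    using that by (simp add: japanese_def R_def le_max_iff_disj power_mono)
  have \<rho>A: "\<rho> \<xi> \<le> A" "1 / \<rho> \<xi> \<in> {1 / A..A}" if "norm \<xi> \<le> r" for \<xi>
  proof -
    have *: "japanese \<xi> powr p \<le> A" if "\<bar>p\<bar> \<le> \<bar>\<tau>\<bar>" for p
    proof -
      have "japanese \<xi> powr p \<le> japanese \<xi> powr \<bar>\<tau>\<bar>" using japanese_ge_1[of \<xi>] that by (intro powr_mono) auto
      also have "\<dots> \<le> A" unfolding A_def using jR[OF \<open>norm \<xi> \<le> r\<close>] japanese_ge_1[of \<xi>] by (intro powr_mono2) auto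
      finally show ?thesis .
    qed
    show 1: "\<rho> \<xi> \<le> A" unfolding \<rho>_def by (rule *) simp
    have "1 / \<rho> \<xi> = japanese \<xi> powr \<tau>" unfolding \<rho>_def by (simp add: powr_minus_divide)
    moreover have "japanese \<xi> powr \<tau> \<le> A" by (rule *) simp
    moreover have "1 / A \<le> 1 / \<rho> \<xi>" using 1 \<rho>_pos[of \<xi>] by (intro frac_le) auto
    ultimately show "1 / \<rho> \<xi> \<in> {1 / A..A}" by simp
  qed
  have "cont_seminorm schwartz_space (schwartz_norm n)" by (rule schwartz_norm_cont_seminorm)
  moreover have "equicont schwartz_space {1 / A..A} dilate" using A by (intro equicont_dilate) simp
  ultimately obtain q where q: "cont_seminorm schwartz_space q" "\<forall>i\<in>{1 / A..A}. \<forall>u\<in>schwartz. schwartz_norm n (dilate i u) \<le> q u"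
    unfolding equicont_def by auto
  obtain n' c' where n': "0 \<le> c'" "\<forall>u\<in>schwartz. q u \<le> c' * schwartz_norm n' u" using schwartz_seminorm_bound[OF q(1)] by blast
  define p where "p = m - length \<alpha> + \<tau> * l"
  define D where "D = A ^ j * (sqrt A * (\<bar>c\<bar> * R powr \<bar>p\<bar> * c')) "
  have "\<bar>t\<bar> ^ j * cmod (I l \<alpha> \<beta> z g t) \<le> D * schwartz_norm n' g" if z: "z \<in> cball 0 r" and g: "g \<in> schwartz" for z g t
  proof -
    obtain x \<xi> where zx: "z = (x, \<xi>)" by fastforce
    have x: "x \<in> cball 0 r" and \<xi>: "norm \<xi> \<le> r"
      using z norm_fst_le[of x \<xi>] norm_snd_le[of \<xi> x] by (auto simp: zx)
    let ?r = "\<rho> \<xi>" and ?t = "t / \<rho> \<xi>"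
    let ?g = "dilate (1 / ?r) g"
    have r0: "?r > 0" by (rule \<rho>_pos)
    have gS: "?g \<in> schwartz" using r0 g by (intro iter_deriv_dilate) auto
    have *: "dilate ?r (I l \<alpha> \<beta> z g) ?t = (LBINT s. kk l \<alpha> \<beta> (x, \<xi>) (?r * ?t) (s / ?r) * ?g s)"
      using I_dilated[OF gS r0, of l z ?t] dilate_inverse(2)[OF r0, of g] by (simp add: zx)
    have "sqrt ?r * cmod (I l \<alpha> \<beta> z g t) = cmod (dilate ?r (I l \<alpha> \<beta> z g) ?t)"
      using r0 by (simp add: dilate_def norm_mult)
    then have **: "sqrt ?r * cmod (I l \<alpha> \<beta> z g t) = cmod (LBINT s. kk l \<alpha> \<beta> (x, \<xi>) (?r * ?t) (s / ?r) * ?g s)"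
      by (simp only: *)
    have 1: "\<bar>?t\<bar> ^ j * (sqrt ?r * cmod (I l \<alpha> \<beta> z g t)) \<le> c * japanese \<xi> powr p * schwartz_norm n ?g"
      unfolding p_def ** by (rule c[rule_format, OF x gS])
    also have "\<dots> \<le> (\<bar>c\<bar> * R powr \<bar>p\<bar>) * (c' * schwartz_norm n' g)"
    proof (intro mult_mono)
      show "japanese \<xi> powr p \<le> R powr \<bar>p\<bar>"
      proof -
        have "japanese \<xi> powr p \<le> japanese \<xi> powr \<bar>p\<bar>" using japanese_ge_1[of \<xi>] by (intro powr_mono) auto
        also have "\<dots> \<le> R powr \<bar>p\<bar>" using jR[OF \<xi>] japanese_ge_1[of \<xi>] by (intro powr_mono2) auto
        finally show ?thesis .
      qed
      have "schwartz_norm n ?g \<le> q g" using q(2) \<rho>A(2)[OF \<xi>] g by blast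
      also have "\<dots> \<le> c' * schwartz_norm n' g" using n'(2) g by blast
      finally show "schwartz_norm n ?g \<le> c' * schwartz_norm n' g" .
    qed (use schwartz_norm_nonneg[OF gS] in auto)
    finally have 2: "\<bar>?t\<bar> ^ j * (sqrt ?r * cmod (I l \<alpha> \<beta> z g t)) \<le> (\<bar>c\<bar> * R powr \<bar>p\<bar>) * (c' * schwartz_norm n' g)" .
    have "\<bar>t\<bar> ^ j * cmod (I l \<alpha> \<beta> z g t) = ?r ^ j * (sqrt (1 / ?r) * (\<bar>?t\<bar> ^ j * (sqrt ?r * cmod (I l \<alpha> \<beta> z g t))))"
    proof -
      have "?r ^ j * \<bar>?t\<bar> ^ j = \<bar>t\<bar> ^ j" using r0 by (simp add: power_mult_distrib[symmetric])
      moreover have "sqrt (1 / ?r) * sqrt ?r = 1" using r0 by (simp add: real_sqrt_divide)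
      ultimately show ?thesis by (metis (no_types, lifting) mult.left_commute mult.assoc mult_1)
    qed
    also have "\<dots> \<le> A ^ j * (sqrt A * ((\<bar>c\<bar> * R powr \<bar>p\<bar>) * (c' * schwartz_norm n' g)))"
      using 2 r0 \<rho>A[OF \<xi>] A n' schwartz_norm_nonneg[OF g, of n']
      by (intro mult_mono power_mono real_sqrt_le_mono 2) auto
    finally show ?thesis by (simp add: D_def mult_ac)
  qed
  moreover have "0 \<le> D" using A n' by (simp add: D_def)
  ultimately show ?thesis by blast
qed

lemma I_schwartz:
  assumes g: "g \<in> schwartz"
  shows "I 0 \<alpha> \<beta> z g \<in> schwartz" "iter_deriv l (I 0 \<alpha> \<beta> z g) = I l \<alpha> \<beta> z g"
proof -
  have "\<exists>C. \<forall>t. \<bar>t\<bar> ^ j * cmod (I k \<alpha> \<beta> z g t) \<le> C" for j k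
    using I_bound[of "norm z" j k] g by (metis dist_0_norm mem_cball order_refl)
  from schwartzI[of "\<lambda>l. I l \<alpha> \<beta> z g", OF I_derivative[OF g] this]
  show "I 0 \<alpha> \<beta> z g \<in> schwartz" "iter_deriv l (I 0 \<alpha> \<beta> z g) = I l \<alpha> \<beta> z g" by auto
qed

end

end

context kernel_family
begin

context
  fixes \<alpha> \<beta> :: "'n list" assumes ab: "set \<alpha> \<subseteq> Basis" "set \<beta> \<subseteq> Basis"
begin

text \<open>Every derivative of a dilated function produces a factor \<open>\<rho> \<xi>\<close>;
  \<open>k\<close> of them cancel the summand \<open>\<tau> * k\<close> in the exponent of
  \<open>est\<close>. This is why that exponent grows with the number of derivatives.\<close>

lemma equicont_dilated:
  assumes "compact K"
  shows "equicont schwartz_space (K \<times> UNIV)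
     (\<lambda>(x, \<xi>) u s. dilate (\<rho> \<xi>) (I 0 \<alpha> \<beta> (x, \<xi>) (dilate (\<rho> \<xi>) u)) s / of_real (japanese \<xi> powr (m - length \<alpha>)))"
  unfolding equicont_schwartz_iff
proof (intro conjI allI ballI)
  have lin: "(\<lambda>s. u s / d) \<in> schwartz" "iter_deriv k (\<lambda>s. u s / d) = (\<lambda>s. iter_deriv k u s / d)" if "u \<in> schwartz" for u d k
  proof -
    have eq: "(\<lambda>s. u s / d) = (\<lambda>s. (1 / d) * u s + 0 * u s)" by simp
    show "(\<lambda>s. u s / d) \<in> schwartz" unfolding eq by (rule schwartz_lin(1)[OF that that])
    show "iter_deriv k (\<lambda>s. u s / d) = (\<lambda>s. iter_deriv k u s / d)" unfolding eq schwartz_lin(2)[OF that that] by simp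
  qed
  have S: "dilate (\<rho> \<xi>) (I 0 \<alpha> \<beta> (x, \<xi>) (dilate (\<rho> \<xi>) u)) \<in> schwartz" if "u \<in> schwartz" for x \<xi> u
    using that by (simp add: schwartz_dilate_iff \<rho>_pos I_schwartz[OF ab])
  {
    fix i :: "'n \<times> 'n" and u assume "i \<in> K \<times> UNIV" "u \<in> schwartz"
    then show "(case i of (x, \<xi>) \<Rightarrow> \<lambda>u s. dilate (\<rho> \<xi>) (I 0 \<alpha> \<beta> (x, \<xi>) (dilate (\<rho> \<xi>) u)) s / of_real (japanese \<xi> powr (m - length \<alpha>))) u \<in> schwartz"
      by (auto intro!: lin S)
  }
  fix j k
  obtain n c where c: "\<forall>x\<in>K. \<forall>\<xi>. \<forall>g\<in>schwartz. \<forall>t. \<bar>t\<bar> ^ j * cmod (LBINT s. kk k \<alpha> \<beta> (x, \<xi>)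
         (\<rho> \<xi> * t) (s / \<rho> \<xi>) * g s) \<le> c * japanese \<xi> powr (m - length \<alpha> + \<tau> * k) * schwartz_norm n g"
    using est[OF ab assms, of j k] unfolding \<rho>_def by blast
  have "\<bar>t\<bar> ^ j * cmod (iter_deriv k (\<lambda>s. dilate (\<rho> \<xi>) (I 0 \<alpha> \<beta> (x, \<xi>) (dilate (\<rho> \<xi>) u)) s / of_real (japanese \<xi> powr (m - length \<alpha>))) t) \<le> c * schwartz_norm n u"
    if x: "x \<in> K" and u: "u \<in> schwartz" for x \<xi> u t
  proof -
    let ?r = "\<rho> \<xi>" and ?J = "japanese \<xi> powr (m - length \<alpha>)"
    have r0: "?r > 0" by (rule \<rho>_pos)
    have J: "?J > 0" using japanese_pos[of \<xi>] by simp
    have du: "dilate ?r u \<in> schwartz" using u r0 by (simp add: schwartz_dilate_iff)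
    have "iter_deriv k (dilate ?r (I 0 \<alpha> \<beta> (x, \<xi>) (dilate ?r u))) t = of_real (?r ^ k) * dilate ?r (I k \<alpha> \<beta> (x, \<xi>) (dilate ?r u)) t"
      by (simp only: iter_deriv_dilate(2)[OF I_schwartz(1)[OF ab du] r0] I_schwartz(2)[OF ab du]) (simp add: dilate_def)
    also have "\<dots> = of_real (?r ^ k) * (LBINT s. kk k \<alpha> \<beta> (x, \<xi>) (?r * t) (s / ?r) * u s)"
      by (simp add: I_dilated[OF ab u r0])
    finally have "\<bar>t\<bar> ^ j * cmod (iter_deriv k (\<lambda>s. dilate ?r (I 0 \<alpha> \<beta> (x, \<xi>) (dilate ?r u)) s / of_real ?J) t)
       = ?r ^ k * (\<bar>t\<bar> ^ j * cmod (LBINT s. kk k \<alpha> \<beta> (x, \<xi>) (?r * t) (s / ?r) * u s)) / ?J"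
      using r0 J by (simp add: lin(2)[OF S[OF u]] norm_mult norm_divide norm_power)
    also have "\<dots> \<le> ?r ^ k * (c * japanese \<xi> powr (m - length \<alpha> + \<tau> * k) * schwartz_norm n u) / ?J"
      using c x u r0 J by (intro divide_right_mono mult_left_mono) auto
    also have "\<dots> = c * schwartz_norm n u"
    proof -
      have "?r ^ k = japanese \<xi> powr (- \<tau> * k)" unfolding \<rho>_def using japanese_pos[of \<xi>] by (simp add: powr_power mult.commute)
      then have "?r ^ k * japanese \<xi> powr (m - length \<alpha> + \<tau> * k) = ?J" by (simp add: powr_add[symmetric])
      then show ?thesis using J by (simp add: mult_ac)
    qed
    finally show ?thesis .
  qed
  then show "\<exists>n C. \<forall>i\<in>K \<times> UNIV. \<forall>u\<in>schwartz. \<forall>t. \<bar>t\<bar> ^ j * cmod (iter_deriv k ((case i of (x, \<xi>) \<Rightarrow> \<lambda>u s.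
      dilate (\<rho> \<xi>) (I 0 \<alpha> \<beta> (x, \<xi>) (dilate (\<rho> \<xi>) u)) s / of_real (japanese \<xi> powr (m - length \<alpha>))) u) t) \<le> C * schwartz_norm n u"
    by (intro exI[of _ n] exI[of _ c]) auto
qed

text \<open>Serves two kinds of quotients: \<open>d = 0\<close> and \<open>e = 1\<close> give the
  Lipschitz quotient, \<open>d = 1\<close> the second order one.\<close>

lemma iter_deriv_I_diff:
  assumes g: "g \<in> schwartz" and ab': "set \<alpha>' \<subseteq> Basis" "set \<beta>' \<subseteq> Basis"
  shows "(\<lambda>s. ((I 0 \<alpha> \<beta> z' g s - I 0 \<alpha> \<beta> z g s) / c - d * I 0 \<alpha>' \<beta>' z g s) / e) \<in> schwartz"
    "iter_deriv l (\<lambda>s. ((I 0 \<alpha> \<beta> z' g s - I 0 \<alpha> \<beta> z g s) / c - d * I 0 \<alpha>' \<beta>' z g s) / e) t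
      = ((I l \<alpha> \<beta> z' g t - I l \<alpha> \<beta> z g t) / c - d * I l \<alpha>' \<beta>' z g t) / e"
proof -
  note S = I_schwartz[OF ab g]
  note S' = I_schwartz[OF ab' g]
  let ?w = "\<lambda>s. (1/c) * I 0 \<alpha> \<beta> z' g s + (- (1/c)) * I 0 \<alpha> \<beta> z g s"
  have w: "?w \<in> schwartz" by (rule schwartz_lin(1)[OF S(1) S(1)])
  have eq: "(\<lambda>s. ((I 0 \<alpha> \<beta> z' g s - I 0 \<alpha> \<beta> z g s) / c - d * I 0 \<alpha>' \<beta>' z g s) / e) = (\<lambda>s. (1/e) * ?w s + (- (d/e)) * I 0 \<alpha>' \<beta>' z g s)"
    by (simp add: diff_divide_distrib add_divide_distrib)
  show "(\<lambda>s. ((I 0 \<alpha> \<beta> z' g s - I 0 \<alpha> \<beta> z g s) / c - d * I 0 \<alpha>' \<beta>' z g s) / e) \<in> schwartz"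
    unfolding eq by (rule schwartz_lin(1)[OF w S'(1)])
  show "iter_deriv l (\<lambda>s. ((I 0 \<alpha> \<beta> z' g s - I 0 \<alpha> \<beta> z g s) / c - d * I 0 \<alpha>' \<beta>' z g s) / e) t
      = ((I l \<alpha> \<beta> z' g t - I l \<alpha> \<beta> z g t) / c - d * I l \<alpha>' \<beta>' z g t) / e"
    unfolding eq schwartz_lin(2)[OF w S'(1)] schwartz_lin(2)[OF S(1) S(1)] S(2) S'(2)
    by (simp add: diff_divide_distrib add_divide_distrib)
qed

end

lemma I_bound_Basis:
  assumes ab: "set \<alpha> \<subseteq> Basis" "set \<beta> \<subseteq> Basis"
  shows "\<exists>n c. 0 \<le> c \<and> (\<forall>b\<in>Basis. \<forall>z\<in>cball 0 r. \<forall>g\<in>schwartz. \<forall>t.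
      \<bar>t\<bar> ^ j * cmod (I l (b # \<alpha>) \<beta> z g t) \<le> c * schwartz_norm n g \<and> \<bar>t\<bar> ^ j * cmod (I l \<alpha> (b # \<beta>) z g t) \<le> c * schwartz_norm n g)"
proof -
  have "\<exists>n c. 0 \<le> c \<and> (\<forall>z\<in>cball 0 r. \<forall>g\<in>schwartz. \<forall>t.
      \<bar>t\<bar> ^ j * cmod (I l (b # \<alpha>) \<beta> z g t) \<le> c * schwartz_norm n g \<and> \<bar>t\<bar> ^ j * cmod (I l \<alpha> (b # \<beta>) z g t) \<le> c * schwartz_norm n g)"
    if b: "b \<in> Basis" for b
  proof -
    obtain n c where 1: "0 \<le> c" "\<And>z g t. z \<in> cball 0 r \<Longrightarrow> g \<in> schwartz \<Longrightarrow> \<bar>t\<bar> ^ j * cmod (I l (b # \<alpha>) \<beta> z g t) \<le> c * schwartz_norm n g"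
      using I_bound[of "b # \<alpha>" \<beta> r j l] ab b by fastforce
    obtain n' c' where 2: "0 \<le> c'" "\<And>z g t. z \<in> cball 0 r \<Longrightarrow> g \<in> schwartz \<Longrightarrow> \<bar>t\<bar> ^ j * cmod (I l \<alpha> (b # \<beta>) z g t) \<le> c' * schwartz_norm n' g"
      using I_bound[of \<alpha> "b # \<beta>" r j l] ab b by fastforce
    have "c * schwartz_norm n g \<le> (c + c') * schwartz_norm (max n n') g" "c' * schwartz_norm n' g \<le> (c + c') * schwartz_norm (max n n') g" if "g \<in> schwartz" for g
      using 1(1) 2(1) schwartz_norm_mono[OF that] schwartz_norm_nonneg[OF that] by (auto intro!: mult_mono)
    then have "\<bar>t\<bar> ^ j * cmod (I l (b # \<alpha>) \<beta> z g t) \<le> (c + c') * schwartz_norm (max n n') g \<and>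
        \<bar>t\<bar> ^ j * cmod (I l \<alpha> (b # \<beta>) z g t) \<le> (c + c') * schwartz_norm (max n n') g"
      if "z \<in> cball 0 r" "g \<in> schwartz" for z g t
      using order_trans[OF 1(2)[OF that]] order_trans[OF 2(2)[OF that]] that by blast
    then show ?thesis
      using 1(1) 2(1) by (intro exI[of _ "max n n'"] exI[of _ "c + c'"]) simp
  qed
  then obtain n c where c: "\<And>b. b \<in> Basis \<Longrightarrow> 0 \<le> c b" "\<And>b z g t. b \<in> Basis \<Longrightarrow> z \<in> cball 0 r \<Longrightarrow> g \<in> schwartz \<Longrightarrow>
      \<bar>t\<bar> ^ j * cmod (I l (b # \<alpha>) \<beta> z g t) \<le> c b * schwartz_norm (n b) g \<and> \<bar>t\<bar> ^ j * cmod (I l \<alpha> (b # \<beta>) z g t) \<le> c b * schwartz_norm (n b) g"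
    by metis
  define N where "N = Max (n ` Basis)"
  define C where "C = (\<Sum>b\<in>Basis. c b)"
  have "c b * schwartz_norm (n b) g \<le> C * schwartz_norm N g" if b: "b \<in> Basis" and g: "g \<in> schwartz" for b g
    using b c(1) g schwartz_norm_nonneg[OF g] unfolding N_def C_def
    by (intro mult_mono schwartz_norm_mono member_le_sum) (auto intro!: sum_nonneg Max_ge)
  moreover have "0 \<le> C" unfolding C_def using c(1) by (intro sum_nonneg)
  ultimately show ?thesis using c(2) by (intro exI[of _ N] exI[of _ C]) (meson order_trans)
qed

text \<open>Mean value theorem along the segment from \<open>z\<close> to \<open>z'\<close>. The
  derivative there is a sum over \<open>2 * DIM('n)\<close> coordinate directions, each estimated by
  \<open>I_bound_Basis\<close> on a ball containing the segment.\<close>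

lemma I_Lipschitz:
  assumes ab: "set \<alpha> \<subseteq> Basis" "set \<beta> \<subseteq> Basis"
  shows "equicont schwartz_space {z'. z' \<noteq> z \<and> dist z' z < 1}
     (\<lambda>z' u s. (I 0 \<alpha> \<beta> z' u s - I 0 \<alpha> \<beta> z u s) / of_real (dist z' z))"
  unfolding equicont_schwartz_iff
proof (intro conjI allI ballI)
  have simp0: "((I l \<alpha> \<beta> z' u s - I l \<alpha> \<beta> z u s) / c - 0 * I l \<alpha> \<beta> z u s) / 1 = (I l \<alpha> \<beta> z' u s - I l \<alpha> \<beta> z u s) / c" for l z' u s and c :: complex
    by simp
  note D = iter_deriv_I_diff[OF ab _ ab, where z = z and d = 0 and e = 1, unfolded simp0]
  show "(\<lambda>s. (I 0 \<alpha> \<beta> z' u s - I 0 \<alpha> \<beta> z u s) / of_real (dist z' z)) \<in> schwartz" if "u \<in> schwartz" for z' u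
    by (rule D(1)[OF that])
  fix j k
  obtain n c where c: "0 \<le> c" "\<And>b z' g t. b\<in>Basis \<Longrightarrow> z'\<in>cball 0 (norm z + 1) \<Longrightarrow> g\<in>schwartz \<Longrightarrow>
      \<bar>t\<bar> ^ j * cmod (I k (b # \<alpha>) \<beta> z' g t) \<le> c * schwartz_norm n g \<and> \<bar>t\<bar> ^ j * cmod (I k \<alpha> (b # \<beta>) z' g t) \<le> c * schwartz_norm n g"
    using I_bound_Basis[OF ab, of "norm z + 1" j k] by blast
  have "\<bar>t\<bar> ^ j * cmod ((I k \<alpha> \<beta> z' u t - I k \<alpha> \<beta> z u t) / of_real (dist z' z)) \<le> (2 * DIM('n) * c) * schwartz_norm n u"
    if z': "z' \<in> {z'. z' \<noteq> z \<and> dist z' z < 1}" and u: "u \<in> schwartz" for z' u t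
  proof -
    define v where "v = z' - z"
    have v: "norm v = dist z' z" "norm v > 0" "norm v < 1" using z' by (auto simp: v_def dist_norm)
    have fs: "\<bar>fst v \<bullet> b\<bar> \<le> norm v" "\<bar>snd v \<bullet> b\<bar> \<le> norm v" if "b \<in> Basis" for b
      using that Basis_le_norm[of b "fst v"] Basis_le_norm[of b "snd v"] norm_fst_le[of "fst v" "snd v"] norm_snd_le[of "snd v" "fst v"]
      by auto
    \<comment> \<open>The weight |t|^j is a constant here: the mean value estimate runs over the
      parameter, with \<open>t\<close> fixed.\<close>
    have "norm (of_real (\<bar>t\<bar> ^ j) * I k \<alpha> \<beta> (z + 1 *\<^sub>R v) u t - of_real (\<bar>t\<bar> ^ j) * I k \<alpha> \<beta> (z + 0 *\<^sub>R v) u t) \<le> (norm v * (2 * DIM('n) * c * schwartz_norm n u)) * \<bar>1 - 0\<bar>"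
    proof (rule mean_value_bound[where g = "\<lambda>\<theta>. of_real (\<bar>t\<bar> ^ j) * I k \<alpha> \<beta> (z + \<theta> *\<^sub>R v) u t", OF has_vector_derivative_mult_right[OF line_I[OF ab u]]])
      fix \<theta> :: real assume "\<theta> \<in> closed_segment 0 1"
      then have \<theta>: "0 \<le> \<theta>" "\<theta> \<le> 1" by (auto simp: closed_segment_eq_real_ivl)
      have "norm (z + \<theta> *\<^sub>R v) \<le> norm z + \<bar>\<theta>\<bar> * norm v" using norm_triangle_ineq[of z "\<theta> *\<^sub>R v"] by simp
      also have "\<dots> \<le> norm z + 1 * 1" using \<theta> v by (intro add_left_mono mult_mono) auto
      finally have zb: "z + \<theta> *\<^sub>R v \<in> cball 0 (norm z + 1)" by simp
      let ?w = "z + \<theta> *\<^sub>R v"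
      have "norm (of_real (\<bar>t\<bar> ^ j) * ((\<Sum>b\<in>Basis. (fst v \<bullet> b) *\<^sub>R I k \<alpha> (b # \<beta>) ?w u t) + (\<Sum>b\<in>Basis. (snd v \<bullet> b) *\<^sub>R I k (b # \<alpha>) \<beta> ?w u t)))
        = norm ((\<Sum>b\<in>Basis. (fst v \<bullet> b) *\<^sub>R (of_real (\<bar>t\<bar> ^ j) * I k \<alpha> (b # \<beta>) ?w u t)) + (\<Sum>b\<in>Basis. (snd v \<bullet> b) *\<^sub>R (of_real (\<bar>t\<bar> ^ j) * I k (b # \<alpha>) \<beta> ?w u t)))"
        by (simp add: distrib_left sum_distrib_left)
      also have "\<dots> \<le> (\<Sum>b\<in>(Basis::'n set). norm v * (c * schwartz_norm n u)) + (\<Sum>b\<in>(Basis::'n set). norm v * (c * schwartz_norm n u))"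
      proof (intro norm_triangle_le add_mono sum_norm_le)
        fix b :: 'n assume b: "b \<in> Basis"
        show "norm ((fst v \<bullet> b) *\<^sub>R (of_real (\<bar>t\<bar> ^ j) * I k \<alpha> (b # \<beta>) ?w u t)) \<le> norm v * (c * schwartz_norm n u)"
          using fs[OF b] c(2)[OF b zb u, of t] by (simp only: norm_scaleR norm_mult norm_of_real power_abs abs_idempotent) (rule mult_mono, auto)
        show "norm ((snd v \<bullet> b) *\<^sub>R (of_real (\<bar>t\<bar> ^ j) * I k (b # \<alpha>) \<beta> ?w u t)) \<le> norm v * (c * schwartz_norm n u)"
          using fs[OF b] c(2)[OF b zb u, of t] by (simp only: norm_scaleR norm_mult norm_of_real power_abs abs_idempotent) (rule mult_mono, auto)
      qed
      also have "\<dots> = norm v * (2 * DIM('n) * c * schwartz_norm n u)" by simp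
      finally show "norm (of_real (\<bar>t\<bar> ^ j) * ((\<Sum>b\<in>Basis. (fst v \<bullet> b) *\<^sub>R I k \<alpha> (b # \<beta>) ?w u t) + (\<Sum>b\<in>Basis. (snd v \<bullet> b) *\<^sub>R I k (b # \<alpha>) \<beta> ?w u t)))
         \<le> norm v * (2 * DIM('n) * c * schwartz_norm n u)" .
    qed
    then have "\<bar>t\<bar> ^ j * cmod (I k \<alpha> \<beta> z' u t - I k \<alpha> \<beta> z u t) \<le> norm v * (2 * DIM('n) * c * schwartz_norm n u)"
      by (simp add: v_def right_diff_distrib[symmetric] norm_mult norm_power)
    then show ?thesis using v by (simp add: norm_divide field_simps)
  qed
  then show "\<exists>n C. \<forall>i\<in>{z'. z' \<noteq> z \<and> dist z' z < 1}. \<forall>u\<in>schwartz. \<forall>t.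
      \<bar>t\<bar> ^ j * cmod (iter_deriv k (\<lambda>s. (I 0 \<alpha> \<beta> i u s - I 0 \<alpha> \<beta> z u s) / of_real (dist i z)) t) \<le> C * schwartz_norm n u"
    by (intro exI[of _ n] exI[of _ "2 * DIM('n) * c"] ballI allI) (subst D(2), assumption, blast)
qed

text \<open>A Taylor remainder of second order from two mean value estimates. The chain of index
  pairs is kept abstract, so that derivatives in the variable and in the covariable are treated
  alike.\<close>

lemma I_quotient:
  assumes ab: "set \<alpha> \<subseteq> Basis" "set \<beta> \<subseteq> Basis" and ab1: "set \<alpha>1 \<subseteq> Basis" "set \<beta>1 \<subseteq> Basis"
    and ab2: "set \<alpha>2 \<subseteq> Basis" "set \<beta>2 \<subseteq> Basis" and v: "norm v \<le> 1"
    and d1: "\<And>l u t \<theta>. u \<in> schwartz \<Longrightarrow> ((\<lambda>\<theta>. I l \<alpha> \<beta> (z + \<theta> *\<^sub>R v) u t) has_vector_derivative I l \<alpha>1 \<beta>1 (z + \<theta> *\<^sub>R v) u t) (at \<theta>)"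
    and d2: "\<And>l u t \<theta>. u \<in> schwartz \<Longrightarrow> ((\<lambda>\<theta>. I l \<alpha>1 \<beta>1 (z + \<theta> *\<^sub>R v) u t) has_vector_derivative I l \<alpha>2 \<beta>2 (z + \<theta> *\<^sub>R v) u t) (at \<theta>)"
  shows "equicont schwartz_space {h::real. h \<noteq> 0 \<and> \<bar>h\<bar> < 1}
     (\<lambda>h u s. ((I 0 \<alpha> \<beta> (z + h *\<^sub>R v) u s - I 0 \<alpha> \<beta> z u s) / of_real h - I 0 \<alpha>1 \<beta>1 z u s) / of_real h)"
  unfolding equicont_schwartz_iff
proof (intro conjI allI ballI)
  note D = iter_deriv_I_diff[OF ab _ ab1, where d = 1, unfolded mult_1_left]
  show "(\<lambda>s. ((I 0 \<alpha> \<beta> (z + h *\<^sub>R v) u s - I 0 \<alpha> \<beta> z u s) / of_real h - I 0 \<alpha>1 \<beta>1 z u s) / of_real h) \<in> schwartz"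
    if "u \<in> schwartz" for h :: real and u
    by (rule D(1)[OF that])
  fix j k
  obtain n c where c: "0 \<le> c" "\<forall>z'\<in>cball 0 (norm z + 1). \<forall>g\<in>schwartz. \<forall>t. \<bar>t\<bar> ^ j * cmod (I k \<alpha>2 \<beta>2 z' g t) \<le> c * schwartz_norm n g"
    using I_bound[OF ab2, of "norm z + 1" j k] by blast
  have "\<bar>t\<bar> ^ j * cmod (((I k \<alpha> \<beta> (z + h *\<^sub>R v) u t - I k \<alpha> \<beta> z u t) / of_real h - I k \<alpha>1 \<beta>1 z u t) / of_real h) \<le> c * schwartz_norm n u"
    if h: "h \<noteq> 0" "\<bar>h\<bar> < 1" and u: "u \<in> schwartz" for h u t
  proof -
    let ?T = "complex_of_real (\<bar>t\<bar> ^ j)"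
    have zb: "z + \<theta> *\<^sub>R v \<in> cball 0 (norm z + 1)" if "\<bar>\<theta>\<bar> \<le> \<bar>h\<bar>" for \<theta>
    proof -
      have "norm (z + \<theta> *\<^sub>R v) \<le> norm z + \<bar>\<theta>\<bar> * norm v" using norm_triangle_ineq[of z "\<theta> *\<^sub>R v"] by simp
      also have "\<dots> \<le> norm z + 1 * 1" using that h v by (intro add_left_mono mult_mono) auto
      finally show ?thesis by simp
    qed
    have seg: "\<bar>\<theta>\<bar> \<le> \<bar>h'\<bar>" if "\<theta> \<in> closed_segment 0 h'" for \<theta> h' :: real
      using that by (auto simp: closed_segment_eq_real_ivl split: if_splits)
    have 1: "norm (?T * I k \<alpha>1 \<beta>1 (z + \<theta> *\<^sub>R v) u t - ?T * I k \<alpha>1 \<beta>1 (z + 0 *\<^sub>R v) u t) \<le> (c * schwartz_norm n u) * \<bar>h\<bar>"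
      if \<theta>: "\<bar>\<theta>\<bar> \<le> \<bar>h\<bar>" for \<theta>
    proof -
      have "norm (?T * I k \<alpha>1 \<beta>1 (z + \<theta> *\<^sub>R v) u t - ?T * I k \<alpha>1 \<beta>1 (z + 0 *\<^sub>R v) u t) \<le> (c * schwartz_norm n u) * \<bar>\<theta> - 0\<bar>"
      proof (rule mean_value_bound[where g = "\<lambda>\<theta>. ?T * I k \<alpha>1 \<beta>1 (z + \<theta> *\<^sub>R v) u t", OF has_vector_derivative_mult_right[OF d2[OF u]]])
        fix x assume "x \<in> closed_segment 0 \<theta>"
        then show "norm (?T * I k \<alpha>2 \<beta>2 (z + x *\<^sub>R v) u t) \<le> c * schwartz_norm n u"
          using c(2) zb[of x] seg[of x \<theta>] \<theta> u by (auto simp: norm_mult norm_power)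
      qed
      also have "\<dots> \<le> (c * schwartz_norm n u) * \<bar>h\<bar>" using \<theta> c(1) schwartz_norm_nonneg[OF u] by (intro mult_left_mono) auto
      finally show ?thesis .
    qed
    have eq: "((I k \<alpha> \<beta> (z + h *\<^sub>R v) u t - I k \<alpha> \<beta> z u t) / of_real h - I k \<alpha>1 \<beta>1 z u t) / of_real h
       = (I k \<alpha> \<beta> (z + h *\<^sub>R v) u t - I k \<alpha> \<beta> z u t - of_real h * I k \<alpha>1 \<beta>1 z u t) / (of_real h * of_real h)"
      using h by (simp add: field_simps)
    have "norm ((?T * I k \<alpha> \<beta> (z + h *\<^sub>R v) u t - h *\<^sub>R (?T * I k \<alpha>1 \<beta>1 z u t)) - (?T * I k \<alpha> \<beta> (z + 0 *\<^sub>R v) u t - 0 *\<^sub>R (?T * I k \<alpha>1 \<beta>1 z u t)))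
      \<le> (c * schwartz_norm n u) * \<bar>h\<bar> * \<bar>h - 0\<bar>"
    proof (rule mean_value_bound[where g' = "\<lambda>\<theta>. ?T * I k \<alpha>1 \<beta>1 (z + \<theta> *\<^sub>R v) u t - ?T * I k \<alpha>1 \<beta>1 z u t"])
      fix x assume x: "x \<in> closed_segment 0 h"
      show "((\<lambda>x. ?T * I k \<alpha> \<beta> (z + x *\<^sub>R v) u t - x *\<^sub>R (?T * I k \<alpha>1 \<beta>1 z u t)) has_vector_derivative
          ?T * I k \<alpha>1 \<beta>1 (z + x *\<^sub>R v) u t - ?T * I k \<alpha>1 \<beta>1 z u t) (at x)"
        by (intro has_vector_derivative_diff has_vector_derivative_mult_right d1 u)
           (auto intro!: derivative_eq_intros)
      show "norm (?T * I k \<alpha>1 \<beta>1 (z + x *\<^sub>R v) u t - ?T * I k \<alpha>1 \<beta>1 z u t) \<le> (c * schwartz_norm n u) * \<bar>h\<bar>"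
        using 1[OF seg[OF x]] by simp
    qed
    moreover have "(?T * I k \<alpha> \<beta> (z + h *\<^sub>R v) u t - h *\<^sub>R (?T * I k \<alpha>1 \<beta>1 z u t)) - (?T * I k \<alpha> \<beta> (z + 0 *\<^sub>R v) u t - 0 *\<^sub>R (?T * I k \<alpha>1 \<beta>1 z u t))
      = ?T * (I k \<alpha> \<beta> (z + h *\<^sub>R v) u t - I k \<alpha> \<beta> z u t - of_real h * I k \<alpha>1 \<beta>1 z u t)"
      by (simp add: scaleR_conv_of_real algebra_simps)
    ultimately have "norm (?T * (I k \<alpha> \<beta> (z + h *\<^sub>R v) u t - I k \<alpha> \<beta> z u t - of_real h * I k \<alpha>1 \<beta>1 z u t)) \<le> (c * schwartz_norm n u) * \<bar>h\<bar> * \<bar>h - 0\<bar>"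
      by (simp only:)
    then have "\<bar>t\<bar> ^ j * cmod (I k \<alpha> \<beta> (z + h *\<^sub>R v) u t - I k \<alpha> \<beta> z u t - of_real h * I k \<alpha>1 \<beta>1 z u t) \<le> (c * schwartz_norm n u) * (\<bar>h\<bar> * \<bar>h\<bar>)"
      by (simp only: norm_mult norm_of_real power_abs abs_idempotent mult.assoc diff_0_right)
    moreover have "0 < \<bar>h\<bar> * \<bar>h\<bar>" by (intro mult_pos_pos) (use h in auto)
    ultimately have "\<bar>t\<bar> ^ j * cmod (I k \<alpha> \<beta> (z + h *\<^sub>R v) u t - I k \<alpha> \<beta> z u t - of_real h * I k \<alpha>1 \<beta>1 z u t) / (\<bar>h\<bar> * \<bar>h\<bar>) \<le> c * schwartz_norm n u"
      by (simp only: pos_divide_le_eq)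
    then show ?thesis
      unfolding eq by (simp only: norm_divide norm_mult norm_of_real times_divide_eq_right)
  qed
  then show "\<exists>n C. \<forall>h\<in>{h. h \<noteq> 0 \<and> \<bar>h\<bar> < 1}. \<forall>u\<in>schwartz. \<forall>t.
      \<bar>t\<bar> ^ j * cmod (iter_deriv k (\<lambda>s. ((I 0 \<alpha> \<beta> (z + h *\<^sub>R v) u s - I 0 \<alpha> \<beta> z u s) / of_real h - I 0 \<alpha>1 \<beta>1 z u s) / of_real h) t) \<le> C * schwartz_norm n u"
    by (intro exI[of _ n] exI[of _ c] ballI allI) (subst D(2), assumption, blast)
qed

lemma sum_delta_Basis: "b \<in> Basis \<Longrightarrow> (\<Sum>c\<in>Basis. (b \<bullet> c) *\<^sub>R f c) = f (b::'n)"
  for f :: "'n \<Rightarrow> complex"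
  by (simp add: inner_Basis if_distrib[of "\<lambda>x. x *\<^sub>R _"] cong: if_cong)

lemma op_family_I: "op_family schwartz_space (\<lambda>j. dilate (j powr - \<tau>)) (\<lambda>j. dilate (j powr - \<tau>)) m (I 0)"
  unfolding op_family_def topspace_schwartz
proof (intro allI impI conjI ballI)
  fix \<alpha> \<beta> :: "'n list" assume "set \<alpha> \<subseteq> Basis \<and> set \<beta> \<subseteq> Basis"
  then have ab: "set \<alpha> \<subseteq> Basis" "set \<beta> \<subseteq> Basis" by auto
  {
    fix z
    show "lin_on schwartz (I 0 \<alpha> \<beta> z)" by (rule lin_on_I[OF ab])
    show "equicont schwartz_space {()} (\<lambda>_. I 0 \<alpha> \<beta> z)"
      unfolding equicont_schwartz_iff
    proof (intro conjI ballI allI)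
      fix j k
      show "\<exists>n C. \<forall>i\<in>{()}. \<forall>u\<in>schwartz. \<forall>t. \<bar>t\<bar> ^ j * cmod (iter_deriv k (I 0 \<alpha> \<beta> z u) t) \<le> C * schwartz_norm n u"
      proof -
        obtain n c where "\<forall>z'\<in>cball 0 (norm z). \<forall>g\<in>schwartz. \<forall>t. \<bar>t\<bar> ^ j * cmod (I k \<alpha> \<beta> z' g t) \<le> c * schwartz_norm n g"
          using I_bound[OF ab, of "norm z" j k] by blast
        then have "\<forall>g\<in>schwartz. \<forall>t. \<bar>t\<bar> ^ j * cmod (I k \<alpha> \<beta> z g t) \<le> c * schwartz_norm n g"
          by simp
        then show ?thesis by (auto simp: I_schwartz(2)[OF ab])
      qed
    qed (auto intro: I_schwartz[OF ab])
    show "\<exists>\<delta>>0. equicont schwartz_space {z'. z' \<noteq> z \<and> dist z' z < \<delta>}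
        (\<lambda>z' u s. (I 0 \<alpha> \<beta> z' u s - I 0 \<alpha> \<beta> z u s) / of_real (dist z' z))"
      using I_Lipschitz[OF ab] zero_less_one by blast
  }
  fix x \<xi> and b :: 'n assume b: "b \<in> Basis"
  have ab': "set (b # \<alpha>) \<subseteq> Basis" "set (b # \<beta>) \<subseteq> Basis" "set (b # b # \<alpha>) \<subseteq> Basis" "set (b # b # \<beta>) \<subseteq> Basis" using ab b by auto
  have l1: "u \<in> schwartz \<Longrightarrow> ((\<lambda>\<theta>. I l \<alpha> \<beta> (z + \<theta> *\<^sub>R (0, b)) u t) has_vector_derivative I l (b # \<alpha>) \<beta> (z + \<theta> *\<^sub>R (0, b)) u t) (at \<theta>)"
    if "set \<alpha> \<subseteq> Basis" for l u z t \<theta> \<alpha>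
    using line_I[OF that ab(2), of u l z "(0, b)" t \<theta>] b by (simp add: sum_delta_Basis)
  have l2: "u \<in> schwartz \<Longrightarrow> ((\<lambda>\<theta>. I l \<alpha> \<beta> (z + \<theta> *\<^sub>R (b, 0)) u t) has_vector_derivative I l \<alpha> (b # \<beta>) (z + \<theta> *\<^sub>R (b, 0)) u t) (at \<theta>)"
    if "set \<beta> \<subseteq> Basis" for l u z t \<theta> \<beta>
    using line_I[OF ab(1) that, of u l z "(b, 0)" t \<theta>] b by (simp add: sum_delta_Basis)
  have "norm b \<le> 1" using b by simp
  then have nb: "norm (0::'n, b) \<le> 1" "norm (b, 0::'n) \<le> 1" by (auto simp: norm_Pair)
  show "\<exists>\<delta>>0. equicont schwartz_space {h::real. h \<noteq> 0 \<and> \<bar>h\<bar> < \<delta>}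
     (\<lambda>h u s. ((I 0 \<alpha> \<beta> (x, \<xi> + h *\<^sub>R b) u s - I 0 \<alpha> \<beta> (x, \<xi>) u s) / of_real h - I 0 (b # \<alpha>) \<beta> (x, \<xi>) u s) / of_real h)"
    using I_quotient[OF ab ab'(1) ab(2) ab'(3) ab(2) nb(1) l1[OF ab(1)] l1[OF ab'(1)], of "(x, \<xi>)"]
    by (intro exI[of _ 1]) simp
  show "\<exists>\<delta>>0. equicont schwartz_space {h::real. h \<noteq> 0 \<and> \<bar>h\<bar> < \<delta>}
     (\<lambda>h u s. ((I 0 \<alpha> \<beta> (x + h *\<^sub>R b, \<xi>) u s - I 0 \<alpha> \<beta> (x, \<xi>) u s) / of_real h - I 0 \<alpha> (b # \<beta>) (x, \<xi>) u s) / of_real h)"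
    using I_quotient[OF ab ab(1) ab'(2) ab(1) ab'(4) nb(2) l2[OF ab(2)] l2[OF ab'(2)], of "(x, \<xi>)"]
    by (intro exI[of _ 1]) simp
next
  fix \<alpha> \<beta> :: "'n list" and K :: "'n set" assume "set \<alpha> \<subseteq> Basis \<and> set \<beta> \<subseteq> Basis" "compact K"
  then show "equicont schwartz_space (K \<times> UNIV)
     (\<lambda>(x, \<xi>) u s. dilate (japanese \<xi> powr - \<tau>) (I 0 \<alpha> \<beta> (x, \<xi>) (dilate (japanese \<xi> powr - \<tau>) u)) s / of_real (japanese \<xi> powr (m - length \<alpha>)))"
    using equicont_dilated[of \<alpha> \<beta> K] by (simp add: \<rho>_def)
qed

end

section \<open>Decay in one variable by repeated partial integration in the other\<close>

section \<open>Kernels that gain decay by partial integration\<close>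

lemma schwartz_norm_iter_deriv_1: "u \<in> schwartz \<Longrightarrow> schwartz_norm n (iter_deriv 1 u) \<le> (n + 1)\<^sup>2 * schwartz_norm (n + 1) u"
proof (intro schwartz_norm_least schwartz_iter_deriv)
  show "\<bar>t\<bar> ^ j * cmod (iter_deriv k (iter_deriv 1 u) t) \<le> schwartz_norm (n + 1) u" if "u \<in> schwartz" "j \<le> n" "k \<le> n" for j k t
    unfolding iter_deriv_add by (rule order_trans[OF schwartz_seminorm_upper schwartz_seminorm_le_schwartz_norm]) (use that in auto)
qed

text \<open>By \<open>dec\<close>, a kernel is up to a total derivative in the integration variable one of lower order
  in \<open>t\<close>; the derivative is moved to the Schwartz function.\<close>

locale decay_class =
  fixes Z :: "'z set" and lam :: "'z \<Rightarrow> real" and \<tau> :: real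
    and C :: "real \<Rightarrow> real \<Rightarrow> real \<Rightarrow> ('z \<Rightarrow> real \<Rightarrow> real \<Rightarrow> complex) \<Rightarrow> bool"
  assumes lam: "z \<in> Z \<Longrightarrow> 1 \<le> lam z"
    and bound: "C \<mu> M N k \<Longrightarrow> \<exists>c. \<forall>z\<in>Z. \<forall>t s. cmod (k z t s) \<le>
      c * lam z powr \<mu> * (1 + \<bar>t\<bar> * lam z powr \<tau>) powr M * (1 + \<bar>s\<bar> * lam z powr - \<tau>) powr N"
    and cont: "C \<mu> M N k \<Longrightarrow> z \<in> Z \<Longrightarrow> continuous_on UNIV (k z t)"
    and dec: "C \<mu> M N k \<Longrightarrow> \<exists>k1 k2. C \<mu> (M - 1) N k1 \<and> C (\<mu> + \<tau>) (M - 1) N k2 \<and>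
      (\<forall>z\<in>Z. \<forall>t s. ((\<lambda>s. k2 z t s) has_vector_derivative k z t s - k1 z t s) (at s))"
begin

abbreviation r where "r z \<equiv> lam z powr - \<tau>"

lemma r_pos: "z \<in> Z \<Longrightarrow> 0 < r z"
  using lam[of z] by simp

text \<open>Dilation removes the powers of \<open>lam z\<close> from the growth in \<open>t\<close>
  and \<open>s\<close>. The exponent \<open>N\<close> is rounded up to a natural number because
  \<open>schwartz_kernel_bound\<close> asks for one.\<close>

lemma dilated_bound:
  assumes "C \<mu> M N k"
  shows "\<exists>c\<ge>0. \<forall>z\<in>Z. \<forall>t s. cmod (k z (r z * t) (s / r z)) \<le>
    c * lam z powr \<mu> * (1 + \<bar>t\<bar>) powr M * (1 + \<bar>s\<bar>) ^ nat \<lceil>N\<rceil>"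
proof -
  obtain c where c: "\<And>z t s. z \<in> Z \<Longrightarrow> cmod (k z t s) \<le>
      c * lam z powr \<mu> * (1 + \<bar>t\<bar> * lam z powr \<tau>) powr M * (1 + \<bar>s\<bar> * lam z powr - \<tau>) powr N"
    using bound[OF assms] by blast
  have "cmod (k z (r z * t) (s / r z)) \<le> \<bar>c\<bar> * lam z powr \<mu> * (1 + \<bar>t\<bar>) powr M * (1 + \<bar>s\<bar>) ^ nat \<lceil>N\<rceil>"
    if z: "z \<in> Z" for z t s
  proof -
    have rr: "r z * lam z powr \<tau> = 1" using lam[OF z] by (simp add: powr_add[symmetric])
    have 1: "\<bar>r z * t\<bar> * lam z powr \<tau> = \<bar>t\<bar>" using rr by (simp add: abs_mult mult_ac)
    have 2: "\<bar>s / r z\<bar> * lam z powr - \<tau> = \<bar>s\<bar>" using r_pos[OF z] by (simp add: abs_divide)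
    have 3: "(1 + \<bar>s\<bar>) powr N \<le> (1 + \<bar>s\<bar>) ^ nat \<lceil>N\<rceil>"
    proof -
      have "(1 + \<bar>s\<bar>) powr N \<le> (1 + \<bar>s\<bar>) powr real (nat \<lceil>N\<rceil>)" by (intro powr_mono) linarith+
      also have "\<dots> = (1 + \<bar>s\<bar>) ^ nat \<lceil>N\<rceil>" by (intro powr_realpow) auto
      finally show ?thesis .
    qed
    have "cmod (k z (r z * t) (s / r z)) \<le> c * lam z powr \<mu> * (1 + \<bar>t\<bar>) powr M * (1 + \<bar>s\<bar>) powr N"
      using c[OF z, of "r z * t" "s / r z"] by (simp only: 1 2)
    also have "\<dots> \<le> \<bar>c\<bar> * lam z powr \<mu> * (1 + \<bar>t\<bar>) powr M * (1 + \<bar>s\<bar>) ^ nat \<lceil>N\<rceil>"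
      by (intro mult_mono 3) auto
    finally show ?thesis .
  qed
  then show ?thesis by (intro exI[of _ "\<bar>c\<bar>"]) auto
qed

lemma dilated_integrable:
  assumes k: "C \<mu> M N k" and z: "z \<in> Z" and g: "g \<in> schwartz"
  shows "integrable lborel (\<lambda>s. k z (r z * t) (s / r z) * g s)"
    "continuous_on UNIV (\<lambda>s. k z (r z * t) (s / r z))"
    "((\<lambda>s. k z (r z * t) (s / r z) * g s) \<longlongrightarrow> 0) at_top" "((\<lambda>s. k z (r z * t) (s / r z) * g s) \<longlongrightarrow> 0) at_bot"
proof -
  obtain c where c: "\<And>z t s. z \<in> Z \<Longrightarrow> cmod (k z (r z * t) (s / r z)) \<le>
    c * lam z powr \<mu> * (1 + \<bar>t\<bar>) powr M * (1 + \<bar>s\<bar>) ^ nat \<lceil>N\<rceil>"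
    using dilated_bound[OF k] by blast
  show co: "continuous_on UNIV (\<lambda>s. k z (r z * t) (s / r z))"
    using cont[OF k z, of "r z * t"] r_pos[OF z]
    by (intro continuous_on_compose2[of UNIV "k z (r z * t)" UNIV "\<lambda>s. s / r z"]) (auto intro!: continuous_intros)
  show "integrable lborel (\<lambda>s. k z (r z * t) (s / r z) * g s)"
    by (rule schwartz_kernel_bound(1)[OF g borel_measurable_continuous_onI[OF co] c[OF z]])
  show "((\<lambda>s. k z (r z * t) (s / r z) * g s) \<longlongrightarrow> 0) at_top" "((\<lambda>s. k z (r z * t) (s / r z) * g s) \<longlongrightarrow> 0) at_bot"
    by (rule schwartz_lim[OF g c[OF z]])+
qed

text \<open>Induction on a natural number above \<open>M + j\<close>. At 0 the growth |t|^j is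
  already compensated by the weight of exponent \<open>M\<close>; otherwise one partial integration
  lowers \<open>M\<close> by 1 at the price of one derivative of \<open>g\<close>.\<close>

lemma decay_estimate:
  assumes "C \<mu> M N k"
  shows "\<exists>n c. 0 \<le> c \<and> (\<forall>z\<in>Z. \<forall>g\<in>schwartz. \<forall>t.
    \<bar>t\<bar> ^ j * cmod (LBINT s. k z (r z * t) (s / r z) * g s) \<le> c * lam z powr \<mu> * schwartz_norm n g)"
proof -
  have "M + j \<le> real (nat \<lceil>M + j\<rceil>)" by linarith
  then obtain p :: nat where "M + j \<le> real p" by blast
  with assms show ?thesis
  proof (induction p arbitrary: \<mu> M k)
    case 0
    obtain c where c: "0 \<le> c" "\<And>z t s. z \<in> Z \<Longrightarrow> cmod (k z (r z * t) (s / r z)) \<le>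
      c * lam z powr \<mu> * (1 + \<bar>t\<bar>) powr M * (1 + \<bar>s\<bar>) ^ nat \<lceil>N\<rceil>"
      using dilated_bound[OF 0(1)] by blast
    define K where "K = 2 ^ (nat \<lceil>N\<rceil> + 3) * (LBINT s::real. 1 / (1 + s\<^sup>2))"
    have K: "0 \<le> K" unfolding K_def by (intro mult_nonneg_nonneg integral_nonneg) (auto simp: add_nonneg_nonneg)
    have "\<bar>t\<bar> ^ j * cmod (LBINT s. k z (r z * t) (s / r z) * g s) \<le> (c * K) * lam z powr \<mu> * schwartz_norm (nat \<lceil>N\<rceil> + 2) g"
      if z: "z \<in> Z" and g: "g \<in> schwartz" for z g t
    proof -
      have "(\<bar>t\<bar> ^ j) * (1 + \<bar>t\<bar>) powr M \<le> (1 + \<bar>t\<bar>) ^ j * (1 + \<bar>t\<bar>) powr M"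
        by (intro mult_right_mono power_mono) auto
      also have "\<dots> = (1 + \<bar>t\<bar>) powr (M + j)"
        by (simp add: powr_add powr_realpow add_pos_nonneg)
      also have "\<dots> \<le> (1 + \<bar>t\<bar>) powr 0" using 0(2) by (intro powr_mono) auto
      finally have 1: "(\<bar>t\<bar> ^ j) * (1 + \<bar>t\<bar>) powr M \<le> 1" by (simp add: add_nonneg_eq_0_iff)
      have "cmod (LBINT s. k z (r z * t) (s / r z) * g s) \<le> c * lam z powr \<mu> * (1 + \<bar>t\<bar>) powr M * K * schwartz_norm (nat \<lceil>N\<rceil> + 2) g"
        unfolding K_def
        by (rule schwartz_kernel_bound(2)[OF g borel_measurable_continuous_onI[OF dilated_integrable(2)[OF 0(1) z g]] c(2)[OF z]])
      then have "\<bar>t\<bar> ^ j * cmod (LBINT s. k z (r z * t) (s / r z) * g s) \<le>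
         \<bar>t\<bar> ^ j * (c * lam z powr \<mu> * (1 + \<bar>t\<bar>) powr M * K * schwartz_norm (nat \<lceil>N\<rceil> + 2) g)"
        by (rule mult_left_mono) simp
      also have "\<dots> = ((\<bar>t\<bar> ^ j) * (1 + \<bar>t\<bar>) powr M) * (c * lam z powr \<mu> * K * schwartz_norm (nat \<lceil>N\<rceil> + 2) g)"
        by (simp add: mult_ac)
      also have "\<dots> \<le> 1 * (c * lam z powr \<mu> * K * schwartz_norm (nat \<lceil>N\<rceil> + 2) g)"
        by (intro mult_right_mono 1) (use c K schwartz_norm_nonneg[OF g] in auto)
      finally show ?thesis by (simp add: mult_ac)
    qed
    then show ?case using c K by (intro exI[of _ "nat \<lceil>N\<rceil> + 2"] exI[of _ "c * K"]) auto
  next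
    case (Suc p)
    obtain k1 k2 where k: "C \<mu> (M - 1) N k1" "C (\<mu> + \<tau>) (M - 1) N k2"
      "\<And>z t s. z \<in> Z \<Longrightarrow> ((\<lambda>s. k2 z t s) has_vector_derivative k z t s - k1 z t s) (at s)"
      using dec[OF Suc.prems(1)] by blast
    have M: "M - 1 + j \<le> real p" using Suc.prems by simp
    obtain n1 c1 where c1: "0 \<le> c1" "\<And>z g t. z \<in> Z \<Longrightarrow> g \<in> schwartz \<Longrightarrow>
      \<bar>t\<bar> ^ j * cmod (LBINT s. k1 z (r z * t) (s / r z) * g s) \<le> c1 * lam z powr \<mu> * schwartz_norm n1 g"
      using Suc.IH[OF k(1) M] by blast
    obtain n2 c2 where c2: "0 \<le> c2" "\<And>z g t. z \<in> Z \<Longrightarrow> g \<in> schwartz \<Longrightarrow>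
      \<bar>t\<bar> ^ j * cmod (LBINT s. k2 z (r z * t) (s / r z) * g s) \<le> c2 * lam z powr (\<mu> + \<tau>) * schwartz_norm n2 g"
      using Suc.IH[OF k(2) M] by blast
    define n where "n = max n1 (n2 + 1)"
    define c where "c = c1 + c2 * (n2 + 1)\<^sup>2"
    have "\<bar>t\<bar> ^ j * cmod (LBINT s. k z (r z * t) (s / r z) * g s) \<le> c * lam z powr \<mu> * schwartz_norm n g"
      if z: "z \<in> Z" and g: "g \<in> schwartz" for z g t
    proof -
      let ?k = "\<lambda>s. k z (r z * t) (s / r z)" and ?k1 = "\<lambda>s. k1 z (r z * t) (s / r z)" and ?k2 = "\<lambda>s. k2 z (r z * t) (s / r z)"
      note i = dilated_integrable[OF Suc.prems(1) z g, of t] dilated_integrable[OF k(1) z g, of t]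
        dilated_integrable[OF k(2) z schwartz_iter_deriv[OF g, of 1], of t] dilated_integrable[OF k(2) z g, of t]
      \<comment> \<open>The factor \<open>r z\<close> cancels the inverse factor that the chain rule
        produces in the dilated argument. In the estimate it reduces the order
        \<open>\<mu> + \<tau>\<close> of \<open>k2\<close> to \<open>\<mu>\<close>.\<close>
      have "(LBINT s. (?k s * g s - ?k1 s * g s) + r z *\<^sub>R (?k2 s * iter_deriv 1 g s)) = 0"
      proof (rule integral_derivative_zero[where F = "\<lambda>s. r z *\<^sub>R (?k2 s * g s)"])
        fix s
        have "((\<lambda>s. s / r z) has_vector_derivative 1 / r z) (at s)"
          using DERIV_cdivide[OF DERIV_ident, of "r z" s] by (simp add: has_real_derivative_iff_has_vector_derivative)
        from vector_diff_chain_at[OF this k(3)[OF z]]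
        have 1: "(?k2 has_vector_derivative (1 / r z) *\<^sub>R (?k s - ?k1 s)) (at s)" by (simp add: o_def)
        have "((\<lambda>s. r z *\<^sub>R (?k2 s * g s)) has_vector_derivative r z *\<^sub>R (?k2 s * iter_deriv 1 g s + (1 / r z) *\<^sub>R (?k s - ?k1 s) * g s)) (at s)"
          using iter_deriv_vector_derivative[OF g, of 0 s]
          by (intro bounded_linear.has_vector_derivative[OF bounded_linear_scaleR_right] has_vector_derivative_mult 1) simp
        moreover have "r z *\<^sub>R (?k2 s * iter_deriv 1 g s + (1 / r z) *\<^sub>R (?k s - ?k1 s) * g s) = (?k s * g s - ?k1 s * g s) + r z *\<^sub>R (?k2 s * iter_deriv 1 g s)"
          using r_pos[OF z] by (simp add: scaleR_add_right algebra_simps)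
        ultimately show "((\<lambda>s. r z *\<^sub>R (?k2 s * g s)) has_vector_derivative (?k s * g s - ?k1 s * g s) + r z *\<^sub>R (?k2 s * iter_deriv 1 g s)) (at s)"
          by (simp only:)
      next
        show "continuous_on UNIV (\<lambda>s. (?k s * g s - ?k1 s * g s) + r z *\<^sub>R (?k2 s * iter_deriv 1 g s))"
          using iter_deriv_continuous[OF g, of 0] iter_deriv_continuous[OF g, of 1] by (intro continuous_intros i) auto
        show "integrable lborel (\<lambda>s. (?k s * g s - ?k1 s * g s) + r z *\<^sub>R (?k2 s * iter_deriv 1 g s))"
          by (intro Bochner_Integration.integrable_add Bochner_Integration.integrable_diff integrable_scaleR_right i)
        show "((\<lambda>s. r z *\<^sub>R (?k2 s * g s)) \<longlongrightarrow> 0) at_top" "((\<lambda>s. r z *\<^sub>R (?k2 s * g s)) \<longlongrightarrow> 0) at_bot"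
          using tendsto_scaleR[OF tendsto_const[of "r z"] i(15)] tendsto_scaleR[OF tendsto_const[of "r z"] i(16)] by simp_all
      qed
      then have "(LBINT s. ?k s * g s) - (LBINT s. ?k1 s * g s) + r z *\<^sub>R (LBINT s. ?k2 s * iter_deriv 1 g s) = 0"
        using i(1,5,9)
        by (simp add: Bochner_Integration.integral_add Bochner_Integration.integral_diff integrable_scaleR_right Bochner_Integration.integrable_diff)
      then have "(LBINT s. ?k s * g s) = (LBINT s. ?k1 s * g s) - r z *\<^sub>R (LBINT s. ?k2 s * iter_deriv 1 g s)"
        by (simp add: algebra_simps eq_diff_eq)
      then have "cmod (LBINT s. ?k s * g s) \<le> cmod (LBINT s. ?k1 s * g s) + r z * cmod (LBINT s. ?k2 s * iter_deriv 1 g s)"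
        using norm_triangle_ineq4[of "LBINT s. ?k1 s * g s" "r z *\<^sub>R (LBINT s. ?k2 s * iter_deriv 1 g s)"] r_pos[OF z] by simp
      then have "\<bar>t\<bar> ^ j * cmod (LBINT s. ?k s * g s) \<le> \<bar>t\<bar> ^ j * (cmod (LBINT s. ?k1 s * g s) + r z * cmod (LBINT s. ?k2 s * iter_deriv 1 g s))"
        by (rule mult_left_mono) simp
      also have "\<dots> = \<bar>t\<bar> ^ j * cmod (LBINT s. ?k1 s * g s) + r z * (\<bar>t\<bar> ^ j * cmod (LBINT s. ?k2 s * iter_deriv 1 g s))"
        by (simp add: algebra_simps)
      also have "\<dots> \<le> c1 * lam z powr \<mu> * schwartz_norm n1 g + r z * (c2 * lam z powr (\<mu> + \<tau>) * schwartz_norm n2 (iter_deriv 1 g))"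
        using less_imp_le[OF r_pos[OF z]] by (intro add_mono mult_left_mono c1(2)[OF z g] c2(2)[OF z schwartz_iter_deriv[OF g]])
      also have "r z * (c2 * lam z powr (\<mu> + \<tau>) * schwartz_norm n2 (iter_deriv 1 g)) = c2 * lam z powr \<mu> * schwartz_norm n2 (iter_deriv 1 g)"
      proof -
        have "r z * lam z powr (\<mu> + \<tau>) = lam z powr (- \<tau> + (\<mu> + \<tau>))" by (rule powr_add[symmetric])
        then have "r z * lam z powr (\<mu> + \<tau>) = lam z powr \<mu>" by simp
        then show ?thesis by (metis mult.assoc mult.left_commute)
      qed
      also have "c1 * lam z powr \<mu> * schwartz_norm n1 g + \<dots> \<le> c1 * lam z powr \<mu> * schwartz_norm n g + c2 * lam z powr \<mu> * ((n2 + 1)\<^sup>2 * schwartz_norm n g)"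
      proof (intro add_mono mult_left_mono)
        show "schwartz_norm n1 g \<le> schwartz_norm n g" unfolding n_def by (rule schwartz_norm_mono[OF g]) simp
        have "schwartz_norm n2 (iter_deriv 1 g) \<le> (n2 + 1)\<^sup>2 * schwartz_norm (n2 + 1) g" using schwartz_norm_iter_deriv_1[OF g, of n2] by (simp add: add.commute)
        also have "\<dots> \<le> (n2 + 1)\<^sup>2 * schwartz_norm n g" unfolding n_def by (intro mult_left_mono schwartz_norm_mono[OF g]) auto
        finally show "schwartz_norm n2 (iter_deriv 1 g) \<le> (n2 + 1)\<^sup>2 * schwartz_norm n g" .
      qed (use c1 c2 in auto)
      also have "\<dots> = c * lam z powr \<mu> * schwartz_norm n g" by (simp add: c_def algebra_simps)
      finally show ?thesis .
    qed
    moreover have "0 \<le> c" using c1 c2 by (simp add: c_def)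
    ultimately show ?case by blast
  qed
qed

end

section \<open>Weighted bounds on derivatives, stable under products and inverses\<close>

section \<open>Weighted symbol classes\<close>

text \<open>Each derivative in a basis direction \<open>v\<close> multiplies the admissible weight
  by \<open>\<omega> v\<close>. Recursion over the order instead of over lists of directions makes
  products and inverses accessible to plain induction.\<close>

primrec weight_class :: "nat \<Rightarrow> 'a::euclidean_space set \<Rightarrow> ('a \<Rightarrow> 'a \<Rightarrow> real) \<Rightarrow> ('a \<Rightarrow> real) \<Rightarrow> ('a \<Rightarrow> 'b::real_normed_field) \<Rightarrow> bool" where
  "weight_class 0 D \<omega> U f \<longleftrightarrow> (\<exists>c. \<forall>p\<in>D. norm (f p) \<le> c * U p)"
| "weight_class (Suc k) D \<omega> U f \<longleftrightarrow> (\<exists>c. \<forall>p\<in>D. norm (f p) \<le> c * U p) \<and> (\<forall>p\<in>D. f differentiable (at p)) \<and>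
     (\<forall>v\<in>Basis. weight_class k D \<omega> (\<lambda>p. \<omega> v p * U p) (pd v f))"

lemma weight_class_bound: "weight_class k D \<omega> U f \<Longrightarrow> \<exists>c. \<forall>p\<in>D. norm (f p) \<le> c * U p"
  by (cases k) auto

lemma weight_class_decrease: "weight_class (Suc k) D \<omega> U f \<Longrightarrow> weight_class k D \<omega> U f"
  by (induction k arbitrary: U f) auto

lemma weight_class_cong:
  assumes "open D" "\<And>p. p \<in> D \<Longrightarrow> f p = g p"
  shows "weight_class k D \<omega> U f \<Longrightarrow> weight_class k D \<omega> U g"
  using assms(2)
proof (induction k arbitrary: U f g)
  case (Suc k)
  have "weight_class k D \<omega> (\<lambda>p. \<omega> v p * U p) (pd v g)" if "v \<in> Basis" for v
  proof (rule Suc.IH[of _ "pd v f"])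
    show "pd v f p = pd v g p" if "p \<in> D" for p
      by (rule differentiable_cong_open(2)[OF assms(1) that Suc.prems(2)])
  qed (use Suc.prems that in simp)
  moreover have "g differentiable (at p)" if "p \<in> D" for p
    using differentiable_cong_open(1)[OF assms(1) that, of f g] Suc.prems that by auto
  ultimately show ?case using Suc.prems by simp
qed simp

lemma weight_class_weight:
  assumes "0 \<le> C" "\<And>p. p \<in> D \<Longrightarrow> U p \<le> C * U' p" "\<And>v p. v \<in> Basis \<Longrightarrow> p \<in> D \<Longrightarrow> 0 \<le> \<omega> v p" "\<And>p. p \<in> D \<Longrightarrow> 0 \<le> U p"
  shows "weight_class k D \<omega> U f \<Longrightarrow> weight_class k D \<omega> U' f"
  using assms(2,4)
proof (induction k arbitrary: U U' f)
  have *: "\<exists>c. \<forall>p\<in>D. norm (f p) \<le> c * U' p"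
    if f: "\<exists>c. \<forall>p\<in>D. norm (f p) \<le> c * U p" and U: "\<And>p. p \<in> D \<Longrightarrow> U p \<le> C * U' p" "\<And>p. p \<in> D \<Longrightarrow> 0 \<le> U p" for U U' f
  proof -
    obtain c where c: "\<And>p. p \<in> D \<Longrightarrow> norm (f p) \<le> c * U p" using f by blast
    have "norm (f p) \<le> (\<bar>c\<bar> * C) * U' p" if "p \<in> D" for p
    proof -
      have "c * U p \<le> \<bar>c\<bar> * U p" using U(2)[OF that] by (intro mult_right_mono) auto
      also have "\<dots> \<le> \<bar>c\<bar> * (C * U' p)" using U(1)[OF that] by (intro mult_left_mono) auto
      finally show ?thesis using c[OF that] by simp
    qed
    then show ?thesis by blast
  qed
  {
    case 0
    show ?case unfolding weight_class.simps by (rule *[OF 0(1)[unfolded weight_class.simps] 0(2,3)])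
  next
    case (Suc k)
    have "weight_class k D \<omega> (\<lambda>p. \<omega> v p * U' p) (pd v f)" if "v \<in> Basis" for v
    proof (rule Suc.IH[of "\<lambda>p. \<omega> v p * U p"])
      fix p assume p: "p \<in> D"
      show "\<omega> v p * U p \<le> C * (\<omega> v p * U' p)"
        using mult_left_mono[OF Suc.prems(2)[OF p] assms(3)[OF that p]] by (simp add: mult_ac)
      show "0 \<le> \<omega> v p * U p" using assms(3)[OF that p] Suc.prems(3)[OF p] by simp
    qed (use Suc.prems that in simp)
    moreover have "\<exists>c. \<forall>p\<in>D. norm (f p) \<le> c * U' p"
      by (rule *[OF _ Suc.prems(2,3)]) (use Suc.prems(1) in simp_all)
    ultimately show ?case using Suc.prems(1) by simp
  }
qed

lemma weight_class_zero: "weight_class k D \<omega> U (\<lambda>p. 0)"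
  by (induction k arbitrary: U) (auto intro: exI[of _ 0])

lemma pd_add: "f differentiable (at p) \<Longrightarrow> g differentiable (at p) \<Longrightarrow> pd v (\<lambda>x. f x + g x) p = pd v f p + pd v g p"
  by (intro pd_eqI has_derivative_add frechet_derivative_works[THEN iffD1])

lemma pd_mult:
  fixes f g :: "'a::euclidean_space \<Rightarrow> 'b::real_normed_field"
  shows "f differentiable (at p) \<Longrightarrow> g differentiable (at p) \<Longrightarrow> pd v (\<lambda>x. f x * g x) p = pd v f p * g p + f p * pd v g p"
  using pd_eqI[OF has_derivative_mult[OF frechet_derivative_works[THEN iffD1] frechet_derivative_works[THEN iffD1]], of f p g v]
  by (simp add: add.commute)

lemma pd_inverse:
  fixes f :: "'a::euclidean_space \<Rightarrow> 'b::real_normed_field"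
  shows "f differentiable (at p) \<Longrightarrow> f p \<noteq> 0 \<Longrightarrow> pd v (\<lambda>x. inverse (f x)) p = - (pd v f p) * (inverse (f p) * inverse (f p))"
    "f differentiable (at p) \<Longrightarrow> f p \<noteq> 0 \<Longrightarrow> (\<lambda>x. inverse (f x)) differentiable (at p)"
proof -
  assume f: "f differentiable (at p)" "f p \<noteq> 0"
  have *: "((\<lambda>x. inverse (f x)) has_derivative (\<lambda>h. - (inverse (f p) * frechet_derivative f (at p) h * inverse (f p)))) (at p)"
    by (rule Deriv.has_derivative_inverse[OF f(2) frechet_derivative_works[THEN iffD1, OF f(1)]])
  show "pd v (\<lambda>x. inverse (f x)) p = - (pd v f p) * (inverse (f p) * inverse (f p))"
    using pd_eqI[OF *, of v] by simp
  show "(\<lambda>x. inverse (f x)) differentiable (at p)" using * unfolding differentiable_def by blast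
qed

lemma weight_class_add:
  assumes "open D"
  shows "weight_class k D \<omega> U f \<Longrightarrow> weight_class k D \<omega> U g \<Longrightarrow> weight_class k D \<omega> U (\<lambda>p. f p + g p)"
proof (induction k arbitrary: U f g)
  have *: "\<exists>c. \<forall>p\<in>D. norm (f p + g p) \<le> c * U p"
    if f: "\<exists>c. \<forall>p\<in>D. norm (f p) \<le> c * U p" and g: "\<exists>c. \<forall>p\<in>D. norm (g p) \<le> c * U p" for f g :: "'a \<Rightarrow> 'b" and U
  proof -
    obtain c c' where "\<forall>p\<in>D. norm (f p) \<le> c * U p" "\<forall>p\<in>D. norm (g p) \<le> c' * U p" using f g by blast
    then have "\<forall>p\<in>D. norm (f p + g p) \<le> (c + c') * U p"
      by (auto simp: distrib_right intro!: norm_triangle_le add_mono)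
    then show ?thesis by blast
  qed
  {
    case 0
    then show ?case using * by simp
  next
    case (Suc k)
    have "weight_class k D \<omega> (\<lambda>p. \<omega> v p * U p) (pd v (\<lambda>p. f p + g p))" if "v \<in> Basis" for v
      by (rule weight_class_cong[OF assms _ Suc.IH[of _ "pd v f" "pd v g"]]) (use Suc.prems that in \<open>auto simp: pd_add\<close>)
    then show ?case using Suc.prems * by (auto intro: differentiable_add)
  }
qed

lemma weight_class_mult:
  assumes "open D" "\<And>v p. v \<in> Basis \<Longrightarrow> p \<in> D \<Longrightarrow> 0 \<le> \<omega> v p"
  shows "weight_class k D \<omega> U f \<Longrightarrow> weight_class k D \<omega> U' g \<Longrightarrow> weight_class k D \<omega> (\<lambda>p. U p * U' p) (\<lambda>p. f p * g p)"
proof (induction k arbitrary: U U' f g)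
  have *: "\<exists>c. \<forall>p\<in>D. norm (f p * g p) \<le> c * (U p * U' p)"
    if f: "\<exists>c. \<forall>p\<in>D. norm (f p) \<le> c * U p" and g: "\<exists>c. \<forall>p\<in>D. norm (g p) \<le> c * U' p" for f g :: "'a \<Rightarrow> 'b" and U U'
  proof -
    obtain c c' where c: "\<And>p. p \<in> D \<Longrightarrow> norm (f p) \<le> c * U p" "\<And>p. p \<in> D \<Longrightarrow> norm (g p) \<le> c' * U' p" using f g by blast
    have "norm (f p * g p) \<le> (c * c') * (U p * U' p)" if "p \<in> D" for p
      using mult_mono[OF c(1)[OF that] c(2)[OF that] order_trans[OF norm_ge_zero c(1)[OF that]] norm_ge_zero]
      by (simp add: norm_mult mult_ac)
    then show ?thesis by blast
  qed
  {
    case 0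
    then show ?case using * by simp
  next
    case (Suc k)
    have "weight_class k D \<omega> (\<lambda>p. \<omega> v p * (U p * U' p)) (pd v (\<lambda>p. f p * g p))" if v: "v \<in> Basis" for v
    proof -
      have 1: "weight_class k D \<omega> (\<lambda>p. (\<omega> v p * U p) * U' p) (\<lambda>p. pd v f p * g p)"
        using Suc.prems(1) v by (intro Suc.IH weight_class_decrease[OF Suc.prems(2)]) simp
      have 2: "weight_class k D \<omega> (\<lambda>p. U p * (\<omega> v p * U' p)) (\<lambda>p. f p * pd v g p)"
        using Suc.prems(2) v by (intro Suc.IH weight_class_decrease[OF Suc.prems(1)]) simp
      have e: "(\<lambda>p. (\<omega> v p * U p) * U' p) = (\<lambda>p. \<omega> v p * (U p * U' p))" "(\<lambda>p. U p * (\<omega> v p * U' p)) = (\<lambda>p. \<omega> v p * (U p * U' p))"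
        by (auto simp: mult_ac)
      show ?thesis
        by (rule weight_class_cong[OF assms(1) _ weight_class_add[OF assms(1) 1[unfolded e] 2[unfolded e]]]) (use Suc.prems in \<open>auto simp: pd_mult\<close>)
    qed
    then show ?case using Suc.prems * by (auto intro: differentiable_mult)
  }
qed

text \<open>The derivative of 1 / f is - f' (1 / f)^2. Order k + 1 for the inverse thus comes from
  order k for the inverse and order k + 1 for \<open>f\<close>, which is why \<open>f\<close> is
  assumed to belong to the class of every order.\<close>

lemma weight_class_inverse:
  assumes D: "open D" "\<And>v p. v \<in> Basis \<Longrightarrow> p \<in> D \<Longrightarrow> 0 \<le> \<omega> v p"
    and f: "\<And>k. weight_class k D \<omega> U f" and c: "0 < c" "\<And>p. p \<in> D \<Longrightarrow> c * U p \<le> norm (f p)" and U: "\<And>p. p \<in> D \<Longrightarrow> 0 < U p"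
  shows "weight_class k D \<omega> (\<lambda>p. inverse (U p)) (\<lambda>p. inverse (f p))"
proof (induction k)
  have nz: "f p \<noteq> 0" if "p \<in> D" for p
    using c(2)[OF that] mult_pos_pos[OF c(1) U[OF that]] by auto
  have "norm (inverse (f p)) \<le> inverse c * inverse (U p)" if "p \<in> D" for p
  proof -
    have "inverse (norm (f p)) \<le> inverse (c * U p)"
      using c(2)[OF that] mult_pos_pos[OF c(1) U[OF that]] by (intro le_imp_inverse_le)
    then show ?thesis by (simp add: norm_inverse inverse_mult_distrib)
  qed
  then have b: "\<exists>c. \<forall>p\<in>D. norm (inverse (f p)) \<le> c * inverse (U p)" by blast
  {
    case 0
    show ?case using b by simp
  next
    case (Suc k)
    have "weight_class k D \<omega> (\<lambda>p. \<omega> v p * inverse (U p)) (pd v (\<lambda>p. inverse (f p)))" if v: "v \<in> Basis" for v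
    proof -
      have f': "weight_class k D \<omega> (\<lambda>p. \<omega> v p * U p) (pd v f)" using f[of "Suc k"] v by simp
      have m: "weight_class k D \<omega> (\<lambda>p. 1) (\<lambda>p. -1 :: 'b)"
        by (cases k) (auto intro!: exI[of _ 1] weight_class_zero)
      from weight_class_mult[OF D weight_class_mult[OF D m f'] weight_class_mult[OF D Suc.IH Suc.IH]]
      have 1: "weight_class k D \<omega> (\<lambda>p. 1 * (\<omega> v p * U p) * (inverse (U p) * inverse (U p))) (\<lambda>p. -1 * pd v f p * (inverse (f p) * inverse (f p)))" .
      have 2: "weight_class k D \<omega> (\<lambda>p. \<omega> v p * inverse (U p)) (\<lambda>p. -1 * pd v f p * (inverse (f p) * inverse (f p)))"
        by (rule weight_class_weight[OF zero_le_one _ D(2) _ 1]) (use U D(2)[OF v] in \<open>auto simp: field_simps less_imp_le\<close>)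
      show ?thesis
        by (rule weight_class_cong[OF D(1) _ 2]) (use f[of "Suc k"] nz in \<open>auto simp: pd_inverse(1)\<close>)
    qed
    moreover have "\<forall>p\<in>D. (\<lambda>p. inverse (f p)) differentiable (at p)"
      using f[of "Suc k"] nz by (auto intro: pd_inverse(2))
    ultimately show ?case using b by simp
  }
qed

text \<open>Entry into the recursive class from bounds on all iterated derivatives, which is the
  form that homogeneity and the definition of \<open>symbols\<close> provide.\<close>

lemma sigI:
  fixes f :: "'a::euclidean_space \<Rightarrow> 'b::real_normed_field" and D :: "'a set"
  assumes f: "partials_on D f"
    and b: "\<And>vs :: 'a list. set vs \<subseteq> Basis \<Longrightarrow> \<exists>c. \<forall>p\<in>D. norm (dirs vs f p) \<le> c * (prod_list (map (\<lambda>v. \<omega> v p) vs) * U p)"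
  shows "weight_class k D \<omega> U f"
proof -
  have "\<And>vs :: 'a list. set vs \<subseteq> Basis \<Longrightarrow> weight_class k D \<omega> (\<lambda>p. prod_list (map (\<lambda>v. \<omega> v p) vs) * U p) (dirs vs f)"
  proof (induction k)
    case (Suc k)
    have "weight_class k D \<omega> (\<lambda>p. \<omega> v p * (prod_list (map (\<lambda>v. \<omega> v p) vs) * U p)) (pd v (dirs vs f))" if "v \<in> Basis" for v
      using Suc.IH[of "v # vs"] Suc.prems that by (simp add: mult.assoc)
    then show ?case
      using b Suc.prems partials_onD[OF f] by auto
  qed (use b in simp)
  from this[of "[]"] show ?thesis by simp
qed

section \<open>Oscillatory kernels and the denominators of the partial integrations\<close>

section \<open>Oscillatory kernels\<close>

abbreviation lam :: "'m::finite rn \<times> 'm rn \<Rightarrow> real" where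
  "lam p \<equiv> japanese (fst (snd p))"

text \<open>The directions of x_n and of xi_n; in kernels these variables are called
  \<open>t\<close> and \<open>s\<close>.\<close>

abbreviation et :: "'m::finite rn \<times> 'm rn" where "et \<equiv> ((0, 1), 0)"
abbreviation es :: "'m::finite rn \<times> 'm rn" where "es \<equiv> (0, (0, 1))"

text \<open>The power of <xi'> that one derivative costs in the rescaled variables: 1 for x_n, -1
  for each covariable and 0 for x'. Among basis vectors, \<open>et\<close> is the only one whose
  component \<open>snd (fst v)\<close> is not 0.\<close>

definition ordw :: "'m::finite rn \<times> 'm rn \<Rightarrow> real" where
  "ordw v = snd (fst v) - (if snd v = 0 then 0 else 1)"

definition \<omega> :: "'m::finite rn \<times> 'm rn \<Rightarrow> 'm rn \<times> 'm rn \<Rightarrow> real" where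
  "\<omega> v p = lam p powr ordw v"

text \<open>The weight has order \<open>\<mu>\<close> in \<open>\<langle>\<xi>'\<rangle>\<close>, and \<open>M\<close> and \<open>N\<close> are the orders in the rescaled
  variables \<open>\<langle>\<xi>'\<rangle> x\<^sub>n\<close> and \<open>\<xi>\<^sub>n / \<langle>\<xi>'\<rangle>\<close>, which are the ones that the group action leaves
  on the kernel.\<close>

definition wt :: "real \<Rightarrow> real \<Rightarrow> real \<Rightarrow> 'm::finite rn \<times> 'm rn \<Rightarrow> real" where
  "wt \<mu> M N p = lam p powr \<mu> * (1 + lam p * \<bar>snd (fst p)\<bar>) powr M * (1 + \<bar>snd (snd p)\<bar> / lam p) powr N"

lemma et_es_Basis: "et \<in> Basis" "es \<in> Basis"
  by (auto simp: Basis_prod_def)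

lemma ordw_et_es [simp]: "ordw et = 1" "ordw es = - 1"
  by (auto simp: ordw_def zero_prod_def)

lemma base_pos: "0 < 1 + lam p * \<bar>snd (fst p)\<bar>" "0 < 1 + \<bar>snd (snd p)\<bar> / lam p"
  using japanese_pos[of "fst (snd p)"] by (auto intro!: add_pos_nonneg)

lemma wt_pos: "0 < wt \<mu> M N p"
  unfolding wt_def using base_pos[of p] japanese_pos[of "fst (snd p)"] by (intro mult_pos_pos) auto

lemma wt_0: "wt 0 0 0 p = 1"
  using base_pos[of p, THEN less_imp_neq] japanese_pos[of "fst (snd p)"] by (simp add: wt_def)

lemma \<omega>_pos: "0 < \<omega> v p"
  unfolding \<omega>_def using japanese_pos[of "fst (snd p)"] by simp

lemma \<omega>_wt: "(\<lambda>p. \<omega> v p * wt \<mu> M N p) = wt (\<mu> + ordw v) M N"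
  by (auto simp: wt_def \<omega>_def powr_add mult_ac)

lemma wt_wt: "(\<lambda>p. wt \<mu> M N p * wt \<mu>' M' N' p) = wt (\<mu> + \<mu>') (M + M') (N + N')"
  by (auto simp: wt_def powr_add mult_ac)

lemma inverse_wt: "(\<lambda>p. inverse (wt \<mu> M N p)) = wt (- \<mu>) (- M) (- N)"
  by (auto simp: wt_def powr_minus inverse_mult_distrib)

lemma wt_mono: "\<mu> \<le> \<mu>' \<Longrightarrow> M \<le> M' \<Longrightarrow> N \<le> N' \<Longrightarrow> wt \<mu> M N p \<le> wt \<mu>' M' N' p"
  unfolding wt_def using japanese_ge_1[of "fst (snd p)"] by (intro mult_mono powr_mono) auto

definition Sym :: "('m::finite rn \<times> 'm rn) set \<Rightarrow> real \<Rightarrow> real \<Rightarrow> real \<Rightarrow> ('m rn \<times> 'm rn \<Rightarrow> complex) \<Rightarrow> bool" where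
  "Sym D \<mu> M N f \<longleftrightarrow> (\<forall>k. weight_class k D \<omega> (wt \<mu> M N) f)"

context
  fixes D :: "('m::finite rn \<times> 'm rn) set" assumes D: "open D"
begin

lemma Sym_cong: "Sym D \<mu> M N f \<Longrightarrow> (\<And>p. p \<in> D \<Longrightarrow> f p = g p) \<Longrightarrow> Sym D \<mu> M N g"
  unfolding Sym_def using weight_class_cong[OF D] by blast

lemma Sym_mono: "Sym D \<mu> M N f \<Longrightarrow> \<mu> \<le> \<mu>' \<Longrightarrow> M \<le> M' \<Longrightarrow> N \<le> N' \<Longrightarrow> Sym D \<mu>' M' N' f"
  unfolding Sym_def
  by (intro allI weight_class_weight[of 1 D "wt \<mu> M N" "wt \<mu>' M' N'" \<omega>])
    (auto intro: wt_mono less_imp_le[OF \<omega>_pos] less_imp_le[OF wt_pos])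

lemma Sym_add: "Sym D \<mu> M N f \<Longrightarrow> Sym D \<mu> M N g \<Longrightarrow> Sym D \<mu> M N (\<lambda>p. f p + g p)"
  unfolding Sym_def using weight_class_add[OF D] by blast

lemma Sym_mult: "Sym D \<mu> M N f \<Longrightarrow> Sym D \<mu>' M' N' g \<Longrightarrow> Sym D (\<mu> + \<mu>') (M + M') (N + N') (\<lambda>p. f p * g p)"
  unfolding Sym_def wt_wt[symmetric] by (intro allI weight_class_mult[OF D less_imp_le[OF \<omega>_pos]]) auto

lemma Sym_inverse:
  assumes "Sym D \<mu> M N f" "0 < c" "\<And>p. p \<in> D \<Longrightarrow> c * wt \<mu> M N p \<le> cmod (f p)"
  shows "Sym D (- \<mu>) (- M) (- N) (\<lambda>p. inverse (f p))"
  unfolding Sym_def inverse_wt[symmetric]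
  using assms(1) by (intro allI weight_class_inverse[OF D less_imp_le[OF \<omega>_pos] _ assms(2,3) wt_pos]) (auto simp: Sym_def)

lemma Sym_pd: "Sym D \<mu> M N f \<Longrightarrow> v \<in> Basis \<Longrightarrow> Sym D (\<mu> + ordw v) M N (pd v f)"
proof (unfold Sym_def \<omega>_wt[symmetric], intro allI)
  fix k assume "\<forall>k. weight_class k D \<omega> (wt \<mu> M N) f" "v \<in> Basis"
  then have "weight_class (Suc k) D \<omega> (wt \<mu> M N) f" by blast
  then show "weight_class k D \<omega> (\<lambda>p. \<omega> v p * wt \<mu> M N p) (pd v f)" using \<open>v \<in> Basis\<close> by simp
qed

lemma Sym_differentiable: "Sym D \<mu> M N f \<Longrightarrow> p \<in> D \<Longrightarrow> f differentiable (at p)"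
  unfolding Sym_def by (drule spec[of _ "Suc 0"]) simp

lemma Sym_bound: "Sym D \<mu> M N f \<Longrightarrow> \<exists>c. \<forall>p\<in>D. cmod (f p) \<le> c * wt \<mu> M N p"
  unfolding Sym_def using weight_class_bound by blast

lemma Sym_zero: "Sym D \<mu> M N (\<lambda>p. 0)"
  unfolding Sym_def using weight_class_zero by blast

lemma Sym_const: "Sym D 0 0 0 (\<lambda>p. c)"
  unfolding Sym_def
proof
  fix k show "weight_class k D \<omega> (wt 0 0 0) (\<lambda>p. c)"
    by (cases k) (auto simp: wt_0 intro!: exI[of _ "cmod c"] weight_class_zero)
qed

lemma Sym_cmult: "Sym D \<mu> M N f \<Longrightarrow> Sym D \<mu> M N (\<lambda>p. c * f p)"
  using Sym_mult[OF Sym_const[of c], of \<mu> M N f] by simp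

lemma Sym_sum: "finite A \<Longrightarrow> (\<And>a. a \<in> A \<Longrightarrow> Sym D \<mu> M N (f a)) \<Longrightarrow> Sym D \<mu> M N (\<lambda>p. \<Sum>a\<in>A. f a p)"
  by (induction A rule: finite_induct) (auto intro: Sym_zero Sym_add)

text \<open>The square of <xi'> is a polynomial in xi', so no root has to be differentiated. It is
  the only power of <xi'> in the denominators below.\<close>

lemma Sym_lam2: "Sym D 2 0 0 (\<lambda>p. of_real ((lam p)\<^sup>2))"
proof -
  have lin: "Sym D 1 0 0 (\<lambda>p. of_real (fst (snd p) \<bullet> b))" if b: "b \<in> Basis" for b :: "real ^ 'm"
    unfolding Sym_def
  proof
    fix k
    have d: "((\<lambda>p. complex_of_real (fst (snd p) \<bullet> b)) has_derivative (\<lambda>v. of_real (fst (snd v) \<bullet> b))) (at p)" for p :: "'m rn \<times> 'm rn"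
      by (auto intro!: derivative_eq_intros)
    have pd: "pd v (\<lambda>p. complex_of_real (fst (snd p) \<bullet> b)) = (\<lambda>p. of_real (fst (snd v) \<bullet> b))" for v :: "'m rn \<times> 'm rn"
      using pd_eqI[OF d] by auto
    have "cmod (of_real (fst (snd p) \<bullet> b)) \<le> 1 * wt 1 0 0 p" for p :: "'m rn \<times> 'm rn"
    proof -
      have "\<bar>fst (snd p) \<bullet> b\<bar> \<le> norm (fst (snd p))" using Basis_le_norm[OF b] .
      also have "\<dots> \<le> lam p" unfolding japanese_def by (simp add: real_le_rsqrt)
      finally show ?thesis using base_pos[of p] japanese_pos[of "fst (snd p)"] by (simp add: wt_def less_imp_neq[symmetric])
    qed
    moreover have "weight_class k D \<omega> (wt (1 + ordw v) 0 0) (\<lambda>p. complex_of_real (fst (snd v) \<bullet> b))" if "v \<in> Basis" for v k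
    proof (cases "snd v = 0")
      case True
      then show ?thesis by (simp add: weight_class_zero)
    next
      case False
      then have "ordw v = - 1" using that by (auto simp: ordw_def Basis_prod_def)
      then show ?thesis using Sym_const unfolding Sym_def by simp
    qed
    ultimately show "weight_class k D \<omega> (wt 1 0 0) (\<lambda>p. complex_of_real (fst (snd p) \<bullet> b))"
    proof (cases k)
      case (Suc k')
      have "(\<lambda>p. complex_of_real (fst (snd p) \<bullet> b)) differentiable (at p)" for p :: "'m rn \<times> 'm rn"
        using d unfolding differentiable_def by blast
      then show ?thesis
        unfolding Suc weight_class.simps pd \<omega>_wt
        using \<open>\<And>p. cmod (of_real (fst (snd p) \<bullet> b)) \<le> 1 * wt 1 0 0 p\<close>
          \<open>\<And>v k. v \<in> Basis \<Longrightarrow> weight_class k D \<omega> (wt (1 + ordw v) 0 0) (\<lambda>p. complex_of_real (fst (snd v) \<bullet> b))\<close> by blast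
    next
      case 0
      show ?thesis unfolding 0 weight_class.simps
        using \<open>\<And>p. cmod (of_real (fst (snd p) \<bullet> b)) \<le> 1 * wt 1 0 0 p\<close> by blast
    qed
  qed
  have eq: "complex_of_real ((lam p)\<^sup>2) = 1 + (\<Sum>b\<in>Basis. of_real (fst (snd p) \<bullet> b) * of_real (fst (snd p) \<bullet> b))" for p :: "'m rn \<times> 'm rn"
  proof -
    have "(lam p)\<^sup>2 = 1 + fst (snd p) \<bullet> fst (snd p)"
      by (simp add: japanese_def add_nonneg_nonneg power2_norm_eq_inner)
    also have "\<dots> = 1 + (\<Sum>b\<in>Basis. (fst (snd p) \<bullet> b) * (fst (snd p) \<bullet> b))" by (subst euclidean_inner) simp
    finally show ?thesis by simp
  qed
  have 1: "Sym D 2 0 0 (\<lambda>p. 1)" by (rule Sym_mono[OF Sym_const]) auto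
  have 2: "Sym D 2 0 0 (\<lambda>p. \<Sum>b\<in>Basis. of_real (fst (snd p) \<bullet> b) * of_real (fst (snd p) \<bullet> b))"
    using Sym_mult[OF lin lin] by (intro Sym_sum) auto
  show ?thesis using Sym_add[OF 1 2] by (simp only: eq)
qed

end

text \<open>\<open>B\<close> is a set of points x', \<open>O'\<close> the part of the collar over it
  on which the phase is controlled, \<open>S0\<close> the support of the amplitude. The phase is
  complex valued so that \<open>Sym\<close> applies to it, and \<open>unimodular\<close> takes the
  place of its being real. The two lower bounds concern the denominators of the partial integrations
  in xi_n and in x_n.\<close>

locale oscillatory =
  fixes B :: "(real ^ 'm::finite) set" and O' S0 :: "'m rn set" and \<Phi> :: "'m rn \<times> 'm rn \<Rightarrow> complex" and c0 :: real
  assumes B: "open B" and O': "open O'" and S0: "closed S0" and sub: "x \<in> S0 \<Longrightarrow> fst x \<in> B \<Longrightarrow> x \<in> O'"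
    and OB: "x \<in> O' \<Longrightarrow> fst x \<in> B"
    and \<Phi>: "Sym (O' \<times> UNIV) 0 1 1 \<Phi>" "Sym (O' \<times> UNIV) (-1) 1 0 (pd es \<Phi>)" "Sym (O' \<times> UNIV) 1 0 1 (pd et \<Phi>)"
    and unimodular: "p \<in> O' \<times> UNIV \<Longrightarrow> cmod (exp (\<i> * \<Phi> p)) = 1"
    and c0: "0 < c0"
    and lower_s: "p \<in> O' \<times> UNIV \<Longrightarrow> c0 * wt 0 2 0 p \<le> cmod (1 + of_real ((lam p)\<^sup>2) * (pd es \<Phi> p)\<^sup>2)"
    and lower_t: "p \<in> O' \<times> UNIV \<Longrightarrow> c0 * wt 2 0 2 p \<le> cmod (of_real ((lam p)\<^sup>2) + 1 * (pd et \<Phi> p)\<^sup>2)"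
begin

abbreviation D :: "('m rn \<times> 'm rn) set" where "D \<equiv> O' \<times> UNIV"
abbreviation E :: "('m rn \<times> 'm rn) set" where "E \<equiv> {p. fst (fst p) \<in> B}"

lemma D: "open D"
  by (intro open_Times O') simp

lemma D_sub: "D \<subseteq> E"
  using OB by auto

text \<open>The kernel is considered for all x_n, although the phase is controlled only on
  \<open>D\<close>. Over the rest of \<open>E\<close> the amplitude vanishes, so the values of
  \<open>\<Phi>\<close> there are irrelevant.\<close>

definition Kclass :: "real \<Rightarrow> real \<Rightarrow> real \<Rightarrow> ('m rn \<times> 'm rn \<Rightarrow> complex) \<Rightarrow> bool" where
  "Kclass \<mu> M N k \<longleftrightarrow> (\<exists>b. Sym D \<mu> M N b \<and> (\<forall>p. fst p \<notin> S0 \<longrightarrow> b p = 0) \<and> (\<forall>p\<in>E. k p = exp (\<i> * \<Phi> p) * b p))"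

lemma E_cases:
  assumes "p \<in> E"
  obtains "p \<in> D" | "p \<notin> D" "fst p \<notin> S0"
proof -
  obtain x \<xi> where "p = (x, \<xi>)" by (cases p)
  then show thesis using that assms sub[of x] by auto
qed

lemma open_off: "open (E \<inter> (- S0) \<times> UNIV)"
proof -
  have "continuous_on UNIV (\<lambda>p :: 'm rn \<times> 'm rn. fst (fst p))" by (intro continuous_intros)
  from open_vimage[OF B this] have "open E" by (simp add: vimage_def)
  then show ?thesis using S0 by (intro open_Int open_Times) auto
qed

lemma exp_derivative:
  assumes "p \<in> D" "Sym D \<mu> M N b"
  shows "(\<lambda>p. exp (\<i> * \<Phi> p) * b p) differentiable (at p)"
    "pd v (\<lambda>p. exp (\<i> * \<Phi> p) * b p) p = exp (\<i> * \<Phi> p) * (pd v b p + \<i> * pd v \<Phi> p * b p)"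
proof -
  have \<Phi>': "(\<Phi> has_derivative frechet_derivative \<Phi> (at p)) (at p)"
    using Sym_differentiable[OF D \<Phi>(1) assms(1)] by (simp add: frechet_derivative_works)
  have b': "(b has_derivative frechet_derivative b (at p)) (at p)"
    using Sym_differentiable[OF D assms(2,1)] by (simp add: frechet_derivative_works)
  have "((\<lambda>p. \<i> * \<Phi> p) has_derivative (\<lambda>h. \<i> * frechet_derivative \<Phi> (at p) h)) (at p)"
    by (rule has_derivative_mult_right[OF \<Phi>'])
  from has_derivative_compose[OF this DERIV_exp[of "\<i> * \<Phi> p", unfolded has_field_derivative_def]]
  have e: "((\<lambda>p. exp (\<i> * \<Phi> p)) has_derivative (\<lambda>h. exp (\<i> * \<Phi> p) * (\<i> * frechet_derivative \<Phi> (at p) h))) (at p)" .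
  note d = has_derivative_mult[OF e b']
  show "(\<lambda>p. exp (\<i> * \<Phi> p) * b p) differentiable (at p)" using d unfolding differentiable_def by blast
  show "pd v (\<lambda>p. exp (\<i> * \<Phi> p) * b p) p = exp (\<i> * \<Phi> p) * (pd v b p + \<i> * pd v \<Phi> p * b p)"
    using pd_eqI[OF d, of v] by (simp add: algebra_simps)
qed

text \<open>\<open>E\<close> is covered by two open sets: \<open>D\<close>, and the complement of
  the support. The case distinction makes the new amplitude vanish off \<open>S0\<close>, as
  \<open>Kclass\<close> demands, even where the derivative of \<open>\<Phi>\<close> is not
  controlled; on \<open>D\<close> it has no effect.\<close>

lemma kernel_derivative:
  assumes b: "Sym D \<mu> M N b" "\<And>p. fst p \<notin> S0 \<Longrightarrow> b p = 0" and k: "\<And>p. p \<in> E \<Longrightarrow> k p = exp (\<i> * \<Phi> p) * b p"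
    and p: "p \<in> E"
  shows "k differentiable (at p)"
    "pd v k p = exp (\<i> * \<Phi> p) * (if fst p \<in> S0 then pd v b p + \<i> * pd v \<Phi> p * b p else 0)"
    "p \<in> D \<Longrightarrow> (if fst p \<in> S0 then pd v b p + \<i> * pd v \<Phi> p * b p else 0) = pd v b p + \<i> * pd v \<Phi> p * b p"
proof -
  have zero: "k differentiable (at p)" "pd v k p = 0" "pd v b p = 0" if "fst p \<notin> S0"
  proof -
    have m: "p \<in> E \<inter> (- S0) \<times> UNIV" using that p by (cases p) auto
    have k0: "k x = 0" and b0: "b x = 0" if "x \<in> E \<inter> (- S0) \<times> UNIV" for x
      using b(2)[of x] k[of x] that by (cases x; simp)+
    show "k differentiable (at p)"
      using differentiable_cong_open(1)[OF open_off m k0] by simp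
    show "pd v k p = 0" "pd v b p = 0"
      using differentiable_cong_open(2)[OF open_off m k0, where v = v] differentiable_cong_open(2)[OF open_off m b0, where v = v] by simp_all
  qed
  have onD: "k differentiable (at p) \<and> pd v k p = exp (\<i> * \<Phi> p) * (pd v b p + \<i> * pd v \<Phi> p * b p)" if "p \<in> D"
  proof -
    have e: "k x = exp (\<i> * \<Phi> x) * b x" if "x \<in> D" for x using k[of x] D_sub that by blast
    show ?thesis
      using differentiable_cong_open(1)[OF D that e] differentiable_cong_open(2)[OF D that e, where v = v]
        exp_derivative(1)[OF that b(1)] exp_derivative(2)[OF that b(1), where v = v] by simp
  qed
  show "k differentiable (at p)"
    using p by (cases rule: E_cases) (use onD zero in auto)
  show "p \<in> D \<Longrightarrow> (if fst p \<in> S0 then pd v b p + \<i> * pd v \<Phi> p * b p else 0) = pd v b p + \<i> * pd v \<Phi> p * b p"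
    using zero b by auto
  show "pd v k p = exp (\<i> * \<Phi> p) * (if fst p \<in> S0 then pd v b p + \<i> * pd v \<Phi> p * b p else 0)"
  proof (cases "fst p \<in> S0")
    case True
    then have "p \<in> D" using p sub by (cases p) auto
    then show ?thesis using onD True by simp
  qed (use zero in simp)
qed

text \<open>The worst term arises when the derivative falls on the exponential: it costs one power
  of each rescaled variable, as \<open>\<Phi>\<close> itself has growth of order 1 in both.\<close>

lemma Kclass_pd:
  assumes "Kclass \<mu> M N k" "v \<in> Basis"
  shows "\<And>p. p \<in> E \<Longrightarrow> k differentiable (at p)" "Kclass (\<mu> + ordw v) (M + 1) (N + 1) (pd v k)"
proof -
  obtain b where b: "Sym D \<mu> M N b" "\<And>p. fst p \<notin> S0 \<Longrightarrow> b p = 0" and k: "\<And>p. p \<in> E \<Longrightarrow> k p = exp (\<i> * \<Phi> p) * b p"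
    using assms(1) unfolding Kclass_def by blast
  show "\<And>p. p \<in> E \<Longrightarrow> k differentiable (at p)" by (rule kernel_derivative(1)[OF b k])
  let ?b = "\<lambda>p. if fst p \<in> S0 then pd v b p + \<i> * pd v \<Phi> p * b p else 0"
  have 1: "Sym D (\<mu> + ordw v) (M + 1) (N + 1) (pd v b)"
    by (rule Sym_mono[OF D Sym_pd[OF D b(1) assms(2)]]) auto
  have 2: "Sym D (\<mu> + ordw v) (M + 1) (N + 1) (\<lambda>p. \<i> * pd v \<Phi> p * b p)"
    using Sym_mult[OF D Sym_cmult[OF D Sym_pd[OF D \<Phi>(1) assms(2)], of "\<i>"] b(1)] by (simp add: add.commute)
  have "Sym D (\<mu> + ordw v) (M + 1) (N + 1) ?b"
  proof (rule Sym_cong[OF D Sym_add[OF D 1 2]])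
    show "pd v b p + \<i> * pd v \<Phi> p * b p = ?b p" if "p \<in> D" for p
      by (rule kernel_derivative(3)[symmetric, OF b k]) (use that D_sub in blast)+
  qed
  then show "Kclass (\<mu> + ordw v) (M + 1) (N + 1) (pd v k)"
    unfolding Kclass_def using kernel_derivative(2)[OF b k] by (intro exI[of _ ?b]) auto
qed

lemma Kclass_bound:
  assumes "Kclass \<mu> M N k"
  shows "\<exists>c. \<forall>p\<in>E. cmod (k p) \<le> c * wt \<mu> M N p"
proof -
  obtain b where b: "Sym D \<mu> M N b" "\<And>p. fst p \<notin> S0 \<Longrightarrow> b p = 0" and k: "\<And>p. p \<in> E \<Longrightarrow> k p = exp (\<i> * \<Phi> p) * b p"
    using assms unfolding Kclass_def by blast
  obtain c where c: "\<And>p. p \<in> D \<Longrightarrow> cmod (b p) \<le> c * wt \<mu> M N p" using Sym_bound[OF D b(1)] by blast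
  have "cmod (k p) \<le> \<bar>c\<bar> * wt \<mu> M N p" if "p \<in> E" for p
    using that
  proof (cases rule: E_cases)
    case 1
    have "cmod (k p) = cmod (b p)" using k[OF that] unimodular[OF 1] by (simp add: norm_mult)
    also have "\<dots> \<le> c * wt \<mu> M N p" by (rule c[OF 1])
    also have "\<dots> \<le> \<bar>c\<bar> * wt \<mu> M N p" using wt_pos[of \<mu> M N p] by (intro mult_right_mono) auto
    finally show ?thesis .
  next
    case 2
    then show ?thesis using k[OF that] b wt_pos[of \<mu> M N p] by simp
  qed
  then show ?thesis by blast
qed

text \<open>With \<open>g\<close> the derivative of the phase in the direction \<open>v\<close> and \<open>q = A + w g\<^sup>2\<close>, the
  oscillating factor is \<open>A/q\<close> times itself plus \<open>-\<i> w g/q\<close> times its own derivative.\<close>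

lemma Kclass_decomposition:
  assumes k: "Kclass \<mu> M N k" and v: "v \<in> Basis"
    and q: "\<And>p. p \<in> D \<Longrightarrow> A p + w p * (pd v \<Phi> p)\<^sup>2 \<noteq> 0"
    and A: "\<And>b. Sym D \<mu> M N b \<Longrightarrow> Sym D \<mu> M' N' (\<lambda>p. A p * b p * inverse (A p + w p * (pd v \<Phi> p)\<^sup>2))"
    and w: "\<And>b. Sym D \<mu> M N b \<Longrightarrow> Sym D (\<mu> - ordw v) M' N' (\<lambda>p. w p * pd v \<Phi> p * b p * inverse (A p + w p * (pd v \<Phi> p)\<^sup>2))"
  shows "\<exists>k1 k2. Kclass \<mu> M' N' k1 \<and> Kclass (\<mu> - ordw v) M' N' k2 \<and>
    (\<forall>p\<in>E. k2 differentiable (at p) \<and> pd v k2 p = k p - k1 p)"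
proof -
  obtain b where b: "Sym D \<mu> M N b" "\<And>p. fst p \<notin> S0 \<Longrightarrow> b p = 0" and k: "\<And>p. p \<in> E \<Longrightarrow> k p = exp (\<i> * \<Phi> p) * b p"
    using k unfolding Kclass_def by blast
  let ?q = "\<lambda>p. A p + w p * (pd v \<Phi> p)\<^sup>2"
  define b2 where "b2 = (\<lambda>p. - \<i> * (w p * pd v \<Phi> p * b p * inverse (?q p)))"
  define k2 where "k2 = (\<lambda>p. exp (\<i> * \<Phi> p) * b2 p)"
  define b1 where "b1 = (\<lambda>p. b p - (if fst p \<in> S0 then pd v b2 p + \<i> * pd v \<Phi> p * b2 p else 0))"
  define k1 where "k1 = (\<lambda>p. exp (\<i> * \<Phi> p) * b1 p)"
  have b2: "Sym D (\<mu> - ordw v) M' N' b2" "\<And>p. fst p \<notin> S0 \<Longrightarrow> b2 p = 0"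
    unfolding b2_def by (rule Sym_cmult[OF D w[OF b(1)]]) (simp add: b)
  have k2: "\<And>p. p \<in> E \<Longrightarrow> k2 p = exp (\<i> * \<Phi> p) * b2 p" by (simp add: k2_def)
  note kd = kernel_derivative[OF b2 k2]
  have "Sym D \<mu> M' N' (\<lambda>p. A p * b p * inverse (?q p) + (-1) * pd v b2 p)"
    using Sym_pd[OF D b2(1) v] by (intro Sym_add[OF D] Sym_cmult[OF D] A b) simp
  then have "Sym D \<mu> M' N' b1"
  proof (rule Sym_cong[OF D])
    fix p assume p: "p \<in> D"
    \<comment> \<open>With g the derivative of the phase and q the denominator, b2 = -i w g b / q,
      so the left side is b (1 - w g^2 / q) = A b / q. The derivative of the phase has disappeared
      from the numerator.\<close>
    have "b p - \<i> * pd v \<Phi> p * b2 p = A p * b p * inverse (?q p)"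
      using q[OF p] by (simp add: b2_def divide_inverse[symmetric] field_simps power2_eq_square)
    show "A p * b p * inverse (?q p) + (-1) * pd v b2 p = b1 p"
    proof -
      have "(if fst p \<in> S0 then pd v b2 p + \<i> * pd v \<Phi> p * b2 p else 0) = pd v b2 p + \<i> * pd v \<Phi> p * b2 p"
        by (rule kd(3)) (use p D_sub in auto)
      with \<open>b p - \<i> * pd v \<Phi> p * b2 p = A p * b p * inverse (?q p)\<close> show ?thesis
        unfolding b1_def by (simp add: algebra_simps)
    qed
  qed
  then have "Kclass \<mu> M' N' k1"
    unfolding Kclass_def k1_def b1_def using b by (intro exI[of _ b1]) (auto simp: b1_def)
  moreover have "Kclass (\<mu> - ordw v) M' N' k2"
    unfolding Kclass_def using b2 k2 by blast
  moreover have "k2 differentiable (at p) \<and> pd v k2 p = k p - k1 p" if "p \<in> E" for p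
  proof -
    have "k2 differentiable (at p)" by (rule kd(1)) (use that in auto)
    moreover have "pd v k2 p = exp (\<i> * \<Phi> p) * (if fst p \<in> S0 then pd v b2 p + \<i> * pd v \<Phi> p * b2 p else 0)"
      by (rule kd(2)) (use that in auto)
    ultimately show ?thesis using k[OF that] by (simp add: k1_def b1_def algebra_simps)
  qed
  ultimately show ?thesis by blast
qed

lemma nonzero_of_lower: "0 < c \<Longrightarrow> c * wt \<mu> M N p \<le> cmod z \<Longrightarrow> z \<noteq> 0"
  using mult_pos_pos[OF _ wt_pos, of c \<mu> M N p] by auto

text \<open>The choice is A = 1 and w = <xi'>^2. The denominator gains two powers of <xi'> x_n, and
  the factor w g in \<open>k2\<close> gives one of them back.\<close>

lemma Kclass_dec_s:
  assumes "Kclass \<mu> M N k"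
  shows "\<exists>k1 k2. Kclass \<mu> (M - 1) N k1 \<and> Kclass (\<mu> + 1) (M - 1) N k2 \<and>
    (\<forall>p\<in>E. k2 differentiable (at p) \<and> pd es k2 p = k p - k1 p)"
proof -
  let ?q = "\<lambda>p. 1 + of_real ((lam p)\<^sup>2) * (pd es \<Phi> p)\<^sup>2"
  have w: "Sym D 1 1 0 (\<lambda>p. of_real ((lam p)\<^sup>2) * pd es \<Phi> p)"
    using Sym_mult[OF D Sym_lam2[OF D] \<Phi>(2)] by simp
  have "Sym D 0 2 0 (\<lambda>p. of_real ((lam p)\<^sup>2) * pd es \<Phi> p * pd es \<Phi> p)"
    using Sym_mult[OF D w \<Phi>(2)] by simp
  from Sym_add[OF D Sym_mono[OF D Sym_const[OF D], of 0 2 0 1] this]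
  have "Sym D 0 2 0 ?q" by (simp add: power2_eq_square mult.assoc)
  from Sym_inverse[OF D this c0 lower_s] have q: "Sym D 0 (-2) 0 (\<lambda>p. inverse (?q p))" by simp
  note dec = Kclass_decomposition[OF assms et_es_Basis(2), where A = "\<lambda>p. 1" and w = "\<lambda>p. of_real ((lam p)\<^sup>2)" and M' = "M - 1" and N' = N]
  have "\<exists>k1 k2. Kclass \<mu> (M - 1) N k1 \<and> Kclass (\<mu> - ordw (es :: 'm rn \<times> 'm rn)) (M - 1) N k2 \<and>
    (\<forall>p\<in>E. k2 differentiable (at p) \<and> pd es k2 p = k p - k1 p)"
  proof (rule dec)
    show "?q p \<noteq> 0" if "p \<in> D" for p by (rule nonzero_of_lower[OF c0 lower_s[OF that]])
    fix b assume b: "Sym D \<mu> M N b"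
    show "Sym D \<mu> (M - 1) N (\<lambda>p. 1 * b p * inverse (?q p))"
      using Sym_mono[OF D Sym_mult[OF D b q], of \<mu> "M - 1" N] by simp
    show "Sym D (\<mu> - ordw (es :: 'm rn \<times> 'm rn)) (M - 1) N (\<lambda>p. of_real ((lam p)\<^sup>2) * pd es \<Phi> p * b p * inverse (?q p))"
      using Sym_mult[OF D Sym_mult[OF D w b] q] by (simp add: add.commute)
  qed
  then show ?thesis by simp
qed

text \<open>The choice is A = <xi'>^2 and w = 1, since d phi / d x_n has order 1 in <xi'> and may
  vanish only where |xi_n| is dominated by <xi'>.\<close>

lemma Kclass_dec_t:
  assumes "Kclass \<mu> M N k"
  shows "\<exists>k1 k2. Kclass \<mu> M (N - 1) k1 \<and> Kclass (\<mu> - 1) M (N - 1) k2 \<and>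
    (\<forall>p\<in>E. k2 differentiable (at p) \<and> pd et k2 p = k p - k1 p)"
proof -
  let ?q = "\<lambda>p. of_real ((lam p)\<^sup>2) + 1 * (pd et \<Phi> p)\<^sup>2"
  have "Sym D 2 0 2 (\<lambda>p. pd et \<Phi> p * pd et \<Phi> p)"
    using Sym_mult[OF D \<Phi>(3) \<Phi>(3)] by simp
  from Sym_add[OF D Sym_mono[OF D Sym_lam2[OF D], of 2 0 2] this]
  have "Sym D 2 0 2 ?q" by (simp add: power2_eq_square)
  from Sym_inverse[OF D this c0 lower_t] have q: "Sym D (-2) 0 (-2) (\<lambda>p. inverse (?q p))" by simp
  have "\<exists>k1 k2. Kclass \<mu> M (N - 1) k1 \<and> Kclass (\<mu> - ordw (et :: 'm rn \<times> 'm rn)) M (N - 1) k2 \<and>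
    (\<forall>p\<in>E. k2 differentiable (at p) \<and> pd et k2 p = k p - k1 p)"
  proof (rule Kclass_decomposition[OF assms et_es_Basis(1), where A = "\<lambda>p. of_real ((lam p)\<^sup>2)" and w = "\<lambda>p. 1"])
    show "?q p \<noteq> 0" if "p \<in> D" for p by (rule nonzero_of_lower[OF c0 lower_t[OF that]])
    fix b assume b: "Sym D \<mu> M N b"
    show "Sym D \<mu> M (N - 1) (\<lambda>p. of_real ((lam p)\<^sup>2) * b p * inverse (?q p))"
      using Sym_mono[OF D Sym_mult[OF D Sym_mult[OF D Sym_lam2[OF D] b] q], of \<mu> M "N - 1"] by simp
    show "Sym D (\<mu> - ordw (et :: 'm rn \<times> 'm rn)) M (N - 1) (\<lambda>p. 1 * pd et \<Phi> p * b p * inverse (?q p))"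
      using Sym_mult[OF D Sym_mult[OF D \<Phi>(3) b] q] by (simp add: algebra_simps)
  qed
  then show ?thesis by simp
qed

end

context oscillatory
begin

lemma Kclass_line:
  assumes "Kclass \<mu> M N k" "x \<in> B"
  shows "((\<lambda>t. k ((x, t), (\<xi>, s))) has_vector_derivative pd et k ((x, t), (\<xi>, s))) (at t)"
    "((\<lambda>s. k ((x, t), (\<xi>, s))) has_vector_derivative pd es k ((x, t), (\<xi>, s))) (at s)"
proof -
  have d: "k differentiable (at ((x, t), (\<xi>, s)))" for t s
    using Kclass_pd(1)[OF assms(1) et_es_Basis(1)] assms(2) by simp
  show "((\<lambda>t. k ((x, t), (\<xi>, s))) has_vector_derivative pd et k ((x, t), (\<xi>, s))) (at t)"
    using line_derivative[of k "((x, 0), (\<xi>, s))" t et] d by simp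
  show "((\<lambda>s. k ((x, t), (\<xi>, s))) has_vector_derivative pd es k ((x, t), (\<xi>, s))) (at s)"
    using line_derivative[of k "((x, t), (\<xi>, 0))" s es] d by simp
qed

lemma Kclass_continuous:
  assumes "Kclass \<mu> M N k" "x \<in> B"
  shows "continuous_on UNIV (\<lambda>t. k ((x, t), (\<xi>, s)))" "continuous_on UNIV (\<lambda>s. k ((x, t), (\<xi>, s)))"
  by (intro continuous_at_imp_continuous_on ballI has_vector_derivative_continuous[OF Kclass_line(1)[OF assms]]
      has_vector_derivative_continuous[OF Kclass_line(2)[OF assms]])+

lemma decay_class_s:
  "decay_class (B \<times> UNIV) (\<lambda>z. japanese (snd z)) 1
     (\<lambda>\<mu> M N \<kappa>. \<exists>k. Kclass \<mu> M N k \<and> \<kappa> = (\<lambda>(x, \<xi>) t s. k ((x, t), (\<xi>, s))))"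
proof
  fix \<mu> M N \<kappa> assume "\<exists>k. Kclass \<mu> M N k \<and> \<kappa> = (\<lambda>(x, \<xi>) t s. k ((x, t), (\<xi>, s)))"
  then obtain k where k: "Kclass \<mu> M N k" and \<kappa>: "\<kappa> = (\<lambda>(x, \<xi>) t s. k ((x, t), (\<xi>, s)))" by blast
  obtain c where c: "\<And>p. p \<in> E \<Longrightarrow> cmod (k p) \<le> c * wt \<mu> M N p" using Kclass_bound[OF k] by blast
  have "cmod (k ((x, t), (\<xi>, s))) \<le> c * japanese \<xi> powr \<mu> * (1 + \<bar>t\<bar> * japanese \<xi> powr 1) powr M * (1 + \<bar>s\<bar> * japanese \<xi> powr - 1) powr N"
    if "x \<in> B" for x \<xi> t s
    using c[of "((x, t), (\<xi>, s))"] that japanese_pos[of \<xi>] by (simp add: wt_def powr_minus_divide mult_ac)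
  then show "\<exists>c. \<forall>z\<in>B \<times> UNIV. \<forall>t s. cmod (\<kappa> z t s)
      \<le> c * japanese (snd z) powr \<mu> * (1 + \<bar>t\<bar> * japanese (snd z) powr 1) powr M * (1 + \<bar>s\<bar> * japanese (snd z) powr - 1) powr N"
    unfolding \<kappa> by (intro exI[of _ c]) auto
  show "continuous_on UNIV (\<kappa> z t)" if "z \<in> B \<times> UNIV" for z t
    using Kclass_continuous(2)[OF k, of "fst z" t "snd z"] that by (auto simp: \<kappa>)
  obtain k1 k2 where "Kclass \<mu> (M - 1) N k1" "Kclass (\<mu> + 1) (M - 1) N k2" and d: "\<And>p. p \<in> E \<Longrightarrow> pd es k2 p = k p - k1 p"
    using Kclass_dec_s[OF k] by blast
  then show "\<exists>\<kappa>1 \<kappa>2. (\<exists>k. Kclass \<mu> (M - 1) N k \<and> \<kappa>1 = (\<lambda>(x, \<xi>) t s. k ((x, t), (\<xi>, s)))) \<and>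
      (\<exists>k. Kclass (\<mu> + 1) (M - 1) N k \<and> \<kappa>2 = (\<lambda>(x, \<xi>) t s. k ((x, t), (\<xi>, s)))) \<and>
      (\<forall>z\<in>B \<times> UNIV. \<forall>t s. ((\<lambda>s. \<kappa>2 z t s) has_vector_derivative \<kappa> z t s - \<kappa>1 z t s) (at s))"
    using Kclass_line(2)[of "\<mu> + 1" "M - 1" N k2]
    by (intro exI[of _ "\<lambda>(x, \<xi>) t s. k1 ((x, t), (\<xi>, s))"] exI[of _ "\<lambda>(x, \<xi>) t s. k2 ((x, t), (\<xi>, s))"] conjI exI[of _ k1] exI[of _ k2])
      (auto simp: \<kappa>)
qed (auto intro: japanese_ge_1)

text \<open>Now x_n is integrated and xi_n is the outer variable. The two growth exponents are
  therefore interchanged, and so is the sense of the rescaling, whence -1.\<close>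

lemma decay_class_t:
  "decay_class (B \<times> UNIV) (\<lambda>z. japanese (snd z)) (-1)
     (\<lambda>\<mu> M N \<kappa>. \<exists>k. Kclass \<mu> N M k \<and> \<kappa> = (\<lambda>(x, \<xi>) s t. k ((x, t), (\<xi>, s))))"
proof
  fix \<mu> M N \<kappa> assume "\<exists>k. Kclass \<mu> N M k \<and> \<kappa> = (\<lambda>(x, \<xi>) s t. k ((x, t), (\<xi>, s)))"
  then obtain k where k: "Kclass \<mu> N M k" and \<kappa>: "\<kappa> = (\<lambda>(x, \<xi>) s t. k ((x, t), (\<xi>, s)))" by blast
  obtain c where c: "\<And>p. p \<in> E \<Longrightarrow> cmod (k p) \<le> c * wt \<mu> N M p" using Kclass_bound[OF k] by blast
  have "cmod (k ((x, t), (\<xi>, s))) \<le> c * japanese \<xi> powr \<mu> * (1 + \<bar>s\<bar> * japanese \<xi> powr - 1) powr M * (1 + \<bar>t\<bar> * japanese \<xi> powr - (- 1)) powr N"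
    if "x \<in> B" for x \<xi> t s
    using c[of "((x, t), (\<xi>, s))"] that japanese_pos[of \<xi>] by (simp add: wt_def powr_minus_divide mult_ac)
  then show "\<exists>c. \<forall>z\<in>B \<times> UNIV. \<forall>t s. cmod (\<kappa> z t s)
      \<le> c * japanese (snd z) powr \<mu> * (1 + \<bar>t\<bar> * japanese (snd z) powr - 1) powr M * (1 + \<bar>s\<bar> * japanese (snd z) powr - (- 1)) powr N"
    unfolding \<kappa> by (intro exI[of _ c]) auto
  show "continuous_on UNIV (\<kappa> z t)" if "z \<in> B \<times> UNIV" for z t
    using Kclass_continuous(1)[OF k, of "fst z" "snd z" t] that by (auto simp: \<kappa>)
  obtain k1 k2 where "Kclass \<mu> N (M - 1) k1" "Kclass (\<mu> - 1) N (M - 1) k2" and d: "\<And>p. p \<in> E \<Longrightarrow> pd et k2 p = k p - k1 p"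
    using Kclass_dec_t[OF k] by blast
  then show "\<exists>\<kappa>1 \<kappa>2. (\<exists>k. Kclass \<mu> N (M - 1) k \<and> \<kappa>1 = (\<lambda>(x, \<xi>) s t. k ((x, t), (\<xi>, s)))) \<and>
      (\<exists>k. Kclass (\<mu> + - 1) N (M - 1) k \<and> \<kappa>2 = (\<lambda>(x, \<xi>) s t. k ((x, t), (\<xi>, s)))) \<and>
      (\<forall>z\<in>B \<times> UNIV. \<forall>t s. ((\<lambda>s. \<kappa>2 z t s) has_vector_derivative \<kappa> z t s - \<kappa>1 z t s) (at s))"
    using Kclass_line(1)[of "\<mu> - 1" N "M - 1" k2]
    by (intro exI[of _ "\<lambda>(x, \<xi>) s t. k1 ((x, t), (\<xi>, s))"] exI[of _ "\<lambda>(x, \<xi>) s t. k2 ((x, t), (\<xi>, s))"] conjI exI[of _ k1] exI[of _ k2])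
      (auto simp: \<kappa>)
qed (auto intro: japanese_ge_1)

lemma Kclass_dirs:
  "Kclass \<mu> M N k \<Longrightarrow> set vs \<subseteq> Basis \<Longrightarrow>
    Kclass (\<mu> + sum_list (map ordw vs)) (M + length vs) (N + length vs) (dirs vs k)"
proof (induction vs)
  case (Cons v vs)
  then have "Kclass (\<mu> + sum_list (map ordw vs)) (M + length vs) (N + length vs) (dirs vs k)" "v \<in> Basis" by auto
  from Kclass_pd(2)[OF this] show ?case by (simp add: algebra_simps)
qed simp

end

section \<open>From local oscillatory kernels to operator-valued symbols\<close>

definition dlist :: "'m::finite rn \<times> 'm rn \<Rightarrow> nat \<Rightarrow> (real ^ 'm) list \<Rightarrow> (real ^ 'm) list \<Rightarrow> ('m rn \<times> 'm rn) list" where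
  "dlist e l \<alpha> \<beta> = replicate l e @ map (\<lambda>b. (0, (b, 0))) \<alpha> @ map (\<lambda>b. ((b, 0), 0)) \<beta>"

lemma dlist_Basis:
  assumes "e \<in> Basis" "set \<alpha> \<subseteq> Basis" "set \<beta> \<subseteq> Basis"
  shows "set (dlist e l \<alpha> \<beta>) \<subseteq> Basis"
proof -
  have "(0, (b, 0)) \<in> (Basis :: ('a rn \<times> 'a rn) set)" "((b, 0), 0) \<in> (Basis :: ('a rn \<times> 'a rn) set)" if "b \<in> Basis" for b
    using that by (auto simp: Basis_prod_def)
  then show ?thesis using assms by (auto simp: dlist_def)
qed

lemma dlist_ordw:
  assumes "set \<alpha> \<subseteq> Basis" "set \<beta> \<subseteq> Basis"
  shows "sum_list (map ordw (dlist e l \<alpha> \<beta>)) = l * ordw e - length \<alpha>"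
proof -
  have 1: "sum_list (map ordw (map (\<lambda>b. (0, (b, 0))) \<alpha>)) = - real (length \<alpha>)"
    using assms(1)
  proof (induction \<alpha>)
    case (Cons b \<alpha>)
    then have "b \<noteq> 0" by auto
    then show ?case using Cons by (simp add: ordw_def zero_prod_def)
  qed simp
  have 2: "sum_list (map ordw (map (\<lambda>b. ((b, 0), 0)) \<beta>)) = 0"
    by (induction \<beta>) (auto simp: ordw_def)
  show ?thesis using 1 2 by (simp add: dlist_def sum_list_replicate)
qed

text \<open>Only \<open>K\<close>, its support and its order are global; the set \<open>B\<close>,
  the phase representation and the growth exponent in xi_n may change with the compact set
  \<open>Kc\<close>. A point of \<open>Kc\<close> outside \<open>B\<close> has no support above it,
  so nothing is left to estimate there.\<close>

locale global_kernel =
  fixes K :: "'m::finite rn \<times> 'm rn \<Rightarrow> complex" and S0 :: "'m rn set" and m :: real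
  assumes S0: "closed S0" and K0: "fst p \<notin> S0 \<Longrightarrow> K p = 0"
    and loc: "compact Kc \<Longrightarrow> \<exists>B O' \<Phi> c0 N. oscillatory B O' S0 \<Phi> c0 \<and> oscillatory.Kclass B O' S0 \<Phi> m 0 N K \<and>
      (\<forall>x\<in>Kc. x \<in> B \<or> (\<forall>t. (x, t) \<notin> S0))"
begin

lemma off_S0: "fst p \<notin> S0 \<Longrightarrow> dirs vs K p = 0" "fst p \<notin> S0 \<Longrightarrow> dirs vs K differentiable (at p)"
proof -
  assume p: "fst p \<notin> S0"
  have o: "open ((- S0) \<times> (UNIV :: 'm rn set))" using S0 by (intro open_Times) auto
  have m: "p \<in> (- S0) \<times> UNIV" using p by (cases p) auto
  have K0': "K x = (\<lambda>_. 0) x" if "x \<in> (- S0) \<times> UNIV" for x using K0[of x] that by (cases x) auto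
  have z: "dirs vs (\<lambda>_. 0 :: complex) = (\<lambda>_ :: 'm rn \<times> 'm rn. 0)" for vs by (induction vs) auto
  show "dirs vs K p = 0" using dirs_cong_open[OF o K0' m, where vs = vs] z by simp
  show "dirs vs K differentiable (at p)"
    using differentiable_cong_open(1)[OF o m dirs_cong_open[OF o K0', where vs = vs]] z by simp
qed

lemma partials_K: "partials_on UNIV K"
  unfolding partials_on_def
proof (intro allI impI ballI)
  fix vs :: "('m rn \<times> 'm rn) list" and p :: "'m rn \<times> 'm rn" assume vs: "set vs \<subseteq> Basis"
  obtain B O' \<Phi> c0 N where o: "oscillatory B O' S0 \<Phi> c0" "oscillatory.Kclass B O' S0 \<Phi> m 0 N K"
      "fst (fst p) \<in> B \<or> (\<forall>t. (fst (fst p), t) \<notin> S0)"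
    using loc[of "{fst (fst p)}"] by auto
  interpret oscillatory B O' S0 \<Phi> c0 by (rule o(1))
  show "dirs vs K differentiable (at p)"
  proof (cases "fst (fst p) \<in> B")
    case True
    then show ?thesis using Kclass_pd(1)[OF Kclass_dirs[OF o(2) vs] et_es_Basis(1)] by simp
  next
    case False
    then have "fst p \<notin> S0" using o(3) by (cases "fst p") auto
    then show ?thesis by (rule off_S0(2))
  qed
qed

text \<open>Differentiation puts the new direction at the front of the list, \<open>dlist\<close>
  puts it in its proper block; the two agree because partial derivatives commute.\<close>

lemma dlist_Cons:
  assumes "e \<in> Basis" "set \<alpha> \<subseteq> Basis" "set \<beta> \<subseteq> Basis" "b \<in> Basis"
  shows "pd (0, (b, 0)) (dirs (dlist e l \<alpha> \<beta>) K) p = dirs (dlist e l (b # \<alpha>) \<beta>) K p"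
    "pd ((b, 0), 0) (dirs (dlist e l \<alpha> \<beta>) K) p = dirs (dlist e l \<alpha> (b # \<beta>)) K p"
proof -
  have ab: "set (dlist e l (b # \<alpha>) \<beta>) \<subseteq> Basis" "set (dlist e l \<alpha> (b # \<beta>)) \<subseteq> Basis"
    using assms by (intro dlist_Basis; simp)+
  show "pd (0, (b, 0)) (dirs (dlist e l \<alpha> \<beta>) K) p = dirs (dlist e l (b # \<alpha>) \<beta>) K p"
    using dirs_perm[OF open_UNIV partials_K ab(1), of "(0, (b, 0)) # dlist e l \<alpha> \<beta>" p] by (simp add: dlist_def)
  show "pd ((b, 0), 0) (dirs (dlist e l \<alpha> \<beta>) K) p = dirs (dlist e l \<alpha> (b # \<beta>)) K p"
    using dirs_perm[OF open_UNIV partials_K ab(2), of "((b, 0), 0) # dlist e l \<alpha> \<beta>" p] by (simp add: dlist_def)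
qed

lemma K_derivative:
  assumes ab: "e \<in> Basis" "set \<alpha> \<subseteq> Basis" "set \<beta> \<subseteq> Basis"
  shows "((\<lambda>z. dirs (dlist e l \<alpha> \<beta>) K ((fst z, t), (snd z, s))) has_derivative
     (\<lambda>v. (\<Sum>b\<in>Basis. (fst v \<bullet> b) *\<^sub>R dirs (dlist e l \<alpha> (b # \<beta>)) K ((fst z, t), (snd z, s)))
         + (\<Sum>b\<in>Basis. (snd v \<bullet> b) *\<^sub>R dirs (dlist e l (b # \<alpha>) \<beta>) K ((fst z, t), (snd z, s))))) (at z)"
proof -
  let ?F = "dirs (dlist e l \<alpha> \<beta>) K" and ?p = "\<lambda>z. ((fst z, t), (snd z, s))"
  have F: "?F differentiable (at p)" for p
    by (rule partials_onD[OF partials_K dlist_Basis[OF ab]]) simp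
  have "((\<lambda>z. ?p z) has_derivative (\<lambda>v. ((fst v, 0), (snd v, 0)))) (at z)"
    by (intro has_derivative_Pair has_derivative_fst has_derivative_snd has_derivative_ident has_derivative_const)
  from has_derivative_compose[OF this frechet_derivative_works[THEN iffD1, OF F]]
  have 1: "((\<lambda>z. ?F (?p z)) has_derivative (\<lambda>v. frechet_derivative ?F (at (?p z)) ((fst v, 0), (snd v, 0)))) (at z)" .
  have lin: "linear (frechet_derivative ?F (at (?p z)))" by (rule linear_frechet_derivative[OF F])
  have "frechet_derivative ?F (at (?p z)) ((fst v, 0), (snd v, 0)) =
     (\<Sum>b\<in>Basis. (fst v \<bullet> b) *\<^sub>R pd ((b, 0), 0) ?F (?p z)) + (\<Sum>b\<in>Basis. (snd v \<bullet> b) *\<^sub>R pd (0, (b, 0)) ?F (?p z))" for v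
  proof -
    have "((fst v, 0), (snd v, 0)) = (\<Sum>b\<in>Basis. (fst v \<bullet> b) *\<^sub>R (((b, 0), 0) :: 'm rn \<times> 'm rn)) + (\<Sum>b\<in>Basis. (snd v \<bullet> b) *\<^sub>R (0, (b, 0)))"
      by (simp add: prod_eq_iff fst_sum snd_sum euclidean_representation)
    then show ?thesis by (simp only: linear_add[OF lin] linear_sum[OF lin] linear_scale[OF lin])
  qed
  then have 2: "frechet_derivative ?F (at (?p z)) ((fst v, 0), (snd v, 0)) = (\<Sum>b\<in>Basis. (fst v \<bullet> b) *\<^sub>R dirs (dlist e l \<alpha> (b # \<beta>)) K (?p z))
         + (\<Sum>b\<in>Basis. (snd v \<bullet> b) *\<^sub>R dirs (dlist e l (b # \<alpha>) \<beta>) K (?p z))" for v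
    using dlist_Cons[OF ab] by simp
  show ?thesis using 1 unfolding 2 .
qed

lemma wt_crude:
  assumes "lam p \<le> R"
  shows "wt \<mu> M N p \<le> R powr \<bar>\<mu>\<bar> * (R * (1 + \<bar>snd (fst p)\<bar>)) powr \<bar>M\<bar> * (1 + \<bar>snd (snd p)\<bar>) powr \<bar>N\<bar>"
proof -
  have l: "1 \<le> lam p" by (rule japanese_ge_1)
  have a: "1 + lam p * \<bar>snd (fst p)\<bar> \<le> R * (1 + \<bar>snd (fst p)\<bar>)"
    using assms l mult_right_mono[of "lam p" R "\<bar>snd (fst p)\<bar>"] by (simp add: algebra_simps)
  have b: "\<bar>snd (snd p)\<bar> / lam p \<le> \<bar>snd (snd p)\<bar> / 1" using l by (intro divide_left_mono) auto
  have 1: "lam p powr \<mu> \<le> R powr \<bar>\<mu>\<bar>"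
    using l assms by (intro order_trans[OF powr_mono powr_mono2]) auto
  have 2: "(1 + lam p * \<bar>snd (fst p)\<bar>) powr M \<le> (R * (1 + \<bar>snd (fst p)\<bar>)) powr \<bar>M\<bar>"
    using l a by (intro order_trans[OF powr_mono powr_mono2]) auto
  have 3: "(1 + \<bar>snd (snd p)\<bar> / lam p) powr N \<le> (1 + \<bar>snd (snd p)\<bar>) powr \<bar>N\<bar>"
    using l b by (intro order_trans[OF powr_mono powr_mono2]) auto
  show ?thesis unfolding wt_def by (intro mult_mono 1 2 3) auto
qed

text \<open>Meant for integrability and for differentiation under the integral, where the parameters
  stay bounded. No uniformity in xi' is retained.\<close>

lemma K_bound:
  assumes vs: "set vs \<subseteq> Basis"
  shows "\<exists>C M N. 0 \<le> C \<and> 0 \<le> M \<and> 0 \<le> N \<and> (\<forall>z\<in>cball 0 r. \<forall>t s. cmod (dirs vs K ((fst z, t), (snd z, s)))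
    \<le> C * (1 + \<bar>t\<bar>) powr M * (1 + \<bar>s\<bar>) powr N)"
proof -
  obtain B O' \<Phi> c0 N where o: "oscillatory B O' S0 \<Phi> c0" "oscillatory.Kclass B O' S0 \<Phi> m 0 N K"
      "\<forall>x\<in>cball 0 r. x \<in> B \<or> (\<forall>t. (x, t) \<notin> S0)"
    using loc[of "cball 0 r"] by auto
  interpret oscillatory B O' S0 \<Phi> c0 by (rule o(1))
  obtain c where c: "\<And>p. fst (fst p) \<in> B \<Longrightarrow> cmod (dirs vs K p) \<le> c * wt (m + sum_list (map ordw vs)) (0 + real (length vs)) (N + length vs) p"
    using Kclass_bound[OF Kclass_dirs[OF o(2) vs]] by blast
  define R where "R = sqrt (1 + r\<^sup>2)"
  let ?\<mu> = "m + sum_list (map ordw vs)" and ?M = "0 + real (length vs)" and ?N = "N + length vs"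
  have "cmod (dirs vs K ((fst z, t), (snd z, s))) \<le> (\<bar>c\<bar> * R powr \<bar>?\<mu>\<bar> * R powr \<bar>?M\<bar>) * (1 + \<bar>t\<bar>) powr \<bar>?M\<bar> * (1 + \<bar>s\<bar>) powr \<bar>?N\<bar>"
    if z: "z \<in> cball 0 r" for z t s
  proof (cases "fst z \<in> B")
    case True
    let ?p = "((fst z, t), (snd z, s))"
    have "norm (snd z) \<le> r" "norm (fst z) \<le> r" using z norm_fst_le[of "fst z" "snd z"] norm_snd_le[of "snd z" "fst z"] by auto
    then have R: "lam ?p \<le> R" unfolding R_def japanese_def by (simp add: power_mono)
    have R1: "1 \<le> R" using order_trans[OF japanese_ge_1 R] by simp
    have "cmod (dirs vs K ?p) \<le> c * wt ?\<mu> ?M ?N ?p" using c[of ?p] True by simp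
    also have "\<dots> \<le> \<bar>c\<bar> * (R powr \<bar>?\<mu>\<bar> * (R * (1 + \<bar>snd (fst ?p)\<bar>)) powr \<bar>?M\<bar> * (1 + \<bar>snd (snd ?p)\<bar>) powr \<bar>?N\<bar>)"
      using wt_pos[of ?\<mu> ?M ?N ?p] by (intro mult_mono wt_crude R) auto
    also have "(R * (1 + \<bar>snd (fst ?p)\<bar>)) powr \<bar>?M\<bar> = R powr \<bar>?M\<bar> * (1 + \<bar>t\<bar>) powr \<bar>?M\<bar>"
      using R1 by (simp add: powr_mult)
    finally show ?thesis by (simp add: mult_ac)
  next
    case False
    have "fst z \<in> cball 0 r" using z norm_fst_le[of "fst z" "snd z"] by auto
    then have "dirs vs K ((fst z, t), (snd z, s)) = 0" using o(3) False by (intro off_S0(1)) auto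
    then show ?thesis by simp
  qed
  then show ?thesis
    by (intro exI[of _ "\<bar>c\<bar> * R powr \<bar>?\<mu>\<bar> * R powr \<bar>?M\<bar>"] exI[of _ "\<bar>?M\<bar>"] exI[of _ "\<bar>?N\<bar>"]) auto
qed

lemma powr_le_power: "1 \<le> (x::real) \<Longrightarrow> x powr N \<le> x ^ nat \<lceil>N\<rceil>"
  using powr_mono[of N "real (nat \<lceil>N\<rceil>)" x] by (subst powr_realpow[symmetric]) (auto, linarith)

definition jet :: "nat \<Rightarrow> (real ^ 'm) list \<Rightarrow> (real ^ 'm) list \<Rightarrow> (real ^ 'm) \<times> (real ^ 'm) \<Rightarrow> real \<Rightarrow> real \<Rightarrow> complex" where
  "jet l \<alpha> \<beta> z t s = dirs (dlist et l \<alpha> \<beta>) K ((fst z, t), (snd z, s))"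

text \<open>The outer variable is xi_n here, so the \<open>l\<close> derivatives are taken in the
  direction \<open>es\<close> and the last two arguments change places.\<close>

definition transposed_jet :: "nat \<Rightarrow> (real ^ 'm) list \<Rightarrow> (real ^ 'm) list \<Rightarrow> (real ^ 'm) \<times> (real ^ 'm) \<Rightarrow> real \<Rightarrow> real \<Rightarrow> complex" where
  "transposed_jet l \<alpha> \<beta> z s t = dirs (dlist es l \<alpha> \<beta>) K ((fst z, t), (snd z, s))"

lemma dirs_line:
  assumes "set vs \<subseteq> Basis"
  shows "((\<lambda>t. dirs vs K ((x, t), (\<xi>, s))) has_vector_derivative dirs (et # vs) K ((x, t), (\<xi>, s))) (at t)"
    "((\<lambda>s. dirs vs K ((x, t), (\<xi>, s))) has_vector_derivative dirs (es # vs) K ((x, t), (\<xi>, s))) (at s)"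
proof -
  have d: "dirs vs K differentiable (at p)" for p by (rule partials_onD[OF partials_K assms]) simp
  show "((\<lambda>t. dirs vs K ((x, t), (\<xi>, s))) has_vector_derivative dirs (et # vs) K ((x, t), (\<xi>, s))) (at t)"
    using line_derivative[of "dirs vs K" "((x, 0), (\<xi>, s))" t et] d by simp
  show "((\<lambda>s. dirs vs K ((x, t), (\<xi>, s))) has_vector_derivative dirs (es # vs) K ((x, t), (\<xi>, s))) (at s)"
    using line_derivative[of "dirs vs K" "((x, t), (\<xi>, 0))" s es] d by simp
qed

lemma dlist_Suc: "dlist e (Suc l) \<alpha> \<beta> = e # dlist e l \<alpha> \<beta>"
  by (simp add: dlist_def)

lemma kernel_family_jet: "kernel_family jet 1 m"
proof
  fix \<alpha> \<beta> :: "(real ^ 'm) list" and l assume ab: "set \<alpha> \<subseteq> Basis" "set \<beta> \<subseteq> Basis"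
  note vs = dlist_Basis[OF et_es_Basis(1) ab, of l]
  show "continuous_on UNIV (jet l \<alpha> \<beta> z t)" for z t
    unfolding jet_def[abs_def]
    by (intro continuous_at_imp_continuous_on ballI has_vector_derivative_continuous[OF dirs_line(2)[OF vs]])
  show "((\<lambda>t. jet l \<alpha> \<beta> z t s) has_vector_derivative jet (Suc l) \<alpha> \<beta> z t s) (at t)" for z t s
    unfolding jet_def dlist_Suc by (rule dirs_line(1)[OF vs])
  show "((\<lambda>z. jet l \<alpha> \<beta> z t s) has_derivative (\<lambda>v. (\<Sum>b\<in>Basis. (fst v \<bullet> b) *\<^sub>R jet l \<alpha> (b # \<beta>) z t s)
         + (\<Sum>b\<in>Basis. (snd v \<bullet> b) *\<^sub>R jet l (b # \<alpha>) \<beta> z t s))) (at z)" for z t s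
    unfolding jet_def by (rule K_derivative[OF et_es_Basis(1) ab])
  show "\<exists>C N. \<forall>z\<in>cball 0 r. \<forall>t\<in>{-r..r}. \<forall>s. cmod (jet l \<alpha> \<beta> z t s) \<le> C * (1 + \<bar>s\<bar>) ^ N" for r
  proof -
    obtain C M N where C: "0 \<le> C" "0 \<le> M" "\<And>z t s. z \<in> cball 0 r \<Longrightarrow> cmod (jet l \<alpha> \<beta> z t s) \<le> C * (1 + \<bar>t\<bar>) powr M * (1 + \<bar>s\<bar>) powr N"
      using K_bound[OF vs, of r] unfolding jet_def by blast
    have "cmod (jet l \<alpha> \<beta> z t s) \<le> (C * (1 + \<bar>r\<bar>) powr M) * (1 + \<bar>s\<bar>) ^ nat \<lceil>N\<rceil>" if "z \<in> cball 0 r" "t \<in> {-r..r}" for z t s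
      using that by (intro order_trans[OF C(3)] mult_mono powr_mono2 powr_le_power C) (auto intro!: mult_nonneg_nonneg C)
    then show ?thesis by blast
  qed
  fix Kc :: "(real ^ 'm) set" and j assume kc: "compact Kc"
  obtain B O' \<Phi> c0 N where o: "oscillatory B O' S0 \<Phi> c0" "oscillatory.Kclass B O' S0 \<Phi> m 0 N K"
      "\<forall>x\<in>Kc. x \<in> B \<or> (\<forall>t. (x, t) \<notin> S0)"
    using loc[OF kc] by auto
  interpret oscillatory B O' S0 \<Phi> c0 by (rule o(1))
  \<comment> \<open>The order is exact: \<open>l\<close> from the derivatives in x_n and
    \<open>- length \<alpha>\<close> from those in xi'. The exponents of the rescaled variables may
    grow, since \<open>decay_estimate\<close> accepts any.\<close>
  have KC: "Kclass (m - real (length \<alpha>) + 1 * real l) (0 + length (dlist et l \<alpha> \<beta>)) (N + length (dlist et l \<alpha> \<beta>)) (dirs (dlist et l \<alpha> \<beta>) K)"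
    using Kclass_dirs[OF o(2) vs] by (simp add: dlist_ordw[OF ab] algebra_simps)
  interpret decay_class "B \<times> UNIV" "\<lambda>z. japanese (snd z)" 1
     "\<lambda>\<mu> M N \<kappa>. \<exists>k. Kclass \<mu> M N k \<and> \<kappa> = (\<lambda>(x, \<xi>) t s. k ((x, t), (\<xi>, s)))"
    by (rule decay_class_s)
  have "\<exists>k. Kclass (m - real (length \<alpha>) + 1 * real l) (0 + length (dlist et l \<alpha> \<beta>)) (N + length (dlist et l \<alpha> \<beta>)) k \<and> jet l \<alpha> \<beta> = (\<lambda>(x, \<xi>) t s. k ((x, t), (\<xi>, s)))"
    using KC by (intro exI[of _ "dirs (dlist et l \<alpha> \<beta>) K"]) (auto simp: jet_def fun_eq_iff)
  from decay_estimate[OF this, of j] obtain n c where c: "0 \<le> c" "\<And>z g t. z \<in> B \<times> UNIV \<Longrightarrow> g \<in> schwartz \<Longrightarrow>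
      \<bar>t\<bar> ^ j * cmod (LBINT s. jet l \<alpha> \<beta> z (japanese (snd z) powr - 1 * t) (s / japanese (snd z) powr - 1) * g s)
      \<le> c * japanese (snd z) powr (m - real (length \<alpha>) + 1 * real l) * schwartz_norm n g"
    by blast
  have "\<bar>t\<bar> ^ j * cmod (LBINT s. jet l \<alpha> \<beta> (x, \<xi>) (japanese \<xi> powr - 1 * t) (s / japanese \<xi> powr - 1) * g s)
      \<le> c * japanese \<xi> powr (m - real (length \<alpha>) + 1 * real l) * schwartz_norm n g" if x: "x \<in> Kc" and g: "g \<in> schwartz" for x \<xi> g t
  proof (cases "x \<in> B")
    case True
    then show ?thesis using c(2)[of "(x, \<xi>)" g t] g by simp
  next
    case False
    then have "jet l \<alpha> \<beta> (x, \<xi>) t' s' = 0" for t' s' unfolding jet_def using o(3) x by (intro off_S0(1)) auto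
    then show ?thesis using c(1) schwartz_norm_nonneg[OF g, of n] by simp
  qed
  then show "\<exists>n c. \<forall>x\<in>Kc. \<forall>\<xi>. \<forall>g\<in>schwartz. \<forall>t. \<bar>t\<bar> ^ j * cmod (LBINT s. jet l \<alpha> \<beta> (x, \<xi>) (japanese \<xi> powr - 1 * t) (s / japanese \<xi> powr - 1) * g s)
      \<le> c * japanese \<xi> powr (m - real (length \<alpha>) + 1 * real l) * schwartz_norm n g" by blast
qed

lemma kernel_family_transposed_jet: "kernel_family transposed_jet (-1) m"
proof
  fix \<alpha> \<beta> :: "(real ^ 'm) list" and l assume ab: "set \<alpha> \<subseteq> Basis" "set \<beta> \<subseteq> Basis"
  note vs = dlist_Basis[OF et_es_Basis(2) ab, of l]
  show "continuous_on UNIV (transposed_jet l \<alpha> \<beta> z s)" for z s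
    unfolding transposed_jet_def[abs_def]
    by (intro continuous_at_imp_continuous_on ballI has_vector_derivative_continuous[OF dirs_line(1)[OF vs]])
  show "((\<lambda>s. transposed_jet l \<alpha> \<beta> z s t) has_vector_derivative transposed_jet (Suc l) \<alpha> \<beta> z s t) (at s)" for z t s
    unfolding transposed_jet_def dlist_Suc by (rule dirs_line(2)[OF vs])
  show "((\<lambda>z. transposed_jet l \<alpha> \<beta> z s t) has_derivative (\<lambda>v. (\<Sum>b\<in>Basis. (fst v \<bullet> b) *\<^sub>R transposed_jet l \<alpha> (b # \<beta>) z s t)
         + (\<Sum>b\<in>Basis. (snd v \<bullet> b) *\<^sub>R transposed_jet l (b # \<alpha>) \<beta> z s t))) (at z)" for z t s
    unfolding transposed_jet_def by (rule K_derivative[OF et_es_Basis(2) ab])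
  show "\<exists>C N. \<forall>z\<in>cball 0 r. \<forall>s\<in>{-r..r}. \<forall>t. cmod (transposed_jet l \<alpha> \<beta> z s t) \<le> C * (1 + \<bar>t\<bar>) ^ N" for r
  proof -
    obtain C M N where C: "0 \<le> C" "0 \<le> N" "\<And>z t s. z \<in> cball 0 r \<Longrightarrow> cmod (transposed_jet l \<alpha> \<beta> z s t) \<le> C * (1 + \<bar>t\<bar>) powr M * (1 + \<bar>s\<bar>) powr N"
      using K_bound[OF vs, of r] unfolding transposed_jet_def by blast
    have "cmod (transposed_jet l \<alpha> \<beta> z s t) \<le> (C * (1 + \<bar>t\<bar>) ^ nat \<lceil>M\<rceil>) * (1 + \<bar>r\<bar>) powr N" if "z \<in> cball 0 r" "s \<in> {-r..r}" for z t s
      using that by (intro order_trans[OF C(3)] mult_mono powr_mono2 powr_le_power C) (auto intro!: mult_nonneg_nonneg C)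
    then show ?thesis by (intro exI[of _ "C * (1 + \<bar>r\<bar>) powr N"] exI[of _ "nat \<lceil>M\<rceil>"]) (auto simp: mult_ac)
  qed
  fix Kc :: "(real ^ 'm) set" and j assume kc: "compact Kc"
  obtain B O' \<Phi> c0 N where o: "oscillatory B O' S0 \<Phi> c0" "oscillatory.Kclass B O' S0 \<Phi> m 0 N K"
      "\<forall>x\<in>Kc. x \<in> B \<or> (\<forall>t. (x, t) \<notin> S0)"
    using loc[OF kc] by auto
  interpret oscillatory B O' S0 \<Phi> c0 by (rule o(1))
  have KC: "Kclass (m - real (length \<alpha>) + - 1 * real l) (0 + length (dlist es l \<alpha> \<beta>)) (N + length (dlist es l \<alpha> \<beta>)) (dirs (dlist es l \<alpha> \<beta>) K)"
    using Kclass_dirs[OF o(2) vs] by (simp add: dlist_ordw[OF ab] algebra_simps)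
  interpret decay_class "B \<times> UNIV" "\<lambda>z. japanese (snd z)" "-1"
     "\<lambda>\<mu> M N \<kappa>. \<exists>k. Kclass \<mu> N M k \<and> \<kappa> = (\<lambda>(x, \<xi>) s t. k ((x, t), (\<xi>, s)))"
    by (rule decay_class_t)
  have "\<exists>k. Kclass (m - real (length \<alpha>) + - 1 * real l) (0 + length (dlist es l \<alpha> \<beta>)) (N + length (dlist es l \<alpha> \<beta>)) k \<and> transposed_jet l \<alpha> \<beta> = (\<lambda>(x, \<xi>) s t. k ((x, t), (\<xi>, s)))"
    using KC by (intro exI[of _ "dirs (dlist es l \<alpha> \<beta>) K"]) (auto simp: transposed_jet_def fun_eq_iff)
  from decay_estimate[OF this, of j] obtain n c where c: "0 \<le> c" "\<And>z g t. z \<in> B \<times> UNIV \<Longrightarrow> g \<in> schwartz \<Longrightarrow>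
      \<bar>t\<bar> ^ j * cmod (LBINT s. transposed_jet l \<alpha> \<beta> z (japanese (snd z) powr - (- 1) * t) (s / japanese (snd z) powr - (- 1)) * g s)
      \<le> c * japanese (snd z) powr (m - real (length \<alpha>) + - 1 * real l) * schwartz_norm n g"
    by blast
  have "\<bar>t\<bar> ^ j * cmod (LBINT s. transposed_jet l \<alpha> \<beta> (x, \<xi>) (japanese \<xi> powr - (- 1) * t) (s / japanese \<xi> powr - (- 1)) * g s)
      \<le> c * japanese \<xi> powr (m - real (length \<alpha>) + - 1 * real l) * schwartz_norm n g" if x: "x \<in> Kc" and g: "g \<in> schwartz" for x \<xi> g t
  proof (cases "x \<in> B")
    case True
    then show ?thesis using c(2)[of "(x, \<xi>)" g t] g by simp
  next
    case False
    then have "transposed_jet l \<alpha> \<beta> (x, \<xi>) t' s' = 0" for t' s' unfolding transposed_jet_def using o(3) x by (intro off_S0(1)) auto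
    then show ?thesis using c(1) schwartz_norm_nonneg[OF g, of n] by simp
  qed
  then show "\<exists>n c. \<forall>x\<in>Kc. \<forall>\<xi>. \<forall>g\<in>schwartz. \<forall>t. \<bar>t\<bar> ^ j * cmod (LBINT s. transposed_jet l \<alpha> \<beta> (x, \<xi>) (japanese \<xi> powr - (- 1) * t) (s / japanese \<xi> powr - (- 1)) * g s)
      \<le> c * japanese \<xi> powr (m - real (length \<alpha>) + - 1 * real l) * schwartz_norm n g" by blast
qed

text \<open>Group actions matter only at positive parameters, where the real powers
  \<open>j powr - 1\<close> and \<open>j powr 1\<close> simplify to \<open>1 / j\<close> and
  \<open>j\<close>.\<close>

lemma op_family_\<kappa>_cong:
  assumes "\<And>j. 0 < j \<Longrightarrow> \<kappa>1 j = \<kappa>1' j" "\<And>j. 0 < j \<Longrightarrow> \<kappa>2 j = \<kappa>2' j"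
  shows "op_family F \<kappa>1 \<kappa>2 m D \<Longrightarrow> op_family F \<kappa>1' \<kappa>2' m D"
  unfolding op_family_def by (simp only: assms[OF japanese_pos])

text \<open>On the Fourier side both actions are dilations by \<open>1 / j\<close>. Composition with
  \<open>fourier\<close> changes the right one into dilation by \<open>j\<close>, the normalisation
  that \<open>op_symbols\<close> prescribes.\<close>

theorem schwartz_operator:
  "(\<lambda>z u t. LBINT s. K ((fst z, t), (snd z, s)) * fourier u s) \<in> op_symbols schwartz_space dilate m"
proof -
  interpret kernel_family jet 1 m by (rule kernel_family_jet)
  have "op_family schwartz_space (\<lambda>j. dilate (1 / j)) (\<lambda>j. dilate (1 / j)) m (I 0)"
    by (rule op_family_\<kappa>_cong[OF _ _ op_family_I]) (auto simp: powr_minus_divide)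
  from op_family_comp_right[OF this _ equicont_fourier, of dilate]
  have "op_family schwartz_space (\<lambda>j. dilate (1 / j)) dilate m (\<lambda>\<alpha> \<beta> z u. I 0 \<alpha> \<beta> z (fourier u))"
    using lin_on_fourier fourier_dilate by simp
  from lc_space.op_family_op_symbols[OF schwartz_lc this[unfolded schwartz_space_eq]]
  show ?thesis by (simp add: schwartz_space_eq I_def[abs_def] jet_def dlist_def)
qed

text \<open>The transposed kernel acts on Schwartz functions of x_n and yields functions of xi_n.
  Its transpose on the strong dual, preceded by the Fourier transform of distributions, is the
  operator in question.\<close>

theorem tempered_operator:
  "(\<lambda>z T f. if f \<in> schwartz then tempered_fourier T (\<lambda>s. LBINT t. K ((fst z, t), (snd z, s)) * f t) else 0)
     \<in> op_symbols tempered_space tempered_dilate m"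
proof -
  interpret kernel_family transposed_jet "-1" m by (rule kernel_family_transposed_jet)
  interpret S: lc_space schwartz schwartz_seminorms by (rule schwartz_lc)
  have S_E: "S.E = schwartz_space" by (rule schwartz_space_eq[symmetric])
  have 1: "op_family schwartz_space dilate dilate m (I 0)"
    by (rule op_family_\<kappa>_cong[OF _ _ op_family_I]) auto
  have 2: "op_family tempered_space (\<lambda>r T f. T (dilate r f)) (\<lambda>r T f. T (dilate r f)) m
      (\<lambda>\<alpha> \<beta> z T f. if f \<in> schwartz then T (I 0 \<alpha> \<beta> z f) else 0)"
    unfolding tempered_space_def S_E[symmetric]
    by (rule S.op_family_transpose[OF 1[folded S_E]]) (auto simp: schwartz_dilate_iff lin_on_dilate)
  have F: "equicont tempered_space {()} (\<lambda>_. tempered_fourier)"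
    using S.equicont_transpose[OF equicont_fourier[folded S_E] lin_on_fourier]
    by (simp add: tempered_space_def S_E tempered_fourier_def[abs_def])
  have "op_family tempered_space (\<lambda>r T f. T (dilate r f)) tempered_dilate m
      (\<lambda>\<alpha> \<beta> z T f. if f \<in> schwartz then tempered_fourier T (I 0 \<alpha> \<beta> z f) else 0)"
  proof (rule op_family_comp_right[OF 2 _ F])
    show "lin_on (topspace tempered_space) tempered_fourier"
      by (auto simp: lin_on_def tempered_fourier_def)
    show "tempered_fourier (tempered_dilate r T) = (\<lambda>f. tempered_fourier T (dilate r f))" if "0 < r" for r T
      using that by (auto simp: tempered_fourier_def tempered_dilate_def schwartz_dilate_iff fourier_dilate)
  qed
  then have "op_family tempered_space (\<lambda>r. tempered_dilate (1 / r)) tempered_dilate m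
      (\<lambda>\<alpha> \<beta> z T f. if f \<in> schwartz then tempered_fourier T (I 0 \<alpha> \<beta> z f) else 0)"
    by (rule op_family_\<kappa>_cong[rotated 2]) (auto simp: tempered_dilate_def)
  from lc_space.op_family_op_symbols[OF S.strong_dual_lc this[unfolded tempered_space_def S_E[symmetric] S.strong_dual_eq]]
  moreover have "I 0 [] [] = (\<lambda>z f s. LBINT t. K ((fst z, t), (snd z, s)) * f t)"
    by (intro ext) (simp add: I_def transposed_jet_def dlist_def)
  ultimately show ?thesis
    by (simp only: tempered_space_def S_E[symmetric] S.strong_dual_eq)
qed

end

section \<open>What preservation of the boundary means for the phase function\<close>

section \<open>Boundary behaviour of the phase function\<close>

lemma tangential_derivative_zero:
  fixes f :: "'a::euclidean_space \<Rightarrow> 'b::real_normed_vector"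
  assumes "f differentiable (at p)" "0 < \<delta>" "\<And>s. \<bar>s\<bar> < \<delta> \<Longrightarrow> f (p + s *\<^sub>R v) = 0"
  shows "pd v f p = 0"
proof -
  have 1: "((\<lambda>s. f (p + s *\<^sub>R v)) has_vector_derivative pd v f p) (at 0)"
    using line_derivative[of f p 0 v] assms(1) by simp
  have "((\<lambda>s. 0) has_vector_derivative pd v f p) (at (0::real))"
    by (rule has_vector_derivative_transform_within_open[OF 1, of "{-\<delta><..<\<delta>}"]) (use assms in auto)
  then show ?thesis
    using has_vector_derivative_const vector_derivative_at by (metis vector_derivative_const_at)
qed

lemma pd_slice:
  fixes \<psi> :: "'a::euclidean_space \<times> 'b::euclidean_space \<Rightarrow> real"
  assumes "\<psi> differentiable (at (x, \<xi>))"
  shows "frechet_derivative (\<lambda>\<eta>. \<psi> (x, \<eta>)) (at \<xi>) v = pd (0, v) \<psi> (x, \<xi>)"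
proof -
  have "((\<lambda>\<eta>. (x, \<eta>)) has_derivative (\<lambda>h. (0, h))) (at \<xi>)"
    by (intro has_derivative_Pair has_derivative_ident has_derivative_const)
  from has_derivative_compose[OF this frechet_derivative_works[THEN iffD1, OF assms]]
  show ?thesis by (rule pd_eqI)
qed

lemma snd_grad:
  fixes \<psi> :: "'m::finite rn \<times> 'm rn \<Rightarrow> real"
  assumes "\<psi> differentiable (at (x, \<xi>))"
  shows "snd (grad (\<lambda>\<eta>. \<psi> (x, \<eta>)) \<xi>) = pd es \<psi> (x, \<xi>)"
proof -
  let ?f = "frechet_derivative (\<lambda>\<eta>. \<psi> (x, \<eta>)) (at \<xi>)"
  have b: "(0, 1) \<in> (Basis :: 'm rn set)" by (auto simp: Basis_prod_def)
  have "snd (grad (\<lambda>\<eta>. \<psi> (x, \<eta>)) \<xi>) = (\<Sum>b\<in>Basis. ?f b *\<^sub>R b) \<bullet> (0, 1)"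
    by (simp add: grad_def inner_prod_def)
  also have "\<dots> = ?f (0, 1)" using b by (rule inner_sum_left_Basis)
  also have "\<dots> = pd es \<psi> (x, \<xi>)" by (rule pd_slice[OF assms])
  finally show ?thesis .
qed

text \<open>The transformation law determines a covector by its coordinates in one chart. This gives
  the \<open>inv_into\<close> in \<open>cot_expr\<close> its intended value.\<close>

lemma inj_on_cot_chart:
  assumes "closed_manifold A" "c \<in> A" "z \<in> cotangent0 A (W \<inter> fst c)" "z' \<in> cotangent0 A (W \<inter> fst c)"
    and eq: "cot_chart c z = cot_chart c z'"
  shows "z = z'"
proof -
  obtain p \<omega> p' \<omega>' where z: "z = (p, \<omega>)" "z' = (p', \<omega>')" by fastforce
  have p: "p \<in> fst c" "p' \<in> fst c" using assms(3,4) by (auto simp: z cotangent0_def)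
  have "is_chart c" using assms(1,2) by (auto simp: closed_manifold_def)
  then have "inj_on (snd c) (fst c)" unfolding is_chart_def homeomorphism_def by (metis inj_on_inverseI)
  then have pp: "p' = p" using eq p by (auto simp: z cot_chart_def dest: inj_onD)
  have tr: "w d \<bullet> v = w c \<bullet> frechet_derivative (transition d c) (at (snd d p)) v"
    if "(p, w) \<in> cotangent0 A (W \<inter> fst c)" "d \<in> A" "p \<in> fst d" for w d v
    using that p(1) assms(2) unfolding cotangent0_def mem_Collect_eq prod.case by blast
  have out: "w d = 0" if "(p, w) \<in> cotangent0 A (W \<inter> fst c)" "\<not> (d \<in> A \<and> p \<in> fst d)" for w d
    using that unfolding cotangent0_def mem_Collect_eq prod.case by blast
  have m: "(p, \<omega>) \<in> cotangent0 A (W \<inter> fst c)" "(p, \<omega>') \<in> cotangent0 A (W \<inter> fst c)"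
    using assms(3,4) by (simp_all only: z pp)
  have oc: "\<omega> c = \<omega>' c" using eq by (simp add: z cot_chart_def)
  have "\<omega> d = \<omega>' d" for d
  proof (cases "d \<in> A \<and> p \<in> fst d")
    case True
    then have "\<omega> d \<bullet> v = \<omega>' d \<bullet> v" for v
      using tr[OF m(1), of d v] tr[OF m(2), of d v] oc by simp
    then show ?thesis using vector_eq_rdot[of "\<omega> d" "\<omega>' d"] by blast
  next
    case False
    then show ?thesis using out[OF m(1)] out[OF m(2)] by simp
  qed
  then show ?thesis by (auto simp: z pp)
qed

text \<open>In boundary charts the sign of the last coordinate decides membership in
  \<open>Y\<close> or \<open>X\<close>. The map \<open>chi\<close> is injective over
  \<open>Yt\<close> and sends the covectors over \<open>Y\<close> onto those over \<open>X\<close>,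
  so membership is carried over in both directions.\<close>

lemma boundary_preserved:
  fixes AY :: "('q::t2_space, 'm::finite rn) chart set" and AX :: "('p::t2_space, 'm rn) chart set"
  assumes AY: "closed_manifold AY"
    and chi: "boundary_symplectomorphism AY Y Yt AX X Xt chi"
    and c: "boundary_chart AY Y c" and d: "boundary_chart AX X d"
    and y: "(y, \<xi>) \<in> cot_dom AY Yt c d chi" and x: "cot_expr AY Yt c d chi (y, \<xi>) = (x, \<eta>)"
  shows "0 \<le> snd x \<longleftrightarrow> 0 \<le> snd y"
proof -
  from y obtain z where z: "z \<in> cotangent0 AY (Yt \<inter> fst c)" "fst (chi z) \<in> fst d" "cot_chart c z = (y, \<xi>)"
    unfolding cot_dom_def by (smt (verit) imageE mem_Collect_eq)
  have cA: "c \<in> AY" using c by (simp add: boundary_chart_def)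
  have "inv_into (cotangent0 AY (Yt \<inter> fst c)) (cot_chart c) (y, \<xi>) = z"
  proof (rule inj_on_cot_chart[OF AY cA, symmetric])
    have m: "(y, \<xi>) \<in> cot_chart c ` cotangent0 AY (Yt \<inter> fst c)" using z by force
    show "inv_into (cotangent0 AY (Yt \<inter> fst c)) (cot_chart c) (y, \<xi>) \<in> cotangent0 AY (Yt \<inter> fst c)"
      by (rule inv_into_into[OF m])
    show "cot_chart c z = cot_chart c (inv_into (cotangent0 AY (Yt \<inter> fst c)) (cot_chart c) (y, \<xi>))"
      using f_inv_into_f[OF m] z by simp
  qed (rule z(1))
  then have x': "snd d (fst (chi z)) = x" using x by (simp add: cot_expr_def cot_chart_def)
  have y': "snd c (fst z) = y" using z(3) by (simp add: cot_chart_def)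
  have fc: "fst z \<in> fst c" and zYt: "z \<in> cotangent0 AY Yt"
    using z(1) by (auto simp: cotangent0_def)
  have 1: "fst z \<in> Y \<longleftrightarrow> 0 \<le> snd y" using c fc y' by (auto simp: boundary_chart_def)
  have 2: "fst (chi z) \<in> X \<longleftrightarrow> 0 \<le> snd x" using d z(2) x' by (auto simp: boundary_chart_def)
  have bij: "bij_betw chi (cotangent0 AY Yt) (cotangent0 AX Xt)" "bij_betw chi (cotangent0 AY Y) (cotangent0 AX X)" "Y \<subseteq> Yt"
    using chi by (auto simp: boundary_symplectomorphism_def symplectomorphism_def)
  have Y: "w \<in> cotangent0 AY Y \<longleftrightarrow> fst w \<in> Y" if "w \<in> cotangent0 AY Yt" for w
    using that by (cases w) (auto simp: cotangent0_def)
  have X: "w \<in> cotangent0 AX X \<longleftrightarrow> fst w \<in> X" if "w \<in> cotangent0 AX Xt" for w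
    using that by (cases w) (auto simp: cotangent0_def)
  have "chi z \<in> cotangent0 AX Xt" using bij(1) zYt by (auto simp: bij_betw_def)
  have "z \<in> cotangent0 AY Y \<longleftrightarrow> chi z \<in> cotangent0 AX X"
  proof
    assume "chi z \<in> cotangent0 AX X"
    then obtain w where w: "w \<in> cotangent0 AY Y" "chi w = chi z" using bij(2) unfolding bij_betw_def by (metis imageE)
    have "w \<in> cotangent0 AY Yt" using w(1) bij(3) by (cases w) (auto simp: cotangent0_def)
    then have "w = z" using w(2) zYt bij(1) by (auto simp: bij_betw_def dest: inj_onD)
    then show "z \<in> cotangent0 AY Y" using w(1) by simp
  qed (use bij(2) in \<open>auto simp: bij_betw_def\<close>)
  then show ?thesis using 1 2 Y[OF zYt] X[OF \<open>chi z \<in> cotangent0 AX Xt\<close>] by simp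
qed

text \<open>The last two conditions are what the estimates retain of \<open>chi\<close>: d psi / d
  xi_n has a zero of exactly first order in x_n at the boundary, in every codirection.\<close>

locale boundary_phase =
  fixes \<Omega>' :: "(real ^ 'm::finite) set" and \<psi> :: "'m rn \<times> 'm rn \<Rightarrow> real"
  assumes open_\<Omega>': "open \<Omega>'"
    and smooth: "smooth_on ((\<Omega>' \<times> {-1<..<1}) \<times> (- {0})) \<psi>"
    and hom: "x \<in> \<Omega>' \<times> {-1<..<1} \<Longrightarrow> \<xi> \<noteq> 0 \<Longrightarrow> 0 < r \<Longrightarrow> \<psi> (x, r *\<^sub>R \<xi>) = r * \<psi> (x, \<xi>)"
    and boundary_zero: "x' \<in> \<Omega>' \<Longrightarrow> \<xi> \<noteq> 0 \<Longrightarrow> pd es \<psi> ((x', 0), \<xi>) = 0"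
    and boundary_nonzero: "x' \<in> \<Omega>' \<Longrightarrow> \<xi> \<noteq> 0 \<Longrightarrow> pd et (pd es \<psi>) ((x', 0), \<xi>) \<noteq> 0"

lemma boundary_phaseI:
  fixes AY :: "('q::t2_space, 'm::finite rn) chart set" and AX :: "('p::t2_space, 'm rn) chart set"
  assumes AY: "closed_manifold AY"
    and chi: "boundary_symplectomorphism AY Y Yt AX X Xt chi"
    and c: "boundary_chart AY Y c" and d: "boundary_chart AX X d"
    and \<Omega>': "open \<Omega>'" and ph: "phase_represents AY Yt c d chi (\<Omega>' \<times> {-1<..<1}) \<psi>"
  shows "boundary_phase \<Omega>' \<psi>"
proof
  let ?\<Omega> = "\<Omega>' \<times> {-1<..<1::real}" and ?S = "(\<Omega>' \<times> {-1<..<1::real}) \<times> (- {0 :: 'm rn})"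
  have S: "open ?S" using \<Omega>' by (intro open_Times) auto
  show sm: "smooth_on ?S \<psi>" using ph by (simp add: phase_represents_def)
  show "\<psi> (x, r *\<^sub>R \<xi>) = r * \<psi> (x, \<xi>)" if "x \<in> ?\<Omega>" "\<xi> \<noteq> 0" "0 < r" for x \<xi> r
    using ph that unfolding phase_represents_def by blast
  have dif: "\<psi> differentiable (at p)" "pd es \<psi> differentiable (at p)" if "p \<in> ?S" for p
    using smooth_on_differentiable[OF sm that] smooth_on_differentiable[OF smooth_on_pd[OF sm] that] by auto
  \<comment> \<open>The \<open>\<xi>\<^sub>n\<close>-derivative of \<open>\<psi>\<close> is the normal component of the point of \<open>Yt\<close> that is mapped to
    \<open>x\<close>.\<close>
  have sign: "0 \<le> snd x \<longleftrightarrow> 0 \<le> pd es \<psi> (x, \<xi>)" if "x \<in> ?\<Omega>" "\<xi> \<noteq> 0" for x \<xi>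
  proof -
    let ?y = "grad (\<lambda>\<eta>. \<psi> (x, \<eta>)) \<xi>"
    have "(?y, \<xi>) \<in> cot_dom AY Yt c d chi" "cot_expr AY Yt c d chi (?y, \<xi>) = (x, grad (\<lambda>w. \<psi> (w, \<xi>)) x)"
      using ph that unfolding phase_represents_def Let_def by blast+
    from boundary_preserved[OF AY chi c d this] show ?thesis
      using snd_grad[OF dif(1), of x \<xi>] that by simp
  qed
  show zero: "pd es \<psi> ((x', 0), \<xi>) = 0" if x: "x' \<in> \<Omega>'" and \<xi>: "\<xi> \<noteq> 0" for x' \<xi>
  proof -
    have "pd es \<psi> ((x', 0), \<xi>) \<ge> 0" using sign[of "(x', 0)" \<xi>] x \<xi> by simp
    \<comment> \<open>For x_n < 0 the derivative is negative by \<open>sign\<close>, so by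
      continuity it cannot be positive at x_n = 0.\<close>
    moreover have "pd es \<psi> ((x', 0), \<xi>) \<le> 0"
    proof -
      let ?g = "\<lambda>t. pd es \<psi> ((x', t), \<xi>)"
      have "isCont (pd es \<psi>) ((x', 0), \<xi>)"
        by (rule differentiable_imp_continuous_within) (rule dif(2), use x \<xi> in auto)
      then have "((\<lambda>t. pd es \<psi> ((x', t), \<xi>)) \<longlongrightarrow> pd es \<psi> ((x', 0), \<xi>)) (at_left 0)"
        by (rule isCont_tendsto_compose) (auto intro!: tendsto_intros)
      moreover have "eventually (\<lambda>t. ?g t \<le> 0) (at_left (0::real))"
      proof -
        have "eventually (\<lambda>t. t \<in> {-1<..<0}) (at_left (0::real))" by (rule eventually_at_left_real) simp
        then show ?thesis
        proof eventually_elim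
          case (elim t)
          then show ?case using sign[of "(x', t)" \<xi>] x \<xi> by auto
        qed
      qed
      ultimately show ?thesis by (rule tendsto_upperbound) simp
    qed
    ultimately show ?thesis by simp
  qed
  \<comment> \<open>Since d psi / d xi_n vanishes on x_n = 0, its derivatives in all other
    coordinate directions vanish there. If the x_n-derivative vanished too, one component of the
    local diffeomorphism \<open>?G\<close> would have differential 0.\<close>
  show "pd et (pd es \<psi>) ((x', 0), \<xi>) \<noteq> 0" if x: "x' \<in> \<Omega>'" and \<xi>: "\<xi> \<noteq> 0" for x' \<xi>
  proof
    assume 0: "pd et (pd es \<psi>) ((x', 0), \<xi>) = 0"
    let ?z = "((x', 0::real), \<xi>)"
    let ?G = "\<lambda>(x, \<xi>). (grad (\<lambda>\<eta>. \<psi> (x, \<eta>)) \<xi>, \<xi>)"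
    have z: "?z \<in> ?S" using x \<xi> by auto
    obtain N where N: "open N" "?z \<in> N" "N \<subseteq> ?S" "inj_on ?G N" "open (?G ` N)" "smooth_on N ?G" "smooth_on (?G ` N) (inv_into N ?G)"
      using ph z unfolding phase_represents_def local_diffeo_on_def by blast
    have Gd: "(?G has_derivative frechet_derivative ?G (at ?z)) (at ?z)"
      using smooth_on_differentiable[OF N(6,2)] by (simp add: frechet_derivative_works)
    let ?I = "inv_into N ?G"
    have Id: "(?I has_derivative frechet_derivative ?I (at (?G ?z))) (at (?G ?z))"
      using smooth_on_differentiable[OF N(7), of "?G ?z"] N(2) by (simp only: frechet_derivative_works[symmetric]) blast
    have Iz: "?I (?G ?z) = ?z" by (rule inv_into_f_f[OF N(4,2)])
    have "((\<lambda>y. ?G (?I y)) has_derivative (\<lambda>h. frechet_derivative ?G (at ?z) (frechet_derivative ?I (at (?G ?z)) h))) (at (?G ?z))"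
      by (rule has_derivative_compose[OF Id]) (simp only: Iz Gd)
    moreover have "((\<lambda>y. ?G (?I y)) has_derivative (\<lambda>h. h)) (at (?G ?z))"
      by (rule has_derivative_transform_within_open[OF has_derivative_ident N(5)])
         (use N(2) f_inv_into_f[of _ ?G N] in \<open>auto simp del: split_paired_All\<close>)
    ultimately have id: "(\<lambda>h. frechet_derivative ?G (at ?z) (frechet_derivative ?I (at (?G ?z)) h)) = (\<lambda>h. h)"
      by (rule has_derivative_unique)
    \<comment> \<open>The preimage of the normal direction under the differential of
      \<open>?G\<close>; the derivative of d psi / d xi_n along \<open>w\<close> is 1.\<close>
    define w where "w = frechet_derivative ?I (at (?G ?z)) (((0, 1), 0) :: 'm rn \<times> 'm rn)"
    have w: "frechet_derivative ?G (at ?z) w = ((0, 1), 0)" using id unfolding w_def by metis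
    have "((\<lambda>p. snd (fst (?G p))) has_derivative (\<lambda>h. snd (fst (frechet_derivative ?G (at ?z) h)))) (at ?z)"
      by (intro has_derivative_snd has_derivative_fst Gd)
    then have "(pd es \<psi> has_derivative (\<lambda>h. snd (fst (frechet_derivative ?G (at ?z) h)))) (at ?z)"
    proof (rule has_derivative_transform_within_open[OF _ N(1,2)])
      fix p assume "p \<in> N"
      then have p: "p \<in> ?S" using N(3) by blast
      obtain y \<eta> where pe: "p = (y, \<eta>)" by (cases p)
      show "snd (fst (?G p)) = pd es \<psi> p" using snd_grad[OF dif(1)[OF p[unfolded pe]]] by (simp add: pe)
    qed
    from pd_eqI[OF this, of w] have "pd w (pd es \<psi>) ?z = 1" by (simp add: w)
    moreover have "pd w (pd es \<psi>) ?z = (\<Sum>b\<in>Basis. (w \<bullet> b) *\<^sub>R pd b (pd es \<psi>) ?z)"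
      by (rule pd_sum_Basis[OF dif(2)[OF z]])
    moreover have "pd b (pd es \<psi>) ?z = 0" if b: "b \<in> Basis" for b
    proof (cases "b = et")
      case True
      then show ?thesis using 0 by simp
    next
      case False
      then have b0: "snd (fst b) = 0" using b by (auto simp: Basis_prod_def)
      have "open (\<Omega>' \<times> - {0 :: 'm rn})" using \<Omega>' by (intro open_Times) auto
      moreover have "(x', \<xi>) \<in> \<Omega>' \<times> - {0}" using x \<xi> by simp
      ultimately obtain e where e: "0 < e" "ball (x', \<xi>) e \<subseteq> \<Omega>' \<times> - {0}" using open_contains_ball by blast
      let ?v = "(fst (fst b), snd b)"
      show ?thesis
      proof (rule tangential_derivative_zero[OF dif(2)[OF z], of "e / (norm ?v + 1)"])
        show "0 < e / (norm ?v + 1)" using e by (simp add: add_nonneg_pos)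
        fix s :: real assume s: "\<bar>s\<bar> < e / (norm ?v + 1)"
        have "norm (s *\<^sub>R ?v) < e"
        proof -
          have "\<bar>s\<bar> * norm ?v \<le> \<bar>s\<bar> * (norm ?v + 1)" by (intro mult_left_mono) auto
          also have "\<dots> < e" using s by (simp add: pos_less_divide_eq add_nonneg_pos)
          finally show ?thesis by (simp only: norm_scaleR)
        qed
        then have "(x', \<xi>) + s *\<^sub>R ?v \<in> ball (x', \<xi>) e" unfolding mem_ball by (metis add_diff_cancel_left' dist_commute dist_norm)
        then have "x' + s *\<^sub>R fst (fst b) \<in> \<Omega>'" "\<xi> + s *\<^sub>R snd b \<noteq> 0" using e(2) by auto
        moreover have "?z + s *\<^sub>R b = ((x' + s *\<^sub>R fst (fst b), 0), \<xi> + s *\<^sub>R snd b)"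
          using b0 by (simp add: prod_eq_iff)
        ultimately show "pd es \<psi> (?z + s *\<^sub>R b) = 0" using zero by simp
      qed
    qed
    ultimately show False by simp
  qed
qed (rule \<Omega>')

section \<open>Counting derivatives, and chain rules for iterated derivatives\<close>

definition cov_order :: "('m::finite rn \<times> 'm rn) list \<Rightarrow> nat" where
  "cov_order vs = length (filter (\<lambda>v. snd v \<noteq> 0) vs)"

lemma cov_order_simps [simp]: "cov_order [] = 0" "cov_order (v # vs) = (if snd v = 0 then 0 else 1) + cov_order vs"
  "cov_order (vs @ ws) = cov_order vs + cov_order ws"
  by (auto simp: cov_order_def)

lemma Basis_product_cases:
  assumes "v \<in> (Basis :: ('m::finite rn \<times> 'm rn) set)"
  obtains "v = et" | b where "v = ((b, 0), 0)" "b \<in> Basis" | b where "v = (0, b)" "b \<in> Basis" "b \<noteq> 0"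
proof -
  have "(\<exists>b\<in>Basis. v = (b, 0)) \<or> (\<exists>b\<in>Basis. v = (0, b))" using assms by (auto simp: Basis_prod_def)
  then consider b where "b \<in> Basis" "v = (b, 0)" | b where "b \<in> Basis" "v = (0, b)" by blast
  then show thesis
  proof cases
    case 1
    then have "(\<exists>b'\<in>Basis. b = (b', 0)) \<or> b = (0, 1)" by (auto simp: Basis_prod_def)
    then show thesis using 1 that by blast
  next
    case 2
    then show thesis using that(3)[of b] nonzero_Basis[of b] by blast
  qed
qed

lemma weight_product:
  fixes vs :: "('m::finite rn \<times> 'm rn) list"
  assumes "set vs \<subseteq> Basis"
  shows "prod_list (map (\<lambda>v. \<omega> v p) vs) = lam p powr (real (count_list vs et) - cov_order vs)"
  using assms
proof (induction vs)
  case Nil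
  show ?case using japanese_pos[of "fst (snd p)"] by simp
next
  case (Cons v vs)
  have "ordw v = (if v = et then 1 else 0) - (if snd v = 0 then 0 else 1)"
  proof (rule Basis_product_cases[of v])
    show "v \<in> Basis" using Cons.prems by simp
  qed (auto simp: ordw_def zero_prod_def nonzero_Basis)
  then have e: "ordw v + (real (count_list vs et) - cov_order vs) = real (count_list (v # vs) et) - cov_order (v # vs)"
    by auto
  have "prod_list (map (\<lambda>v. \<omega> v p) (v # vs)) = lam p powr ordw v * lam p powr (real (count_list vs et) - cov_order vs)"
    using Cons by (simp add: \<omega>_def)
  then show ?case by (simp only: powr_add[symmetric] e)
qed

text \<open>One has <xi> = <xi'> sqrt (1 + (xi_n / <xi'>)^2). The power of <xi'> is kept exactly,
  and only the second factor is enlarged, to a nonnegative exponent \<open>N\<close>; this covers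
  both signs of \<open>\<mu>\<close>.\<close>

lemma japanese_split:
  assumes "\<mu> \<le> N" "0 \<le> N"
  shows "japanese (snd p) powr \<mu> \<le> wt \<mu> 0 N p"
proof -
  define \<rho> where "\<rho> = sqrt (1 + (snd (snd p) / lam p)\<^sup>2)"
  have l: "0 < lam p" by (rule japanese_pos)
  have \<rho>: "1 \<le> \<rho>" by (simp add: \<rho>_def)
  have "1 + (snd (snd p) / lam p)\<^sup>2 \<le> (1 + \<bar>snd (snd p)\<bar> / lam p)\<^sup>2"
    using l by (simp add: power2_sum power_divide)
  then have "\<rho> \<le> sqrt ((1 + \<bar>snd (snd p)\<bar> / lam p)\<^sup>2)" unfolding \<rho>_def by (rule real_sqrt_le_mono)
  then have \<rho>': "\<rho> \<le> 1 + \<bar>snd (snd p)\<bar> / lam p" using base_pos(2)[of p] by simp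
  have "(lam p * \<rho>)\<^sup>2 = (lam p)\<^sup>2 + (snd (snd p))\<^sup>2"
    using l by (simp add: \<rho>_def power_mult_distrib field_simps)
  also have "\<dots> = (japanese (snd p))\<^sup>2"
    by (simp add: japanese_def norm_prod_def add_nonneg_nonneg)
  finally have "japanese (snd p) = lam p * \<rho>"
    using l \<rho> japanese_pos[of "snd p"] by (smt (verit) mult_pos_pos power2_eq_imp_eq)
  then have "japanese (snd p) powr \<mu> = lam p powr \<mu> * \<rho> powr \<mu>"
    using l \<rho> by (simp add: powr_mult)
  also have "\<rho> powr \<mu> \<le> \<rho> powr N" using \<rho> assms by (intro powr_mono) auto
  also have "\<rho> powr N \<le> (1 + \<bar>snd (snd p)\<bar> / lam p) powr N" using \<rho> \<rho>' assms by (intro powr_mono2) auto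
  finally show ?thesis
    using l base_pos(1)[of p] by (simp add: wt_def mult_left_mono less_imp_neq[symmetric])
qed

lemma dirs_of_real:
  fixes f :: "'a::euclidean_space \<Rightarrow> real"
  assumes D: "open D" and f: "partials_on D f"
  shows "set vs \<subseteq> Basis \<Longrightarrow> p \<in> D \<Longrightarrow> dirs vs (\<lambda>p. complex_of_real (f p)) p = of_real (dirs vs f p)"
proof (induction vs arbitrary: p)
  case (Cons v vs)
  have d: "((\<lambda>p. complex_of_real (dirs vs f p)) has_derivative (\<lambda>h. of_real (frechet_derivative (dirs vs f) (at p) h))) (at p)"
    by (intro has_derivative_of_real frechet_derivative_works[THEN iffD1] partials_onD[OF f]) (use Cons.prems in auto)
  have "dirs (v # vs) (\<lambda>p. complex_of_real (f p)) p = pd v (\<lambda>p. complex_of_real (dirs vs f p)) p"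
    unfolding dirs_Cons by (rule differentiable_cong_open(2)[OF D Cons.prems(2) Cons.IH]) (use Cons.prems in auto)
  also have "\<dots> = of_real (dirs (v # vs) f p)" unfolding dirs_Cons by (rule pd_eqI[OF d])
  finally show ?case .
qed simp

lemma partials_on_of_real:
  fixes f :: "'a::euclidean_space \<Rightarrow> real"
  assumes D: "open D" and f: "partials_on D f"
  shows "partials_on D (\<lambda>p. complex_of_real (f p))"
  unfolding partials_on_def
proof (intro allI impI ballI)
  fix vs :: "'a list" and p assume vs: "set vs \<subseteq> Basis" and p: "p \<in> D"
  have "((\<lambda>p. complex_of_real (dirs vs f p)) has_derivative (\<lambda>h. of_real (frechet_derivative (dirs vs f) (at p) h))) (at p)"
    by (intro has_derivative_of_real frechet_derivative_works[THEN iffD1] partials_onD[OF f vs p])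
  then have "(\<lambda>p. complex_of_real (dirs vs f p)) differentiable (at p)" unfolding differentiable_def by blast
  then show "dirs vs (\<lambda>p. complex_of_real (f p)) differentiable (at p)"
    using differentiable_cong_open(1)[OF D p, of "dirs vs (\<lambda>p. complex_of_real (f p))" "\<lambda>p. complex_of_real (dirs vs f p)"]
      dirs_of_real[OF D f vs] by blast
qed

lemma dirs_diff:
  fixes f g :: "'a::euclidean_space \<Rightarrow> 'b::real_normed_vector"
  assumes D: "open D" and f: "partials_on D f" and g: "partials_on D g"
  shows "set vs \<subseteq> Basis \<Longrightarrow> p \<in> D \<Longrightarrow> dirs vs (\<lambda>p. f p - g p) p = dirs vs f p - dirs vs g p"
proof (induction vs arbitrary: p)
  case (Cons v vs)
  have d: "((\<lambda>p. dirs vs f p - dirs vs g p) has_derivative (\<lambda>h. frechet_derivative (dirs vs f) (at p) h - frechet_derivative (dirs vs g) (at p) h)) (at p)"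
    by (intro has_derivative_diff frechet_derivative_works[THEN iffD1] partials_onD[OF f] partials_onD[OF g]) (use Cons.prems in auto)
  have "dirs (v # vs) (\<lambda>p. f p - g p) p = pd v (\<lambda>p. dirs vs f p - dirs vs g p) p"
    unfolding dirs_Cons by (rule differentiable_cong_open(2)[OF D Cons.prems(2) Cons.IH]) (use Cons.prems in auto)
  also have "\<dots> = dirs (v # vs) f p - dirs (v # vs) g p" unfolding dirs_Cons by (rule pd_eqI[OF d])
  finally show ?case .
qed simp

lemma partials_on_diff:
  fixes f g :: "'a::euclidean_space \<Rightarrow> 'b::real_normed_vector"
  assumes D: "open D" and f: "partials_on D f" and g: "partials_on D g"
  shows "partials_on D (\<lambda>p. f p - g p)"
  unfolding partials_on_def
proof (intro allI impI ballI)
  fix vs :: "'a list" and p assume vs: "set vs \<subseteq> Basis" and p: "p \<in> D"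
  have "(\<lambda>p. dirs vs f p - dirs vs g p) differentiable (at p)"
    by (intro differentiable_diff partials_onD[OF f vs p] partials_onD[OF g vs p])
  then show "dirs vs (\<lambda>p. f p - g p) differentiable (at p)"
    using differentiable_cong_open(1)[OF D p, of "dirs vs (\<lambda>p. f p - g p)" "\<lambda>p. dirs vs f p - dirs vs g p"]
      dirs_diff[OF D f g vs] by blast
qed

lemma dirs_zero_direction:
  assumes "open D" "smooth_on D f" "0 \<in> set vs" "p \<in> D"
  shows "dirs vs f p = 0"
  using assms(3,4)
proof (induction vs arbitrary: p)
  case (Cons v vs)
  show ?case
  proof (cases "v = 0")
    case True
    have "linear (frechet_derivative (dirs vs f) (at p))"
      by (rule linear_frechet_derivative[OF smooth_on_differentiable[OF smooth_on_dirs[OF assms(2)] Cons.prems(2)]])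
    then show ?thesis by (simp add: dirs_Cons True linear_0)
  next
    case False
    then have "pd v (dirs vs f) p = pd v (\<lambda>_. 0) p"
      using Cons by (intro differentiable_cong_open(2)[OF assms(1)]) auto
    then show ?thesis by (simp add: dirs_Cons)
  qed
qed simp

lemma affine_derivative:
  fixes f :: "'a::euclidean_space \<Rightarrow> 'b::real_normed_vector"
  assumes "bounded_linear L0" "f differentiable (at (c + L0 p))"
  shows "((\<lambda>p. f (c + L0 p)) has_derivative (\<lambda>v. pd (L0 v) f (c + L0 p))) (at p)"
proof -
  have "((\<lambda>p. c + L0 p) has_derivative L0) (at p)"
    using bounded_linear_imp_has_derivative[OF assms(1)] by (auto intro!: derivative_eq_intros)
  from has_derivative_compose[OF this frechet_derivative_works[THEN iffD1, OF assms(2)]]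
  show ?thesis .
qed

lemma dirs_affine:
  fixes f :: "'a::euclidean_space \<Rightarrow> 'b::real_normed_vector" and L0 :: "'a \<Rightarrow> 'a"
  assumes D: "open D" and f: "smooth_on S f" and L: "bounded_linear L0" "\<And>p. p \<in> D \<Longrightarrow> c + L0 p \<in> S"
  shows "p \<in> D \<Longrightarrow> dirs vs (\<lambda>p. f (c + L0 p)) p = dirs (map L0 vs) f (c + L0 p)"
proof (induction vs arbitrary: p)
  case (Cons v vs)
  have "dirs (v # vs) (\<lambda>p. f (c + L0 p)) p = pd v (\<lambda>p. dirs (map L0 vs) f (c + L0 p)) p"
    unfolding dirs_Cons by (rule differentiable_cong_open(2)[OF D Cons.prems Cons.IH])
  also have "\<dots> = pd (L0 v) (dirs (map L0 vs) f) (c + L0 p)"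
    by (rule pd_eqI[OF affine_derivative[OF L(1)]])
       (rule smooth_on_differentiable[OF smooth_on_dirs[OF f] L(2)[OF Cons.prems]])
  finally show ?case by (simp add: dirs_Cons)
qed simp

lemma partials_on_affine:
  fixes f :: "'a::euclidean_space \<Rightarrow> 'b::real_normed_vector" and L0 :: "'a \<Rightarrow> 'a"
  assumes D: "open D" and f: "smooth_on S f" and L: "bounded_linear L0" "\<And>p. p \<in> D \<Longrightarrow> c + L0 p \<in> S"
  shows "partials_on D (\<lambda>p. f (c + L0 p))"
  unfolding partials_on_def
proof (intro allI impI ballI)
  fix vs :: "'a list" and p assume p: "p \<in> D"
  have "(\<lambda>p. dirs (map L0 vs) f (c + L0 p)) differentiable (at p)"
    using affine_derivative[OF L(1) smooth_on_differentiable[OF smooth_on_dirs[OF f] L(2)[OF p]]]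
    unfolding differentiable_def by blast
  then show "dirs vs (\<lambda>p. f (c + L0 p)) differentiable (at p)"
    using differentiable_cong_open(1)[OF D p, of "dirs vs (\<lambda>p. f (c + L0 p))" "\<lambda>p. dirs (map L0 vs) f (c + L0 p)"]
      dirs_affine[OF D f L] by blast
qed

section \<open>Homogeneity and compactness: upper and lower bounds for the phase\<close>

section \<open>Estimates for the phase\<close>

context boundary_phase
begin

abbreviation "\<Omega> \<equiv> \<Omega>' \<times> {-1<..<1::real}"
abbreviation "S \<equiv> \<Omega> \<times> (- {0 :: 'm rn})"

lemma open_S: "open S" "open \<Omega>" "open (\<Omega> \<times> (UNIV :: 'm rn set))"
  using open_\<Omega>' by (auto intro!: open_Times)

text \<open>Variable directions keep the degree and covariable directions lower it by 1. A direction
  with both components would mix two degrees, whence the condition on \<open>v\<close>.\<close>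

lemma homogeneous_pd:
  assumes f: "\<And>x \<xi> r. (x, \<xi>) \<in> S \<Longrightarrow> 0 < r \<Longrightarrow> f (x, r *\<^sub>R \<xi>) = r powr \<mu> * f (x, \<xi>)"
    and fd: "\<And>p. p \<in> S \<Longrightarrow> f differentiable (at p)"
    and v: "fst v = 0 \<or> snd v = 0" and m: "(x, \<xi>) \<in> S" and r: "0 < r"
  shows "pd v f (x, r *\<^sub>R \<xi>) = r powr (\<mu> - (if snd v = 0 then 0 else 1)) * (pd v f (x, \<xi>) :: real)"
proof -
  let ?L = "\<lambda>p :: 'm rn \<times> 'm rn. (fst p, r *\<^sub>R snd p)"
  have rm: "(x, r *\<^sub>R \<xi>) \<in> S" using m r by auto
  have L: "(?L has_derivative ?L) (at (x, \<xi>))" by (auto intro!: derivative_eq_intros)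
  have "(f has_derivative frechet_derivative f (at (x, r *\<^sub>R \<xi>))) (at (?L (x, \<xi>)))"
    using fd[OF rm] by (simp add: frechet_derivative_works)
  from has_derivative_compose[OF L this]
  have 1: "((\<lambda>p. f (?L p)) has_derivative (\<lambda>h. frechet_derivative f (at (x, r *\<^sub>R \<xi>)) (?L h))) (at (x, \<xi>))" .
  have "((\<lambda>p. r powr \<mu> * f p) has_derivative (\<lambda>h. r powr \<mu> * frechet_derivative f (at (x, \<xi>)) h)) (at (x, \<xi>))"
    using fd[OF m] by (intro has_derivative_mult_right) (simp add: frechet_derivative_works)
  then have "((\<lambda>p. f (?L p)) has_derivative (\<lambda>h. r powr \<mu> * frechet_derivative f (at (x, \<xi>)) h)) (at (x, \<xi>))"
    by (rule has_derivative_transform_within_open[OF _ open_S(1) m]) (use f r in \<open>auto simp: mem_Times_iff\<close>)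
  from has_derivative_unique[OF 1 this]
  have e: "frechet_derivative f (at (x, r *\<^sub>R \<xi>)) (?L v) = r powr \<mu> * pd v f (x, \<xi>)" by metis
  show ?thesis
  proof (cases "snd v = 0")
    case True
    then have "?L v = v" by (simp add: prod_eq_iff)
    then show ?thesis using e True by simp
  next
    case False
    then have "fst v = 0" using v by blast
    then have "?L v = r *\<^sub>R v" by (simp add: prod_eq_iff)
    moreover have "linear (frechet_derivative f (at (x, r *\<^sub>R \<xi>)))" by (rule linear_frechet_derivative[OF fd[OF rm]])
    ultimately have "r * pd v f (x, r *\<^sub>R \<xi>) = r powr \<mu> * pd v f (x, \<xi>)" using e by (simp add: linear_scale)
    then show ?thesis using r False by (simp add: powr_diff field_simps)
  qed
qed

lemma homogeneous_dirs:
  assumes "set vs \<subseteq> Basis" "(x, \<xi>) \<in> S" "0 < r"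
  shows "dirs vs \<psi> (x, r *\<^sub>R \<xi>) = r powr (1 - real (cov_order vs)) * dirs vs \<psi> (x, \<xi>)"
  using assms
proof (induction vs arbitrary: x \<xi> r)
  case Nil
  then show ?case using hom[of x \<xi> r] by simp
next
  case (Cons v vs)
  have "fst v = 0 \<or> snd v = 0" using Cons.prems by (auto simp: Basis_prod_def)
  from homogeneous_pd[where f = "dirs vs \<psi>", OF Cons.IH smooth_on_differentiable[OF smooth_on_dirs[OF smooth]] this Cons.prems(2,3)]
  show ?case using Cons.prems by (simp add: algebra_simps)
qed

text \<open>At xi' = 0 the function d psi / d x_n is homogeneous of degree 1 in xi_n. A zero at
  \<open>s\<close> spreads along the ray through \<open>s\<close>, and then the xi_n-derivative,
  which equals the mixed derivative, is 0 as well.\<close>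

lemma normal_derivative_nonzero:
  assumes x: "x \<in> \<Omega>" and s: "s \<noteq> 0" and nz: "pd et (pd es \<psi>) (x, (0, s)) \<noteq> 0"
  shows "pd et \<psi> (x, (0, s)) \<noteq> 0"
proof
  assume 0: "pd et \<psi> (x, (0, s)) = 0"
  have m: "(x, (0, s)) \<in> S" using x s by (simp add: zero_prod_def mem_Times_iff)
  have "pd es (pd et \<psi>) (x, (0, s)) = 0"
  proof (rule tangential_derivative_zero[where \<delta> = "\<bar>s\<bar>"])
    show "pd et \<psi> differentiable at (x, 0, s)"
      by (rule smooth_on_differentiable[OF smooth_on_pd[OF smooth] m])
    fix h :: real assume h: "\<bar>h\<bar> < \<bar>s\<bar>"
    then have r: "0 < 1 + h / s" using s by (auto simp: field_simps abs_if split: if_splits)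
    have e: "(x, (0, s)) + h *\<^sub>R es = (x, (1 + h / s) *\<^sub>R (0, s))" using s by (simp add: field_simps)
    show "pd et \<psi> ((x, (0, s)) + h *\<^sub>R es) = 0"
      unfolding e using homogeneous_dirs[OF _ m r, of "[et]"] 0 by (simp add: et_es_Basis)
  qed (use s in simp)
  moreover have "pd es (pd et \<psi>) (x, (0, s)) = pd et (pd es \<psi>) (x, (0, s))"
    by (rule pd_commute_partials[OF open_S(1) smooth_on_partials[OF smooth] _ _ m]) (rule et_es_Basis)+
  ultimately show False using nz by simp
qed

end

text \<open>\<open>C\<close> is a compact piece of the collar over which constants are uniform. By
  \<open>star\<close> the normal segment from a point of \<open>C\<close> to x_n = 0 stays in
  \<open>C\<close>, as the mean value arguments in x_n require.\<close>

locale phase_collar = boundary_phase \<Omega>' \<psi> for \<Omega>' :: "(real ^ 'm::finite) set" and \<psi> +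
  fixes C :: "'m rn set" and \<psi>m :: "'m rn \<times> 'm rn \<Rightarrow> real" and R :: real
  assumes C: "compact C" "C \<subseteq> \<Omega>' \<times> {-1<..<1}"
    and star: "(x', t) \<in> C \<Longrightarrow> \<bar>t'\<bar> \<le> \<bar>t\<bar> \<Longrightarrow> (x', t') \<in> C"
    and nondegenerate: "x \<in> C \<Longrightarrow> \<xi> \<noteq> 0 \<Longrightarrow> pd et (pd es \<psi>) (x, \<xi>) \<noteq> 0"
    and \<psi>m: "smooth_on ((\<Omega>' \<times> {-1<..<1}) \<times> UNIV) \<psi>m"
    and R: "0 < R" "x \<in> \<Omega>' \<times> {-1<..<1} \<Longrightarrow> R \<le> norm \<xi> \<Longrightarrow> \<psi>m (x, \<xi>) = \<psi> (x, \<xi>)"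
begin

lemma dirs_\<psi>m:
  assumes "x \<in> \<Omega>" "R < norm \<xi>"
  shows "dirs vs \<psi>m (x, \<xi>) = dirs vs \<psi> (x, \<xi>)"
proof (rule dirs_cong_open[where vs = vs])
  have "open {\<xi> :: 'm rn. R < norm \<xi>}" by (intro open_Collect_less continuous_intros)
  with open_S(2) show "open (\<Omega> \<times> {\<xi> :: 'm rn. R < norm \<xi>})" by (rule open_Times)
qed (use assms R(2) in auto)

lemma C_sphere: "compact (C \<times> sphere (0 :: 'm rn) 1)" "C \<times> sphere (0 :: 'm rn) 1 \<subseteq> S"
  using C by (auto intro!: compact_Times)

lemma normalize:
  assumes "set vs \<subseteq> Basis" "x \<in> C" "\<xi> \<noteq> 0"
  shows "dirs vs \<psi> (x, \<xi>) = norm \<xi> powr (1 - real (cov_order vs)) * dirs vs \<psi> (x, (1 / norm \<xi>) *\<^sub>R \<xi>)"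
    "(x, (1 / norm \<xi>) *\<^sub>R \<xi>) \<in> C \<times> sphere 0 1"
proof -
  show m: "(x, (1 / norm \<xi>) *\<^sub>R \<xi>) \<in> C \<times> sphere 0 1" using assms by auto
  show "dirs vs \<psi> (x, \<xi>) = norm \<xi> powr (1 - real (cov_order vs)) * dirs vs \<psi> (x, (1 / norm \<xi>) *\<^sub>R \<xi>)"
    using homogeneous_dirs[OF assms(1) subsetD[OF C_sphere(2) m], of "norm \<xi>"] assms(3) by simp
qed

lemma continuous_dirs: "continuous_on (C \<times> sphere 0 1) (dirs vs \<psi>)"
  using continuous_on_subset[OF smooth_on_continuous[OF smooth] C_sphere(2)] .

lemma continuous_positive_bound:
  fixes f :: "'m rn \<times> 'm rn \<Rightarrow> real"
  assumes "compact A" "continuous_on A f" "\<And>p. p \<in> A \<Longrightarrow> 0 < f p"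
  shows "\<exists>c>0. \<forall>p\<in>A. c \<le> f p"
proof (cases "A = {}")
  case False
  from continuous_attains_inf[OF assms(1) this assms(2)]
  obtain q where "q \<in> A" "\<forall>p\<in>A. f q \<le> f p" by blast
  then show ?thesis using assms(3) by blast
qed (auto intro: exI[of _ 1])

lemma continuous_bound:
  fixes f :: "'m rn \<times> 'm rn \<Rightarrow> real"
  assumes "compact A" "continuous_on A f"
  shows "\<exists>c\<ge>0. \<forall>p\<in>A. \<bar>f p\<bar> \<le> c"
proof -
  have "bounded (f ` A)" by (rule compact_imp_bounded[OF compact_continuous_image[OF assms(2,1)]])
  then obtain c where "\<forall>y\<in>f ` A. norm y \<le> c" unfolding bounded_iff by blast
  then show ?thesis by (intro exI[of _ "\<bar>c\<bar>"]) force
qed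

text \<open>For |xi| > R homogeneity reduces the bound to the unit sphere over \<open>C\<close>; for
  |xi| <= R the arguments themselves range over a compact set.\<close>

lemma symbol_bound:
  assumes vs: "set vs \<subseteq> Basis"
  shows "\<exists>c\<ge>0. \<forall>x\<in>C. \<forall>\<xi>. \<bar>dirs vs \<psi>m (x, \<xi>)\<bar> \<le> c * japanese \<xi> powr (1 - real (cov_order vs))"
proof -
  let ?\<mu> = "1 - real (cov_order vs)"
  obtain c1 where c1: "0 \<le> c1" "\<And>p. p \<in> C \<times> sphere 0 1 \<Longrightarrow> \<bar>dirs vs \<psi> p\<bar> \<le> c1"
    using continuous_bound[OF C_sphere(1) continuous_dirs] by blast
  have "continuous_on (C \<times> cball 0 R) (\<lambda>p. dirs vs \<psi>m p * japanese (snd p) powr (- ?\<mu>))"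
  proof (intro continuous_intros)
    show "continuous_on (C \<times> cball 0 R) (dirs vs \<psi>m)"
      by (rule continuous_on_subset[OF smooth_on_continuous[OF \<psi>m]]) (use C in auto)
    show "continuous_on (C \<times> cball 0 R) (\<lambda>p. japanese (snd p))"
      unfolding japanese_def by (intro continuous_intros)
    show "\<forall>p\<in>C \<times> cball 0 R. japanese (snd p) \<noteq> 0" using less_imp_neq[OF japanese_pos] by metis
  qed
  from continuous_bound[OF _ this] C(1)
  obtain c2 where c2: "0 \<le> c2" "\<And>p. p \<in> C \<times> cball 0 R \<Longrightarrow> \<bar>dirs vs \<psi>m p * japanese (snd p) powr (- ?\<mu>)\<bar> \<le> c2"
    by (blast intro: compact_Times compact_cball)
  \<comment> \<open>For |xi| > R this gives <xi> <= k |xi|, the comparison needed when the exponent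
    is negative.\<close>
  define k where "k = sqrt (1 + R\<^sup>2) / R"
  have k: "1 \<le> k" using R(1) by (simp add: k_def le_divide_eq real_le_rsqrt)
  have big: "norm \<xi> powr ?\<mu> \<le> k powr \<bar>?\<mu>\<bar> * japanese \<xi> powr ?\<mu>" if \<xi>: "R < norm \<xi>" for \<xi> :: "'m rn"
  proof (cases "0 \<le> ?\<mu>")
    case True
    have "norm \<xi> \<le> japanese \<xi>" by (simp add: japanese_def real_le_rsqrt)
    then have "norm \<xi> powr ?\<mu> \<le> 1 * japanese \<xi> powr ?\<mu>" using True by (simp add: powr_mono2)
    also have "\<dots> \<le> k powr \<bar>?\<mu>\<bar> * japanese \<xi> powr ?\<mu>" using k by (intro mult_right_mono ge_one_powr_ge_zero) auto
    finally show ?thesis .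
  next
    case False
    have "1 + (norm \<xi>)\<^sup>2 \<le> (k * norm \<xi>)\<^sup>2"
    proof -
      have "R\<^sup>2 \<le> (norm \<xi>)\<^sup>2" using \<xi> R(1) by (intro power_mono) auto
      then show ?thesis using R(1) by (simp add: k_def power_mult_distrib power_divide field_simps)
    qed
    then have "japanese \<xi> \<le> k * norm \<xi>" unfolding japanese_def using k by (intro real_le_lsqrt) auto
    then have "(k * norm \<xi>) powr ?\<mu> \<le> japanese \<xi> powr ?\<mu>"
      using False japanese_pos[of \<xi>] by (intro powr_mono2') auto
    then have "k powr (- ?\<mu>) * (k powr ?\<mu> * norm \<xi> powr ?\<mu>) \<le> k powr (- ?\<mu>) * japanese \<xi> powr ?\<mu>"
      using k by (simp add: powr_mult mult_left_mono)
    moreover have "k powr (- ?\<mu>) * k powr ?\<mu> = 1" using k by (simp add: powr_add[symmetric])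
    ultimately show ?thesis using False by (simp add: mult.assoc[symmetric])
  qed
  have "\<bar>dirs vs \<psi>m (x, \<xi>)\<bar> \<le> (c1 * k powr \<bar>?\<mu>\<bar> + c2) * japanese \<xi> powr ?\<mu>" if x: "x \<in> C" for x \<xi>
  proof (cases "R < norm \<xi>")
    case True
    have \<xi>0: "\<xi> \<noteq> 0" using True R(1) by auto
    have "\<bar>dirs vs \<psi>m (x, \<xi>)\<bar> = norm \<xi> powr ?\<mu> * \<bar>dirs vs \<psi> (x, (1 / norm \<xi>) *\<^sub>R \<xi>)\<bar>"
      using dirs_\<psi>m[OF subsetD[OF C(2) x] True] normalize(1)[OF vs x \<xi>0] by (simp add: abs_mult)
    also have "\<dots> \<le> norm \<xi> powr ?\<mu> * c1" using c1(2)[OF normalize(2)[OF vs x \<xi>0]] by (intro mult_left_mono) auto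
    also have "\<dots> \<le> (k powr \<bar>?\<mu>\<bar> * japanese \<xi> powr ?\<mu>) * c1" using big[OF True] c1(1) by (rule mult_right_mono)
    also have "\<dots> \<le> (c1 * k powr \<bar>?\<mu>\<bar> + c2) * japanese \<xi> powr ?\<mu>" using c2(1) by (simp add: algebra_simps)
    finally show ?thesis .
  next
    case False
    then have "\<bar>dirs vs \<psi>m (x, \<xi>)\<bar> * japanese \<xi> powr (- ?\<mu>) \<le> c2"
      using c2(2)[of "(x, \<xi>)"] x by (simp add: abs_mult)
    then have "\<bar>dirs vs \<psi>m (x, \<xi>)\<bar> \<le> c2 * japanese \<xi> powr ?\<mu>"
      using japanese_pos[of \<xi>] unfolding powr_minus by (simp add: field_simps)
    also have "\<dots> \<le> (c1 * k powr \<bar>?\<mu>\<bar> + c2) * japanese \<xi> powr ?\<mu>" using c1(1) by (intro mult_right_mono) auto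
    finally show ?thesis .
  qed
  moreover have "0 \<le> c1 * k powr \<bar>?\<mu>\<bar> + c2" using c1(1) c2(1) by simp
  ultimately show ?thesis by blast
qed

text \<open>The mixed derivative is homogeneous of degree 0 in xi and has no zero over
  \<open>C\<close>, so it is bounded away from 0. Integrating it from x_n = 0, where d psi / d xi_n
  vanishes, produces the factor |x_n|.\<close>

lemma normal_bound: "\<exists>c>0. \<forall>x t \<xi>. (x, t) \<in> C \<longrightarrow> \<xi> \<noteq> 0 \<longrightarrow> c * \<bar>t\<bar> \<le> \<bar>pd es \<psi> ((x, t), \<xi>)\<bar>"
proof -
  have "continuous_on (C \<times> sphere 0 1) (\<lambda>p. \<bar>dirs [et, es] \<psi> p\<bar>)" by (intro continuous_intros continuous_dirs)
  moreover have "0 < \<bar>dirs [et, es] \<psi> p\<bar>" if p: "p \<in> C \<times> sphere 0 1" for p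
  proof -
    have "fst p \<in> C" "snd p \<noteq> 0" using p by (auto simp: mem_Times_iff)
    from nondegenerate[OF this] show ?thesis by simp
  qed
  ultimately have "\<exists>c>0. \<forall>p\<in>C \<times> sphere 0 1. c \<le> \<bar>dirs [et, es] \<psi> p\<bar>" by (rule continuous_positive_bound[OF C_sphere(1)])
  then
  obtain c where c: "0 < c" "\<And>p. p \<in> C \<times> sphere 0 1 \<Longrightarrow> c \<le> \<bar>dirs [et, es] \<psi> p\<bar>"
    by blast
  have cb: "c \<le> \<bar>pd et (pd es \<psi>) (x, \<xi>)\<bar>" if "x \<in> C" "\<xi> \<noteq> 0" for x \<xi>
  proof -
    have B: "set [et, es] \<subseteq> (Basis :: ('m rn \<times> 'm rn) set)" by (simp add: et_es_Basis)
    have "cov_order [et, es :: 'm rn \<times> 'm rn] = 1" by (simp add: zero_prod_def)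
    then show ?thesis using normalize[OF B that] c(2)[of "(x, (1 / norm \<xi>) *\<^sub>R \<xi>)"] that(2) by simp
  qed
  have "c * \<bar>t\<bar> \<le> \<bar>pd es \<psi> ((x, t), \<xi>)\<bar>" if x: "(x, t) \<in> C" and \<xi>: "\<xi> \<noteq> 0" for x t \<xi>
  proof -
    let ?g = "\<lambda>s. pd es \<psi> (((x, 0), \<xi>) + s *\<^sub>R et)"
    have mem: "((x, s), \<xi>) \<in> S" if "\<bar>s\<bar> \<le> \<bar>t\<bar>" for s
      using star[OF x that] C \<xi> by auto
    have "(?g has_vector_derivative pd et (pd es \<psi>) (((x, 0), \<xi>) + s *\<^sub>R et)) (at s)" if "\<bar>s\<bar> \<le> \<bar>t\<bar>" for s
      by (rule line_derivative[OF smooth_on_differentiable[OF smooth_on_pd[OF smooth]]]) (use mem[OF that] in simp)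
    then have der: "(?g has_real_derivative pd et (pd es \<psi>) ((x, s), \<xi>)) (at s)" if "\<bar>s\<bar> \<le> \<bar>t\<bar>" for s
      using that by (simp add: has_real_derivative_iff_has_vector_derivative)
    \<comment> \<open>The mean value theorem in the form of an equality, because a bound from below
      is wanted. It is available for real functions and used on either side of 0.\<close>
    have "\<exists>z. \<bar>z\<bar> \<le> \<bar>t\<bar> \<and> ?g t - ?g 0 = t * pd et (pd es \<psi>) ((x, z), \<xi>)"
    proof (cases t "0 :: real" rule: linorder_cases)
      case less
      have "\<exists>z>t. z < 0 \<and> ?g 0 - ?g t = (0 - t) * pd et (pd es \<psi>) ((x, z), \<xi>)"
        by (rule MVT2[OF less]) (use der less in auto)
      then obtain z where "t < z" "z < 0" "?g 0 - ?g t = (0 - t) * pd et (pd es \<psi>) ((x, z), \<xi>)" by blast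
      then show ?thesis by (intro exI[of _ z]) (simp add: algebra_simps)
    next
      case greater
      have "\<exists>z>0. z < t \<and> ?g t - ?g 0 = (t - 0) * pd et (pd es \<psi>) ((x, z), \<xi>)"
        by (rule MVT2[OF greater]) (use der greater in auto)
      then obtain z where "0 < z" "z < t" "?g t - ?g 0 = (t - 0) * pd et (pd es \<psi>) ((x, z), \<xi>)" by blast
      then show ?thesis by (intro exI[of _ z]) (simp add: algebra_simps)
    qed auto
    then obtain z where z: "\<bar>z\<bar> \<le> \<bar>t\<bar>" "?g t - ?g 0 = t * pd et (pd es \<psi>) ((x, z), \<xi>)" by blast
    have "x \<in> \<Omega>'" using x C by auto
    then have "?g 0 = 0" using boundary_zero[OF _ \<xi>] by simp
    then have "\<bar>pd es \<psi> ((x, t), \<xi>)\<bar> = \<bar>t\<bar> * \<bar>pd et (pd es \<psi>) ((x, z), \<xi>)\<bar>" using z(2) by (simp add: abs_mult)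
    also have "\<dots> \<ge> \<bar>t\<bar> * c" by (intro mult_left_mono cb star[OF x z(1)] \<xi>) simp
    finally show ?thesis by (simp add: mult.commute)
  qed
  then show ?thesis using c(1) by blast
qed

text \<open>Both sides have degree 2 in xi, so the unit sphere over the compact set \<open>C\<close>
  suffices. At points with xi' = 0 the second summand is positive by
  \<open>normal_derivative_nonzero\<close>, at all others the first one is.\<close>

lemma tangential_bound:
  "\<exists>c>0. \<forall>x\<in>C. \<forall>\<xi>. \<xi> \<noteq> 0 \<longrightarrow> c * (norm \<xi>)\<^sup>2 \<le> (norm (fst \<xi>))\<^sup>2 + (pd et \<psi> (x, \<xi>))\<^sup>2"
proof -
  let ?h = "\<lambda>p. (norm (fst (snd p)))\<^sup>2 + (dirs [et] \<psi> p)\<^sup>2"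
  have "continuous_on (C \<times> sphere 0 1) ?h" by (intro continuous_intros continuous_dirs)
  moreover have "0 < ?h p" if p: "p \<in> C \<times> sphere 0 1" for p
  proof (cases "fst (snd p) = 0")
    case True
    obtain x s where ps: "p = (x, (0, s))" using True by (metis prod.collapse)
    then have s: "s \<noteq> 0" "x \<in> C" using p by auto
    have "pd et \<psi> (x, (0, s)) \<noteq> 0"
      using s C(2) nondegenerate[of x "(0, s)"] by (intro normal_derivative_nonzero) (auto simp: zero_prod_def)
    then show ?thesis by (simp add: ps)
  qed (simp add: add_pos_nonneg)
  ultimately obtain c where c: "0 < c" "\<And>p. p \<in> C \<times> sphere 0 1 \<Longrightarrow> c \<le> ?h p"
    using continuous_positive_bound[OF C_sphere(1), of ?h] by blast
  have "c * (norm \<xi>)\<^sup>2 \<le> (norm (fst \<xi>))\<^sup>2 + (pd et \<psi> (x, \<xi>))\<^sup>2" if "x \<in> C" "\<xi> \<noteq> 0" for x \<xi>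
  proof -
    let ?e = "(1 / norm \<xi>) *\<^sub>R \<xi>"
    have "c * (norm \<xi>)\<^sup>2 \<le> ?h (x, ?e) * (norm \<xi>)\<^sup>2"
      by (intro mult_right_mono c(2) normalize(2)[of "[et]"] that) (auto simp: et_es_Basis)
    also have "\<dots> = (norm (fst \<xi>))\<^sup>2 + (norm \<xi> * dirs [et] \<psi> (x, ?e))\<^sup>2"
      using that(2) by (simp add: power_mult_distrib power_divide distrib_right)
    also have "norm \<xi> * dirs [et] \<psi> (x, ?e) = pd et \<psi> (x, \<xi>)"
      using normalize(1)[of "[et]", OF _ that] that(2) by (simp add: et_es_Basis)
    finally show ?thesis .
  qed
  then show ?thesis using c(1) by blast
qed

end

lemma wt_shift:
  "wt (\<mu> + 1) M N p = lam p * wt \<mu> M N p"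
  "wt \<mu> (M + 1) N p = (1 + lam p * \<bar>snd (fst p)\<bar>) * wt \<mu> M N p"
  using japanese_pos[of "fst (snd p)"] base_pos[of p] by (simp_all add: wt_def powr_add)

section \<open>The phase minus its boundary value, as a weighted symbol\<close>

context phase_collar
begin

text \<open>A linear projection, so that the boundary phase is \<open>\<psi>\<close> after the
  affine substitution \<open>es + boundary_part p\<close>. The shift by \<open>es\<close> inserts
  the value 1 for xi_n and keeps the covariable nonzero.\<close>

definition boundary_part :: "'m rn \<times> 'm rn \<Rightarrow> 'm rn \<times> 'm rn" where
  "boundary_part v = ((fst (fst v), 0), (fst (snd v), 0))"

definition \<phi> :: "'m rn \<times> 'm rn \<Rightarrow> real" where
  "\<phi> p = \<psi>m p - \<psi> (es + boundary_part p)"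

lemma \<phi>_eq: "\<phi> p = \<psi>m p - phase_boundary \<psi> (fst (fst p)) (fst (snd p))"
  by (simp add: \<phi>_def boundary_part_def phase_boundary_def zero_prod_def)

lemma boundary_part_bounded_linear: "bounded_linear boundary_part"
  unfolding boundary_part_def by (intro bounded_linear_intros)

lemma boundary_part_mem: "p \<in> \<Omega> \<times> UNIV \<Longrightarrow> es + boundary_part p \<in> S"
  by (auto simp: boundary_part_def zero_prod_def)

lemma partials_\<phi>: "partials_on (\<Omega> \<times> UNIV) \<phi>"
  unfolding \<phi>_def
  by (intro partials_on_diff open_S smooth_on_partials[OF \<psi>m] partials_on_affine[OF open_S(3) smooth boundary_part_bounded_linear] boundary_part_mem)

lemma dirs_\<phi>:
  assumes "set vs \<subseteq> Basis" "p \<in> \<Omega> \<times> UNIV"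
  shows "dirs vs \<phi> p = dirs vs \<psi>m p - dirs (map boundary_part vs) \<psi> (es + boundary_part p)"
proof -
  have "dirs vs \<phi> p = dirs vs \<psi>m p - dirs vs (\<lambda>p. \<psi> (es + boundary_part p)) p"
    unfolding \<phi>_def
    by (rule dirs_diff[OF open_S(3) smooth_on_partials[OF \<psi>m] partials_on_affine[OF open_S(3) smooth boundary_part_bounded_linear] assms])
      (rule boundary_part_mem)
  also have "dirs vs (\<lambda>p. \<psi> (es + boundary_part p)) p = dirs (map boundary_part vs) \<psi> (es + boundary_part p)"
    by (rule dirs_affine[OF open_S(3) smooth boundary_part_bounded_linear boundary_part_mem assms(2)])
  finally show ?thesis .
qed

text \<open>The projection sends \<open>et\<close> and \<open>es\<close> to 0, so one such direction
  anywhere in the list removes the boundary term.\<close>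

lemma dirs_\<phi>_normal:
  assumes "set vs \<subseteq> Basis" "p \<in> \<Omega> \<times> UNIV" "et \<in> set vs \<or> es \<in> set vs"
  shows "dirs vs \<phi> p = dirs vs \<psi>m p"
proof -
  have "boundary_part et = 0" "boundary_part es = 0" by (simp_all add: boundary_part_def zero_prod_def)
  then have "0 \<in> set (map boundary_part vs)" using assms(3) by force
  from dirs_zero_direction[OF open_S(1) smooth this boundary_part_mem[OF assms(2)]]
  show ?thesis using dirs_\<phi>[OF assms(1,2)] by simp
qed

text \<open>As xi' is nonzero, the line of all \<open>(fst \<xi>, s)\<close> avoids the zero
  covector, and \<open>\<psi>\<close> is constant on it by \<open>boundary_zero\<close>. The
  condition |xi'| > R excludes the region where the phase was modified, whatever xi_n is.\<close>

lemma \<phi>_zero: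
  assumes x: "x' \<in> \<Omega>'" and \<xi>: "R < norm (fst \<xi>)"
  shows "\<phi> ((x', 0), \<xi>) = 0"
proof -
  have \<xi>0: "fst \<xi> \<noteq> 0" using \<xi> R(1) by auto
  have mem: "((x', 0), (fst \<xi>, s)) \<in> S" for s using x \<xi>0 by (auto simp: zero_prod_def)
  let ?g = "\<lambda>s. \<psi> (((x', 0), (fst \<xi>, 0)) + s *\<^sub>R es)"
  have "norm (?g (snd \<xi>) - ?g 1) \<le> 0 * \<bar>snd \<xi> - 1\<bar>"
  proof (rule mean_value_bound)
    fix s
    show "(?g has_vector_derivative pd es \<psi> (((x', 0), (fst \<xi>, 0)) + s *\<^sub>R es)) (at s)"
      by (rule line_derivative[OF smooth_on_differentiable[OF smooth]]) (use mem[of s] in simp)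
    show "norm (pd es \<psi> (((x', 0), (fst \<xi>, 0)) + s *\<^sub>R es)) \<le> 0"
      using boundary_zero[OF x, of "(fst \<xi>, s)"] \<xi>0 by (simp add: zero_prod_def)
  qed
  then have "\<psi> ((x', 0), \<xi>) = \<psi> ((x', 0), (fst \<xi>, 1))" by simp
  moreover have "R \<le> norm \<xi>" using \<xi> norm_fst_le[of "fst \<xi>" "snd \<xi>"] by simp
  ultimately show ?thesis using R(2)[of "(x', 0)" \<xi>] x by (simp add: \<phi>_eq phase_boundary_def)
qed

text \<open>By \<open>\<phi>_zero\<close> the function vanishes on an open piece of the hypersurface
  x_n = 0; a direction other than \<open>et\<close> is tangential to it.\<close>

lemma dirs_\<phi>_zero:
  assumes "set vs \<subseteq> Basis" "et \<notin> set vs" "x' \<in> \<Omega>'" "R < norm (fst \<xi>)"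
  shows "dirs vs \<phi> ((x', 0), \<xi>) = 0"
  using assms
proof (induction vs arbitrary: x' \<xi>)
  case Nil
  then show ?case using \<phi>_zero by simp
next
  case (Cons v vs)
  have v: "snd (fst v) = 0"
    by (rule Basis_product_cases[of v]) (use Cons.prems in auto)
  let ?z = "((x', 0 :: real), \<xi>)"
  let ?W = "\<Omega>' \<times> {\<xi> :: 'm rn. R < norm (fst \<xi>)}"
  have "open ?W" using open_\<Omega>' by (intro open_Times open_Collect_less continuous_intros)
  moreover have "(x', \<xi>) \<in> ?W" using Cons.prems by simp
  ultimately obtain e where e: "0 < e" "ball (x', \<xi>) e \<subseteq> ?W" using open_contains_ball by blast
  let ?v = "(fst (fst v), snd v)"
  have "pd v (dirs vs \<phi>) ?z = 0"
  proof (rule tangential_derivative_zero)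
    show "dirs vs \<phi> differentiable (at ?z)"
      by (rule partials_onD[OF partials_\<phi>]) (use Cons.prems in auto)
    show "0 < e / (norm ?v + 1)" using e by (simp add: add_nonneg_pos)
    fix s :: real assume s: "\<bar>s\<bar> < e / (norm ?v + 1)"
    have "norm (s *\<^sub>R ?v) < e"
    proof -
      have "\<bar>s\<bar> * norm ?v \<le> \<bar>s\<bar> * (norm ?v + 1)" by (intro mult_left_mono) auto
      also have "\<dots> < e" using s by (simp add: pos_less_divide_eq add_nonneg_pos)
      finally show ?thesis by (simp only: norm_scaleR)
    qed
    then have "(x', \<xi>) + s *\<^sub>R ?v \<in> ball (x', \<xi>) e" unfolding mem_ball by (metis add_diff_cancel_left' dist_commute dist_norm)
    then have "(x', \<xi>) + s *\<^sub>R ?v \<in> ?W" using e(2) by blast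
    then have "x' + s *\<^sub>R fst (fst v) \<in> \<Omega>'" "R < norm (fst (\<xi> + s *\<^sub>R snd v))" by simp_all
    from Cons.IH[OF _ _ this] have "dirs vs \<phi> ((x' + s *\<^sub>R fst (fst v), 0), \<xi> + s *\<^sub>R snd v) = 0" using Cons.prems by simp
    moreover have "?z + s *\<^sub>R v = ((x' + s *\<^sub>R fst (fst v), 0), \<xi> + s *\<^sub>R snd v)"
      using v by (simp add: prod_eq_iff)
    ultimately show "dirs vs \<phi> (?z + s *\<^sub>R v) = 0" by simp
  qed
  then show ?case by simp
qed

lemma boundary_bound: "\<exists>c\<ge>0. \<forall>p. fst p \<in> C \<longrightarrow> norm (fst (snd p)) \<le> R \<longrightarrow> \<bar>dirs vs \<psi> (es + boundary_part p)\<bar> \<le> c"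
proof -
  let ?f = "\<lambda>(x :: 'm rn, \<eta>). ((fst x, 0), (\<eta>, 1)) :: 'm rn \<times> 'm rn"
  let ?A = "?f ` (C \<times> cball (0 :: real ^ 'm) R)"
  have K: "compact ?A"
    unfolding case_prod_beta by (intro compact_continuous_image compact_Times C(1) compact_cball continuous_intros)
  have "?A \<subseteq> S" using C(2) by (auto simp: zero_prod_def)
  then have cont: "continuous_on ?A (dirs vs \<psi>)" by (rule continuous_on_subset[OF smooth_on_continuous[OF smooth]])
  from continuous_bound[OF K cont] obtain c where c: "0 \<le> c" "\<forall>p\<in>?A. \<bar>dirs vs \<psi> p\<bar> \<le> c"
    by (elim exE conjE)
  have "\<bar>dirs vs \<psi> (es + boundary_part p)\<bar> \<le> c" if "fst p \<in> C" "norm (fst (snd p)) \<le> R" for p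
  proof -
    have "es + boundary_part p \<in> ?A"
      using that by (intro image_eqI[of _ _ "(fst p, fst (snd p))"]) (auto simp: boundary_part_def zero_prod_def)
    with c(2) show ?thesis by (rule bspec)
  qed
  with c(1) show ?thesis by (intro exI[of _ c]) simp
qed

definition J :: real where "J = sqrt (1 + R\<^sup>2)"

lemma J: "0 < J" "norm (fst (snd p)) \<le> R \<Longrightarrow> lam p \<le> J"
  unfolding J_def japanese_def by (auto intro!: power_mono simp: add_pos_nonneg)

text \<open>Outside \<open>|\<xi>'| \<le> R\<close> the phase vanishes at \<open>x\<^sub>n = 0\<close>; this gives the factor \<open>|x\<^sub>n|\<close> that
  compensates the order 1 of the phase.\<close>

lemma phase_bound:
  assumes vs: "set vs \<subseteq> Basis"
  shows "\<exists>c\<ge>0. \<forall>p. fst p \<in> C \<longrightarrow> \<bar>dirs vs \<phi> p\<bar> \<le>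
    c * wt (real (count_list vs et) - cov_order vs) (if et \<in> set vs then 0 else 1) (if cov_order vs = 0 then 1 else 0) p"
proof -
  define n where "n = real (cov_order vs)"
  define N :: real where "N = (if cov_order vs = 0 then 1 else 0)"
  have nN: "1 - n \<le> N" "0 \<le> N" "0 \<le> n" by (auto simp: n_def N_def)
  obtain c1 where c1: "0 \<le> c1" "\<And>x \<xi>. x \<in> C \<Longrightarrow> \<bar>dirs vs \<psi>m (x, \<xi>)\<bar> \<le> c1 * japanese \<xi> powr (1 - n)"
    using symbol_bound[OF vs] unfolding n_def by blast
  have b1: "\<bar>dirs vs \<psi>m p\<bar> \<le> c1 * wt (1 - n) 0 N p" if "fst p \<in> C" for p
    using c1(2)[OF that, of "snd p"] mult_left_mono[OF japanese_split[OF nN(1,2), of p] c1(1)] by simp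
  have mem: "p \<in> \<Omega> \<times> UNIV" if "fst p \<in> C" for p :: "'m rn \<times> 'm rn" using that C(2) by (cases p) auto
  show ?thesis
  proof (cases "et \<in> set vs")
    case True
    \<comment> \<open>Each \<open>et\<close> raises the exponent of <xi'> in the weight by 1, so a
      single one already accounts for the order 1 of the phase.\<close>
    have "1 \<le> count_list vs et" using True by (metis Suc_leI count_list_0_iff gr0I One_nat_def)
    then have "wt (1 - n) 0 N p \<le> wt (real (count_list vs et) - n) 0 N p" for p :: "'m rn \<times> 'm rn"
      by (intro wt_mono) auto
    then have "\<bar>dirs vs \<phi> p\<bar> \<le> c1 * wt (real (count_list vs et) - n) 0 N p" if "fst p \<in> C" for p
      using b1[OF that] dirs_\<phi>_normal[OF vs mem[OF that]] True mult_left_mono[OF _ c1(1)] by (metis order_trans)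
    then show ?thesis using c1(1) True unfolding n_def N_def by auto
  next
    case False
    have vs': "set (et # vs) \<subseteq> Basis" using vs et_es_Basis(1) by simp
    obtain c2 where c2: "0 \<le> c2" "\<And>x \<xi>. x \<in> C \<Longrightarrow> \<bar>dirs (et # vs) \<psi>m (x, \<xi>)\<bar> \<le> c2 * japanese \<xi> powr (1 - n)"
      using symbol_bound[OF vs'] by (auto simp: n_def)
    obtain c3 where c3: "0 \<le> c3" "\<And>p. fst p \<in> C \<Longrightarrow> norm (fst (snd p)) \<le> R \<Longrightarrow> \<bar>dirs (map boundary_part vs) \<psi> (es + boundary_part p)\<bar> \<le> c3"
      using boundary_bound by blast
    \<comment> \<open>The first two summands serve |xi'| <= R, where <xi'> is at most
      \<open>J\<close>: one for the modified phase, one for its boundary value. The last serves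
      |xi'| > R, through the mean value theorem in x_n.\<close>
    define c where "c = c1 * J + c3 * J powr n + c2"
    have Jn: "0 \<le> c3 * J powr n" "0 \<le> c1 * J" using c1(1) c3(1) J(1) by auto
    have "\<bar>dirs vs \<phi> p\<bar> \<le> c * wt (- n) 1 N p" if p: "fst p \<in> C" for p
    proof (cases "norm (fst (snd p)) \<le> R")
      case True
      have "wt (1 - n) 0 N p = lam p * wt (- n) 0 N p" using wt_shift(1)[of "- n" 0 N p] by simp
      also have "\<dots> \<le> J * wt (- n) 0 N p" using J(2)[OF True] wt_pos[of "- n" 0 N p] by (intro mult_right_mono) auto
      also have "\<dots> \<le> J * wt (- n) 1 N p" using J(1) by (intro mult_left_mono wt_mono) auto
      finally have 1: "c1 * wt (1 - n) 0 N p \<le> c1 * J * wt (- n) 1 N p" using c1(1) by (simp add: mult.assoc mult_left_mono)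
      have "J powr (- n) \<le> lam p powr (- n)" using J(2)[OF True] japanese_pos[of "fst (snd p)"] nN(3) by (intro powr_mono2') auto
      also have "\<dots> = wt (- n) 0 0 p" using base_pos[of p] by (simp add: wt_def less_imp_neq[symmetric])
      also have "\<dots> \<le> wt (- n) 1 N p" using nN by (intro wt_mono) auto
      finally have "J powr n * J powr (- n) \<le> J powr n * wt (- n) 1 N p" using J(1) by (intro mult_left_mono) auto
      then have "1 \<le> J powr n * wt (- n) 1 N p" using J(1) by (simp add: powr_add[symmetric])
      then have "c3 * 1 \<le> c3 * (J powr n * wt (- n) 1 N p)" using c3(1) by (rule mult_left_mono)
      then have "\<bar>dirs vs \<phi> p\<bar> \<le> c1 * J * wt (- n) 1 N p + c3 * J powr n * wt (- n) 1 N p"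
        using 1 b1[OF p] c3(2)[OF p True] dirs_\<phi>[OF vs mem[OF p]] by (simp add: mult.assoc)
      also have "\<dots> \<le> c * wt (- n) 1 N p"
        using c2(1) wt_pos[of "- n" 1 N p] by (simp add: c_def distrib_right)
      finally show ?thesis .
    next
      case False
      obtain x t \<xi> where pe: "p = ((x, t), \<xi>)" by (metis prod.collapse)
      have seg: "(x, s) \<in> C" if "s \<in> closed_segment 0 t" for s
        by (rule star[of x t]) (use p that in \<open>auto simp: pe closed_segment_eq_real_ivl split: if_splits\<close>)
      let ?g = "\<lambda>s. dirs vs \<phi> (((x, 0), \<xi>) + s *\<^sub>R et)"
      have "norm (?g t - ?g 0) \<le> c2 * wt (1 - n) 0 N p * \<bar>t - 0\<bar>"
      proof (rule mean_value_bound)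
        fix s assume s: "s \<in> closed_segment 0 t"
        have m: "((x, s), \<xi>) \<in> \<Omega> \<times> UNIV" using mem[of "((x, s), \<xi>)"] seg[OF s] by simp
        show "(?g has_vector_derivative pd et (dirs vs \<phi>) (((x, 0), \<xi>) + s *\<^sub>R et)) (at s)"
          by (rule line_derivative[OF partials_onD[OF partials_\<phi> vs]]) (use m in simp)
        have "wt (1 - n) 0 N ((x, s), \<xi>) = wt (1 - n) 0 N p"
          using base_pos(1)[of p] base_pos(1)[of "((x, s), \<xi>)"] by (simp add: pe wt_def less_imp_neq[symmetric])
        then have "\<bar>dirs (et # vs) \<psi>m ((x, s), \<xi>)\<bar> \<le> c2 * wt (1 - n) 0 N p"
          using c2(2)[OF seg[OF s], of \<xi>] mult_left_mono[OF japanese_split[OF nN(1,2), of "((x, s), \<xi>)"] c2(1)] by simp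
        then show "norm (pd et (dirs vs \<phi>) (((x, 0), \<xi>) + s *\<^sub>R et)) \<le> c2 * wt (1 - n) 0 N p"
          using dirs_\<phi>_normal[OF vs' m] by simp
      qed
      moreover have "?g 0 = 0"
        using dirs_\<phi>_zero[OF vs \<open>et \<notin> set vs\<close>, of x \<xi>] False mem[OF p] by (simp add: pe)
      ultimately have "\<bar>dirs vs \<phi> p\<bar> \<le> c2 * (\<bar>t\<bar> * wt (1 - n) 0 N p)" by (simp add: pe mult_ac)
      also have "\<bar>t\<bar> * wt (1 - n) 0 N p = (lam p * \<bar>t\<bar>) * wt (- n) 0 N p" using wt_shift(1)[of "- n" 0 N p] by simp
      also have "\<dots> \<le> (1 + lam p * \<bar>t\<bar>) * wt (- n) 0 N p" using wt_pos[of "- n" 0 N p] by (intro mult_right_mono) auto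
      also have "\<dots> = wt (- n) 1 N p" using wt_shift(2)[of "- n" 0 N p] by (simp add: pe)
      finally have "\<bar>dirs vs \<phi> p\<bar> \<le> c2 * wt (- n) 1 N p" using c2(1) by (simp add: mult_left_mono)
      also have "\<dots> \<le> c * wt (- n) 1 N p" using Jn wt_pos[of "- n" 1 N p] by (intro mult_right_mono) (auto simp: c_def)
      finally show ?thesis .
    qed
    moreover have "0 \<le> c" using Jn c2(1) by (simp add: c_def)
    moreover have "count_list vs et = 0" using False by simp
    ultimately show ?thesis using False unfolding n_def N_def by auto
  qed
qed

text \<open>Further directions \<open>vs\<close> in front of \<open>ws\<close> can only lower the
  two growth exponents of \<open>phase_bound\<close>, so the values for \<open>ws\<close> alone
  bound all derivatives. Their effect on the order is exactly the product of the weights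
  \<open>\<omega> v p\<close>.\<close>

lemma Sym_phase:
  fixes ws :: "('m rn \<times> 'm rn) list"
  assumes ws: "set ws \<subseteq> Basis" and O': "open O'" "O' \<subseteq> C"
    and M: "(if et \<in> set ws then 0 else 1) \<le> M" and N: "(if cov_order ws = 0 then 1 else 0) \<le> N"
  shows "Sym (O' \<times> UNIV) (real (count_list ws et) - cov_order ws) M N (dirs ws (\<lambda>p. of_real (\<phi> p)))"
  unfolding Sym_def
proof (intro allI sigI)
  have P: "partials_on (\<Omega> \<times> UNIV) (\<lambda>p. complex_of_real (\<phi> p))"
    by (rule partials_on_of_real[OF open_S(3) partials_\<phi>])
  have sub: "O' \<times> UNIV \<subseteq> \<Omega> \<times> (UNIV :: 'm rn set)" using O'(2) C(2) by blast
  show "partials_on (O' \<times> UNIV) (dirs ws (\<lambda>p. complex_of_real (\<phi> p)))"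
    by (rule partials_on_subset[OF partials_on_dirs[OF P ws] sub])
  fix vs :: "('m rn \<times> 'm rn) list" assume vs: "set vs \<subseteq> Basis"
  then have vw: "set (vs @ ws) \<subseteq> Basis" using ws by simp
  let ?n = "\<lambda>vs :: ('m rn \<times> 'm rn) list. real (count_list vs et) - cov_order vs"
  obtain c where c: "0 \<le> c" "\<And>p. fst p \<in> C \<Longrightarrow> \<bar>dirs (vs @ ws) \<phi> p\<bar> \<le>
      c * wt (?n (vs @ ws)) (if et \<in> set (vs @ ws) then 0 else 1) (if cov_order (vs @ ws) = 0 then 1 else 0) p"
    using phase_bound[OF vw] by blast
  have "norm (dirs vs (dirs ws (\<lambda>p. complex_of_real (\<phi> p))) p) \<le>
      c * (prod_list (map (\<lambda>v. \<omega> v p) vs) * wt (?n ws) M N p)" if p: "p \<in> O' \<times> UNIV" for p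
  proof -
    have pC: "fst p \<in> C" using p O'(2) by auto
    have "norm (dirs vs (dirs ws (\<lambda>p. complex_of_real (\<phi> p))) p) = \<bar>dirs (vs @ ws) \<phi> p\<bar>"
      using dirs_of_real[OF open_S(3) partials_\<phi> vw subsetD[OF sub p]] by (simp add: dirs_append)
    also have "\<dots> \<le> c * wt (?n (vs @ ws)) (if et \<in> set (vs @ ws) then 0 else 1) (if cov_order (vs @ ws) = 0 then 1 else 0) p"
      by (rule c(2)[OF pC])
    also have "\<dots> \<le> c * wt (?n (vs @ ws)) M N p"
    proof (intro mult_left_mono[OF _ c(1)] wt_mono)
      show "(if et \<in> set (vs @ ws) then 0 else 1) \<le> M" "(if cov_order (vs @ ws) = 0 then 1 else 0) \<le> N"
        using M N by (auto split: if_splits)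
    qed simp
    also have "wt (?n (vs @ ws)) M N p = prod_list (map (\<lambda>v. \<omega> v p) vs) * wt (?n ws) M N p"
    proof -
      have "?n (vs @ ws) = ?n vs + ?n ws" by (simp add: count_list_append)
      then have "lam p powr ?n (vs @ ws) = lam p powr ?n vs * lam p powr ?n ws" by (simp only: powr_add)
      then show ?thesis unfolding weight_product[OF vs] wt_def by (simp only: mult.assoc)
    qed
    finally show ?thesis .
  qed
  then show "\<exists>c. \<forall>p\<in>O' \<times> UNIV. norm (dirs vs (dirs ws (\<lambda>p. complex_of_real (\<phi> p))) p) \<le>
      c * (prod_list (map (\<lambda>v. \<omega> v p) vs) * wt (?n ws) M N p)" by blast
qed

end

context phase_collar
begin

lemma lower_bound_normal:
  "\<exists>c>0. \<forall>p. fst p \<in> C \<longrightarrow> c * wt 0 2 0 p \<le> 1 + (lam p)\<^sup>2 * (pd es \<psi>m p)\<^sup>2"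
proof -
  obtain c1 where c1: "0 < c1" "\<And>x t \<xi>. (x, t) \<in> C \<Longrightarrow> \<xi> \<noteq> 0 \<Longrightarrow> c1 * \<bar>t\<bar> \<le> \<bar>pd es \<psi> ((x, t), \<xi>)\<bar>"
    using normal_bound by blast
  \<comment> \<open>Write y = <xi'> |x_n|. The first entry serves |xi'| > R together with (1 + y)^2
    <= 2 (1 + y^2); the second serves |xi'| <= R, where y is at most \<open>J\<close> and the
    summand 1 on the right suffices.\<close>
  define c where "c = min (min 1 (c1\<^sup>2) / 2) (1 / (1 + J)\<^sup>2)"
  have "c * wt 0 2 0 p \<le> 1 + (lam p)\<^sup>2 * (pd es \<psi>m p)\<^sup>2" if p: "fst p \<in> C" for p
  proof -
    obtain x t \<xi> where pe: "p = ((x, t), \<xi>)" by (metis prod.collapse)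
    let ?y = "lam p * \<bar>t\<bar>"
    have y: "0 \<le> ?y" using japanese_pos[of "fst (snd p)"] by simp
    have wt: "wt 0 2 0 p = (1 + ?y)\<^sup>2"
      using base_pos[of p] japanese_pos[of "fst (snd p)"] by (simp add: wt_def pe less_imp_neq[symmetric])
    show ?thesis
    proof (cases "norm (fst \<xi>) \<le> R")
      case True
      have "\<bar>t\<bar> \<le> 1" using subsetD[OF C(2) p] by (auto simp: pe)
      then have "?y \<le> J * 1" using J(2)[of p] True J(1) by (intro mult_mono) (auto simp: pe)
      then have "(1 + ?y)\<^sup>2 \<le> (1 + J)\<^sup>2" using y by (intro power_mono) auto
      then have "1 / (1 + J)\<^sup>2 * (1 + ?y)\<^sup>2 \<le> 1" using J(1) by (simp add: divide_le_eq)
      moreover have "c * (1 + ?y)\<^sup>2 \<le> 1 / (1 + J)\<^sup>2 * (1 + ?y)\<^sup>2" unfolding c_def by (intro mult_right_mono) auto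
      moreover have "0 \<le> (lam p)\<^sup>2 * (pd es \<psi>m p)\<^sup>2" by simp
      ultimately show ?thesis unfolding wt by linarith
    next
      case False
      then have \<xi>: "R < norm \<xi>" "\<xi> \<noteq> 0" using norm_fst_le[of "fst \<xi>" "snd \<xi>"] R(1) by auto
      have "pd es \<psi>m p = pd es \<psi> p" using dirs_\<psi>m[OF _ \<xi>(1), of "(x, t)" "[es]"] p C(2) by (auto simp: pe)
      then have "c1 * \<bar>t\<bar> \<le> \<bar>pd es \<psi>m p\<bar>" using c1(2)[of x t \<xi>] \<xi>(2) p by (simp add: pe)
      then have "(c1 * \<bar>t\<bar>)\<^sup>2 \<le> (pd es \<psi>m p)\<^sup>2" using c1(1) power_mono[of "c1 * \<bar>t\<bar>" _ 2] by fastforce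
      then have "(lam p)\<^sup>2 * (c1 * \<bar>t\<bar>)\<^sup>2 \<le> (lam p)\<^sup>2 * (pd es \<psi>m p)\<^sup>2" by (intro mult_left_mono) auto
      then have 1: "c1\<^sup>2 * ?y\<^sup>2 \<le> (lam p)\<^sup>2 * (pd es \<psi>m p)\<^sup>2" by (simp add: power_mult_distrib mult_ac)
      have "2 * ?y \<le> 1 + ?y\<^sup>2" using sum_squares_bound[of 1 ?y] by simp
      then have "(1 + ?y)\<^sup>2 \<le> 2 * (1 + ?y\<^sup>2)" by (simp add: power2_sum)
      then have "c * (1 + ?y)\<^sup>2 \<le> (min 1 (c1\<^sup>2) / 2) * (2 * (1 + ?y\<^sup>2))" unfolding c_def by (intro mult_mono) auto
      also have "\<dots> = min 1 (c1\<^sup>2) * 1 + min 1 (c1\<^sup>2) * ?y\<^sup>2" by (simp add: algebra_simps)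
      also have "\<dots> \<le> 1 * 1 + c1\<^sup>2 * ?y\<^sup>2" by (intro add_mono mult_right_mono) auto
      finally show ?thesis using 1 unfolding wt by linarith
    qed
  qed
  moreover have "0 < c" using c1(1) J(1) by (simp add: c_def)
  ultimately show ?thesis by blast
qed

lemma lower_bound_tangential:
  "\<exists>c>0. \<forall>p. fst p \<in> C \<longrightarrow> c * wt 2 0 2 p \<le> (lam p)\<^sup>2 + (pd et \<psi>m p)\<^sup>2"
proof -
  obtain c2 where c2: "0 < c2" "\<And>x \<xi>. x \<in> C \<Longrightarrow> \<xi> \<noteq> 0 \<Longrightarrow> c2 * (norm \<xi>)\<^sup>2 \<le> (norm (fst \<xi>))\<^sup>2 + (pd et \<psi> (x, \<xi>))\<^sup>2"
    using tangential_bound by blast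
  \<comment> \<open>The weight is (<xi'> + |xi_n|)^2, at most 2 (1 + |xi|^2). The first entry serves
    |xi| > R by \<open>tangential_bound\<close>; the second serves |xi| <= R, where the right side
    is at least 1.\<close>
  define c where "c = min (min 1 c2 / 2) (1 / (2 * (1 + R\<^sup>2)))"
  have c: "0 < c" using c2(1) by (simp add: c_def add_pos_nonneg)
  have "c * wt 2 0 2 p \<le> (lam p)\<^sup>2 + (pd et \<psi>m p)\<^sup>2" if p: "fst p \<in> C" for p
  proof -
    obtain x \<xi> where pe: "p = (x, \<xi>)" by (cases p)
    have l: "0 < lam p" "(lam p)\<^sup>2 = 1 + (norm (fst \<xi>))\<^sup>2"
      using japanese_pos[of "fst (snd p)"] by (simp_all add: pe japanese_def add_nonneg_nonneg)
    have "wt 2 0 2 p = (lam p)\<^sup>2 * (1 + \<bar>snd \<xi>\<bar> / lam p)\<^sup>2"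
      using base_pos[of p] l by (simp add: wt_def pe less_imp_neq[symmetric])
    also have "\<dots> = (lam p * (1 + \<bar>snd \<xi>\<bar> / lam p))\<^sup>2" by (rule power_mult_distrib[symmetric])
    also have "lam p * (1 + \<bar>snd \<xi>\<bar> / lam p) = lam p + \<bar>snd \<xi>\<bar>" using l(1) by (simp add: distrib_left)
    also have "(lam p + \<bar>snd \<xi>\<bar>)\<^sup>2 \<le> 2 * ((lam p)\<^sup>2 + (snd \<xi>)\<^sup>2)"
      using sum_squares_bound[of "lam p" "\<bar>snd \<xi>\<bar>"] by (simp add: power2_sum)
    also have "\<dots> = 2 * (1 + (norm \<xi>)\<^sup>2)" using l(2) by (simp add: norm_prod_def)
    finally have wt: "c * wt 2 0 2 p \<le> c * (2 * (1 + (norm \<xi>)\<^sup>2))" using c by (intro mult_left_mono) auto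
    show ?thesis
    proof (cases "norm \<xi> \<le> R")
      case True
      then have "(norm \<xi>)\<^sup>2 \<le> R\<^sup>2" by (intro power_mono) auto
      then have "c * (2 * (1 + (norm \<xi>)\<^sup>2)) \<le> 1 / (2 * (1 + R\<^sup>2)) * (2 * (1 + R\<^sup>2))"
        unfolding c_def by (intro mult_mono) auto
      also have "\<dots> = 1" by (simp add: add_pos_nonneg less_imp_neq[symmetric])
      finally show ?thesis using wt l(2) zero_le_power2[of "norm (fst \<xi>)"] zero_le_power2[of "pd et \<psi>m p"] by linarith
    next
      case False
      then have \<xi>: "R < norm \<xi>" "\<xi> \<noteq> 0" using R(1) by auto
      have "pd et \<psi>m p = pd et \<psi> p" using dirs_\<psi>m[OF _ \<xi>(1), of x "[et]"] p C(2) by (auto simp: pe)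
      then have 1: "c2 * (norm \<xi>)\<^sup>2 \<le> (norm (fst \<xi>))\<^sup>2 + (pd et \<psi>m p)\<^sup>2" using c2(2)[of x \<xi>] \<xi>(2) p by (simp add: pe)
      have "c * (2 * (1 + (norm \<xi>)\<^sup>2)) \<le> (min 1 c2 / 2) * (2 * (1 + (norm \<xi>)\<^sup>2))"
        unfolding c_def by (intro mult_right_mono) auto
      also have "\<dots> = min 1 c2 * 1 + min 1 c2 * (norm \<xi>)\<^sup>2" by (simp add: algebra_simps)
      also have "\<dots> \<le> 1 * 1 + c2 * (norm \<xi>)\<^sup>2" by (intro add_mono mult_right_mono) auto
      finally show ?thesis using wt 1 l(2) by linarith
    qed
  qed
  then show ?thesis using c by blast
qed

lemma oscillatory_phase:
  assumes "open B" "open O'" "closed S0" "\<And>x. x \<in> S0 \<Longrightarrow> fst x \<in> B \<Longrightarrow> x \<in> O'" "\<And>x. x \<in> O' \<Longrightarrow> fst x \<in> B"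
    and sub: "O' \<subseteq> C"
  shows "\<exists>c0. oscillatory B O' S0 (\<lambda>p. of_real (\<phi> p)) c0"
proof -
  obtain c1 where c1: "0 < c1" "\<And>p. fst p \<in> C \<Longrightarrow> c1 * wt 0 2 0 p \<le> 1 + (lam p)\<^sup>2 * (pd es \<psi>m p)\<^sup>2"
    using lower_bound_normal by blast
  obtain c2 where c2: "0 < c2" "\<And>p. fst p \<in> C \<Longrightarrow> c2 * wt 2 0 2 p \<le> (lam p)\<^sup>2 + (pd et \<psi>m p)\<^sup>2"
    using lower_bound_tangential by blast
  let ?\<Phi> = "\<lambda>p. complex_of_real (\<phi> p)"
  have pd: "pd v ?\<Phi> p = of_real (pd v \<psi>m p)" if v: "v = et \<or> v = es" and p: "p \<in> O' \<times> UNIV" for v p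
  proof -
    have m: "p \<in> \<Omega> \<times> UNIV" using p sub C(2) by auto
    have B: "set [v] \<subseteq> Basis" using v et_es_Basis by auto
    show ?thesis using dirs_of_real[OF open_S(3) partials_\<phi> B m] dirs_\<phi>_normal[OF B m] v by auto
  qed
  have "oscillatory B O' S0 ?\<Phi> (min c1 c2)"
  proof
    show "Sym (O' \<times> UNIV) 0 1 1 ?\<Phi>"
      using Sym_phase[of "[]", OF _ assms(2) sub, of 1 1] by simp
    have B: "set [es] \<subseteq> (Basis :: ('m rn \<times> 'm rn) set)" "set [et] \<subseteq> (Basis :: ('m rn \<times> 'm rn) set)"
      by (simp_all add: et_es_Basis)
    show "Sym (O' \<times> UNIV) (-1) 1 0 (pd es ?\<Phi>)"
      using Sym_phase[OF B(1) assms(2) sub, of 1 0] by (simp add: zero_prod_def)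
    show "Sym (O' \<times> UNIV) 1 0 1 (pd et ?\<Phi>)"
      using Sym_phase[OF B(2) assms(2) sub, of 0 1] by (simp add: zero_prod_def)
    show "0 < min c1 c2" using c1(1) c2(1) by simp
    fix p :: "'m rn \<times> 'm rn" assume p: "p \<in> O' \<times> UNIV"
    then have pC: "fst p \<in> C" using sub by auto
    show "cmod (exp (\<i> * ?\<Phi> p)) = 1" by (simp add: norm_exp_i_times)
    have "min c1 c2 * wt 0 2 0 p \<le> c1 * wt 0 2 0 p" using wt_pos[of 0 2 0 p] by (intro mult_right_mono) auto
    also note c1(2)[OF pC]
    also have "1 + (lam p)\<^sup>2 * (pd es \<psi>m p)\<^sup>2 = cmod (of_real (1 + (lam p)\<^sup>2 * (pd es \<psi>m p)\<^sup>2))"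
      by (simp only: norm_of_real) simp
    finally show "min c1 c2 * wt 0 2 0 p \<le> cmod (1 + of_real ((lam p)\<^sup>2) * (pd es ?\<Phi> p)\<^sup>2)"
      using pd[OF _ p, of es] by simp
    have "min c1 c2 * wt 2 0 2 p \<le> c2 * wt 2 0 2 p" using wt_pos[of 2 0 2 p] by (intro mult_right_mono) auto
    also note c2(2)[OF pC]
    also have "(lam p)\<^sup>2 + (pd et \<psi>m p)\<^sup>2 = cmod (of_real ((lam p)\<^sup>2 + (pd et \<psi>m p)\<^sup>2))"
      by (simp only: norm_of_real) simp
    finally show "min c1 c2 * wt 2 0 2 p \<le> cmod (of_real ((lam p)\<^sup>2) + 1 * (pd et ?\<Phi> p)\<^sup>2)"
      using pd[OF _ p, of et] by simp
  qed (use assms in blast)+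
  then show ?thesis by blast
qed

end

text \<open>By \<open>japanese_split\<close>, with the exponent |m| chosen because it is nonnegative
  and dominates m - k for every number k of covariable derivatives. The directions are reordered to
  match the form in \<open>symbols\<close>, covariables in front.\<close>

lemma Sym_amplitude:
  fixes a :: "'m::finite rn \<times> 'm rn \<Rightarrow> complex"
  assumes a: "a \<in> symbols m"
  shows "Sym D m 0 \<bar>m\<bar> a"
  unfolding Sym_def
proof (intro allI sigI)
  have P: "partials_on UNIV a" using a by (auto simp: symbols_def intro: smooth_on_partials)
  then show "partials_on D a" by (rule partials_on_subset) simp
  fix vs :: "('m rn \<times> 'm rn) list" assume vs: "set vs \<subseteq> Basis"
  define \<alpha> where "\<alpha> = map snd (filter (\<lambda>v. snd v \<noteq> 0) vs)"
  define \<beta> where "\<beta> = map fst (filter (\<lambda>v. snd v = 0) vs)"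
  have B: "(v = (0, snd v) \<and> snd v \<in> Basis) \<or> (snd v = 0 \<and> v = (fst v, 0) \<and> fst v \<in> Basis)" if "v \<in> set vs" for v
    using vs that nonzero_Basis by (auto simp: Basis_prod_def)
  have 1: "map (\<lambda>b. (0, b)) \<alpha> = filter (\<lambda>v. snd v \<noteq> 0) vs"
    unfolding \<alpha>_def map_map using B by (intro map_idI) (auto simp: prod_eq_iff)
  have 2: "map (\<lambda>b. (b, 0)) \<beta> = filter (\<lambda>v. snd v = 0) vs"
    unfolding \<beta>_def map_map using B by (intro map_idI) (auto simp: prod_eq_iff)
  have "snd v \<in> Basis" if "v \<in> set vs" "snd v \<noteq> 0" for v using B[OF that(1)] that(2) by blast
  moreover have "fst v \<in> Basis" if "v \<in> set vs" "snd v = 0" for v using B[OF that(1)] that(2) nonzero_Basis by metis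
  ultimately have 3: "set \<alpha> \<subseteq> Basis" "set \<beta> \<subseteq> Basis" unfolding \<alpha>_def \<beta>_def by (simp_all add: image_subset_iff)
  have 4: "length \<alpha> = cov_order vs" by (simp add: \<alpha>_def cov_order_def)
  obtain c where c: "\<And>x \<xi>. cmod (dirs (map (\<lambda>b. (0, b)) \<alpha> @ map (\<lambda>b. (b, 0)) \<beta>) a (x, \<xi>))
      \<le> c * japanese \<xi> powr (m - length \<alpha>)"
    using a 3 unfolding symbols_def by blast
  have "cmod (dirs vs a p) \<le> \<bar>c\<bar> * (prod_list (map (\<lambda>v. \<omega> v p) vs) * wt m 0 \<bar>m\<bar> p)" for p
  proof -
    have "dirs vs a p = dirs (map (\<lambda>b. (0, b)) \<alpha> @ map (\<lambda>b. (b, 0)) \<beta>) a p"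
      unfolding 1 2 by (rule dirs_perm[OF open_UNIV P vs]) auto
    then have "cmod (dirs vs a p) \<le> c * japanese (snd p) powr (m - cov_order vs)"
      using c[of "fst p" "snd p"] by (simp add: 4)
    also have "\<dots> \<le> \<bar>c\<bar> * japanese (snd p) powr (m - cov_order vs)" by (intro mult_right_mono) auto
    also have "japanese (snd p) powr (m - cov_order vs) \<le> wt (m - cov_order vs) 0 \<bar>m\<bar> p" by (rule japanese_split) auto
    also have "wt (m - cov_order vs) 0 \<bar>m\<bar> p \<le> wt (real (count_list vs et) - cov_order vs + m) 0 \<bar>m\<bar> p" by (intro wt_mono) auto
    also have "\<dots> = prod_list (map (\<lambda>v. \<omega> v p) vs) * wt m 0 \<bar>m\<bar> p"
      unfolding weight_product[OF vs] wt_def by (simp only: powr_add mult.assoc)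
    finally show ?thesis by (simp add: mult_left_mono)
  qed
  then show "\<exists>c. \<forall>p\<in>D. norm (dirs vs a p) \<le> c * (prod_list (map (\<lambda>v. \<omega> v p) vs) * wt m 0 \<bar>m\<bar> p)" by blast
qed

section \<open>Width of the collar, and localization over compact sets of x'\<close>

section \<open>Localization to a collar\<close>

context boundary_phase
begin

text \<open>The mixed derivative has no zero over x_n = 0. By compactness of the sphere (tube lemma)
  this persists over an open set \<open>W\<close> containing the boundary points, and the distance
  to the complement of \<open>W\<close> gives a continuous width.\<close>

lemma collar_function:
  "\<exists>\<epsilon>. continuous_on \<Omega>' \<epsilon> \<and> (\<forall>x'\<in>\<Omega>'. 0 < \<epsilon> x' \<and> \<epsilon> x' \<le> 1 / 2) \<and>
     (\<forall>x'\<in>\<Omega>'. \<forall>t \<xi>. \<bar>t\<bar> \<le> \<epsilon> x' \<longrightarrow> \<xi> \<noteq> 0 \<longrightarrow> pd et (pd es \<psi>) ((x', t), \<xi>) \<noteq> 0)"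
proof -
  define P where "P = S \<inter> pd et (pd es \<psi>) -` (- {0})"
  have "continuous_on S (pd et (pd es \<psi>))" using smooth_on_continuous[OF smooth, of "[et, es]"] by simp
  then have P: "open P" unfolding P_def by (intro continuous_open_preimage open_S) auto
  define W where "W = {x. {x} \<times> sphere (0 :: 'm rn) 1 \<subseteq> P}"
  have "open W"
  proof (subst open_subopen, intro ballI)
    fix x assume "x \<in> W"
    then have "\<exists>X0. x \<in> X0 \<and> open X0 \<and> X0 \<times> sphere (0 :: 'm rn) 1 \<subseteq> P"
      unfolding W_def by (intro Elementary_Topology.tube_lemma[OF _ P]) auto
    then show "\<exists>T. open T \<and> x \<in> T \<and> T \<subseteq> W" unfolding W_def by blast
  qed
  have W\<Omega>: "x \<in> \<Omega>" if "x \<in> W" for x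
  proof -
    have "(x, (0, 1)) \<in> {x} \<times> sphere (0 :: 'm rn) 1" by simp
    then have "(x, (0, 1)) \<in> S" using that unfolding W_def P_def by blast
    then show ?thesis by (rule SigmaE2)
  qed
  have W0: "(x', 0) \<in> W" if "x' \<in> \<Omega>'" for x'
  proof -
    have "((x', 0), \<xi>) \<in> P" if "\<xi> \<in> sphere 0 1" for \<xi>
    proof -
      have "\<xi> \<noteq> 0" using that by auto
      then show ?thesis using boundary_nonzero[OF \<open>x' \<in> \<Omega>'\<close>] \<open>x' \<in> \<Omega>'\<close> by (simp add: P_def)
    qed
    then show ?thesis by (auto simp: W_def)
  qed
  have cW: "closed (- W)" "- W \<noteq> {}"
    using \<open>open W\<close> W\<Omega>[of "(0, 1)"] by auto
  \<comment> \<open>The bound 1/2 keeps the closed collar of this width inside ]-1, 1[. Halving the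
    distance leaves |t| strictly below it for all |t| up to the width.\<close>
  define \<epsilon> where "\<epsilon> = (\<lambda>x'. min (1 / 2) (infdist (x', 0 :: real) (- W) / 2))"
  have pos: "0 < infdist (x', 0) (- W)" if "x' \<in> \<Omega>'" for x'
    by (rule infdist_pos_not_in_closed[OF cW]) (use W0[OF that] in simp)
  have "continuous_on \<Omega>' \<epsilon>" unfolding \<epsilon>_def by (intro continuous_intros) auto
  moreover have "0 < \<epsilon> x' \<and> \<epsilon> x' \<le> 1 / 2" if "x' \<in> \<Omega>'" for x' using pos[OF that] by (simp add: \<epsilon>_def)
  moreover have "pd et (pd es \<psi>) ((x', t), \<xi>) \<noteq> 0" if x: "x' \<in> \<Omega>'" and t: "\<bar>t\<bar> \<le> \<epsilon> x'" and \<xi>: "\<xi> \<noteq> 0" for x' t \<xi>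
  proof -
    have "(x', t) \<in> W"
    proof (rule ccontr)
      assume "(x', t) \<notin> W"
      then have "infdist (x', 0) (- W) \<le> dist (x', 0) (x', t)" by (intro infdist_le) simp
      also have "\<dots> = \<bar>t\<bar>" by (simp add: dist_Pair_Pair)
      finally show False using t pos[OF x] by (simp add: \<epsilon>_def)
    qed
    then have m: "((x', t), (1 / norm \<xi>) *\<^sub>R \<xi>) \<in> P" using \<xi> by (auto simp: W_def)
    have B: "set [et, es] \<subseteq> (Basis :: ('m rn \<times> 'm rn) set)" by (simp add: et_es_Basis)
    have "((x', t), (1 / norm \<xi>) *\<^sub>R \<xi>) \<in> S" "pd et (pd es \<psi>) ((x', t), (1 / norm \<xi>) *\<^sub>R \<xi>) \<noteq> 0"
      using m unfolding P_def by blast+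
    then show ?thesis
      using homogeneous_dirs[OF B, of "(x', t)" "(1 / norm \<xi>) *\<^sub>R \<xi>" "norm \<xi>"] \<xi> by (simp add: zero_prod_def)
  qed
  ultimately show ?thesis by blast
qed

text \<open>The support over \<open>Kc\<close> projects to a compact subset \<open>P\<close> of
  \<open>\<Omega>'\<close>. A small open neighbourhood of \<open>P\<close> is taken for
  \<open>B\<close>, and a compact one, still in \<open>\<Omega>'\<close>, as base of
  \<open>C\<close>; above them lie the open and the closed collar.\<close>

lemma local_collar:
  fixes \<epsilon> :: "real ^ 'm \<Rightarrow> real"
  assumes \<epsilon>: "continuous_on \<Omega>' \<epsilon>" "\<And>x'. x' \<in> \<Omega>' \<Longrightarrow> 0 < \<epsilon> x' \<and> \<epsilon> x' \<le> 1 / 2"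
    and S0: "closed S0" "S0 \<subseteq> {(x', t). x' \<in> \<Omega>' \<and> \<bar>t\<bar> < \<epsilon> x'}" and Kc: "compact Kc"
  obtains B O' C where "open B" "open O'" "compact C" "O' \<subseteq> C" "C \<subseteq> {(x', t). x' \<in> \<Omega>' \<and> \<bar>t\<bar> \<le> \<epsilon> x'}"
    "\<forall>x' t t'. (x', t) \<in> C \<longrightarrow> \<bar>t'\<bar> \<le> \<bar>t\<bar> \<longrightarrow> (x', t') \<in> C"
    "\<forall>x\<in>S0. fst x \<in> B \<longrightarrow> x \<in> O'" "\<forall>x\<in>O'. fst x \<in> B"
    "\<forall>x\<in>Kc. \<forall>t. (x, t) \<in> S0 \<longrightarrow> x \<in> B"
proof -
  \<comment> \<open>Intersecting with |x_n| <= 1 loses nothing, since \<open>\<epsilon>\<close> is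
    at most 1/2 on \<open>\<Omega>'\<close>, and makes the set to be projected compact.\<close>
  define P where "P = fst ` (S0 \<inter> Kc \<times> {-1..1})"
  have "compact (Kc \<times> {-1..1::real})" using Kc by (intro compact_Times) auto
  then have P: "compact P" unfolding P_def using S0(1) by (intro compact_continuous_image continuous_intros closed_Int_compact)
  have "P \<subseteq> \<Omega>'" using S0(2) by (auto simp: P_def)
  from compact_subset_open_imp_cball_epsilon_subset[OF P open_\<Omega>' this]
  obtain e where e: "0 < e" "(\<Union>x\<in>P. cball x e) \<subseteq> \<Omega>'" .
  define B where "B = (\<Union>x\<in>P. ball x e)"
  define Cc where "Cc = {x + y | x y. x \<in> P \<and> y \<in> cball 0 e}"
  have Cc: "compact Cc" unfolding Cc_def by (intro compact_sums P compact_cball)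
  have "Cc \<subseteq> \<Omega>'"
  proof
    fix z assume "z \<in> Cc"
    then obtain x y where "z = x + y" "x \<in> P" "norm y \<le> e" by (auto simp: Cc_def)
    then have "z \<in> cball x e" by (simp add: dist_norm)
    then show "z \<in> \<Omega>'" using e(2) \<open>x \<in> P\<close> by blast
  qed
  have "B \<subseteq> Cc"
  proof
    fix z assume "z \<in> B"
    then obtain x where x: "x \<in> P" "dist x z < e" by (auto simp: B_def)
    then have "z = x + (z - x)" "z - x \<in> cball 0 e" by (auto simp: dist_norm norm_minus_commute)
    then show "z \<in> Cc" unfolding Cc_def using x(1) by blast
  qed
  define O' where "O' = {(x', t). x' \<in> B \<and> \<bar>t\<bar> < \<epsilon> x'}"
  define C where "C = {(x', t). x' \<in> Cc \<and> \<bar>t\<bar> \<le> \<epsilon> x'}"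
  have B: "open B" by (auto simp: B_def)
  show thesis
  proof
    have "continuous_on (B \<times> UNIV) (\<lambda>p. \<epsilon> (fst p) - \<bar>snd p\<bar>)"
      using \<open>B \<subseteq> Cc\<close> \<open>Cc \<subseteq> \<Omega>'\<close> by (intro continuous_intros continuous_on_compose2[OF \<epsilon>(1)]) auto
    then have "open ((B \<times> UNIV) \<inter> (\<lambda>p. \<epsilon> (fst p) - \<bar>snd p\<bar>) -` {0<..})"
      using B by (intro continuous_open_preimage open_Times) auto
    also have "(B \<times> UNIV) \<inter> (\<lambda>p. \<epsilon> (fst p) - \<bar>snd p\<bar>) -` {0<..} = O'" by (auto simp: O'_def)
    finally show "open O'" .
    \<comment> \<open>The closed collar is the image of a product of compact sets under rescaling of
      the normal fibre by \<open>\<epsilon>\<close>.\<close>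
    have "compact ((\<lambda>p. (fst p, snd p * \<epsilon> (fst p))) ` (Cc \<times> {-1..1}))"
      using \<open>Cc \<subseteq> \<Omega>'\<close> by (intro compact_continuous_image compact_Times Cc continuous_intros continuous_on_compose2[OF \<epsilon>(1)]) auto
    also have "(\<lambda>p. (fst p, snd p * \<epsilon> (fst p))) ` (Cc \<times> {-1..1}) = C"
    proof (intro equalityI subsetI)
      fix z assume "z \<in> (\<lambda>p. (fst p, snd p * \<epsilon> (fst p))) ` (Cc \<times> {-1..1})"
      then obtain p where "p \<in> Cc \<times> {-1..1}" "z = (fst p, snd p * \<epsilon> (fst p))" by (rule imageE)
      moreover define x \<tau> where "x = fst p" and "\<tau> = snd p"
      ultimately have z: "z = (x, \<tau> * \<epsilon> x)" "x \<in> Cc" "\<bar>\<tau>\<bar> \<le> 1" by auto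
      have "0 < \<epsilon> x" using \<epsilon>(2) z(2) \<open>Cc \<subseteq> \<Omega>'\<close> by blast
      then have "\<bar>\<tau> * \<epsilon> x\<bar> \<le> 1 * \<epsilon> x" unfolding abs_mult using z(3) by (intro mult_mono) auto
      then show "z \<in> C" using z by (simp add: C_def)
    next
      fix z assume "z \<in> C"
      then obtain x t where z: "z = (x, t)" "x \<in> Cc" "\<bar>t\<bar> \<le> \<epsilon> x" by (auto simp: C_def)
      have "0 < \<epsilon> x" using \<epsilon>(2) z(2) \<open>Cc \<subseteq> \<Omega>'\<close> by blast
      then show "z \<in> (\<lambda>p. (fst p, snd p * \<epsilon> (fst p))) ` (Cc \<times> {-1..1})"
        using z by (intro image_eqI[of _ _ "(x, t / \<epsilon> x)"]) (auto simp: field_simps abs_le_iff)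
    qed
    finally show "compact C" .
    show "O' \<subseteq> C" using \<open>B \<subseteq> Cc\<close> by (auto simp: O'_def C_def)
    show "C \<subseteq> {(x', t). x' \<in> \<Omega>' \<and> \<bar>t\<bar> \<le> \<epsilon> x'}" using \<open>Cc \<subseteq> \<Omega>'\<close> by (auto simp: C_def)
    show "\<forall>x\<in>Kc. \<forall>t. (x, t) \<in> S0 \<longrightarrow> x \<in> B"
    proof (intro ballI allI impI)
      fix x t assume that: "x \<in> Kc" "(x, t) \<in> S0"
      have "x \<in> \<Omega>'" "\<bar>t\<bar> < \<epsilon> x" using subsetD[OF S0(2) that(2)] by simp_all
      then have "\<bar>t\<bar> \<le> 1" using \<epsilon>(2)[of x] by linarith
      then have "(x, t) \<in> S0 \<inter> Kc \<times> {-1..1}" using that by auto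
      then have "x \<in> P" unfolding P_def by force
      then show "x \<in> B" unfolding B_def by (rule UN_I) (simp add: e(1))
    qed
  qed (use B S0(2) in \<open>auto simp: O'_def C_def\<close>)
qed

lemma operator_symbols:
  fixes \<epsilon> :: "real ^ 'm \<Rightarrow> real"
  assumes \<epsilon>: "continuous_on \<Omega>' \<epsilon>" "\<And>x'. x' \<in> \<Omega>' \<Longrightarrow> 0 < \<epsilon> x' \<and> \<epsilon> x' \<le> 1 / 2"
    and nondeg: "\<And>x' t \<xi>. x' \<in> \<Omega>' \<Longrightarrow> \<bar>t\<bar> \<le> \<epsilon> x' \<Longrightarrow> \<xi> \<noteq> 0 \<Longrightarrow> pd et (pd es \<psi>) ((x', t), \<xi>) \<noteq> 0"
    and a: "a \<in> symbols m" and supp: "closure {x. \<exists>\<xi>. a (x, \<xi>) \<noteq> 0} \<subseteq> {(x', t). x' \<in> \<Omega>' \<and> \<bar>t\<bar> < \<epsilon> x'}"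
    and mod: "phase_modification \<Omega> \<psi> \<psi>m"
  shows "op_A \<psi> \<psi>m a \<in> op_symbols schwartz_space dilate m \<and>
    op_A_tempered \<psi> \<psi>m a \<in> op_symbols tempered_space tempered_dilate m"
proof -
  define S0 where "S0 = closure {x. \<exists>\<xi>. a (x, \<xi>) \<noteq> 0}"
  \<comment> \<open>The factor 1 / (2 pi) of the inverse transform is made part of the amplitude, so
    that both operators are integrals against the same kernel.\<close>
  define K where "K = (\<lambda>p. exp (\<i> * of_real (\<psi>m p - phase_boundary \<psi> (fst (fst p)) (fst (snd p)))) * (a p / of_real (2 * pi)))"
  obtain R where R: "0 < R" "\<And>x \<xi>. x \<in> \<Omega> \<Longrightarrow> R \<le> norm \<xi> \<Longrightarrow> \<psi>m (x, \<xi>) = \<psi> (x, \<xi>)" and sm: "smooth_on (\<Omega> \<times> UNIV) \<psi>m"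
    using mod unfolding phase_modification_def by blast
  have a0: "a p = 0" if "fst p \<notin> S0" for p
  proof (rule ccontr)
    assume "a p \<noteq> 0"
    then have "fst p \<in> {x. \<exists>\<xi>. a (x, \<xi>) \<noteq> 0}" by (metis (mono_tags, lifting) mem_Collect_eq prod.collapse)
    then have "fst p \<in> S0" unfolding S0_def by (rule subsetD[OF closure_subset])
    with that show False by contradiction
  qed
  have "global_kernel K S0 m"
  proof
    show S0: "closed S0" by (simp add: S0_def)
    show "K p = 0" if "fst p \<notin> S0" for p using a0[OF that] by (simp add: K_def)
    fix Kc :: "(real ^ 'm) set" assume Kc: "compact Kc"
    from local_collar[OF \<epsilon> S0 supp[folded S0_def] Kc]
    obtain B O' C where c: "open B" "open O'" "compact C" "O' \<subseteq> C" "C \<subseteq> {(x', t). x' \<in> \<Omega>' \<and> \<bar>t\<bar> \<le> \<epsilon> x'}"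
      "\<forall>x' t t'. (x', t) \<in> C \<longrightarrow> \<bar>t'\<bar> \<le> \<bar>t\<bar> \<longrightarrow> (x', t') \<in> C"
      "\<forall>x\<in>S0. fst x \<in> B \<longrightarrow> x \<in> O'" "\<forall>x\<in>O'. fst x \<in> B"
      "\<forall>x\<in>Kc. \<forall>t. (x, t) \<in> S0 \<longrightarrow> x \<in> B"
      .
    interpret phase_collar \<Omega>' \<psi> C \<psi>m R
    proof
      show "C \<subseteq> \<Omega>"
      proof
        fix x assume "x \<in> C"
        then have "fst x \<in> \<Omega>'" "\<bar>snd x\<bar> \<le> \<epsilon> (fst x)" using c(5) by auto
        then show "x \<in> \<Omega>" using \<epsilon>(2)[of "fst x"] by (auto simp: mem_Times_iff)
      qed
      show "pd et (pd es \<psi>) (x, \<xi>) \<noteq> 0" if "x \<in> C" "\<xi> \<noteq> 0" for x \<xi>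
      proof -
        have "fst x \<in> \<Omega>'" "\<bar>snd x\<bar> \<le> \<epsilon> (fst x)" using c(5) that(1) by auto
        from nondeg[OF this that(2)] show ?thesis by simp
      qed
    qed (use c(3,6) sm R in blast)+
    obtain c0 where osc: "oscillatory B O' S0 (\<lambda>p. of_real (\<phi> p)) c0"
      using oscillatory_phase[OF c(1,2) S0 c(7,8)[rule_format] c(4)] by blast
    have "oscillatory.Kclass B O' S0 (\<lambda>p. of_real (\<phi> p)) m 0 \<bar>m\<bar> K"
      unfolding oscillatory.Kclass_def[OF osc]
    proof (intro exI conjI ballI allI impI)
      have D: "open (O' \<times> (UNIV :: 'm rn set))" using c(2) by (intro open_Times) auto
      show "Sym (O' \<times> UNIV) m 0 \<bar>m\<bar> (\<lambda>p. 1 / of_real (2 * pi) * a p)"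
        by (rule Sym_cmult[OF D Sym_amplitude[OF a]])
    qed (use a0 in \<open>simp_all add: K_def \<phi>_eq\<close>)
    moreover have "\<forall>x\<in>Kc. x \<in> B \<or> (\<forall>t. (x, t) \<notin> S0)" using c(9) by blast
    ultimately show "\<exists>B O' \<Phi> c0 N. oscillatory B O' S0 \<Phi> c0 \<and> oscillatory.Kclass B O' S0 \<Phi> m 0 N K \<and>
        (\<forall>x\<in>Kc. x \<in> B \<or> (\<forall>t. (x, t) \<notin> S0))"
      using osc by (intro exI[of _ B] exI[of _ O'] exI[of _ "\<lambda>p. of_real (\<phi> p)"] exI[of _ c0] exI[of _ "\<bar>m\<bar>"] conjI)
  qed
  then interpret global_kernel K S0 m .
  have "op_A \<psi> \<psi>m a = (\<lambda>z u t. LBINT s. K ((fst z, t), (snd z, s)) * fourier u s)"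
    by (intro ext) (simp add: op_A_def kernel_A_def K_def case_prod_beta mult_ac)
  moreover have "op_A_tempered \<psi> \<psi>m a = (\<lambda>z T f. if f \<in> schwartz then tempered_fourier T (\<lambda>s. LBINT t. K ((fst z, t), (snd z, s)) * f t) else 0)"
    by (intro ext) (simp add: op_A_tempered_def kernel_A_def K_def case_prod_beta mult_ac)
  ultimately show ?thesis using schwartz_operator tempered_operator by simp
qed

end

theorem theorem1p2:
  fixes AY :: "('q::t2_space, 'm::finite rn) chart set" and Y Yt :: "'q set"
    and AX :: "('p::t2_space, 'm rn) chart set" and X Xt :: "'p set"
    and chi :: "('q, 'm rn) covector \<Rightarrow> ('p, 'm rn) covector"
    and c :: "('q, 'm rn) chart" and d :: "('p, 'm rn) chart"
    and \<Omega>' :: "(real ^ 'm) set" and \<psi> :: "'m rn \<times> 'm rn \<Rightarrow> real"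
  assumes "closed_manifold AY" and "closed_manifold AX"
    and "boundary_symplectomorphism AY Y Yt AX X Xt chi"
    and "admissible AY Y Yt AX X chi"
    and "boundary_chart AY Y c" and "boundary_chart AX X d"
    and "open \<Omega>'" and "connected \<Omega>'"
    and "phase_represents AY Yt c d chi (\<Omega>' \<times> {-1<..<1}) \<psi>"
  shows "\<exists>\<epsilon>. continuous_on \<Omega>' \<epsilon> \<and> (\<forall>x'\<in>\<Omega>'. 0 < \<epsilon> x' \<and> \<epsilon> x' \<le> 1) \<and>
    (\<forall>(m::real) a \<psi>m.
       a \<in> symbols m \<and> symbol_transmission m a \<and>
       closure {x. \<exists>\<xi>. a (x, \<xi>) \<noteq> 0} \<subseteq> {(x', t). x' \<in> \<Omega>' \<and> \<bar>t\<bar> < \<epsilon> x'} \<and>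
       phase_modification (\<Omega>' \<times> {-1<..<1}) \<psi> \<psi>m \<longrightarrow>
         op_A \<psi> \<psi>m a \<in> op_symbols schwartz_space dilate m \<and>
         op_A_tempered \<psi> \<psi>m a \<in> op_symbols tempered_space tempered_dilate m)"
proof -
  interpret boundary_phase \<Omega>' \<psi> using assms by (intro boundary_phaseI)
  \<comment> \<open>The width is determined by \<open>\<psi>\<close> over \<open>\<Omega>'\<close>
    alone, so one choice serves every order, every amplitude and every modification of the
    phase.\<close>
  from collar_function obtain \<epsilon> where \<epsilon>: "continuous_on \<Omega>' \<epsilon>" "\<forall>x'\<in>\<Omega>'. 0 < \<epsilon> x' \<and> \<epsilon> x' \<le> 1 / 2"
    "\<forall>x'\<in>\<Omega>'. \<forall>t \<xi>. \<bar>t\<bar> \<le> \<epsilon> x' \<longrightarrow> \<xi> \<noteq> 0 \<longrightarrow> pd et (pd es \<psi>) ((x', t), \<xi>) \<noteq> 0"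
    by (elim exE conjE)
  show ?thesis
  proof (intro exI[of _ \<epsilon>] conjI allI impI ballI)
    show "\<epsilon> x' \<le> 1" if "x' \<in> \<Omega>'" for x' using \<epsilon>(2) that by fastforce
    fix m :: real and a \<psi>m
    assume *: "a \<in> symbols m \<and> symbol_transmission m a \<and>
       closure {x. \<exists>\<xi>. a (x, \<xi>) \<noteq> 0} \<subseteq> {(x', t). x' \<in> \<Omega>' \<and> \<bar>t\<bar> < \<epsilon> x'} \<and>
       phase_modification (\<Omega>' \<times> {-1<..<1}) \<psi> \<psi>m"
    have "op_A \<psi> \<psi>m a \<in> op_symbols schwartz_space dilate m \<and>
      op_A_tempered \<psi> \<psi>m a \<in> op_symbols tempered_space tempered_dilate m"
    proof (rule operator_symbols[OF \<epsilon>(1)])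
      show "pd et (pd es \<psi>) ((x', t), \<xi>) \<noteq> 0" if "x' \<in> \<Omega>'" "\<bar>t\<bar> \<le> \<epsilon> x'" "\<xi> \<noteq> 0" for x' t \<xi>
        using \<epsilon>(3)[rule_format, OF that] .
    qed (use * \<epsilon>(2) in simp_all)
    then show "op_A \<psi> \<psi>m a \<in> op_symbols schwartz_space dilate m"
      "op_A_tempered \<psi> \<psi>m a \<in> op_symbols tempered_space tempered_dilate m" by simp_all
  qed (use \<epsilon> in auto)
qed

end
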